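(* Suppose that $C:\mathbb{F}^{\rho n}\to\mathbb{F}^n$ is a systematic linear code of rate $\rho$ and relative distance $\delta$ that is $(\alpha,\ell,L)$-(globally) list recoverable, and $\widehat C:\mathbb{F}^{\widehat k}\to\mathbb{F}^{(\rho n)^t}$ is $(\widehat Q,\widehat\alpha)$-locally decodable. Then $\widetilde C:=C^{\otimes t}(\widehat C):\mathbb{F}^{\widehat k}\to\mathbb{F}^{n^t}$ (i.e. $x\mapsto C^{\otimes t}(\widehat C(x))$) is $(\widetilde Q,\widetilde\alpha,\ell,\widetilde L)$-locally list recoverable for $\widetilde\alpha=\alpha\cdot\widehat\alpha\cdot\rho^{t}\cdot\delta^{O(t)}$, $$\widetilde Q=\widehat Q\cdot n\cdot\frac{\log^{t}L}{(\alpha\cdot\widehat\alpha)^{O(t)}\cdot(\rho\cdot\delta)^{O(t^2)}},$$ and $$\widetilde L=\exp\left(\frac{\log^{t}L}{(\alpha\cdot\widehat\alpha)^{O(t)}\cdot(\rho\cdot\delta)^{O(t^2)}}\right).$$ Moreover, the local list recovery algorithm for $\widetilde C$ has preprocessing time $$\widetilde T_{\mathrm{pre}}=\exp\left(\frac{\log^{t}L}{(\alpha\cdot\widehat\alpha)^{O(t)}\cdot(\rho\cdot\delta)^{O(t^2)}}\right)\cdot\log n,$$ and if the (global) list recovery algorithm for $C$ runs in time $T$ and the local decoding algorithm for $\widehat C$ runs in time $\widehat T$, then the local list recovery algorithm for $\widetilde C$ runs in time $$\widetilde T=\widehat T+\widehat Q\cdot T\cdot\frac{\log^{t}L}{(\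alpha\cdot\widehat\alpha)^{O(t)}\cdot(\rho\cdot\delta)^{O(t^2)}}.$$
   Context: Codes. $\mathbb{F}$ is a finite field and $t$ is a positive integer. A code is an injective map $C:\Sigma^k\to\Sigma^n$ with rate $k/n$; elements of $\Sigma^k$ are messages, elements of the image are codewords. It is linear if $\Sigma=\mathbb{F}$ is a finite field and the map is $\mathbb{F}$-linear, in which case $C(x)=Gx$ with generating matrix $G\in\mathbb{F}^{n\times k}$. It is systematic if every message is a prefix of its encoding. The relative distance is the minimum over distinct messages $x,y$ of $\mathrm{dist}(C(x),C(y))$, where $\mathrm{dist}$ is the fraction of differing coordinates. $\binom{\Sigma}{\ell}$ is the set of subsets of $\Sigma$ of size $\ell$; for $x\in\Sigma^n$ and $S\in\binom{\Sigma}{\ell}^n$, $\mathrm{dist}(x,S)$ is the fraction of $i\in[n]$ with $x_i\notin S_i$; "$\alpha$-close" means distance at most $\alpha$. For $\alpha\in[0,1]$ and integers $\ell,L$, $C$ is $(\alpha,\ell,L)$-list recoverable if for any $S\in\binom{\Sigma}{\ell}^n$ there are at most $L$ different messages $x$ with $\mathrm{dist}(C(x),S)\le\alpha$; a (global) list recovery algorithm outputs, given $S$, the list of these. Tensor codes. For linear codes $C_1:\mathbb{F}^{k_1}\to\mathbb{F}^{n_1}$, $C_2:\mathbb{F}^{k_2}\to\mathbb{F}^{n_2}$ with generating matrices $G_1,G_2$, $C_1\otimes C_2:\mathbb{F}^{k_1\times k_2}\to\mathbb{F}^{n_1\times n_2}$ is $(C_1\otimes C_2)(M)=G_1MG_2^{T}$.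 $C^{\otimes1}:=C$ and $C^{\otimes t}:=C\otimes C^{\otimes(t-1)}$. Index sets $[\rho n]^t$ and $[(\rho n)^t]$ are identified. Locally decodable codes. $C:\Sigma^k\to\Sigma^n$ is $(Q,\alpha)$-locally decodable if there is a randomized algorithm that, given $i\in[k]$ and oracle access to a string $w\in\Sigma^n$ that is $\alpha$-close to some codeword $C(x)$, makes at most $Q$ queries to $w$ and outputs $x_i$ with probability at least $2/3$. Local list recovery. $C:\Sigma^k\to\Sigma^n$ is $(Q,\alpha,\ell,L)$-locally list recoverable if there is a randomized algorithm $A$ such that: $A$ outputs $L$ randomized algorithms $A_1,\dots,A_L$; each $A_j$ takes as input $i\in[k]$, gets oracle access to a string $S\in\binom{\Sigma}{\ell}^n$, and makes at most $Q$ queries to $S$; and for every codeword $C(x)$ that is $\alpha$-close to $S$, with probability at least $2/3$ over the randomness of $A$ there exists $j\in[L]$ such that for all $i\in[k]$, $\Pr[A_j(i)=x_i]\ge2/3$ over the internal randomness of $A_j$. $A$ has preprocessing time $T_{\mathrm{pre}}$ if it outputs the description of $A_1,\dots,A_L$ in time at most $T_{\mathrm{pre}}$, and running time $T$ if each $A_j$ runs in time at most $T$. Conventions. $\log$ is base 2; $\exp(x)$ denotes $2^{\Theta(x)}$.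
   Formalization: log L and log n are read as log max(2,L) and log max(2,n), since L=1 would give zero queries and n=1 zero preprocessing time; α and α̂ are assumed positive, as the bounds divide by them; the second term of the running time carries an absolute constant factor. *)

theory Defs
  imports "HOL-Algebra.Ring" "HOL-Probability.Probability"
begin

section \<open>Codes\<close>

text \<open>
  Strings of length n over an alphabet \<Sigma> are extensional functions on \<open>{..<n}\<close>; coordinates are
  numbered from 0. Alphabets are sets of natural numbers: a finite field is a HOL-Algebra field
  whose carrier is a finite set of natural numbers. Up to isomorphism these are all finite fields,
  and a single carrier type lets a statement quantify over all finite fields inside a formula
  (a constant can then be chosen independently of the field) and lets the machine below treat
  field elements as words.
\<close>

definition strings :: "nat set \<Rightarrow> nat \<Rightarrow> (nat \<Rightarrow> nat) set" where
  "strings \<Sigma> n = ({..<n} \<rightarrow>\<^sub>E \<Sigma>)"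

definition is_code :: "nat set \<Rightarrow> nat \<Rightarrow> nat \<Rightarrow> ((nat \<Rightarrow> nat) \<Rightarrow> (nat \<Rightarrow> nat)) \<Rightarrow> bool" where
  "is_code \<Sigma> k n C \<longleftrightarrow> C \<in> strings \<Sigma> k \<rightarrow> strings \<Sigma> n \<and> inj_on C (strings \<Sigma> k)"

definition linear_code :: "nat ring \<Rightarrow> nat \<Rightarrow> nat \<Rightarrow> ((nat \<Rightarrow> nat) \<Rightarrow> (nat \<Rightarrow> nat)) \<Rightarrow> bool" where
  "linear_code F k n C \<longleftrightarrow>
     is_code (carrier F) k n C \<and>
     (\<forall>x\<in>strings (carrier F) k. \<forall>y\<in>strings (carrier F) k. \<forall>i<n.
        C (\<lambda>j\<in>{..<k}. x j \<oplus>\<^bsub>F\<^esub> y j) i = C x i \<oplus>\<^bsub>F\<^esub> C y i) \<and>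
     (\<forall>a\<in>carrier F. \<forall>x\<in>strings (carrier F) k. \<forall>i<n.
        C (\<lambda>j\<in>{..<k}. a \<otimes>\<^bsub>F\<^esub> x j) i = a \<otimes>\<^bsub>F\<^esub> C x i)"

definition systematic :: "nat set \<Rightarrow> nat \<Rightarrow> nat \<Rightarrow> ((nat \<Rightarrow> nat) \<Rightarrow> (nat \<Rightarrow> nat)) \<Rightarrow> bool" where
  "systematic \<Sigma> k n C \<longleftrightarrow> k \<le> n \<and> (\<forall>x\<in>strings \<Sigma> k. \<forall>j<k. C x j = x j)"

definition hdist :: "nat \<Rightarrow> (nat \<Rightarrow> nat) \<Rightarrow> (nat \<Rightarrow> nat) \<Rightarrow> real" where
  "hdist n x y = real (card {i. i < n \<and> x i \<noteq> y i}) / real n"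

definition relative_distance :: "nat set \<Rightarrow> nat \<Rightarrow> nat \<Rightarrow> ((nat \<Rightarrow> nat) \<Rightarrow> (nat \<Rightarrow> nat)) \<Rightarrow> real" where
  "relative_distance \<Sigma> k n C =
     Min {hdist n (C x) (C y) | x y. x \<in> strings \<Sigma> k \<and> y \<in> strings \<Sigma> k \<and> x \<noteq> y}"

definition list_strings :: "nat set \<Rightarrow> nat \<Rightarrow> nat \<Rightarrow> (nat \<Rightarrow> nat set) set" where
  "list_strings \<Sigma> l n = ({..<n} \<rightarrow>\<^sub>E {A. A \<subseteq> \<Sigma> \<and> card A = l})"

definition list_dist :: "nat \<Rightarrow> (nat \<Rightarrow> nat) \<Rightarrow> (nat \<Rightarrow> nat set) \<Rightarrow> real" where
  "list_dist n x S = real (card {i. i < n \<and> x i \<notin> S i}) / real n"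

definition close_messages ::
  "nat set \<Rightarrow> nat \<Rightarrow> nat \<Rightarrow> ((nat \<Rightarrow> nat) \<Rightarrow> (nat \<Rightarrow> nat)) \<Rightarrow> real \<Rightarrow> (nat \<Rightarrow> nat set) \<Rightarrow> (nat \<Rightarrow> nat) set" where
  "close_messages \<Sigma> k n C \<alpha> S = {x \<in> strings \<Sigma> k. list_dist n (C x) S \<le> \<alpha>}"

definition list_recoverable ::
  "nat set \<Rightarrow> nat \<Rightarrow> nat \<Rightarrow> ((nat \<Rightarrow> nat) \<Rightarrow> (nat \<Rightarrow> nat)) \<Rightarrow> real \<Rightarrow> nat \<Rightarrow> nat \<Rightarrow> bool" where
  "list_recoverable \<Sigma> k n C \<alpha> l L \<longleftrightarrow>
     (\<forall>S\<in>list_strings \<Sigma> l n. card (close_messages \<Sigma> k n C \<alpha> S) \<le> L)"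

section \<open>Tensor codes\<close>

text \<open>Column p of the generating matrix is the encoding of the p-th unit vector.\<close>

definition gen_mat :: "nat ring \<Rightarrow> nat \<Rightarrow> ((nat \<Rightarrow> nat) \<Rightarrow> (nat \<Rightarrow> nat)) \<Rightarrow> nat \<Rightarrow> nat \<Rightarrow> nat" where
  "gen_mat F k C i p = C (\<lambda>j\<in>{..<k}. if j = p then \<one>\<^bsub>F\<^esub> else \<zero>\<^bsub>F\<^esub>) i"

text \<open>
  The map taking M to G1 M G2^T. A matrix with n2 columns is stored row by row, with entry (a, b)
  at position a * n2 + b, and likewise for messages. Iterated, this is the lexicographic
  identification of the t-fold power of [n] with [n ^ t].
\<close>

definition tensor_code ::
  "nat ring \<Rightarrow> nat \<Rightarrow> nat \<Rightarrow> ((nat \<Rightarrow> nat) \<Rightarrow> (nat \<Rightarrow> nat)) \<Rightarrow>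
   nat \<Rightarrow> nat \<Rightarrow> ((nat \<Rightarrow> nat) \<Rightarrow> (nat \<Rightarrow> nat)) \<Rightarrow> (nat \<Rightarrow> nat) \<Rightarrow> (nat \<Rightarrow> nat)" where
  "tensor_code F k1 n1 C1 k2 n2 C2 M =
     (\<lambda>r\<in>{..<n1 * n2}. \<Oplus>\<^bsub>F\<^esub>p\<in>{..<k1}. \<Oplus>\<^bsub>F\<^esub>q\<in>{..<k2}.
        gen_mat F k1 C1 (r div n2) p \<otimes>\<^bsub>F\<^esub> M (p * k2 + q) \<otimes>\<^bsub>F\<^esub> gen_mat F k2 C2 (r mod n2) q)"

fun tensor_pow ::
  "nat ring \<Rightarrow> nat \<Rightarrow> nat \<Rightarrow> ((nat \<Rightarrow> nat) \<Rightarrow> (nat \<Rightarrow> nat)) \<Rightarrow> nat \<Rightarrow> (nat \<Rightarrow> nat) \<Rightarrow> (nat \<Rightarrow> nat)" where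
  "tensor_pow F k n C 0 = undefined"
| "tensor_pow F k n C (Suc 0) = C"
| "tensor_pow F k n C (Suc (Suc t)) =
     tensor_code F k n C (k ^ Suc t) (n ^ Suc t) (tensor_pow F k n C (Suc t))"

section \<open>The machine model\<close>

text \<open>
  Randomized unit-cost random access machines with an oracle, over a finite field F. Words are
  natural numbers; the operations on words are addition, truncated subtraction and comparison, and
  the field operations also cost one step. The memory is a family of arrays, named by natural
  numbers; cell 0 of array x is also used as the scalar variable x. Variable and array names are
  fixed by the program text, array indices are computed.

  As is usual for a fixed code, programs may depend on the code, its length and the field. Memory
  that does not hold the input is not assumed to be initialized: a program has to be correct
  whatever such cells contain.
\<close>

type_synonym mem = "nat \<Rightarrow> nat \<Rightarrow> nat"

datatype oper = Add | Sub | FAdd | FSub | FMul | FDiv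

datatype test = Eq nat nat | Less nat nat

datatype com =
    Const nat nat            \<comment> \<open>\<open>Const x v\<close>: x := v\<close>
  | Op oper nat nat nat      \<comment> \<open>\<open>Op f x y z\<close>: x := f y z\<close>
  | Load nat nat nat         \<comment> \<open>\<open>Load x a y\<close>: x := a[y]\<close>
  | Store nat nat nat        \<comment> \<open>\<open>Store a y x\<close>: a[y] := x\<close>
  | Toss nat                 \<comment> \<open>\<open>Toss x\<close>: x := a fair random bit\<close>
  | Query nat nat            \<comment> \<open>\<open>Query a y\<close>: write the oracle's answer at y into a[0], a[1], ...\<close>
  | Emit nat                 \<comment> \<open>\<open>Emit x\<close>: append x to the current output item\<close>
  | EndItem                  \<comment> \<open>close the current output item and start a new one\<close>
  | Skip
  | Seq com com
  | Cond test com com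
  | While test com

record state =
  memory :: mem
  queries :: nat                \<comment> \<open>number of queries made so far\<close>
  current :: "nat list"         \<comment> \<open>unfinished output item\<close>
  items :: "nat list list"      \<comment> \<open>finished output items\<close>

text \<open>
  The field operations yield 0 on words that are not in the carrier, and division by zero yields 0;
  otherwise the arbitrary values that a HOL-Algebra structure has there would be available to
  programs.
\<close>

fun apply_op :: "nat ring \<Rightarrow> oper \<Rightarrow> nat \<Rightarrow> nat \<Rightarrow> nat" where
  "apply_op F Add u v = u + v"
| "apply_op F Sub u v = u - v"
| "apply_op F FAdd u v = (if u \<in> carrier F \<and> v \<in> carrier F then u \<oplus>\<^bsub>F\<^esub> v else 0)"
| "apply_op F FSub u v = (if u \<in> carrier F \<and> v \<in> carrier F then u \<ominus>\<^bsub>F\<^esub> v else 0)"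
| "apply_op F FMul u v = (if u \<in> carrier F \<and> v \<in> carrier F then u \<otimes>\<^bsub>F\<^esub> v else 0)"
| "apply_op F FDiv u v =
     (if u \<in> carrier F \<and> v \<in> carrier F \<and> v \<noteq> \<zero>\<^bsub>F\<^esub> then u \<otimes>\<^bsub>F\<^esub> inv\<^bsub>F\<^esub> v else 0)"

definition var :: "state \<Rightarrow> nat \<Rightarrow> nat" where
  "var s x = memory s x 0"

definition put :: "nat \<Rightarrow> nat \<Rightarrow> nat \<Rightarrow> state \<Rightarrow> state" where
  "put a i v s = s\<lparr>memory := (memory s)(a := (memory s a)(i := v))\<rparr>"

fun passes :: "test \<Rightarrow> state \<Rightarrow> bool" where
  "passes (Eq x y) s = (var s x = var s y)"
| "passes (Less x y) s = (var s x < var s y)"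

text \<open>
  A configuration is a stack of commands still to be executed and a state; the machine has halted
  when the stack is empty.
\<close>

type_synonym config = "com list \<times> state"

fun step :: "nat ring \<Rightarrow> (nat \<Rightarrow> nat list) \<Rightarrow> config \<Rightarrow> config pmf" where
  "step F orc ([], s) = return_pmf ([], s)"
| "step F orc (Const x v # cs, s) = return_pmf (cs, put x 0 v s)"
| "step F orc (Op f x y z # cs, s) = return_pmf (cs, put x 0 (apply_op F f (var s y) (var s z)) s)"
| "step F orc (Load x a y # cs, s) = return_pmf (cs, put x 0 (memory s a (var s y)) s)"
| "step F orc (Store a y x # cs, s) = return_pmf (cs, put a (var s y) (var s x) s)"
| "step F orc (Toss x # cs, s) = map_pmf (\<lambda>b. (cs, put x 0 (of_bool b) s)) (bernoulli_pmf (1/2))"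
| "step F orc (Query a y # cs, s) =
     (let ans = orc (var s y) in
      return_pmf (cs,
        s\<lparr>memory := (memory s)(a := (\<lambda>i. if i < length ans then ans ! i else memory s a i)),
          queries := Suc (queries s)\<rparr>))"
| "step F orc (Emit x # cs, s) = return_pmf (cs, s\<lparr>current := current s @ [var s x]\<rparr>)"
| "step F orc (EndItem # cs, s) =
     return_pmf (cs, s\<lparr>current := [], items := items s @ [current s]\<rparr>)"
| "step F orc (Skip # cs, s) = return_pmf (cs, s)"
| "step F orc (Seq c d # cs, s) = return_pmf (c # d # cs, s)"
| "step F orc (Cond b c d # cs, s) = return_pmf ((if passes b s then c else d) # cs, s)"
| "step F orc (While b c # cs, s) =
     return_pmf (if passes b s then c # While b c # cs else cs, s)"

fun steps :: "nat ring \<Rightarrow> (nat \<Rightarrow> nat list) \<Rightarrow> nat \<Rightarrow> config \<Rightarrow> config pmf" where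
  "steps F orc 0 cfg = return_pmf cfg"
| "steps F orc (Suc T) cfg = bind_pmf (step F orc cfg) (steps F orc T)"

definition run :: "nat ring \<Rightarrow> (nat \<Rightarrow> nat list) \<Rightarrow> nat \<Rightarrow> com \<Rightarrow> mem \<Rightarrow> config pmf" where
  "run F orc T c m = steps F orc T ([c], \<lparr>memory = m, queries = 0, current = [], items = []\<rparr>)"

text \<open>
  Inputs are placed in the initial memory: a list in the first cells of array 1, and a number in
  variable 0. For a local algorithm the number is the index of the message symbol to be computed
  and the list is the description \<sigma> of the algorithm (empty for a local decoder).
\<close>

definition input_array :: "nat list \<Rightarrow> mem \<Rightarrow> bool" where
  "input_array \<sigma> m \<longleftrightarrow> (\<forall>r<length \<sigma>. m 1 r = \<sigma> ! r)"

definition input_mem :: "nat \<Rightarrow> nat list \<Rightarrow> mem \<Rightarrow> bool" where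
  "input_mem i \<sigma> m \<longleftrightarrow> m 0 0 = i \<and> input_array \<sigma> m"

definition no_oracle :: "nat \<Rightarrow> nat list" where
  "no_oracle = (\<lambda>_. [])"

definition string_oracle :: "nat \<Rightarrow> (nat \<Rightarrow> nat) \<Rightarrow> nat \<Rightarrow> nat list" where
  "string_oracle n w i = (if i < n then [w i] else [])"

text \<open>One query to S returns the whole set at that coordinate, as an increasing list.\<close>

definition list_oracle :: "nat \<Rightarrow> (nat \<Rightarrow> nat set) \<Rightarrow> nat \<Rightarrow> nat list" where
  "list_oracle n S i = (if i < n then sorted_list_of_set (S i) else [])"

section \<open>Algorithms for codes\<close>

text \<open>
  \<open>P\<close> is a (global) list recovery algorithm with running time T. It has no oracle; its input is the
  whole string S, the sets being listed one after the other, each in increasing order. Its output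
  items are the messages that are \<alpha>-close to S, in some order and without repetitions.
\<close>

definition list_recovery_alg ::
  "nat ring \<Rightarrow> nat \<Rightarrow> nat \<Rightarrow> ((nat \<Rightarrow> nat) \<Rightarrow> (nat \<Rightarrow> nat)) \<Rightarrow> real \<Rightarrow> nat \<Rightarrow> com \<Rightarrow> nat \<Rightarrow> bool" where
  "list_recovery_alg F k n C \<alpha> l P T \<longleftrightarrow>
     (\<forall>S\<in>list_strings (carrier F) l n. \<forall>m.
        input_array (concat (map (\<lambda>i. sorted_list_of_set (S i)) [0..<n])) m \<longrightarrow>
        (\<forall>(cs, s)\<in>set_pmf (run F no_oracle T P m).
           cs = [] \<and> distinct (items s) \<and>
           set (items s) = (\<lambda>x. map x [0..<k]) ` close_messages (carrier F) k n C \<alpha> S))"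

text \<open>
  \<open>B\<close> is a (Q, \<alpha>)-local decoder with running time T. The bounds on queries and time hold for every
  oracle string, correctness only for strings that are \<alpha>-close to a codeword.
\<close>

definition local_decoder ::
  "nat ring \<Rightarrow> nat \<Rightarrow> nat \<Rightarrow> ((nat \<Rightarrow> nat) \<Rightarrow> (nat \<Rightarrow> nat)) \<Rightarrow> nat \<Rightarrow> real \<Rightarrow> com \<Rightarrow> nat \<Rightarrow> bool" where
  "local_decoder F k n C Q \<alpha> B T \<longleftrightarrow>
     (\<forall>w\<in>strings (carrier F) n. \<forall>i<k. \<forall>m. input_mem i [] m \<longrightarrow>
        (\<forall>(cs, s)\<in>set_pmf (run F (string_oracle n w) T B m). cs = [] \<and> queries s \<le> Q) \<and>
        (\<forall>x\<in>strings (carrier F) k. hdist n w (C x) \<le> \<alpha> \<longrightarrow>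
           measure_pmf.prob (run F (string_oracle n w) T B m) {(cs, s). items s = [[x i]]} \<ge> 2/3))"

definition locally_decodable ::
  "nat ring \<Rightarrow> nat \<Rightarrow> nat \<Rightarrow> ((nat \<Rightarrow> nat) \<Rightarrow> (nat \<Rightarrow> nat)) \<Rightarrow> nat \<Rightarrow> real \<Rightarrow> bool" where
  "locally_decodable F k n C Q \<alpha> \<longleftrightarrow> (\<exists>B T. local_decoder F k n C Q \<alpha> B T)"

text \<open>
  A local list recovery algorithm is a pair of programs. The program A has no oracle and, in time
  \<open>Tpre\<close>, outputs the descriptions of L algorithms, as its L output items. The algorithm described
  by \<sigma> is the program B run with \<sigma> as additional input.
\<close>

definition local_list_recovery_alg ::
  "nat ring \<Rightarrow> nat \<Rightarrow> nat \<Rightarrow> ((nat \<Rightarrow> nat) \<Rightarrow> (nat \<Rightarrow> nat)) \<Rightarrow> nat \<Rightarrow> real \<Rightarrow> nat \<Rightarrow> nat \<Rightarrow>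
   com \<Rightarrow> com \<Rightarrow> nat \<Rightarrow> nat \<Rightarrow> bool" where
  "local_list_recovery_alg F k n C Q \<alpha> l L A B Tpre T \<longleftrightarrow>
     (\<forall>m. \<forall>(cs, s)\<in>set_pmf (run F no_oracle Tpre A m).
        cs = [] \<and> length (items s) = L \<and>
        (\<forall>\<sigma>\<in>set (items s). \<forall>S\<in>list_strings (carrier F) l n. \<forall>i<k. \<forall>m'. input_mem i \<sigma> m' \<longrightarrow>
           (\<forall>(cs', s')\<in>set_pmf (run F (list_oracle n S) T B m'). cs' = [] \<and> queries s' \<le> Q))) \<and>
     (\<forall>S\<in>list_strings (carrier F) l n. \<forall>x\<in>strings (carrier F) k. list_dist n (C x) S \<le> \<alpha> \<longrightarrow>
        (\<forall>m. measure_pmf.prob (run F no_oracle Tpre A m)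
           {(cs, s). \<exists>j<L. \<forall>i<k. \<forall>m'. input_mem i (items s ! j) m' \<longrightarrow>
              measure_pmf.prob (run F (list_oracle n S) T B m') {(cs', s'). items s' = [[x i]]} \<ge> 2/3}
           \<ge> 2/3))"

definition locally_list_recoverable ::
  "nat ring \<Rightarrow> nat \<Rightarrow> nat \<Rightarrow> ((nat \<Rightarrow> nat) \<Rightarrow> (nat \<Rightarrow> nat)) \<Rightarrow> nat \<Rightarrow> real \<Rightarrow> nat \<Rightarrow> nat \<Rightarrow> bool" where
  "locally_list_recoverable F k n C Q \<alpha> l L \<longleftrightarrow>
     (\<exists>A B Tpre T. local_list_recovery_alg F k n C Q \<alpha> l L A B Tpre T)"

end

theory Submission
  imports Defs
begin

text \<open>For a message matrix \<open>M\<close> of the tensor code and a received string \<open>S\<close>, the entry of \<open>M\<close> at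
  \<open>y\<close> is found by recursion on the number \<open>s\<close> of dimensions. List recover the fiber of \<open>S\<close> through
  \<open>y\<close> in the last direction; if it is close to the codeword of the corresponding column of \<open>M\<close>, that
  column is on the list. Choose \<open>m\<close> random rows in the last direction. Each of them restricts the
  encoding of \<open>M\<close> to a codeword of the \<open>s - 1\<close>-dimensional tensor code, and systematicity lets the
  recursion recover its value at the remaining coordinates of \<open>y\<close>. Since distinct codewords of \<open>C\<close>
  differ on a fraction \<open>\<delta>\<close> of the rows, the \<open>m\<close> values single out the right column from the list. In
  dimension 1 the list index is advice, one number below \<open>L\<close> for each of the \<open>m ^ (t - 1)\<close> leaves,
  and running over all advice gives the list of local algorithms; the random rows are drawn once, in
  the preprocessing.

  Summing over \<open>y\<close>, the expected fraction of wrong entries is controlled by Markov's inequality for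
  fibers with many errors, a union bound over the list for rows that do not separate it, and a tail
  bound for rows with too many errors or with a wrong recursive value. It is at most
  \<open>\<alpha>hat / 3\<close>, so with probability \<open>2/3\<close> the recovered matrix is \<open>\<alpha>hat\<close>-close to
  \<open>Chat x\<close>, and the local decoder of \<open>Chat\<close> is run with its queries answered this way.\<close>

text \<open>Three obstacles shape the proof. Advice is an index into a list, so that list must come
  out in the same order at each call, while a list recovery program may order it by its coins and by
  uninitialized memory. It is therefore simulated with all coins 0, on a memory that reads as 0
  outside its input. Second, the claimed radius and the quantity \<open>X\<close> have no constant
  in front: a constant can only be absorbed by powers of \<open>\<delta>\<close> and of
  \<open>\<rho> * \<delta>\<close>, and \<open>\<delta>\<close> may be close to 1. The Singleton
  bound helps: for \<open>k \<ge> 2\<close> it gives \<open>\<rho> \<le> 2 * (1 - \<delta>)\<close>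
  and \<open>\<rho> * \<delta> \<le> 9 / 16\<close>, so \<open>\<rho> * \<delta> ^ c\<close> is
  small for large \<open>c\<close>. For \<open>k = 1\<close> there may be nothing to absorb
  constants, but then the radius admits no error at all and dimension 1 suffices. Third, the given
  \<open>L\<close> may exceed any bound in terms of the running time \<open>T\<close>. It is
  replaced by the largest list size that occurs, which a list recovery program must have time to
  write. The factor \<open>\<rho> ^ t\<close> in the radius reflects that all errors may lie on
  fibers through systematic positions.\<close>

section \<open>Executing programs\<close>

lemma steps_add: "steps F orc (a + b) cfg = bind_pmf (steps F orc a cfg) (steps F orc b)"
proof (induction a arbitrary: cfg)
  case (Suc a)
  then have "steps F orc (a + b) = (\<lambda>cfg. bind_pmf (steps F orc a cfg) (steps F orc b))" by blast
  then show ?case by (simp add: bind_assoc_pmf)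
qed (simp add: bind_return_pmf)

lemma steps_halted [simp]: "steps F orc N ([], s) = return_pmf ([], s)"
  by (induction N) (auto simp: bind_return_pmf)

text \<open>Branching is allowed, loops and coins are not: on such programs the machine computes the
  function \<open>exec\<close> below, within a time \<open>tm\<close> read off the syntax. The
  values of \<open>exec\<close> at \<open>Toss\<close> and \<open>While\<close> are placeholders.
  All code added to a given program, apart from the sampling of rows, is of this kind.\<close>

primrec determ :: "com \<Rightarrow> bool" where
  "determ (Const x v) = True"
| "determ (Op f x y z) = True"
| "determ (Load x a y) = True"
| "determ (Store a y x) = True"
| "determ (Toss x) = False"
| "determ (Query a y) = True"
| "determ (Emit x) = True"
| "determ EndItem = True"
| "determ Skip = True"
| "determ (Seq c d) = (determ c \<and> determ d)"
| "determ (Cond b c d) = (determ c \<and> determ d)"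
| "determ (While b c) = False"

definition ask :: "(nat \<Rightarrow> nat list) \<Rightarrow> nat \<Rightarrow> nat \<Rightarrow> state \<Rightarrow> state" where
  "ask orc a i s =
     s\<lparr>memory := (memory s)(a := (\<lambda>r. if r < length (orc i) then orc i ! r else memory s a r)),
       queries := Suc (queries s)\<rparr>"

primrec exec :: "nat ring \<Rightarrow> (nat \<Rightarrow> nat list) \<Rightarrow> com \<Rightarrow> state \<Rightarrow> state" where
  "exec F orc (Const x v) s = put x 0 v s"
| "exec F orc (Op f x y z) s = put x 0 (apply_op F f (var s y) (var s z)) s"
| "exec F orc (Load x a y) s = put x 0 (memory s a (var s y)) s"
| "exec F orc (Store a y x) s = put a (var s y) (var s x) s"
| "exec F orc (Toss x) s = s"
| "exec F orc (Query a y) s = ask orc a (var s y) s"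
| "exec F orc (Emit x) s = s\<lparr>current := current s @ [var s x]\<rparr>"
| "exec F orc EndItem s = s\<lparr>current := [], items := items s @ [current s]\<rparr>"
| "exec F orc Skip s = s"
| "exec F orc (Seq c d) s = exec F orc d (exec F orc c s)"
| "exec F orc (Cond b c d) s = (if passes b s then exec F orc c s else exec F orc d s)"
| "exec F orc (While b c) s = s"

primrec tm :: "com \<Rightarrow> nat" where
  "tm (Const x v) = 1"
| "tm (Op f x y z) = 1"
| "tm (Load x a y) = 1"
| "tm (Store a y x) = 1"
| "tm (Toss x) = 1"
| "tm (Query a y) = 1"
| "tm (Emit x) = 1"
| "tm EndItem = 1"
| "tm Skip = 1"
| "tm (Seq c d) = 1 + tm c + tm d"
| "tm (Cond b c d) = 1 + max (tm c) (tm d)"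
| "tm (While b c) = 1"

text \<open>The number of steps depends on the state, through the branches taken, but not on the
  stack underneath. The quantifier over \<open>cs\<close> is innermost because
  \<open>tr_steps\<close> needs one step count for every continuation.\<close>

lemma steps_determ:
  assumes "determ c"
  shows "\<exists>N\<le>tm c. \<forall>cs. steps F orc N (c # cs, s) = return_pmf (cs, exec F orc c s)"
  using assms
proof (induction c arbitrary: s)
  case (Seq c d)
  from Seq obtain N1 where N1: "N1 \<le> tm c"
    "\<And>cs. steps F orc N1 (c # cs, s) = return_pmf (cs, exec F orc c s)" by fastforce
  from Seq obtain N2 where N2: "N2 \<le> tm d"
    "\<And>cs. steps F orc N2 (d # cs, exec F orc c s) = return_pmf (cs, exec F orc d (exec F orc c s))"
    by fastforce
  have "steps F orc (Suc (N1 + N2)) (Seq c d # cs, s) = return_pmf (cs, exec F orc (Seq c d) s)" for cs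
    by (simp add: steps_add bind_return_pmf N1 N2)
  then show ?case using N1(1) N2(1) by (intro exI[of _ "Suc (N1 + N2)"]) auto
next
  case (Cond b c d)
  let ?e = "if passes b s then c else d"
  from Cond obtain N where N: "N \<le> tm ?e"
    "\<And>cs. steps F orc N (?e # cs, s) = return_pmf (cs, exec F orc ?e s)"
    by (cases "passes b s") fastforce+
  have "steps F orc (Suc N) (Cond b c d # cs, s) = return_pmf (cs, exec F orc (Cond b c d) s)" for cs
    using N(2) by (auto simp: bind_return_pmf)
  then show ?case using N(1) by (intro exI[of _ "Suc N"]) (auto split: if_splits)
qed (auto intro!: exI[of _ "Suc 0"] simp: bind_return_pmf ask_def Let_def)

lemma steps_determ_halts:
  assumes "determ c" "tm c \<le> N"
  shows "steps F orc N ([c], s) = return_pmf ([], exec F orc c s)"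
proof -
  obtain N' where N': "N' \<le> tm c" "steps F orc N' ([c], s) = return_pmf ([], exec F orc c s)"
    using steps_determ[OF assms(1)] by blast
  have "steps F orc (N' + (N - N')) ([c], s) = return_pmf ([], exec F orc c s)"
    by (subst steps_add) (simp add: N'(2) bind_return_pmf)
  then show ?thesis using N'(1) assms(2) by simp
qed

primrec writes :: "com \<Rightarrow> nat set" where
  "writes (Const x v) = {x}"
| "writes (Op f x y z) = {x}"
| "writes (Load x a y) = {x}"
| "writes (Store a y x) = {a}"
| "writes (Toss x) = {x}"
| "writes (Query a y) = {a}"
| "writes (Emit x) = {}"
| "writes EndItem = {}"
| "writes Skip = {}"
| "writes (Seq c d) = writes c \<union> writes d"
| "writes (Cond b c d) = writes c \<union> writes d"
| "writes (While b c) = writes c"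

primrec silent :: "com \<Rightarrow> bool" where
  "silent (Const x v) = True"
| "silent (Op f x y z) = True"
| "silent (Load x a y) = True"
| "silent (Store a y x) = True"
| "silent (Toss x) = True"
| "silent (Query a y) = True"
| "silent (Emit x) = False"
| "silent EndItem = False"
| "silent Skip = True"
| "silent (Seq c d) = (silent c \<and> silent d)"
| "silent (Cond b c d) = (silent c \<and> silent d)"
| "silent (While b c) = silent c"

primrec nq :: "com \<Rightarrow> nat" where
  "nq (Const x v) = 0"
| "nq (Op f x y z) = 0"
| "nq (Load x a y) = 0"
| "nq (Store a y x) = 0"
| "nq (Toss x) = 0"
| "nq (Query a y) = 1"
| "nq (Emit x) = 0"
| "nq EndItem = 0"
| "nq Skip = 0"
| "nq (Seq c d) = nq c + nq d"
| "nq (Cond b c d) = max (nq c) (nq d)"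
| "nq (While b c) = 0"

lemma memory_put [simp]: "memory (put a i v s) = (memory s)(a := (memory s a)(i := v))"
  and put_simps [simp]: "queries (put a i v s) = queries s" "current (put a i v s) = current s"
    "items (put a i v s) = items s"
  by (simp_all add: put_def)

lemma ask_simps [simp]: "queries (ask orc a i s) = Suc (queries s)"
    "current (ask orc a i s) = current s" "items (ask orc a i s) = items s"
    "memory (ask orc a i s) = (memory s)(a := (\<lambda>r. if r < length (orc i) then orc i ! r else memory s a r))"
  by (simp_all add: ask_def)

lemma exec_frame: "a \<notin> writes c \<Longrightarrow> memory (exec F orc c s) a = memory s a"
  by (induction c arbitrary: s) auto

lemma exec_silent:
  "silent c \<Longrightarrow> items (exec F orc c s) = items s \<and> current (exec F orc c s) = current s"
  by (induction c arbitrary: s) auto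

lemma exec_queries: "queries (exec F orc c s) \<le> queries s + nq c"
proof (induction c arbitrary: s)
  case (Seq c d)
  show ?case using Seq(1)[of s] Seq(2)[of "exec F orc c s"] by simp
next
  case (Cond b c d)
  show ?case using Cond(1)[of s] Cond(2)[of s] by auto
qed auto

definition ok :: "nat set \<Rightarrow> nat \<Rightarrow> nat \<Rightarrow> com \<Rightarrow> bool" where
  "ok W q T c \<longleftrightarrow> determ c \<and> silent c \<and> writes c \<subseteq> W \<and> nq c \<le> q \<and> tm c \<le> T"

lemma ok_mono: "ok W q T c \<Longrightarrow> W \<subseteq> W' \<Longrightarrow> q \<le> q' \<Longrightarrow> T \<le> T' \<Longrightarrow> ok W' q' T' c"
  by (auto simp: ok_def)

lemma ok_Seq: "ok W q1 T1 c \<Longrightarrow> ok W q2 T2 d \<Longrightarrow> ok W (q1 + q2) (1 + T1 + T2) (Seq c d)"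
  by (auto simp: ok_def)

lemma ok_Cond: "ok W q T c \<Longrightarrow> ok W q T d \<Longrightarrow> ok W q (Suc T) (Cond b c d)"
  by (auto simp: ok_def)

fun seqs :: "com list \<Rightarrow> com" where
  "seqs [] = Skip"
| "seqs [c] = c"
| "seqs (c # cs) = Seq c (seqs cs)"

fun loop :: "nat \<Rightarrow> (nat \<Rightarrow> com) \<Rightarrow> com" where
  "loop 0 body = Skip"
| "loop (Suc N) body = Seq (loop N body) (body N)"

lemma loop_inv:
  assumes "I 0 s" "\<And>i s. i < N \<Longrightarrow> I i s \<Longrightarrow> I (Suc i) (exec F orc (body i) s)"
  shows "I N (exec F orc (loop N body) s)"
proof -
  have "j \<le> N \<Longrightarrow> I j (exec F orc (loop j body) s)" for j
    by (induction j) (use assms in auto)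
  then show ?thesis by blast
qed

lemma ok_loop:
  assumes "\<And>i. i < N \<Longrightarrow> ok W q T (body i)"
  shows "ok W (N * q) (N * Suc T + 1) (loop N body)"
  using assms
proof (induction N)
  case (Suc N)
  have "ok W (N * q + q) (1 + (N * Suc T + 1) + T) (Seq (loop N body) (body N))"
    using Suc by (intro ok_Seq) auto
  then show ?case by (auto simp: ok_def)
qed (auto simp: ok_def)

lemma ok_frame:
  assumes "ok W q T c" "a \<notin> W"
  shows "memory (exec F orc c s) a = memory s a"
  using assms by (intro exec_frame) (auto simp: ok_def)

section \<open>The layout of the memory\<close>

text \<open>The array \<open>a\<close> of the decoder of the outer code is kept in \<open>bv a\<close>, an array \<open>a\<close> of the list
  recovery program in \<open>dat a\<close> with its stamps in \<open>stp a\<close>, and \<open>ar i j\<close> is working storage. None of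
  them is array 1, which holds the input.\<close>

definition bv :: "nat \<Rightarrow> nat" where "bv x = 4 * x"
definition ar :: "nat \<Rightarrow> nat \<Rightarrow> nat" where "ar i j = 4 * prod_encode (i, j) + 5"
definition dat :: "nat \<Rightarrow> nat" where "dat a = 4 * a + 2"
definition stp :: "nat \<Rightarrow> nat" where "stp a = 4 * a + 3"

lemma layout_inj [simp]: "bv x = bv y \<longleftrightarrow> x = y" "ar i j = ar i' j' \<longleftrightarrow> i = i' \<and> j = j'"
  "dat x = dat y \<longleftrightarrow> x = y" "stp x = stp y \<longleftrightarrow> x = y"
  by (auto simp: bv_def ar_def dat_def stp_def)

text \<open>The four families differ modulo 4, and the 5 in \<open>ar\<close> skips array 1. Since
  \<open>bv 0 = 0\<close>, the index of the wanted symbol already stands where the outer decoder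
  expects it.\<close>

lemma layout_disj [simp]:
  "bv x \<noteq> ar i j" "bv x \<noteq> dat a" "bv x \<noteq> stp a" "ar i j \<noteq> dat a" "ar i j \<noteq> stp a" "dat a \<noteq> stp b"
  "ar i j \<noteq> bv x" "dat a \<noteq> bv x" "stp a \<noteq> bv x" "dat a \<noteq> ar i j" "stp a \<noteq> ar i j" "stp b \<noteq> dat a"
  "bv x \<noteq> Suc 0" "ar i j \<noteq> Suc 0" "dat a \<noteq> Suc 0" "stp a \<noteq> Suc 0"
  "Suc 0 \<noteq> bv x" "Suc 0 \<noteq> ar i j" "Suc 0 \<noteq> dat a" "Suc 0 \<noteq> stp a"
  unfolding bv_def ar_def dat_def stp_def by presburger+

abbreviation "rI \<equiv> ar 0 0"
abbreviation "rCnt \<equiv> ar 0 11"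
abbreviation "rG \<equiv> ar 0 2"
abbreviation "rA \<equiv> ar 0 3"
abbreviation "rJ \<equiv> ar 0 4"
abbreviation "rC \<equiv> ar 0 5"
abbreviation "rZ \<equiv> ar 0 6"
abbreviation "rOne \<equiv> ar 0 7"
abbreviation "rOC \<equiv> ar 0 8"
abbreviation "r1 \<equiv> ar 0 9"
abbreviation "r2 \<equiv> ar 0 10"
abbreviation "LA \<equiv> ar 9 0"
abbreviation "LI \<equiv> ar 9 2"
abbreviation "OUT \<equiv> ar 9 3"
abbreviation "rDN \<equiv> ar 9 4"

section \<open>Simulating a program on a memory that is zero outside its input\<close>

text \<open>The sparse-set trick: a cell of the simulated memory counts as initialized if its stamp
  points below the counter to a log entry that names this cell. Setting the counter to 0 thus
  clears the whole memory in one step, whatever the arrays contain.\<close>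

definition valid :: "state \<Rightarrow> nat \<Rightarrow> nat \<Rightarrow> bool" where
  "valid s a y \<longleftrightarrow> memory s (stp a) y < var s rCnt \<and>
     memory s LA (memory s (stp a) y) = a \<and> memory s LI (memory s (stp a) y) = y"

definition absm :: "state \<Rightarrow> mem" where
  "absm s a y = (if valid s a y then memory s (dat a) y else 0)"

definition touch_init :: "nat \<Rightarrow> com" where
  "touch_init a = seqs [Store (stp a) rI rCnt, Store LA rCnt rC, Store LI rCnt rI,
     Const rZ 0, Store (dat a) rI rZ, Const rOne 1, Op Add rCnt rCnt rOne]"

definition touch :: "nat \<Rightarrow> com" where
  "touch a = seqs [Load rG (stp a) rI, Load rA LA rG, Load rJ LI rG, Const rC a,
     Cond (Less rG rCnt)
       (Cond (Eq rA rC) (Cond (Eq rJ rI) Skip (touch_init a)) (touch_init a)) (touch_init a)]"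

definition simW :: "nat set" where
  "simW = range dat \<union> range stp \<union> range (ar 0) \<union> range (ar 9)"

lemma simW_mem [simp]: "dat a \<in> simW" "stp a \<in> simW" "ar 0 j \<in> simW" "ar 9 j \<in> simW"
  "bv x \<notin> simW" "Suc 0 \<notin> simW" "i \<noteq> 0 \<Longrightarrow> i \<noteq> 9 \<Longrightarrow> ar i j \<notin> simW"
  by (auto simp: simW_def)

lemma ok_touch: "ok simW 0 25 (touch a)"
  by (simp add: ok_def touch_def touch_init_def)

lemma exec_touch_init:
  assumes s': "s' = exec F orc (touch_init a) s" and c: "var s rC = a"
  shows "memory s' (stp a) = (memory s (stp a))(var s rI := var s rCnt)"
    "memory s' LA = (memory s LA)(var s rCnt := a)"
    "memory s' LI = (memory s LI)(var s rCnt := var s rI)"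
    "memory s' (dat a) = (memory s (dat a))(var s rI := 0)"
    "var s' rCnt = Suc (var s rCnt)"
    "memory s' rI = memory s rI"
    "\<And>b. b \<noteq> a \<Longrightarrow> memory s' (stp b) = memory s (stp b)"
    "\<And>b. b \<noteq> a \<Longrightarrow> memory s' (dat b) = memory s (dat b)"
    "\<And>j. j \<notin> {2,3,4,5,6,7,11} \<Longrightarrow> memory s' (ar 0 j) = memory s (ar 0 j)"
    "\<And>j. j \<notin> {0,2} \<Longrightarrow> memory s' (ar 9 j) = memory s (ar 9 j)"
  using c by (simp_all add: s' touch_init_def var_def)

text \<open>A stale stamp of another cell may equal the old counter and so fall below the new one,
  but the log entry there names the cell just touched; hence no other cell becomes valid. The
  touched cell receives 0, the value it already represented.\<close>

lemma absm_touch_init: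
  assumes s': "s' = exec F orc (touch_init a) s" and c: "var s rC = a"
    and nv: "\<not> valid s a (var s rI)"
  shows "absm s' = absm s" "valid s' a (var s rI)"
proof -
  note [simp] = exec_touch_init[OF s' c]
  show v: "valid s' a (var s rI)" by (simp add: valid_def)
  have "valid s' b y \<longleftrightarrow> valid s b y" if "b \<noteq> a \<or> y \<noteq> var s rI" for b y
  proof (cases "b = a")
    case True
    with that show ?thesis by (auto simp: valid_def)
  next
    case False
    then show ?thesis by (auto simp: valid_def)
  qed
  moreover have "memory s' (dat b) y = memory s (dat b) y" if "b \<noteq> a \<or> y \<noteq> var s rI" for b y
    using that by (cases "b = a") auto
  moreover have "absm s' a (var s rI) = absm s a (var s rI)"
    using v nv by (simp add: absm_def)
  ultimately show "absm s' = absm s"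
    by (intro ext) (metis absm_def)
qed

lemma exec_touch:
  assumes s': "s' = exec F orc (touch a) s"
  shows "absm s' = absm s" "valid s' a (var s rI)" "memory s' rI = memory s rI"
    "\<And>j. j \<notin> {2,3,4,5,6,7,11} \<Longrightarrow> memory s' (ar 0 j) = memory s (ar 0 j)"
    "\<And>j. j \<notin> {0,2} \<Longrightarrow> memory s' (ar 9 j) = memory s (ar 9 j)"
proof -
  define s1 where "s1 = exec F orc (seqs [Load rG (stp a) rI, Load rA LA rG, Load rJ LI rG, Const rC a]) s"
  have s1: "memory s1 (stp b) = memory s (stp b)" "memory s1 (dat b) = memory s (dat b)"
    "memory s1 (ar 9 j) = memory s (ar 9 j)" "memory s1 rI = memory s rI" "var s1 rC = a"
    "memory s1 rCnt = memory s rCnt" for b j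
    by (simp_all add: s1_def var_def)
  have s1j: "memory s1 (ar 0 j) = memory s (ar 0 j)" if "j \<notin> {2,3,4,5,6,7,11}" for j
    using that by (simp add: s1_def)
  have valid1: "valid s1 b y \<longleftrightarrow> valid s b y" for b y
    using s1(3)[of 0] s1(3)[of 2] by (simp add: valid_def s1 var_def)
  have abs1: "absm s1 = absm s" by (intro ext) (simp add: absm_def valid1 s1)
  have I1: "var s1 rI = var s rI" by (simp add: var_def s1)
  have eq: "s' = (if valid s a (var s rI) then s1 else exec F orc (touch_init a) s1)"
    unfolding s' touch_def s1_def by (auto simp: valid_def var_def)
  have "absm s' = absm s \<and> valid s' a (var s rI) \<and> memory s' rI = memory s rI \<and>
    (\<forall>j. j \<notin> {2,3,4,5,6,7,11} \<longrightarrow> memory s' (ar 0 j) = memory s (ar 0 j)) \<and>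
    (\<forall>j. j \<notin> {0,2} \<longrightarrow> memory s' (ar 9 j) = memory s (ar 9 j))"
  proof (cases "valid s a (var s rI)")
    case True
    then show ?thesis unfolding eq using abs1 valid1 s1j by (simp add: s1)
  next
    case False
    define s2 where "s2 = exec F orc (touch_init a) s1"
    note s2 = exec_touch_init[OF s2_def s1(5)] absm_touch_init[OF s2_def s1(5)]
    have "s' = s2" using False by (simp add: eq s2_def)
    moreover have "absm s2 = absm s" "valid s2 a (var s rI)"
      using s2(11,12) False abs1 by (simp_all add: valid1 I1)
    moreover have "memory s2 rI = memory s rI" using s2(6) by (simp add: s1)
    ultimately show ?thesis using s1j s2(9,10) s1(3) by simp
  qed
  then show "absm s' = absm s" "valid s' a (var s rI)" "memory s' rI = memory s rI"
    "\<And>j. j \<notin> {2,3,4,5,6,7,11} \<Longrightarrow> memory s' (ar 0 j) = memory s (ar 0 j)"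
    "\<And>j. j \<notin> {0,2} \<Longrightarrow> memory s' (ar 9 j) = memory s (ar 9 j)"
    by blast+
qed

definition rdi :: "nat \<Rightarrow> nat \<Rightarrow> com" where
  "rdi a r = seqs [touch a, Load r (dat a) rI]"

definition rd :: "nat \<Rightarrow> nat \<Rightarrow> com" where
  "rd a r = seqs [Const rI 0, rdi a r]"

definition wr :: "nat \<Rightarrow> nat \<Rightarrow> com" where
  "wr a r = seqs [touch a, Store (dat a) rI r]"

lemma absm_cong:
  assumes "\<And>b. memory s' (stp b) = memory s (stp b)" "\<And>b. memory s' (dat b) = memory s (dat b)"
    "memory s' LA = memory s LA" "memory s' LI = memory s LI" "memory s' rCnt = memory s rCnt"
  shows "absm s' = absm s"
  using assms by (intro ext) (simp add: absm_def valid_def var_def)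

lemma exec_rdi:
  assumes s': "s' = exec F orc (rdi a (ar 0 r)) s" and r: "r \<in> {9,10}"
  shows "absm s' = absm s" "memory s' (ar 0 r) 0 = absm s a (memory s rI 0)"
    "\<And>j. j \<in> {9,10} \<Longrightarrow> j \<noteq> r \<Longrightarrow> memory s' (ar 0 j) = memory s (ar 0 j)"
    "memory s' OUT = memory s OUT" "memory s' rOC = memory s rOC" "memory s' rDN = memory s rDN"
proof -
  define s1 where "s1 = exec F orc (touch a) s"
  note n = exec_touch[OF s1_def]
  have eq: "s' = put (ar 0 r) 0 (memory s1 (dat a) (memory s1 rI 0)) s1"
    by (simp add: s' rdi_def s1_def var_def)
  show "absm s' = absm s"
    unfolding n(1)[symmetric] eq using r by (intro absm_cong) auto
  have "absm s1 a (memory s rI 0) = memory s1 (dat a) (memory s rI 0)"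
    using n(2) by (simp add: absm_def var_def)
  then show "memory s' (ar 0 r) 0 = absm s a (memory s rI 0)"
    by (simp add: eq n(3) n(1))
  show "memory s' (ar 0 j) = memory s (ar 0 j)" if "j \<in> {9,10}" "j \<noteq> r" for j
    using that n(4)[of j] by (auto simp: eq)
  show "memory s' OUT = memory s OUT" "memory s' rOC = memory s rOC" "memory s' rDN = memory s rDN"
    using n(4)[of 8] n(5)[of 3] n(5)[of 4] r by (auto simp: eq)
qed

lemma exec_rd:
  assumes s': "s' = exec F orc (rd a (ar 0 r)) s" and r: "r \<in> {9,10}"
  shows "absm s' = absm s" "memory s' (ar 0 r) 0 = absm s a 0"
    "\<And>j. j \<in> {9,10} \<Longrightarrow> j \<noteq> r \<Longrightarrow> memory s' (ar 0 j) = memory s (ar 0 j)"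
    "memory s' OUT = memory s OUT" "memory s' rOC = memory s rOC" "memory s' rDN = memory s rDN"
proof -
  define s1 where "s1 = put rI 0 0 s"
  have eq: "s' = exec F orc (rdi a (ar 0 r)) s1" by (simp add: s' s1_def rd_def)
  note n = exec_rdi[OF eq r]
  have a: "absm s1 = absm s" by (rule absm_cong) (auto simp: s1_def)
  show "absm s' = absm s" "memory s' (ar 0 r) 0 = absm s a 0"
    by (simp_all add: n(1,2) a) (simp add: s1_def)
  show "memory s' (ar 0 j) = memory s (ar 0 j)" if "j \<in> {9,10}" "j \<noteq> r" for j
    using n(3)[OF that] that by (auto simp: s1_def)
  show "memory s' OUT = memory s OUT" "memory s' rOC = memory s rOC" "memory s' rDN = memory s rDN"
    by (simp_all add: n(4-6)) (simp_all add: s1_def)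
qed

lemma exec_wr:
  assumes s': "s' = exec F orc (wr a (ar 0 r)) s" and r: "r \<in> {9,10}"
  shows "absm s' = (absm s)(a := (absm s a)(memory s rI 0 := memory s (ar 0 r) 0))"
    "memory s' OUT = memory s OUT" "memory s' rOC = memory s rOC" "memory s' rDN = memory s rDN"
    "\<And>j. j \<notin> {2,3,4,5,6,7,11} \<Longrightarrow> memory s' (ar 0 j) = memory s (ar 0 j)"
    "\<And>j. j \<notin> {0,2} \<Longrightarrow> memory s' (ar 9 j) = memory s (ar 9 j)"
proof -
  define s1 where "s1 = exec F orc (touch a) s"
  note n = exec_touch[OF s1_def]
  define v where "v = memory s (ar 0 r) 0"
  define i where "i = memory s rI 0"
  have eq: "s' = put (dat a) i v s1"
    using n(4)[of r] r by (auto simp: s' wr_def s1_def var_def v_def i_def n(3)[unfolded s1_def])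
  have "valid s' b y = valid s1 b y" for b y
    by (simp add: eq valid_def var_def)
  moreover have "valid s1 a i" using n(2) by (simp add: i_def var_def)
  ultimately have "absm s' b y = (if b = a \<and> y = i then v else absm s1 b y)" for b y
    by (auto simp: absm_def eq)
  then show "absm s' = (absm s)(a := (absm s a)(memory s rI 0 := memory s (ar 0 r) 0))"
    by (intro ext) (auto simp: n(1) v_def i_def)
  show "memory s' OUT = memory s OUT" "memory s' rOC = memory s rOC" "memory s' rDN = memory s rDN"
    using n(4)[of 8] n(5)[of 3] n(5)[of 4] by (auto simp: eq)
  show "\<And>j. j \<notin> {2,3,4,5,6,7,11} \<Longrightarrow> memory s' (ar 0 j) = memory s (ar 0 j)"
    "\<And>j. j \<notin> {0,2} \<Longrightarrow> memory s' (ar 9 j) = memory s (ar 9 j)"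
    using n(4,5) by (auto simp: eq)
qed

lemma ok_wr: "ok simW 0 30 (wr a (ar 0 r))"
  using ok_touch[of a] by (auto simp: ok_def wr_def)

text \<open>Coins are fixed to 0: the guarantee in \<open>list_recovery_alg\<close> holds for every
  run in the support, so it holds for this one, by \<open>dsteps_in_steps\<close>. A query is
  skipped because \<open>no_oracle\<close> answers with the empty list and thus writes
  nothing.\<close>

fun simc :: "com \<Rightarrow> com" where
  "simc (Const x v) = seqs [Const r1 v, Const rI 0, wr x r1]"
| "simc (Op f x y z) = seqs [rd y r1, rd z r2, Op f r1 r1 r2, Const rI 0, wr x r1]"
| "simc (Load x a y) = seqs [rd y r1, Const rI 0, Op Add rI r1 rI, rdi a r1, Const rI 0, wr x r1]"
| "simc (Store a y x) = seqs [rd y r2, rd x r1, Const rI 0, Op Add rI r2 rI, wr a r1]"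
| "simc (Toss x) = seqs [Const r1 0, Const rI 0, wr x r1]"
| "simc (Emit x) = seqs [rd x r1, Store OUT rOC r1, Const rOne 1, Op Add rOC rOC rOne]"
| "simc EndItem = seqs [Const rZ 0, Op Add rDN rOC rZ]"
| "simc _ = Skip"

definition ltest :: "test \<Rightarrow> com" where
  "ltest b = (case b of Eq x y \<Rightarrow> seqs [rd x r1, rd y r2] | Less x y \<Rightarrow> seqs [rd x r1, rd y r2])"

definition etest :: "test \<Rightarrow> test" where
  "etest b = (case b of Eq x y \<Rightarrow> Eq r1 r2 | Less x y \<Rightarrow> Less r1 r2)"

text \<open>A loop cannot be simulated by a loop with the same number of steps, so the program is unrolled to
  the depth of its time bound. The size of a program is not charged for, only its running time.\<close>

fun unroll :: "nat \<Rightarrow> com list \<Rightarrow> com" where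
  "unroll 0 cs = Skip"
| "unroll (Suc N) [] = Skip"
| "unroll (Suc N) (c # cs) =
     (case c of
        Seq d e \<Rightarrow> unroll N (d # e # cs)
      | Cond b d e \<Rightarrow> Seq (ltest b) (Cond (etest b) (unroll N (d # cs)) (unroll N (e # cs)))
      | While b d \<Rightarrow> Seq (ltest b) (Cond (etest b) (unroll N (d # While b d # cs)) (unroll N cs))
      | _ \<Rightarrow> Seq (simc c) (unroll N cs))"

fun dstep :: "nat ring \<Rightarrow> config \<Rightarrow> config" where
  "dstep F ([], s) = ([], s)"
| "dstep F (c # cs, s) =
     (case c of
        Seq d e \<Rightarrow> (d # e # cs, s)
      | Cond b d e \<Rightarrow> ((if passes b s then d else e) # cs, s)
      | While b d \<Rightarrow> (if passes b s then d # While b d # cs else cs, s)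
      | Toss x \<Rightarrow> (cs, put x 0 0 s)
      | _ \<Rightarrow> (cs, exec F no_oracle c s))"

lemma dstep_in_step: "dstep F cfg \<in> set_pmf (step F no_oracle cfg)"
proof (cases cfg)
  case (Pair cs s)
  show ?thesis
  proof (cases cs)
    case (Cons c cs')
    show ?thesis
      unfolding Pair Cons
      by (cases c) (auto simp: ask_def Let_def set_pmf_bernoulli image_iff intro!: bexI[of _ False])
  qed (simp add: Pair)
qed

lemma dsteps_in_steps: "(dstep F ^^ N) cfg \<in> set_pmf (steps F no_oracle N cfg)"
proof (induction N arbitrary: cfg)
  case (Suc N)
  have "(dstep F ^^ Suc N) cfg = (dstep F ^^ N) (dstep F cfg)" by (simp add: funpow_swap1)
  then show ?case using Suc[of "dstep F cfg"] dstep_in_step[of F cfg] by auto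
qed simp

text \<open>Item boundaries are not stored: the items of a list recovery program all have length
  \<open>k\<close>, so positions in the flat array \<open>OUT\<close> identify them.
  \<open>rDN\<close> marks the end of the last finished item and keeps an unfinished one
  apart.\<close>

definition simrel :: "state \<Rightarrow> state \<Rightarrow> bool" where
  "simrel s z \<longleftrightarrow> absm s = memory z \<and>
     concat (items z) @ current z = map (memory s OUT) [0..<memory s rOC 0] \<and>
     memory s rDN 0 = length (concat (items z))"

lemma simc_correct:
  assumes "simrel s z" and c: "\<And>d e. c \<noteq> Seq d e" "\<And>b d e. c \<noteq> Cond b d e" "\<And>b d. c \<noteq> While b d"
  shows "simrel (exec F orc (simc c) s) (snd (dstep F (c # cs, z)))"
proof -
  have a: "absm s = memory z"
    and o: "concat (items z) @ current z = map (memory s OUT) [0..<memory s rOC 0]"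
    and d: "memory s rDN 0 = length (concat (items z))"
    using assms(1) by (auto simp: simrel_def)
  have putI: "absm (put (ar 0 j) i v t) = absm t" if "j \<noteq> 11" for j i v t
    using that by (intro absm_cong) auto
  have wr0: "simrel (exec F orc (wr x r1) (put rI 0 0 t)) (put x 0 (memory t r1 0) z)"
    if "absm t = memory z" "memory t OUT = memory s OUT" "memory t rOC = memory s rOC"
      "memory t rDN = memory s rDN" for t x
  proof -
    define t' where "t' = exec F orc (wr x r1) (put rI 0 0 t)"
    note w = exec_wr[OF t'_def]
    show ?thesis unfolding t'_def[symmetric] simrel_def
      using that o d by (simp add: w putI)
  qed
  show ?thesis
  proof (cases c)
    case (Const x v)
    show ?thesis using wr0[of "put r1 0 v s" x] by (simp add: Const putI a)
  next
    case (Toss x)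
    show ?thesis using wr0[of "put r1 0 0 s" x] by (simp add: Toss putI a)
  next
    case (Op f x y w)
    define s1 where "s1 = exec F orc (rd y r1) s"
    define s2 where "s2 = exec F orc (rd w r2) s1"
    note e1 = exec_rd[OF s1_def, simplified] and e2 = exec_rd[OF s2_def, simplified]
    show ?thesis
      using wr0[of "put r1 0 (apply_op F f (memory z y 0) (memory z w 0)) s2" x]
      by (simp add: Op s1_def[symmetric] s2_def[symmetric] putI a e1 e2 var_def)
  next
    case (Load x b y)
    define s1 where "s1 = exec F orc (rd y r1) s"
    define s2 where "s2 = put rI 0 (memory z y 0) (put rI 0 0 s1)"
    define s3 where "s3 = exec F orc (rdi b r1) s2"
    note e1 = exec_rd[OF s1_def, simplified] and e3 = exec_rdi[OF s3_def, simplified]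
    have "exec F orc (simc c) s = exec F orc (wr x r1) (put rI 0 0 s3)"
      by (simp add: Load s1_def[symmetric] s3_def s2_def e1 a var_def)
    moreover have "memory s3 r1 0 = memory z b (memory z y 0)" "absm s3 = memory z"
      "memory s3 OUT = memory s OUT" "memory s3 rOC = memory s rOC" "memory s3 rDN = memory s rDN"
      by (simp_all add: e3) (simp_all add: s2_def e1 putI a)
    ultimately show ?thesis using wr0[of s3 x] by (simp add: Load var_def)
  next
    case (Store b y x)
    define s1 where "s1 = exec F orc (rd y r2) s"
    define s2 where "s2 = exec F orc (rd x r1) s1"
    define s3 where "s3 = put rI 0 (memory z y 0) (put rI 0 0 s2)"
    define s4 where "s4 = exec F orc (wr b r1) s3"
    note e1 = exec_rd[OF s1_def, simplified] and e2 = exec_rd[OF s2_def, simplified]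
      and e4 = exec_wr[OF s4_def, simplified]
    have "exec F orc (simc c) s = s4"
      by (simp add: Store s1_def[symmetric] s2_def[symmetric] s4_def s3_def e1 e2 a var_def)
    moreover have "absm s4 = (memory z)(b := (memory z b)(memory z y 0 := memory z x 0))"
      by (simp add: e4) (simp add: s3_def putI e1 e2 a)
    moreover have "memory s4 OUT = memory s OUT" "memory s4 rOC = memory s rOC" "memory s4 rDN = memory s rDN"
      by (simp_all add: e4) (simp_all add: s3_def e1 e2)
    ultimately show ?thesis using o d by (simp add: Store simrel_def var_def)
  next
    case (Emit x)
    define s1 where "s1 = exec F orc (rd x r1) s"
    note e1 = exec_rd[OF s1_def, simplified]
    define s2 where "s2 = exec F orc (simc c) s"
    have s2: "s2 = put rOC 0 (memory s rOC 0 + 1) (put rOne 0 1 (put OUT (memory s rOC 0) (memory z x 0) s1))"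
      by (simp add: s2_def Emit s1_def[symmetric] e1 var_def a)
    have "absm s2 = absm s1" unfolding s2 by (intro absm_cong) auto
    moreover have "map (memory s2 OUT) [0..<memory s2 rOC 0] =
        map (memory s OUT) [0..<memory s rOC 0] @ [memory z x 0]"
      by (simp add: s2 e1)
    moreover have "memory s2 rDN 0 = memory s rDN 0" by (simp add: s2 e1)
    moreover have "snd (dstep F (c # cs, z)) = z\<lparr>current := current z @ [memory z x 0]\<rparr>"
      by (simp add: Emit var_def)
    moreover have "concat (items z) @ current z @ [memory z x 0] =
        map (memory s OUT) [0..<memory s rOC 0] @ [memory z x 0]"
      unfolding append_assoc[symmetric] o ..
    ultimately show ?thesis
      unfolding s2_def[symmetric] simrel_def using d e1(1) a by simp
  next
    case EndItem
    define s2 where "s2 = exec F orc (simc c) s"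
    have s2: "s2 = put rDN 0 (memory s rOC 0) (put rZ 0 0 s)"
      by (simp add: s2_def EndItem var_def)
    have "absm s2 = absm s" unfolding s2 by (intro absm_cong) auto
    moreover have l: "memory s rOC 0 = length (concat (items z) @ current z)"
      unfolding o by simp
    moreover have "map (memory s2 OUT) [0..<memory s2 rOC 0] = concat (items z) @ current z"
      unfolding o by (simp add: s2)
    moreover have "memory s2 rDN 0 = length (concat (items z) @ current z)"
      unfolding l[symmetric] by (simp add: s2)
    moreover have "snd (dstep F (c # cs, z)) = z\<lparr>current := [], items := items z @ [current z]\<rparr>"
      by (simp add: EndItem)
    ultimately show ?thesis
      unfolding s2_def[symmetric] simrel_def using a by simp
  next
    case (Query b y)
    then show ?thesis using assms(1) by (simp add: simrel_def no_oracle_def)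
  qed (use assms in \<open>auto simp: simrel_def\<close>)
qed

lemma exec_ltest:
  assumes s': "s' = exec F orc (ltest b) s" and "simrel s z"
  shows "simrel s' z" "passes (etest b) s' = passes b z"
proof -
  have a: "absm s = memory z"
    and o: "concat (items z) @ current z = map (memory s OUT) [0..<memory s rOC 0]"
    and d: "memory s rDN 0 = length (concat (items z))"
    using assms(2) by (auto simp: simrel_def)
  have *: "simrel s' z \<and> memory s' r1 0 = memory z x 0 \<and> memory s' r2 0 = memory z y 0"
    if "s' = exec F orc (rd y r2) (exec F orc (rd x r1) s)" for x y
  proof -
    define s1 where "s1 = exec F orc (rd x r1) s"
    note e1 = exec_rd[OF s1_def, simplified]
    have "s' = exec F orc (rd y r2) s1" using that by (simp add: s1_def)
    note e2 = exec_rd[OF this, simplified]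
    show ?thesis using o d by (simp add: simrel_def e1 e2 a)
  qed
  show "simrel s' z" "passes (etest b) s' = passes b z"
    using *[of "case b of Eq x y \<Rightarrow> y | Less x y \<Rightarrow> y" "case b of Eq x y \<Rightarrow> x | Less x y \<Rightarrow> x"]
    by (cases b; simp add: s' ltest_def etest_def var_def)+
qed

text \<open>Pending commands are the argument \<open>cs\<close> of \<open>unroll\<close>, so the
  control stack of the simulated machine is resolved in the program text; only its memory and output
  need an invariant.\<close>

lemma unroll_correct:
  "simrel s z \<Longrightarrow> simrel (exec F orc (unroll N cs) s) (snd ((dstep F ^^ N) (cs, z)))"
proof (induction N arbitrary: cs s z)
  case (Suc N)
  have eq: "(dstep F ^^ Suc N) cfg = (dstep F ^^ N) (dstep F cfg)" for cfg
    by (simp add: funpow_swap1)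
  show ?case
  proof (cases cs)
    case Nil
    have "(dstep F ^^ M) ([], z) = ([], z)" for M by (induction M) auto
    then show ?thesis using Suc.prems Nil by (simp del: funpow.simps)
  next
    case (Cons c cs')
    have basic: ?thesis if u: "unroll (Suc N) cs = Seq (simc c) (unroll N cs')"
      and fst: "fst (dstep F (c # cs', z)) = cs'"
      and c: 
      "\<And>d e. c \<noteq> Seq d e" "\<And>b d e. c \<noteq> Cond b d e" "\<And>b d. c \<noteq> While b d"
    proof -
      obtain z' where z': "dstep F (c # cs', z) = (cs', z')" using fst by (cases "dstep F (c # cs', z)") auto
      have "simrel (exec F orc (simc c) s) z'"
        using simc_correct[OF Suc.prems c, where F=F and orc=orc and cs=cs'] z' by simp
      from Suc.IH[OF this, of cs'] show ?thesis
        unfolding u eq using Cons z' by simp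
    qed
    show ?thesis
    proof (cases c)
      case (Seq d e)
      then show ?thesis using Suc.IH[OF Suc.prems] by (simp add: Cons eq del: funpow.simps)
    next
      case (Cond b d e)
      define s1 where "s1 = exec F orc (ltest b) s"
      note l = exec_ltest[OF s1_def Suc.prems]
      show ?thesis using Suc.IH[OF l(1)] l(2)
        by (simp add: Cons eq Cond s1_def[symmetric] del: funpow.simps)
    next
      case (While b d)
      define s1 where "s1 = exec F orc (ltest b) s"
      note l = exec_ltest[OF s1_def Suc.prems]
      show ?thesis using Suc.IH[OF l(1)] l(2)
        by (simp add: Cons eq While s1_def[symmetric] del: funpow.simps)
    qed (rule basic; simp add: Cons)+
  qed
qed simp

lemma ok_simc: "ok simW 0 180 (simc c)"
  by (cases c) (simp_all add: ok_def rd_def rdi_def wr_def touch_def touch_init_def)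

lemma ok_ltest: "ok simW 0 80 (ltest b)"
  by (cases b) (simp_all add: ok_def ltest_def rd_def rdi_def touch_def touch_init_def)

lemma ok_unroll: "ok simW 0 (N * 200 + 1) (unroll N cs)"
proof (induction N arbitrary: cs)
  case 0
  then show ?case by (simp add: ok_def)
next
  case (Suc N)
  show ?case
  proof (cases cs)
    case Nil
    then show ?thesis by (simp add: ok_def)
  next
    case (Cons c cs')
    have basic: "ok simW 0 (Suc N * 200 + 1) (Seq (simc c) (unroll N cs'))"
      using ok_Seq[OF ok_simc[of c] Suc[of cs']] by (rule ok_mono) simp_all
    have cond: "ok simW 0 (Suc N * 200 + 1) (Seq (ltest b) (Cond (etest b) (unroll N ds) (unroll N es)))"
      for b ds es
      using ok_Seq[OF ok_ltest[of b] ok_Cond[OF Suc[of ds] Suc[of es], of "etest b"]]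
      by (rule ok_mono) simp_all
    have "ok simW 0 (Suc N * 200 + 1) (unroll N (d # e # cs'))" for d e
      using Suc[of "d # e # cs'"] by (rule ok_mono) simp_all
    with basic cond show ?thesis
      by (cases c) (simp_all only: Cons unroll.simps com.simps)
  qed
qed

definition imem :: "nat list \<Rightarrow> mem" where
  "imem xs a y = (if a = 1 \<and> y < length xs then xs ! y else 0)"

definition start :: "nat list \<Rightarrow> state" where
  "start xs = \<lparr>memory = imem xs, queries = 0, current = [], items = []\<rparr>"

definition lister :: "nat ring \<Rightarrow> nat \<Rightarrow> com \<Rightarrow> nat list \<Rightarrow> nat list list" where
  "lister F T P xs = items (snd ((dstep F ^^ T) ([P], start xs)))"

lemma imem_snoc: "(imem xs)(1 := (imem xs 1)(length xs := v)) = imem (xs @ [v])"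
  by (intro ext) (auto simp: imem_def nth_append)

section \<open>The recursive decoder and its translation into a program\<close>

fun esum :: "nat ring \<Rightarrow> (nat \<Rightarrow> nat) \<Rightarrow> (nat \<Rightarrow> nat) \<Rightarrow> nat \<Rightarrow> nat" where
  "esum F g x 0 = \<zero>\<^bsub>F\<^esub>"
| "esum F g x (Suc p) = apply_op F FAdd (esum F g x p) (apply_op F FMul (g p) (x p))"

lemma esum_cong: "(\<And>p. p < N \<Longrightarrow> x p = x' p) \<Longrightarrow> esum F g x N = esum F g x' N"
  by (induction N) auto

text \<open>The position in \<open>[n] ^ s\<close> of the systematic coordinate with index \<open>y\<close> in \<open>[k] ^ s\<close>.\<close>

definition conv :: "nat \<Rightarrow> nat \<Rightarrow> nat \<Rightarrow> nat \<Rightarrow> nat" where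
  "conv k n s y = (\<Sum>u<s. (y div k ^ u mod k) * n ^ u)"

lemma conv_less: "0 < k \<Longrightarrow> k \<le> n \<Longrightarrow> conv k n s y < n ^ s"
proof (induction s)
  case (Suc s)
  have "y div k ^ s mod k < n" using Suc.prems by (meson mod_less_divisor order_less_le_trans)
  then have "(y div k ^ s mod k) * n ^ s + n ^ s \<le> n * n ^ s"
    by (metis Suc_leI add.commute mult_Suc mult_le_mono1)
  then show ?case using Suc by (simp add: conv_def)
qed (simp add: conv_def)

abbreviation "g0 \<equiv> ar 10 20"
abbreviation "g1 \<equiv> ar 10 21"
abbreviation "g2 \<equiv> ar 10 22"
abbreviation "g3 \<equiv> ar 10 23"
abbreviation "g4 \<equiv> ar 10 24"
abbreviation "g5 \<equiv> ar 10 25"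
abbreviation "g6 \<equiv> ar 10 26"
abbreviation "g7 \<equiv> ar 10 27"
abbreviation "BUF \<equiv> ar 8 20"
abbreviation "MC \<equiv> ar 8 21"
abbreviation "Zr s \<equiv> ar 2 s"
abbreviation "Vr s \<equiv> ar 3 s"
abbreviation "VEC s \<equiv> ar 4 s"
abbreviation "DG s \<equiv> ar 5 s"
abbreviation "LO s \<equiv> ar 6 s"
abbreviation "WT s \<equiv> ar 7 s"

text \<open>What a call in dimension \<open>s\<close> may overwrite. Working storage is indexed by
  the dimension, as only one call per dimension is active at a time. The offset \<open>Zr s\<close>
  of the call itself and the digits of the position survive.\<close>

definition evW :: "nat \<Rightarrow> nat set" where
  "evW s = simW \<union> range (ar 8) \<union> range (ar 10) \<union> ar 2 ` {..<s} \<union> ar 3 ` {..s} \<union> ar 4 ` {..s}"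

definition fibW :: "nat set" where
  "fibW = simW \<union> range (ar 8) \<union> range (ar 10)"

lemma fibW_mem [simp]: "ar i j \<in> fibW \<longleftrightarrow> i = 0 \<or> i = 8 \<or> i = 9 \<or> i = 10"
  "dat a \<in> fibW" "stp a \<in> fibW" "bv x \<notin> fibW" "Suc 0 \<notin> fibW"
  by (auto simp: fibW_def simW_def)

lemma evW_mem [simp]: "ar i j \<in> evW s \<longleftrightarrow>
    i = 0 \<or> i = 8 \<or> i = 9 \<or> i = 10 \<or> i = 2 \<and> j < s \<or> (i = 3 \<or> i = 4) \<and> j \<le> s"
  "dat a \<in> evW s" "stp a \<in> evW s" "bv x \<notin> evW s" "Suc 0 \<notin> evW s"
  by (auto simp: evW_def simW_def)

lemma fibW_evW: "fibW \<subseteq> evW s" by (auto simp: fibW_def evW_def)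

lemma evW_mono: "s \<le> s' \<Longrightarrow> evW s \<subseteq> evW s'" unfolding evW_def by force

text \<open>The generating matrix lives in the program text, so its row is selected by testing which
  multiple \<open>r * w\<close> the variable \<open>g2\<close> holds. The tests cost at most
  \<open>3 * N\<close> in all, added to the cost of the one selected body.\<close>

fun cas :: "nat \<Rightarrow> (nat \<Rightarrow> com) \<Rightarrow> nat \<Rightarrow> com" where
  "cas w body 0 = Skip"
| "cas w body (Suc r) = seqs [Const g0 (r * w), Cond (Eq g2 g0) (body r) (cas w body r)]"

definition mismatches ::
  "nat ring \<Rightarrow> (nat \<Rightarrow> nat \<Rightarrow> nat) \<Rightarrow> nat \<Rightarrow> nat \<Rightarrow> (nat \<Rightarrow> nat) \<Rightarrow> (nat \<Rightarrow> nat) \<Rightarrow> nat list \<Rightarrow> nat" where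
  "mismatches F G k m rr v x = card {i. i < m \<and> esum F (G (rr i)) (\<lambda>p. x ! p) k \<noteq> v i}"

text \<open>Scanning with overwriting makes the order of the list immaterial once exactly one entry
  stays below \<open>\<theta>\<close>; outside the event \<open>bad\<close> this is the
  case.\<close>

definition pick :: "nat ring \<Rightarrow> (nat \<Rightarrow> nat \<Rightarrow> nat) \<Rightarrow> nat \<Rightarrow> nat \<Rightarrow> nat \<Rightarrow> nat list list \<Rightarrow>
    (nat \<Rightarrow> nat) \<Rightarrow> (nat \<Rightarrow> nat) \<Rightarrow> nat \<Rightarrow> nat" where
  "pick F G k m \<theta> xs rr v a =
     fold (\<lambda>x acc. if mismatches F G k m rr v x < \<theta> then x ! a else acc) xs \<zero>\<^bsub>F\<^esub>"

text \<open>\<open>conv\<close> fixes the lower \<open>s - 1\<close> coordinates at the systematic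
  position given by \<open>y\<close>. The last direction is the most significant digit, so
  \<open>p\<close> moves with stride \<open>n ^ (s - 1)\<close>.\<close>

definition fib :: "nat \<Rightarrow> nat \<Rightarrow> (nat \<Rightarrow> nat set) \<Rightarrow> nat \<Rightarrow> nat \<Rightarrow> nat \<Rightarrow> nat \<Rightarrow> nat set" where
  "fib k n S s z y = (\<lambda>p\<in>{..<n}. S (z + conv k n (s - 1) y + p * n ^ (s - 1)))"

text \<open>The recursive decoder in dimension \<open>s\<close> on the part of \<open>S\<close> that starts at offset \<open>z\<close>: \<open>rs\<close> are the
  sampled rows, of which dimension \<open>s + 2\<close> uses the \<open>s\<close>-th block of \<open>m\<close>, and \<open>J\<close> is the
  advice, of which this call uses the \<open>m ^ (s - 1)\<close> entries from \<open>off\<close> on. Sharing the rows between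
  all calls in the same dimension keeps the description short.\<close>

fun dec :: "nat ring \<Rightarrow> (nat \<Rightarrow> nat \<Rightarrow> nat) \<Rightarrow> nat \<Rightarrow> nat \<Rightarrow> nat \<Rightarrow> nat \<Rightarrow> ((nat \<Rightarrow> nat set) \<Rightarrow> nat list list) \<Rightarrow>
    (nat \<Rightarrow> nat) \<Rightarrow> (nat \<Rightarrow> nat) \<Rightarrow> (nat \<Rightarrow> nat set) \<Rightarrow> nat \<Rightarrow> nat \<Rightarrow> nat \<Rightarrow> nat \<Rightarrow> nat" where
  "dec F G k n m \<theta> lst rs J S 0 off z y = \<zero>\<^bsub>F\<^esub>"
| "dec F G k n m \<theta> lst rs J S (Suc 0) off z y =
     (let xs = lst (fib k n S 1 z y) in if J off < length xs then xs ! J off ! (y mod k) else \<zero>\<^bsub>F\<^esub>)"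
| "dec F G k n m \<theta> lst rs J S (Suc (Suc s)) off z y =
     pick F G k m \<theta> (lst (fib k n S (Suc (Suc s)) z y)) (\<lambda>i. rs (s * m + i))
       (\<lambda>i. dec F G k n m \<theta> lst rs J S (Suc s) (off + i * m ^ s) (z + rs (s * m + i) * n ^ Suc s) y)
       (y div k ^ Suc s mod k)"

lemma length_concat_equal: "\<forall>x\<in>set xs. length x = k \<Longrightarrow> length (concat xs) = length xs * k"
  by (induction xs) auto

lemma nth_concat_equal:
  "\<forall>x\<in>set xs. length x = k \<Longrightarrow> q < length xs \<Longrightarrow> p < k \<Longrightarrow> concat xs ! (q * k + p) = xs ! q ! p"
proof (induction xs arbitrary: q)
  case (Cons x xs)
  then show ?case by (cases q) (auto simp: nth_append add.assoc)
qed simp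

locale prog =
  fixes F :: "nat ring" and k n l t m L \<theta> T :: nat and P :: com and G :: "nat \<Rightarrow> nat \<Rightarrow> nat"
  assumes k: "0 < k" and kn: "k \<le> n"
begin

definition loadrow :: "nat \<Rightarrow> com" where
  "loadrow p = loop l (\<lambda>q. seqs [Const g1 q, Load r1 BUF g1, Const rI (p * l + q), wr 1 r1])"

definition fiber :: "nat \<Rightarrow> com" where
  "fiber s = seqs [Const rCnt 0, Const rOC 0, Const rDN 0,
     loop n (\<lambda>p. seqs [Const g0 (p * n ^ (s - 1)), Op Add g0 g0 (Zr s), Op Add g0 g0 (LO s),
       Query BUF g0, loadrow p]),
     unroll T [P]]"

definition symb :: "nat \<Rightarrow> nat \<Rightarrow> com" where
  "symb r q = seqs [Const g5 \<zero>\<^bsub>F\<^esub>,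
     loop k (\<lambda>p. seqs [Const g6 (G r p), Const g7 (q * k + p), Load g7 OUT g7, Op FMul g7 g6 g7,
       Op FAdd g5 g5 g7])]"

definition cntbody :: "nat \<Rightarrow> nat \<Rightarrow> com" where
  "cntbody r q = seqs [symb r q, Cond (Eq g5 g3) Skip
       (seqs [Const g0 q, Load g1 MC g0, Const g4 1, Op Add g1 g1 g4, Store MC g0 g1])]"

definition cnt :: "nat \<Rightarrow> com" where
  "cnt r = loop L (cntbody r)"

definition cntallbody :: "nat \<Rightarrow> nat \<Rightarrow> com" where
  "cntallbody s i = seqs [Const g0 (s * m + i), Load g2 1 g0, Const g0 i,
     Load g3 (VEC (Suc (Suc s))) g0, cas (n ^ Suc s) cnt n]"

definition clearbody :: "nat \<Rightarrow> com" where
  "clearbody q = seqs [Const g0 q, Const g1 0, Store MC g0 g1]"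

text \<open>All \<open>L\<close> counters are updated, those past the end of the list from leftover
  cells of \<open>OUT\<close>. The comparison of \<open>q * k\<close> with the length
  \<open>rDN\<close> of the finished output discards them.\<close>

definition pickbody :: "nat \<Rightarrow> nat \<Rightarrow> com" where
  "pickbody s q = seqs [Const g0 q, Load g1 MC g0, Const g4 \<theta>,
       Cond (Less g1 g4)
         (seqs [Const g0 (q * k), Cond (Less g0 rDN) (seqs [Op Add g0 g0 (DG s), Load (Vr s) OUT g0]) Skip])
         Skip]"

definition select :: "nat \<Rightarrow> com" where
  "select s = seqs [loop L clearbody, loop m (cntallbody s), Const (Vr (Suc (Suc s))) \<zero>\<^bsub>F\<^esub>,
     loop L (pickbody (Suc (Suc s)))]"

definition leafread :: "nat \<Rightarrow> com" where
  "leafread off = seqs [Const (Vr 1) \<zero>\<^bsub>F\<^esub>, Const g0 ((t - 1) * m + off), Load g1 1 g0,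
     Cond (Less g1 rDN) (seqs [Op Add g1 g1 (DG 1), Load (Vr 1) OUT g1]) Skip]"

text \<open>The recursion is expanded in the program text, so \<open>off\<close> is a constant of
  each copy. The recursive calls come before the fiber of the call itself because all calls share
  the output array \<open>OUT\<close>.\<close>

fun ev :: "nat \<Rightarrow> nat \<Rightarrow> com" where
  "ev 0 off = Skip"
| "ev (Suc 0) off = Seq (fiber 1) (leafread off)"
| "ev (Suc (Suc s)) off = seqs [
     loop m (\<lambda>i. seqs [Const g0 (s * m + i), Load g1 1 g0, Op Add (Zr (Suc s)) (Zr (Suc (Suc s))) g1,
       ev (Suc s) (off + i * m ^ s), Const g0 i, Store (VEC (Suc (Suc s))) g0 (Vr (Suc s))]),
     fiber (Suc (Suc s)), select s]"

lemma ok_loadrow: "ok fibW 0 (l * 40 + 1) (loadrow p)"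
proof -
  have "ok fibW 0 39 (seqs [Const g1 q, Load r1 BUF g1, Const rI (p * l + q), wr 1 r1])" for q
    by (simp add: ok_def wr_def touch_def touch_init_def)
  from ok_loop[OF this, of l] show ?thesis by (simp add: loadrow_def)
qed

lemma ok_fiber: "ok fibW n (n * (l * 40 + 15) + T * 200 + 10) (fiber s)"
proof -
  define body where "body p = seqs [Const g0 (p * n ^ (s - 1)), Op Add g0 g0 (Zr s),
      Op Add g0 g0 (LO s), Query BUF g0, loadrow p]" for p
  have "ok fibW 1 (l * 40 + 9) (body p)" for p
    using ok_loadrow[of p] by (simp add: ok_def body_def)
  then have "ok fibW (n * 1) (n * Suc (l * 40 + 9) + 1) (loop n body)"
    by (intro ok_loop) auto
  moreover have "n * Suc (l * 40 + 9) + 1 + (T * 200 + 1) + 8 \<le> n * (l * 40 + 15) + T * 200 + 10"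
    by (simp add: algebra_simps)
  moreover have "ok fibW 0 (T * 200 + 1) (unroll T [P])"
    using ok_unroll by (rule ok_mono) (auto simp: fibW_def)
  moreover have "fiber s = seqs [Const rCnt 0, Const rOC 0, Const rDN 0, loop n body, unroll T [P]]"
    by (simp add: fiber_def body_def[abs_def])
  ultimately show ?thesis
    by (auto simp: ok_def algebra_simps)
qed

lemma exec_loadrow:
  assumes s': "s' = exec F orc (loadrow p) s" and a: "absm s = imem xs" and len: "length xs = p * l"
    and buf: "\<And>r. r < l \<Longrightarrow> memory s BUF r = rw ! r" and rw: "length rw = l"
  shows "absm s' = imem (xs @ rw) \<and> memory s' rOC = memory s rOC \<and> memory s' rDN = memory s rDN \<and>
    memory s' OUT = memory s OUT"
proof -
  define I where "I q st \<longleftrightarrow> absm st = imem (xs @ take q rw) \<and> memory st rOC = memory s rOC \<and>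
      memory st rDN = memory s rDN \<and> memory st OUT = memory s OUT \<and> memory st BUF = memory s BUF" for q st
  have "I l s'"
    unfolding s' loadrow_def
  proof (rule loop_inv)
    show "I 0 s" using a by (simp add: I_def)
  next
    fix q st assume q: "q < l" and I: "I q st"
    define s1 where "s1 = put rI 0 (p * l + q) (put r1 0 (rw ! q) (put g1 0 q st))"
    define s2 where "s2 = exec F orc (wr 1 r1) s1"
    have "memory st BUF q = rw ! q" using I buf[OF q] by (simp add: I_def)
    then have e: "exec F orc (seqs [Const g1 q, Load r1 BUF g1, Const rI (p * l + q), wr 1 r1]) st = s2"
      by (simp add: s2_def s1_def var_def)
    note w = exec_wr[OF s2_def, simplified]
    have a1: "absm s1 = absm st" unfolding s1_def by (intro absm_cong) auto
    have "absm s2 = (imem (xs @ take q rw))(1 := (imem (xs @ take q rw) 1)(length (xs @ take q rw) := rw ! q))"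
      using I q len rw by (simp add: w(1) a1 I_def) (simp add: s1_def)
    then have "absm s2 = imem (xs @ take (Suc q) rw)"
      using q rw by (simp only: imem_snoc) (simp add: take_Suc_conv_app_nth)
    moreover have "memory s2 BUF = memory s1 BUF"
      unfolding s2_def by (rule ok_frame[OF ok_wr]) simp
    ultimately show "I (Suc q) (exec F orc (seqs [Const g1 q, Load r1 BUF g1, Const rI (p * l + q), wr 1 r1]) st)"
      unfolding e using I w by (simp add: I_def) (simp add: s1_def)
  qed
  then show ?thesis using rw by (simp add: I_def)
qed

text \<open>The output is a function of the fiber alone, whatever \<open>s0\<close> contains: the
  simulated memory is cleared before the fiber is loaded into it.\<close>

lemma exec_fiber:
  assumes s': "s' = exec F orc (fiber s) s0"
    and rw: "\<And>p. p < n \<Longrightarrow> orc (memory s0 (Zr s) 0 + memory s0 (LO s) 0 + p * n ^ (s - 1)) = rw p"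
    and len: "\<And>p. p < n \<Longrightarrow> length (rw p) = l"
  defines "xs \<equiv> concat (lister F T P (concat (map rw [0..<n])))"
  shows "memory s' rDN 0 = length xs" "\<And>i. i < length xs \<Longrightarrow> memory s' OUT i = xs ! i"
proof -
  define I where "I p st \<longleftrightarrow> absm st = imem (concat (map rw [0..<p])) \<and> memory st rOC 0 = 0 \<and>
      memory st rDN 0 = 0 \<and> (\<forall>a. a \<notin> fibW \<longrightarrow> memory st a = memory s0 a)" for p st
  define s1 where "s1 = put rDN 0 0 (put rOC 0 0 (put rCnt 0 0 s0))"
  define body where "body p = seqs [Const g0 (p * n ^ (s - 1)), Op Add g0 g0 (Zr s),
      Op Add g0 g0 (LO s), Query BUF g0, loadrow p]" for p
  define s2 where "s2 = exec F orc (loop n body) s1"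
  have lens: "p \<le> n \<Longrightarrow> length (concat (map rw [0..<p])) = p * l" for p
    by (induction p) (auto simp: len)
  have "I n s2"
    unfolding s2_def
  proof (rule loop_inv)
    have "absm s1 = imem []" by (intro ext) (simp add: s1_def absm_def valid_def var_def imem_def)
    moreover have "memory s1 a = memory s0 a" if "a \<notin> fibW" for a using that by (auto simp: s1_def)
    ultimately show "I 0 s1" by (simp add: I_def) (simp add: s1_def)
  next
    fix p st assume p: "p < n" and I: "I p st"
    define adr where "adr = memory s0 (Zr s) 0 + memory s0 (LO s) 0 + p * n ^ (s - 1)"
    define x1 where "x1 = p * n ^ (s - 1)"
    define x2 where "x2 = x1 + memory s0 (Zr s) 0"
    define st1 where "st1 = ask orc BUF adr (put g0 0 adr (put g0 0 x2 (put g0 0 x1 st)))"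
    define st2 where "st2 = exec F orc (loadrow p) st1"
    have Z: "memory st (Zr s) = memory s0 (Zr s)" "memory st (LO s) = memory s0 (LO s)"
      using I by (auto simp: I_def)
    have e: "exec F orc (body p) st = st2"
      by (simp add: body_def st2_def st1_def var_def Z adr_def x1_def x2_def add_ac)
    have adr: "orc adr = rw p" using rw[OF p] by (simp add: adr_def)
    have a1: "absm st1 = absm st" unfolding st1_def by (intro absm_cong) auto
    have fr: "memory st1 b = memory st b" if "b \<notin> fibW" for b using that by (auto simp: st1_def)
    have fr2: "memory st2 b = memory st1 b" if "b \<notin> fibW" for b
      unfolding st2_def using that by (rule ok_frame[OF ok_loadrow])
    have "absm st2 = imem (concat (map rw [0..<p]) @ rw p) \<and> memory st2 rOC = memory st1 rOC \<and>
        memory st2 rDN = memory st1 rDN \<and> memory st2 OUT = memory st1 OUT"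
      using st2_def
    proof (rule exec_loadrow)
      show "absm st1 = imem (concat (map rw [0..<p]))" using I a1 by (simp add: I_def)
      show "length (concat (map rw [0..<p])) = p * l" using lens p by simp
      show "length (rw p) = l" using len p by simp
      show "memory st1 BUF r = rw p ! r" if "r < l" for r
        using that by (simp add: st1_def adr len[OF p])
    qed
    then show "I (Suc p) (exec F orc (body p) st)"
      unfolding e using I fr fr2 by (simp add: I_def) (simp add: st1_def)
  qed
  define inp where "inp = concat (map rw [0..<n])"
  have "simrel s2 (start inp)"
    using \<open>I n s2\<close> by (simp add: I_def simrel_def start_def inp_def)
  from unroll_correct[OF this, where N=T and cs="[P]" and F=F and orc=orc]
  obtain z where z: "simrel (exec F orc (unroll T [P]) s2) z" "items z = lister F T P inp"
    by (auto simp: lister_def)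
  have "s' = exec F orc (unroll T [P]) s2"
    by (simp add: s' fiber_def s2_def s1_def body_def[abs_def])
  then have rel: "simrel s' z" using z by simp
  have xs: "xs = concat (items z)" by (simp add: xs_def z(2) inp_def)
  show "memory s' rDN 0 = length xs" using rel by (simp add: simrel_def xs)
  fix i assume i: "i < length xs"
  have *: "concat (items z) @ current z = map (memory s' OUT) [0..<memory s' rOC 0]"
    using rel by (simp add: simrel_def)
  have "length (concat (items z) @ current z) = memory s' rOC 0" unfolding * by simp
  then have "i < memory s' rOC 0" using i xs by simp
  then have "memory s' OUT i = (concat (items z) @ current z) ! i" unfolding * by simp
  then show "memory s' OUT i = xs ! i" using i by (simp add: xs nth_append)
qed

lemma ok_cas: "(\<And>r. r < N \<Longrightarrow> ok fibW 0 B (body r)) \<Longrightarrow> ok fibW 0 (B + 3 * N + 1) (cas w body N)"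
proof (induction N)
  case (Suc N)
  have "ok fibW 0 (B + 3 * N + 1) (cas w body N)" using Suc by simp
  moreover have "ok fibW 0 B (body N)" using Suc by simp
  ultimately show ?case by (auto simp: ok_def)
qed (simp add: ok_def)

text \<open>The tests leave the last constant compared in \<open>g0\<close>, hence the existential
  value \<open>v\<close>.\<close>

lemma exec_cas:
  assumes "r < N"
  shows "memory s g2 0 = r * w \<Longrightarrow> 0 < w \<Longrightarrow> \<exists>v. exec F orc (cas w body N) s = exec F orc (body r) (put g0 0 v s)"
  using assms
proof (induction N arbitrary: s)
  case (Suc N)
  show ?case
  proof (cases "r = N")
    case True
    then show ?thesis using Suc.prems by (auto simp: var_def)
  next
    case False
    have eq: "exec F orc (cas w body (Suc N)) s = exec F orc (cas w body N) (put g0 0 (N * w) s)"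
      using Suc.prems False by (simp add: var_def)
    have "\<exists>v. exec F orc (cas w body N) (put g0 0 (N * w) s) = exec F orc (body r) (put g0 0 v (put g0 0 (N * w) s))"
      using Suc.prems False by (intro Suc.IH) auto
    moreover have "put g0 0 v (put g0 0 u s) = put g0 0 v s" for u v by (simp add: put_def)
    ultimately show ?thesis unfolding eq by simp
  qed
qed simp

lemma ok_symb: "ok fibW 0 (k * 10 + 3) (symb r q)"
proof -
  define body where "body p = seqs [Const g6 (G r p), Const g7 (q * k + p), Load g7 OUT g7, Op FMul g7 g6 g7,
       Op FAdd g5 g5 g7]" for p
  have "ok fibW (k * 0) (k * Suc 9 + 1) (loop k body)"
    by (intro ok_loop) (simp add: ok_def body_def)
  moreover have "symb r q = seqs [Const g5 \<zero>\<^bsub>F\<^esub>, loop k body]"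
    by (simp add: symb_def body_def[abs_def])
  ultimately show ?thesis by (auto simp: ok_def)
qed

lemma exec_symb:
  assumes s': "s' = exec F orc (symb r q) s" and x: "\<And>p. p < k \<Longrightarrow> memory s OUT (q * k + p) = x p"
  shows "memory s' g5 0 = esum F (G r) x k"
    "\<And>a. a \<notin> {g5, g6, g7} \<Longrightarrow> memory s' a = memory s a"
proof -
  define I where "I p st \<longleftrightarrow> memory st g5 0 = esum F (G r) x p \<and> (\<forall>a. a \<notin> {g5, g6, g7} \<longrightarrow> memory st a = memory s a)"
    for p and st :: state
  have "I k s'"
    unfolding s' symb_def seqs.simps exec.simps
    by (rule loop_inv) (auto simp: I_def var_def x)
  then show "memory s' g5 0 = esum F (G r) x k" "\<And>a. a \<notin> {g5, g6, g7} \<Longrightarrow> memory s' a = memory s a"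
    by (auto simp: I_def)
qed

lemma ok_cntbody: "ok fibW 0 (k * 10 + 15) (cntbody r q)"
  using ok_symb[of r q] by (auto simp: ok_def cntbody_def)

lemma ok_cnt: "ok fibW 0 (L * (k * 10 + 16) + 1) (cnt r)"
  using ok_loop[of L fibW 0 "k * 10 + 15" "cntbody r", OF ok_cntbody] by (simp add: cnt_def algebra_simps)

lemma exec_cnt:
  assumes s': "s' = exec F orc (cnt r) s" and x: "\<forall>q<L. \<forall>p<k. memory s OUT (q * k + p) = x q p"
  shows "\<And>q. q < L \<Longrightarrow> memory s' MC q = memory s MC q + (if esum F (G r) (x q) k = memory s g3 0 then 0 else 1)"
    "\<And>a. a \<notin> {g0, g1, g4, g5, g6, g7, MC} \<Longrightarrow> memory s' a = memory s a"
proof -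
  define I where "I j st \<longleftrightarrow>
      (\<forall>q. memory st MC q = memory s MC q + (if q < j \<and> esum F (G r) (x q) k \<noteq> memory s g3 0 then 1 else 0)) \<and>
      (\<forall>a. a \<notin> {g0, g1, g4, g5, g6, g7, MC} \<longrightarrow> memory st a = memory s a)" for j and st :: state
  have "I L s'"
    unfolding s' cnt_def
  proof (rule loop_inv)
    fix q st assume q: "q < L" and I: "I q st"
    define s1 where "s1 = exec F orc (symb r q) st"
    have "memory st OUT (q * k + p) = x q p" if "p < k" for p
      using I x q that by (simp add: I_def)
    note e = exec_symb[OF s1_def this]
    have s1: "memory s1 g3 = memory s g3" "memory s1 MC = memory st MC" using I by (auto simp: e(2) I_def)
    have fr: "memory s1 a = memory s a" if "a \<notin> {g0, g1, g4, g5, g6, g7, MC}" for a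
      using that I e(2)[of a] by (auto simp: I_def)
    show "I (Suc q) (exec F orc (cntbody r q) st)"
    proof (cases "esum F (G r) (x q) k = memory s g3 0")
      case True
      have "exec F orc (cntbody r q) st = s1"
        by (simp add: cntbody_def s1_def[symmetric] var_def s1 e(1) True)
      then show ?thesis using I True fr by (auto simp: I_def s1 less_Suc_eq)
    next
      case False
      have "exec F orc (cntbody r q) st =
          put MC q (memory st MC q + 1) (put g1 0 (memory st MC q + 1) (put g4 0 1 (put g1 0 (memory st MC q) (put g0 0 q s1))))"
        using False by (simp add: cntbody_def s1_def[symmetric] var_def s1 e(1))
      then show ?thesis using I False fr by (auto simp: I_def s1 less_Suc_eq)
    qed
  qed (auto simp: I_def)
  then show "\<And>q. q < L \<Longrightarrow> memory s' MC q = memory s MC q + (if esum F (G r) (x q) k = memory s g3 0 then 0 else 1)"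
    "\<And>a. a \<notin> {g0, g1, g4, g5, g6, g7, MC} \<Longrightarrow> memory s' a = memory s a"
    by (auto simp: I_def)
qed

lemma ok_cntallbody: "ok fibW 0 (L * (k * 10 + 16) + 3 * n + 12) (cntallbody s i)"
proof -
  have "ok fibW 0 (L * (k * 10 + 16) + 1 + 3 * n + 1) (cas (n ^ Suc s) cnt n)"
    by (intro ok_cas ok_cnt)
  then show ?thesis by (auto simp: ok_def cntallbody_def)
qed

lemma ok_pickbody: "ok (fibW \<union> {Vr s}) 0 15 (pickbody s q)"
  by (simp add: ok_def pickbody_def)

lemma ok_select:
  "ok (evW (Suc (Suc s))) 0 (m * (L * (k * 10 + 16) + 3 * n + 13) + L * 22 + 10) (select s)"
proof -
  have "ok fibW (L * 0) (L * Suc 5 + 1) (loop L clearbody)"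
    by (intro ok_loop) (simp add: ok_def clearbody_def)
  then have a: "ok (evW (Suc (Suc s))) 0 (L * 6 + 1) (loop L clearbody)"
    by (rule ok_mono) (auto simp: fibW_evW)
  have "ok fibW (m * 0) (m * Suc (L * (k * 10 + 16) + 3 * n + 12) + 1) (loop m (cntallbody s))"
    by (intro ok_loop ok_cntallbody)
  then have b: "ok (evW (Suc (Suc s))) 0 (m * (L * (k * 10 + 16) + 3 * n + 13) + 1) (loop m (cntallbody s))"
    by (rule ok_mono) (auto simp: fibW_evW)
  have "ok (fibW \<union> {Vr (Suc (Suc s))}) (L * 0) (L * Suc 15 + 1) (loop L (pickbody (Suc (Suc s))))"
    by (intro ok_loop ok_pickbody)
  then have c: "ok (evW (Suc (Suc s))) 0 (L * 16 + 1) (loop L (pickbody (Suc (Suc s))))"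
    by (rule ok_mono) (use fibW_evW in auto)
  show ?thesis using a b c unfolding select_def by (auto simp: ok_def)
qed

lemma exec_cntall:
  assumes s': "s' = exec F orc (loop m (cntallbody s)) s0"
    and x: "\<And>q p. q < L \<Longrightarrow> p < k \<Longrightarrow> memory s0 OUT (q * k + p) = x q p"
    and rr: "\<And>i. i < m \<Longrightarrow> memory s0 1 (s * m + i) = rr i * n ^ Suc s \<and> rr i < n"
    and v: "\<And>i. i < m \<Longrightarrow> memory s0 (VEC (Suc (Suc s))) i = v i"
    and MC0: "\<And>q. q < L \<Longrightarrow> memory s0 MC q = 0"
  shows "\<And>q. q < L \<Longrightarrow> memory s' MC q = card {i. i < m \<and> esum F (G (rr i)) (x q) k \<noteq> v i}"
    "\<And>a. a \<notin> {g0, g1, g2, g3, g4, g5, g6, g7, MC} \<Longrightarrow> memory s' a = memory s0 a"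
proof -
  define I where "I j st \<longleftrightarrow>
      (\<forall>q<L. memory st MC q = card {i. i < j \<and> esum F (G (rr i)) (x q) k \<noteq> v i}) \<and>
      (\<forall>a. a \<notin> {g0, g1, g2, g3, g4, g5, g6, g7, MC} \<longrightarrow> memory st a = memory s0 a)"
    for j and st :: state
  have "I m s'"
    unfolding s'
  proof (rule loop_inv)
    show "I 0 s0" using MC0 by (simp add: I_def)
  next
    fix i st assume i: "i < m" and I: "I i st"
    define s1 where "s1 = put g3 0 (v i) (put g0 0 i (put g2 0 (rr i * n ^ Suc s) (put g0 0 (s * m + i) st)))"
    have fr: "memory st a = memory s0 a" if "a \<notin> {g0, g1, g2, g3, g4, g5, g6, g7, MC}" for a
      using that I by (auto simp: I_def)
    have e1: "exec F orc (cntallbody s i) st = exec F orc (cas (n ^ Suc s) cnt n) s1"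
      using rr[OF i] v[OF i] by (simp add: cntallbody_def s1_def var_def fr)
    have "memory s1 g2 0 = rr i * n ^ Suc s" by (simp add: s1_def)
    moreover have "0 < n ^ Suc s" using k kn by simp
    ultimately obtain u where u: "exec F orc (cas (n ^ Suc s) cnt n) s1 = exec F orc (cnt (rr i)) (put g0 0 u s1)"
      using exec_cas[where r="rr i" and N=n and s=s1 and w="n ^ Suc s" and body=cnt] rr[OF i] by blast
    define s2 where "s2 = exec F orc (cnt (rr i)) (put g0 0 u s1)"
    have "\<forall>q<L. \<forall>p<k. memory (put g0 0 u s1) OUT (q * k + p) = x q p"
      using x by (simp add: s1_def fr)
    note c = exec_cnt[OF s2_def this]
    have "memory s2 MC q = card {i'. i' < Suc i \<and> esum F (G (rr i')) (x q) k \<noteq> v i'}" if q: "q < L" for q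
    proof -
      have "{i'. i' < Suc i \<and> esum F (G (rr i')) (x q) k \<noteq> v i'} =
          (if esum F (G (rr i)) (x q) k = v i then {i'. i' < i \<and> esum F (G (rr i')) (x q) k \<noteq> v i'}
           else insert i {i'. i' < i \<and> esum F (G (rr i')) (x q) k \<noteq> v i'})"
        by (auto simp: less_Suc_eq)
      moreover have "memory s2 MC q = memory st MC q + (if esum F (G (rr i)) (x q) k = v i then 0 else 1)"
        using c(1)[OF q] by (simp add: s1_def)
      ultimately show ?thesis using I q by (simp add: I_def)
    qed
    moreover have "memory s2 a = memory s0 a" if "a \<notin> {g0, g1, g2, g3, g4, g5, g6, g7, MC}" for a
      using c(2)[of a] that fr[of a] by (simp add: s1_def)
    ultimately show "I (Suc i) (exec F orc (cntallbody s i) st)"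
      unfolding e1 u s2_def[symmetric] by (simp add: I_def)
  qed
  then show "\<And>q. q < L \<Longrightarrow> memory s' MC q = card {i. i < m \<and> esum F (G (rr i)) (x q) k \<noteq> v i}"
    "\<And>a. a \<notin> {g0, g1, g2, g3, g4, g5, g6, g7, MC} \<Longrightarrow> memory s' a = memory s0 a"
    by (auto simp: I_def)
qed

lemma exec_select:
  assumes s': "s' = exec F orc (select s) s0"
    and xs: "length xs \<le> L" "\<forall>x\<in>set xs. length x = k"
    and dn: "memory s0 rDN 0 = length (concat xs)"
    and out: "\<And>i. i < length (concat xs) \<Longrightarrow> memory s0 OUT i = concat xs ! i"
    and rr: "\<And>i. i < m \<Longrightarrow> memory s0 1 (s * m + i) = rr i * n ^ Suc s \<and> rr i < n"
    and v: "\<And>i. i < m \<Longrightarrow> memory s0 (VEC (Suc (Suc s))) i = v i"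
    and a: "memory s0 (DG (Suc (Suc s))) 0 = a" "a < k"
  shows "memory s' (Vr (Suc (Suc s))) 0 = pick F G k m \<theta> xs rr v a"
proof -
  define W where "W = {g0, g1, g2, g3, g4, g5, g6, g7, MC}"
  define I0 where "I0 j st \<longleftrightarrow> (\<forall>q<j. memory st MC q = 0) \<and> (\<forall>b. b \<notin> W \<longrightarrow> memory st b = memory s0 b)"
    for j and st :: state
  define s1 where "s1 = exec F orc (loop L clearbody) s0"
  have "I0 L s1"
    unfolding s1_def
    by (rule loop_inv) (auto simp: I0_def clearbody_def var_def W_def less_Suc_eq)
  then have MC1: "\<And>q. q < L \<Longrightarrow> memory s1 MC q = 0" and fr1: "\<And>b. b \<notin> W \<Longrightarrow> memory s1 b = memory s0 b"
    by (auto simp: I0_def)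
  define s2 where "s2 = exec F orc (loop m (cntallbody s)) s1"
  \<comment> \<open>The counters are followed on raw cells of \<open>OUT\<close>, since for
    \<open>q \<ge> length xs\<close> these hold no message; the identification with list entries is
    made only below \<open>length xs\<close>, in \<open>MC3\<close>.\<close>
  note c = exec_cntall[OF s2_def _ _ _ MC1, where x = "\<lambda>q p. memory s0 OUT (q * k + p)" and rr=rr and v=v]
  have MC2: "memory s2 MC q = card {i. i < m \<and> esum F (G (rr i)) (\<lambda>p. memory s0 OUT (q * k + p)) k \<noteq> v i}"
    if "q < L" for q
    using that rr v by (intro c(1)) (auto simp: fr1 W_def)
  have fr2: "memory s2 b = memory s0 b" if "b \<notin> W" for b
    using that rr v fr1[of b] by (subst c(2)) (auto simp: fr1 W_def)
  have seg: "memory s0 OUT (q * k + p) = xs ! q ! p" if "q < length xs" "p < k" for q p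
  proof -
    have "q * k + p < Suc q * k" using that(2) by simp
    also have "\<dots> \<le> length xs * k" using that(1) by (intro mult_le_mono1) simp
    finally show ?thesis using out nth_concat_equal[OF xs(2) that] by (simp add: length_concat_equal[OF xs(2)])
  qed
  have MC3: "memory s2 MC q = mismatches F G k m rr v (xs ! q)" if q: "q < length xs" for q
  proof -
    have "esum F (G (rr i)) (\<lambda>p. memory s0 OUT (q * k + p)) k = esum F (G (rr i)) (\<lambda>p. xs ! q ! p) k" for i
      using seg[OF q] by (intro esum_cong)
    then show ?thesis using MC2[of q] q xs(1) by (simp add: mismatches_def)
  qed
  define ff where "ff x acc = (if mismatches F G k m rr v x < \<theta> then x ! a else acc)" for x acc
  define I where "I q st \<longleftrightarrow> memory st (Vr (Suc (Suc s))) 0 = fold ff (take q xs) \<zero>\<^bsub>F\<^esub> \<and>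
      memory st MC = memory s2 MC \<and> (\<forall>b. b \<notin> insert (Vr (Suc (Suc s))) W \<longrightarrow> memory st b = memory s0 b)"
    for q and st :: state
  have s'_eq: "s' = exec F orc (loop L (pickbody (Suc (Suc s)))) (put (Vr (Suc (Suc s))) 0 \<zero>\<^bsub>F\<^esub> s2)"
    by (simp add: s' select_def s1_def s2_def)
  have "I L s'"
    unfolding s'_eq
  proof (rule loop_inv)
    show "I 0 (put (Vr (Suc (Suc s))) 0 \<zero>\<^bsub>F\<^esub> s2)" using fr2 by (simp add: I_def W_def)
  next
    fix q st assume q: "q < L" and I: "I q st"
    have fr: "memory st b = memory s0 b" if "b \<notin> insert (Vr (Suc (Suc s))) W" for b
      using that I by (auto simp: I_def)
    define st1 where "st1 = put g4 0 \<theta> (put g1 0 (memory s2 MC q) (put g0 0 q st))"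
    define st' where "st' = exec F orc (pickbody (Suc (Suc s)) q) st"
    have lt: "q * k < length (concat xs) \<longleftrightarrow> q < length xs"
      using k by (simp add: length_concat_equal[OF xs(2)])
    have dn': "memory st rDN 0 = length (concat xs)" using fr dn by (simp add: W_def)
    have dg: "memory st (DG (Suc (Suc s))) 0 = a" using fr a by (simp add: W_def)
    have out': "memory st OUT = memory s0 OUT" using fr by (simp add: W_def)
    have MC: "memory st MC = memory s2 MC" using I by (simp add: I_def)
    have V: "memory st' (Vr (Suc (Suc s))) 0 =
       (if q < length xs \<and> memory s2 MC q < \<theta> then memory s0 OUT (q * k + a) else memory st (Vr (Suc (Suc s))) 0)"
      by (auto simp: st'_def pickbody_def var_def MC dn' dg out' lt)
    have oth: "memory st' b = memory st b" if "b \<notin> {Vr (Suc (Suc s)), g0, g1, g4}" for b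
      using that by (simp add: st'_def pickbody_def)
    have "memory st' (Vr (Suc (Suc s))) 0 = fold ff (take (Suc q) xs) \<zero>\<^bsub>F\<^esub>"
    proof (cases "q < length xs")
      case True
      then show ?thesis using V I MC3[OF True] seg[OF True a(2)]
        by (simp add: take_Suc_conv_app_nth I_def ff_def)
    next
      case False
      then show ?thesis using V I by (simp add: I_def)
    qed
    moreover have "memory st' MC = memory s2 MC" using oth[of MC] MC by simp
    moreover have "memory st' b = memory s0 b" if "b \<notin> insert (Vr (Suc (Suc s))) W" for b
      using oth[of b] that fr[OF that] by (auto simp: W_def)
    ultimately show "I (Suc q) (exec F orc (pickbody (Suc (Suc s)) q) st)"
      unfolding st'_def[symmetric] by (simp add: I_def)
  qed
  then show ?thesis using xs(1) by (simp add: I_def pick_def ff_def[abs_def])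
qed

definition evT :: nat where
  "evT = n * (l * 40 + 15) + T * 200 + m * (L * (k * 10 + 16) + 3 * n + 24) + L * 22 + 60"

text \<open>A call in dimension \<open>s\<close> makes \<open>m\<close> calls in dimension
  \<open>s - 1\<close> and handles one fiber of its own. The latter is charged
  \<open>m ^ (s - 1)\<close> times over, which leads to the factor \<open>s\<close>;
  \<open>evT\<close> collects all work done outside the recursive calls.\<close>

lemma ok_ev: "0 < m \<Longrightarrow> 0 < s \<Longrightarrow> ok (evW s) (s * m ^ (s - 1) * n) (s * m ^ (s - 1) * evT) (ev s off)"
proof (induction s arbitrary: off rule: induct_nat_012)
  case 1
  have "ok (evW 1) n (n * (l * 40 + 15) + T * 200 + 10) (fiber 1)"
    using ok_fiber by (rule ok_mono) (auto simp: fibW_evW)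
  moreover have "ok (evW 1) 0 12 (leafread off)" by (simp add: ok_def leafread_def)
  ultimately show ?case by (auto simp: ok_def evT_def)
next
  case (ge2 s)
  define body where "body i = seqs [Const g0 (s * m + i), Load g1 1 g0, Op Add (Zr (Suc s)) (Zr (Suc (Suc s))) g1,
       ev (Suc s) (off + i * m ^ s), Const g0 i, Store (VEC (Suc (Suc s))) g0 (Vr (Suc s))]" for i
  define q where "q = Suc s * m ^ s * n"
  define B where "B = Suc s * m ^ s * evT"
  have "ok (evW (Suc (Suc s))) q B (ev (Suc s) o')" for o'
    using ge2(2)[OF ge2.prems(1), of o'] by (rule ok_mono[OF _ evW_mono]) (simp_all add: q_def B_def)
  then have "ok (evW (Suc (Suc s))) q (B + 10) (body i)" for i
    by (auto simp: ok_def body_def)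
  then have a: "ok (evW (Suc (Suc s))) (m * q) (m * Suc (B + 10) + 1) (loop m body)"
    by (intro ok_loop)
  have b: "ok (evW (Suc (Suc s))) n (n * (l * 40 + 15) + T * 200 + 10) (fiber (Suc (Suc s)))"
    using ok_fiber by (rule ok_mono) (auto simp: fibW_evW)
  note c = ok_select[of s]
  have eq: "ev (Suc (Suc s)) off = seqs [loop m body, fiber (Suc (Suc s)), select s]"
    by (simp add: body_def[abs_def])
  have ge1: "1 \<le> m * m ^ s" using ge2.prems(1) by simp
  have "m * q + n \<le> Suc (Suc s) * m ^ Suc s * n"
    using mult_le_mono1[OF ge1, of n] by (simp add: q_def algebra_simps)
  moreover have "m * Suc (B + 10) + 1 + (n * (l * 40 + 15) + T * 200 + 10) +
      (m * (L * (k * 10 + 16) + 3 * n + 13) + L * 22 + 10) + 2 \<le> Suc (Suc s) * m ^ Suc s * evT" (is "?l \<le> _")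
  proof -
    have "?l \<le> m * B + evT" by (simp add: evT_def algebra_simps)
    also have "\<dots> \<le> m * B + m * m ^ s * evT" using mult_le_mono1[OF ge1, of evT] by simp
    also have "\<dots> = Suc (Suc s) * m ^ Suc s * evT" by (simp add: B_def algebra_simps)
    finally show ?thesis .
  qed
  ultimately show ?case using a b c unfolding eq by (auto simp: ok_def simp del: power_Suc)
qed simp

definition lst :: "(nat \<Rightarrow> nat set) \<Rightarrow> nat list list" where
  "lst Sf = lister F T P (concat (map (\<lambda>p. sorted_list_of_set (Sf p)) [0..<n]))"

text \<open>Rows and advice are stored already multiplied by their strides, because the machine
  cannot multiply words. Block \<open>e div m\<close> serves dimension \<open>e div m + 2\<close>,
  whose rows are \<open>n ^ Suc (e div m)\<close> apart.\<close>

definition descr :: "(nat \<Rightarrow> nat) \<Rightarrow> (nat \<Rightarrow> nat) \<Rightarrow> mem \<Rightarrow> bool" where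
  "descr rs J M \<longleftrightarrow> (\<forall>e<(t - 1) * m. M 1 e = rs e * n ^ Suc (e div m) \<and> rs e < n) \<and>
     (\<forall>j<m ^ (t - 1). M 1 ((t - 1) * m + j) = J j * k)"

definition lists_ok :: bool where
  "lists_ok \<longleftrightarrow> (\<forall>Sf. (\<forall>p<n. Sf p \<subseteq> carrier F \<and> card (Sf p) = l) \<longrightarrow>
     length (lst Sf) \<le> L \<and> (\<forall>x\<in>set (lst Sf). length x = k))"

lemma exec_fib:
  assumes s': "s' = exec F orc (fiber (Suc s)) s0" and lists_ok
    and z: "memory s0 (Zr (Suc s)) 0 = z" "memory s0 (LO (Suc s)) 0 = conv k n s y"
    and orc: "\<forall>r<n ^ Suc s. orc (z + r) = sorted_list_of_set (S (z + r)) \<and>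
      S (z + r) \<subseteq> carrier F \<and> card (S (z + r)) = l"
  defines "xs \<equiv> lst (fib k n S (Suc s) z y)"
  shows "memory s' rDN 0 = length (concat xs)"
    "\<And>i. i < length (concat xs) \<Longrightarrow> memory s' OUT i = concat xs ! i"
    "length xs \<le> L" "\<forall>x\<in>set xs. length x = k"
proof -
  have lt: "conv k n s y + p * n ^ s < n ^ Suc s" if "p < n" for p
  proof -
    have "conv k n s y + p * n ^ s < Suc p * n ^ s" using conv_less[OF k kn, of s y] by simp
    also have "\<dots> \<le> n * n ^ s" using that by (intro mult_le_mono1) simp
    finally show ?thesis by simp
  qed
  define Sf where "Sf = fib k n S (Suc s) z y"
  have Sf: "orc (memory s0 (Zr (Suc s)) 0 + memory s0 (LO (Suc s)) 0 + p * n ^ (Suc s - 1)) = sorted_list_of_set (Sf p)"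
    "Sf p \<subseteq> carrier F" "card (Sf p) = l" if "p < n" for p
    using orc[rule_format, OF lt[OF that]] that by (auto simp: z Sf_def fib_def add.assoc)
  have "length (sorted_list_of_set (Sf p)) = l" if "p < n" for p using Sf(3)[OF that] by simp
  note e = exec_fiber[OF s' Sf(1) this]
  show "memory s' rDN 0 = length (concat xs)"
    "\<And>i. i < length (concat xs) \<Longrightarrow> memory s' OUT i = concat xs ! i"
    using e by (simp_all add: xs_def lst_def Sf_def)
  show "length xs \<le> L" "\<forall>x\<in>set xs. length x = k"
    using \<open>lists_ok\<close> Sf(2,3) unfolding lists_ok_def xs_def Sf_def by blast+
qed

text \<open>The description, the digits and the positions in \<open>LO\<close> lie outside
  \<open>evW\<close>, so they survive the recursive calls. Only the offset \<open>z\<close> changes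
  from a call to its subcalls.\<close>

lemma exec_ev:
  assumes lo: lists_ok
    and "descr rs J (memory s0)" "0 < s" "s \<le> t" "off + m ^ (s - 1) \<le> m ^ (t - 1)"
    and "\<And>u. u < s \<Longrightarrow> memory s0 (DG (Suc u)) 0 = y div k ^ u mod k \<and> memory s0 (LO (Suc u)) 0 = conv k n u y"
    and "memory s0 (Zr s) 0 = z"
    and "\<And>r. r < n ^ s \<Longrightarrow> orc (z + r) = sorted_list_of_set (S (z + r)) \<and>
      S (z + r) \<subseteq> carrier F \<and> card (S (z + r)) = l"
    and m: "0 < m"
  shows "memory (exec F orc (ev s off) s0) (Vr s) 0 = dec F G k n m \<theta> lst rs J S s off z y"
  using assms(2-8)
proof (induction s arbitrary: off z s0 rule: induct_nat_012)
  case 1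
  define s1 where "s1 = exec F orc (fiber (Suc 0)) s0"
  have pre: "memory s0 (Zr (Suc 0)) 0 = z" "memory s0 (LO (Suc 0)) 0 = conv k n 0 y"
    "memory s0 (DG (Suc 0)) 0 = y mod k"
    using 1(5)[of 0] 1(6) by simp_all
  have orc: "\<forall>r<n ^ Suc 0. orc (z + r) = sorted_list_of_set (S (z + r)) \<and>
      S (z + r) \<subseteq> carrier F \<and> card (S (z + r)) = l" using 1(7) by auto
  note e = exec_fib[OF s1_def lo pre(1,2) orc]
  define xs where "xs = lst (fib k n S (Suc 0) z y)"
  note e' = e[folded xs_def]
  have fr: "memory s1 a = memory s0 a" if "a \<notin> fibW" for a
    unfolding s1_def using that by (rule ok_frame[OF ok_fiber])
  have J: "memory s0 (Suc 0) ((t - Suc 0) * m + off) = J off * k"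
    using 1(1,4) by (simp add: descr_def)
  have lt: "J off * k < length (concat xs) \<longleftrightarrow> J off < length xs"
    using k by (simp add: length_concat_equal[OF e'(4)])
  have seg: "memory s1 OUT (J off * k + y mod k) = xs ! J off ! (y mod k)" if "J off < length xs"
  proof -
    have "y mod k < k" using k by simp
    then have "J off * k + y mod k < Suc (J off) * k" by simp
    also have "\<dots> \<le> length xs * k" using that by (intro mult_le_mono1) simp
    finally show ?thesis
      using e'(2) nth_concat_equal[OF e'(4) that \<open>y mod k < k\<close>] by (simp add: length_concat_equal[OF e'(4)])
  qed
  have eq: "exec F orc (ev (Suc 0) off) s0 = exec F orc (leafread off) s1"
    by (simp only: ev.simps exec.simps s1_def One_nat_def)
  show ?case
    unfolding eq using seg by (simp add: leafread_def var_def J e'(1) lt fr pre Let_def xs_def[symmetric])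
next
  case (ge2 s)
  define rr where "rr i = rs (s * m + i)" for i
  define v where "v i = dec F G k n m \<theta> lst rs J S (Suc s) (off + i * m ^ s) (z + rr i * n ^ Suc s) y" for i
  define body where "body i = seqs [Const g0 (s * m + i), Load g1 1 g0, Op Add (Zr (Suc s)) (Zr (Suc (Suc s))) g1,
       ev (Suc s) (off + i * m ^ s), Const g0 i, Store (VEC (Suc (Suc s))) g0 (Vr (Suc s))]" for i
  define W where "W = insert (VEC (Suc (Suc s))) (insert (Zr (Suc s)) (evW (Suc s)))"
  have sm: "s * m + i < (t - 1) * m" if "i < m" for i
  proof -
    have "s * m + i < Suc s * m" using that by simp
    also have "\<dots> \<le> (t - 1) * m" using ge2.prems(3) by (intro mult_le_mono1) auto
    finally show ?thesis .
  qed
  have rr: "memory s0 1 (s * m + i) = rr i * n ^ Suc s \<and> rr i < n" if "i < m" for i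
  proof -
    have "(s * m + i) div m = s" using that by simp
    then show ?thesis
      using sm[OF that] ge2.prems(1) by (simp only: descr_def rr_def)
  qed
  define I where "I j st \<longleftrightarrow> (\<forall>i<j. memory st (VEC (Suc (Suc s))) i = v i) \<and>
      (\<forall>a. a \<notin> W \<longrightarrow> memory st a = memory s0 a)" for j and st :: state
  define s1 where "s1 = exec F orc (loop m body) s0"
  have "I m s1"
    unfolding s1_def
  proof (rule loop_inv)
    show "I 0 s0" by (simp add: I_def)
  next
    fix i st assume i: "i < m" and I: "I i st"
    have fr: "memory st a = memory s0 a" if "a \<notin> W" for a using I that by (simp add: I_def)
    define st1 where "st1 = put (Zr (Suc s)) 0 (z + rr i * n ^ Suc s) (put g1 0 (rr i * n ^ Suc s) (put g0 0 (s * m + i) st))"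
    define st2 where "st2 = exec F orc (ev (Suc s) (off + i * m ^ s)) st1"
    have Z: "memory st (Zr (Suc (Suc s))) 0 = z" "memory st 1 = memory s0 1"
      using fr ge2.prems(6) by (simp_all add: W_def)
    have eq: "exec F orc (body i) st = put (VEC (Suc (Suc s))) i (memory st2 (Vr (Suc s)) 0) (put g0 0 i st2)"
      using rr[OF i] Z by (simp add: body_def st2_def st1_def var_def)
    have fr1: "memory st1 a = memory st a" if "a \<notin> W" for a
      using that by (auto simp: st1_def W_def)
    have okev: "ok (evW (Suc s)) (Suc s * m ^ s * n) (Suc s * m ^ s * evT) (ev (Suc s) o')" for o'
      using ok_ev[OF m, of "Suc s" o'] by simp
    have fr2: "memory st2 a = memory st1 a" if "a \<notin> evW (Suc s)" for a
      unfolding st2_def using that by (rule ok_frame[OF okev])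
    have le: "off + i * m ^ s + m ^ s \<le> m ^ (t - 1)"
    proof -
      have "i * m ^ s + m ^ s = Suc i * m ^ s" by simp
      also have "\<dots> \<le> m * m ^ s" using i by (intro mult_le_mono1) simp
      finally show ?thesis using ge2.prems(4) by simp
    qed
    have "memory st2 (Vr (Suc s)) 0 = v i"
      unfolding st2_def v_def
    proof (rule ge2.IH(2))
      show "descr rs J (memory st1)"
        using ge2.prems(1) fr1[of 1] fr[of 1] by (simp add: descr_def W_def)
      show "Suc s \<le> t" using ge2.prems(3) by simp
      show "off + i * m ^ s + m ^ (Suc s - 1) \<le> m ^ (t - 1)" using le by simp
      show "memory st1 (DG (Suc u)) 0 = y div k ^ u mod k \<and> memory st1 (LO (Suc u)) 0 = conv k n u y"
        if "u < Suc s" for u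
        using ge2.prems(5)[of u] that fr1[of "DG (Suc u)"] fr1[of "LO (Suc u)"] fr[of "DG (Suc u)"] fr[of "LO (Suc u)"]
        by (simp add: W_def)
      show "memory st1 (Zr (Suc s)) 0 = z + rr i * n ^ Suc s" by (simp add: st1_def)
      show "orc (z + rr i * n ^ Suc s + r) = sorted_list_of_set (S (z + rr i * n ^ Suc s + r)) \<and>
          S (z + rr i * n ^ Suc s + r) \<subseteq> carrier F \<and> card (S (z + rr i * n ^ Suc s + r)) = l"
        if "r < n ^ Suc s" for r
      proof -
        have "rr i * n ^ Suc s + r < Suc (rr i) * n ^ Suc s" using that by simp
        also have "\<dots> \<le> n * n ^ Suc s" using rr[OF i] by (intro mult_le_mono1) simp
        finally have "rr i * n ^ Suc s + r < n ^ Suc (Suc s)" by simp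
        from ge2.prems(7)[OF this] show ?thesis by (simp only: add.assoc)
      qed
    qed simp
    moreover have "memory st2 (VEC (Suc (Suc s))) = memory st (VEC (Suc (Suc s)))"
      by (subst fr2) (simp_all add: st1_def)
    moreover have "memory st2 a = memory s0 a" if "a \<notin> W" for a
      using that fr2[of a] fr1[of a] fr[of a] by (simp add: W_def)
    ultimately show "I (Suc i) (exec F orc (body i) st)"
      unfolding eq using I by (auto simp: I_def less_Suc_eq W_def)
  qed
  then have v1: "\<And>i. i < m \<Longrightarrow> memory s1 (VEC (Suc (Suc s))) i = v i"
    and fr1: "\<And>a. a \<notin> W \<Longrightarrow> memory s1 a = memory s0 a"
    by (auto simp: I_def)
  define s2 where "s2 = exec F orc (fiber (Suc (Suc s))) s1"
  have pre: "memory s1 (Zr (Suc (Suc s))) 0 = z" "memory s1 (LO (Suc (Suc s))) 0 = conv k n (Suc s) y"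
    using ge2.prems(5)[of "Suc s"] ge2.prems(6) by (simp_all add: fr1 W_def)
  have orc: "\<forall>r<n ^ Suc (Suc s). orc (z + r) = sorted_list_of_set (S (z + r)) \<and>
      S (z + r) \<subseteq> carrier F \<and> card (S (z + r)) = l" using ge2.prems(7) by blast
  note e = exec_fib[OF s2_def lo pre orc]
  have fr2: "memory s2 a = memory s1 a" if "a \<notin> fibW" for a
    unfolding s2_def using that by (rule ok_frame[OF ok_fiber])
  have "exec F orc (ev (Suc (Suc s)) off) s0 = exec F orc (select s) s2"
    by (simp add: s2_def s1_def body_def[abs_def])
  moreover have "memory (exec F orc (select s) s2) (Vr (Suc (Suc s))) 0 =
      pick F G k m \<theta> (lst (fib k n S (Suc (Suc s)) z y)) rr v (y div k ^ Suc s mod k)"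
    using refl e(3,4,1,2)
  proof (rule exec_select)
    show "memory s2 1 (s * m + i) = rr i * n ^ Suc s \<and> rr i < n" if "i < m" for i
      using rr[OF that] fr1[of 1] fr2[of 1] by (simp add: W_def)
    show "memory s2 (VEC (Suc (Suc s))) i = v i" if "i < m" for i
      using v1[OF that] by (simp add: fr2)
    show "memory s2 (DG (Suc (Suc s))) 0 = y div k ^ Suc s mod k"
      using ge2.prems(5)[of "Suc s"] by (simp add: fr2 fr1 W_def)
    show "y div k ^ Suc s mod k < k" using k by simp
  qed
  ultimately show ?case by (simp add: rr_def[abs_def] v_def[abs_def])
qed simp

end

section \<open>Digits of a queried position, and the subroutine that answers a query\<close>

abbreviation "REM \<equiv> ar 10 28"

lemma conv_Suc: "conv k n (Suc s) y = conv k n s y + (y div k ^ s mod k) * n ^ s"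
  by (simp add: conv_def)

lemma div_mod_digit: "u < s \<Longrightarrow> y mod k ^ s div k ^ u mod k = y div k ^ u mod (k::nat)"
proof (induction s)
  case (Suc s)
  have "y mod k ^ s' div k ^ u mod k = y div k ^ u mod k" if s': "u < s'" for s'
  proof -
    have "k ^ s' = k ^ u * (k * k ^ (s' - Suc u))"
      using s' by (simp flip: power_Suc power_add)
    then have "y mod k ^ s' div k ^ u = y div k ^ u mod (k * k ^ (s' - Suc u))"
      by (cases "k = 0") (auto simp: mod_mult2_eq power_0_left)
    then show ?thesis by (simp add: mod_mod_cancel)
  qed
  then show ?case using Suc.prems by blast
qed simp

lemma conv_mod: "conv k n s (y mod k ^ s) = conv k n s y"
  unfolding conv_def by (intro sum.cong refl) (simp add: div_mod_digit)

lemma conv_mod': "u \<le> s \<Longrightarrow> conv k n u (y mod k ^ s) = conv k n u y"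
  unfolding conv_def by (intro sum.cong refl) (simp add: div_mod_digit)

definition digW :: "nat \<Rightarrow> nat set" where
  "digW s = ar 5 ` {..s} \<union> ar 7 ` {..s} \<union> ar 6 ` {..Suc s} \<union> range (ar 10)"

lemma digW_mem [simp]: "ar i j \<in> digW s \<longleftrightarrow> i = 10 \<or> (i = 5 \<or> i = 7) \<and> j \<le> s \<or> i = 6 \<and> j \<le> Suc s"
  "bv x \<notin> digW s" "Suc 0 \<notin> digW s"
  by (auto simp: digW_def)

lemma digW_mono: "s \<le> s' \<Longrightarrow> digW s \<subseteq> digW s'"
  unfolding digW_def by force

context prog
begin

text \<open>Without division or multiplication, a digit is found by at most \<open>k\<close>
  subtractions, and its contribution to the position in \<open>[n] ^ s\<close> is summed up along
  with it.\<close>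

definition digbody :: "nat \<Rightarrow> nat \<Rightarrow> com" where
  "digbody s d = seqs [Const g0 (k ^ s), Cond (Less REM g0) Skip
     (seqs [Op Sub REM REM g0, Const g1 1, Op Add (DG (Suc s)) (DG (Suc s)) g1, Const g1 (n ^ s),
       Op Add (WT (Suc s)) (WT (Suc s)) g1])]"

primrec dig :: "nat \<Rightarrow> com" where
  "dig 0 = Const (LO (Suc 0)) 0"
| "dig (Suc s) = seqs [Const (DG (Suc s)) 0, Const (WT (Suc s)) 0, loop k (digbody s), dig s,
     Op Add (LO (Suc (Suc s))) (LO (Suc s)) (WT (Suc s))]"

lemma ok_dig: "ok (digW s) 0 (s * (k * 15 + 20) + 1) (dig s)"
proof (induction s)
  case (Suc s)
  have "ok (digW (Suc s)) (k * 0) (k * Suc 12 + 1) (loop k (digbody s))"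
    by (intro ok_loop) (simp add: ok_def digbody_def)
  moreover have "ok (digW (Suc s)) 0 (s * (k * 15 + 20) + 1) (dig s)"
    using Suc by (rule ok_mono) (simp_all add: digW_mono)
  ultimately show ?case by (auto simp: ok_def algebra_simps)
qed (simp add: ok_def)

lemma exec_dig:
  "memory s0 REM 0 = y \<Longrightarrow> y < k ^ s \<Longrightarrow>
   (\<forall>u<s. memory (exec F orc (dig s) s0) (DG (Suc u)) 0 = y div k ^ u mod k) \<and>
   (\<forall>u\<le>s. memory (exec F orc (dig s) s0) (LO (Suc u)) 0 = conv k n u y)"
proof (induction s arbitrary: s0 y)
  case 0
  then show ?case by (simp add: conv_def)
next
  case (Suc s)
  \<comment> \<open>The last clause says that every round so far has subtracted unless the remainder
    is already small; after \<open>k\<close> rounds a large remainder would contradict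
    \<open>y < k ^ Suc s\<close>.\<close>
  define I where "I d st \<longleftrightarrow> memory st REM 0 + memory st (DG (Suc s)) 0 * k ^ s = y \<and>
     memory st (WT (Suc s)) 0 = memory st (DG (Suc s)) 0 * n ^ s \<and>
     (memory st REM 0 < k ^ s \<or> memory st (DG (Suc s)) 0 = d)" for d and st :: state
  define s1 where "s1 = exec F orc (loop k (digbody s)) (put (WT (Suc s)) 0 0 (put (DG (Suc s)) 0 0 s0))"
  have "I k s1"
    unfolding s1_def
  proof (rule loop_inv)
    show "I 0 (put (WT (Suc s)) 0 0 (put (DG (Suc s)) 0 0 s0))" using Suc.prems by (simp add: I_def)
  next
    fix d st assume "I d st"
    then show "I (Suc d) (exec F orc (digbody s d) st)"
      by (auto simp: I_def digbody_def var_def algebra_simps)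
  qed
  moreover have "memory s1 REM 0 < k ^ s"
  proof (rule ccontr)
    assume "\<not> memory s1 REM 0 < k ^ s"
    with \<open>I k s1\<close> have "memory s1 REM 0 + k * k ^ s = y" by (auto simp: I_def)
    then show False using Suc.prems by simp
  qed
  ultimately have R: "memory s1 REM 0 < k ^ s" "memory s1 REM 0 + memory s1 (DG (Suc s)) 0 * k ^ s = y"
    and W: "memory s1 (WT (Suc s)) 0 = memory s1 (DG (Suc s)) 0 * n ^ s"
    by (auto simp: I_def)
  have kpos: "0 < k ^ s" using k by simp
  have D: "memory s1 (DG (Suc s)) 0 = y div k ^ s" using R kpos
    by (metis add.commute add_0 div_less div_mult_self1 neq0_conv)
  have M: "memory s1 REM 0 = y mod k ^ s" using R
    by (metis mod_less mod_mult_self1)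
  have D': "y div k ^ s mod k = y div k ^ s"
    using Suc.prems(2) by (simp add: less_mult_imp_div_less)
  define s2 where "s2 = exec F orc (dig s) s1"
  have fr: "memory s2 a = memory s1 a" if "a \<notin> digW s" for a
    unfolding s2_def using that by (rule ok_frame[OF ok_dig])
  have IH: "\<And>u. u < s \<Longrightarrow> memory s2 (DG (Suc u)) 0 = y div k ^ u mod k"
    "\<And>u. u \<le> s \<Longrightarrow> memory s2 (LO (Suc u)) 0 = conv k n u y"
    using Suc.IH[OF M] kpos by (simp_all add: s2_def div_mod_digit conv_mod')
  have eq: "exec F orc (dig (Suc s)) s0 =
      put (LO (Suc (Suc s))) 0 (memory s2 (LO (Suc s)) 0 + memory s2 (WT (Suc s)) 0) s2"
    by (simp add: s2_def s1_def var_def)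
  show ?case
    unfolding eq using IH by (auto simp: less_Suc_eq le_Suc_eq fr D D' W conv_Suc)
qed

text \<open>A query beyond the end of the string has the empty list as its answer and changes
  nothing, hence the range test. The sum with a zero copies the index.\<close>

definition block :: "nat \<Rightarrow> nat \<Rightarrow> com" where
  "block a x = seqs [Const g0 (k ^ t), Const g1 0, Op Add REM (bv x) g1,
     Cond (Less REM g0)
       (seqs [dig t, Const (Zr t) 0, ev t 0, Const g0 0, Store (bv a) g0 (Vr t)]) Skip]"

definition blockQ :: nat where "blockQ = t * m ^ (t - 1) * n"

definition blockT :: nat where "blockT = t * (k * 15 + 20) + t * m ^ (t - 1) * evT + 30"

lemma ok_block:
  assumes "0 < t" "0 < m"
  shows "ok (evW (Suc t) \<union> digW t \<union> {bv a}) blockQ blockT (block a x)"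
proof -
  have "ok (evW (Suc t) \<union> digW t \<union> {bv a}) 0 (t * (k * 15 + 20) + 1) (dig t)"
    using ok_dig by (rule ok_mono) auto
  moreover have "ok (evW (Suc t) \<union> digW t \<union> {bv a}) blockQ (t * m ^ (t - 1) * evT) (ev t 0)"
    using ok_ev[OF assms(2,1), of 0] by (rule ok_mono) (use evW_mono[of t "Suc t"] in \<open>auto simp: blockQ_def\<close>)
  ultimately show ?thesis by (auto simp: ok_def block_def blockT_def)
qed

text \<open>The word that the outer decoder reads. Every query uses the same rows and the same
  advice, so all answers come from one string, as the definition of a local decoder
  requires.\<close>

definition answer :: "(nat \<Rightarrow> nat) \<Rightarrow> (nat \<Rightarrow> nat) \<Rightarrow> (nat \<Rightarrow> nat set) \<Rightarrow> nat \<Rightarrow> nat" where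
  "answer rs J S = (\<lambda>y\<in>{..<k ^ t}. dec F G k n m \<theta> lst rs J S t 0 0 y)"

lemma exec_block:
  assumes s': "s' = exec F orc (block a x) s0" and lists_ok "descr rs J (memory s0)" "0 < t" "0 < m"
    and orc: "\<And>r. r < n ^ t \<Longrightarrow> orc r = sorted_list_of_set (S r) \<and> S r \<subseteq> carrier F \<and> card (S r) = l"
  defines "ans \<equiv> string_oracle (k ^ t) (answer rs J S) (memory s0 (bv x) 0)"
  shows "memory s' (bv b) = (if b = a then \<lambda>i. if i < length ans then ans ! i else memory s0 (bv a) i
     else memory s0 (bv b))" "memory s' 1 = memory s0 1"
proof -
  show "memory s' 1 = memory s0 1"
    unfolding s' by (rule ok_frame[OF ok_block[OF assms(4,5)]]) auto
  have fr0: "memory s' (bv b) = memory s0 (bv b)" if "b \<noteq> a" for b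
    unfolding s' using that by (intro ok_frame[OF ok_block[OF assms(4,5)]]) auto
  define y where "y = memory s0 (bv x) 0"
  define s1 where "s1 = put REM 0 y (put g1 0 0 (put g0 0 (k ^ t) s0))"
  have "memory s' (bv a) = (\<lambda>i. if i < length ans then ans ! i else memory s0 (bv a) i)"
  proof (cases "y < k ^ t")
    case False
    then have "s' = s1" by (simp add: s' block_def s1_def y_def var_def)
    moreover have "ans = []" using False by (simp add: ans_def string_oracle_def y_def)
    ultimately show ?thesis by (simp add: s1_def)
  next
    case True
    define s2 where "s2 = exec F orc (dig t) s1"
    define s3 where "s3 = put (Zr t) 0 0 s2"
    define s4 where "s4 = exec F orc (ev t 0) s3"
    have s'_eq: "s' = put (bv a) 0 (memory s4 (Vr t) 0) (put g0 0 0 s4)"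
      using True by (simp add: s' block_def s1_def s2_def s3_def s4_def y_def var_def)
    have fr2: "memory s2 c = memory s1 c" if "c \<notin> digW t" for c
      unfolding s2_def using that by (rule ok_frame[OF ok_dig])
    have fr4: "memory s4 c = memory s3 c" if "c \<notin> evW t" for c
      unfolding s4_def using that by (rule ok_frame[OF ok_ev[OF assms(5,4)]])
    have "memory s1 REM 0 = y" by (simp add: s1_def)
    note dg = exec_dig[OF this True, where orc=orc, folded s2_def]
    have "memory s4 (Vr t) 0 = dec F G k n m \<theta> lst rs J S t 0 0 y"
      unfolding s4_def
    proof (rule exec_ev[OF \<open>lists_ok\<close>])
      show "descr rs J (memory s3)" using assms(3) by (simp add: descr_def s3_def fr2 s1_def)
      show "memory s3 (DG (Suc u)) 0 = y div k ^ u mod k \<and> memory s3 (LO (Suc u)) 0 = conv k n u y"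
        if "u < t" for u using dg that by (simp add: s3_def)
    qed (use assms(4,5) orc in \<open>auto simp: s3_def\<close>)
    moreover have "ans = [dec F G k n m \<theta> lst rs J S t 0 0 y]"
      using True by (simp add: ans_def string_oracle_def y_def answer_def)
    moreover have "memory s4 (bv a) = memory s0 (bv a)"
      by (simp add: fr4 s3_def fr2 s1_def)
    ultimately show ?thesis unfolding s'_eq by (auto simp: fun_eq_iff)
  qed
  with fr0 show "memory s' (bv b) = (if b = a then \<lambda>i. if i < length ans then ans ! i else memory s0 (bv a) i
     else memory s0 (bv b))" by auto
qed

end

section \<open>Answering the queries of a program by a subroutine\<close>

primrec trt :: "test \<Rightarrow> test" where
  "trt (Eq x y) = Eq (bv x) (bv y)"
| "trt (Less x y) = Less (bv x) (bv y)"

primrec tr :: "(nat \<Rightarrow> nat \<Rightarrow> com) \<Rightarrow> com \<Rightarrow> com" where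
  "tr sub (Const x v) = Const (bv x) v"
| "tr sub (Op f x y z) = Op f (bv x) (bv y) (bv z)"
| "tr sub (Load x a y) = Load (bv x) (bv a) (bv y)"
| "tr sub (Store a y x) = Store (bv a) (bv y) (bv x)"
| "tr sub (Toss x) = Toss (bv x)"
| "tr sub (Query a y) = sub a y"
| "tr sub (Emit x) = Emit (bv x)"
| "tr sub EndItem = EndItem"
| "tr sub Skip = Skip"
| "tr sub (Seq c d) = Seq (tr sub c) (tr sub d)"
| "tr sub (Cond b c d) = Cond (trt b) (tr sub c) (tr sub d)"
| "tr sub (While b c) = While (trt b) (tr sub c)"

definition trrel :: "(nat \<Rightarrow> nat) \<Rightarrow> state \<Rightarrow> state \<Rightarrow> bool" where
  "trrel \<sigma> s z \<longleftrightarrow> (\<forall>x. memory s (bv x) = memory z x) \<and> memory s 1 = \<sigma> \<and>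
     items s = items z \<and> current s = current z"

lemma trrel_put: "trrel \<sigma> s z \<Longrightarrow> trrel \<sigma> (put (bv a) i v s) (put a i v z)"
  by (auto simp: trrel_def)

lemma trrel_var: "trrel \<sigma> s z \<Longrightarrow> var s (bv x) = var z x"
  by (simp add: trrel_def var_def)

lemma trrel_passes: "trrel \<sigma> s z \<Longrightarrow> passes (trt b) s = passes b z"
  by (cases b) (simp_all add: trrel_var)

lemma step_queries_mono: "(cs', s') \<in> set_pmf (step F orc (cs, s)) \<Longrightarrow> queries s \<le> queries s'"
proof (cases cs)
  case (Cons c cs'')
  assume "(cs', s') \<in> set_pmf (step F orc (cs, s))"
  then show ?thesis unfolding Cons by (cases c) (auto simp: Let_def)
qed auto

lemma steps_queries_mono: "(cs', s') \<in> set_pmf (steps F orc N (cs, s)) \<Longrightarrow> queries s \<le> queries s'"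
proof (induction N arbitrary: cs s)
  case (Suc N)
  then obtain cs1 s1 where "(cs1, s1) \<in> set_pmf (step F orc (cs, s))"
    "(cs', s') \<in> set_pmf (steps F orc N (cs1, s1))" by auto
  then show ?case using Suc.IH step_queries_mono by (meson order_trans)
qed simp

text \<open>A coupling of the two machines: both steps are images of one coin distribution
  \<open>p\<close>, and a step that tosses no coin ignores it.\<close>

lemma tr_step:
  assumes rel: "trrel \<sigma> s z" and nq: "\<And>a y. c \<noteq> Query a y"
  shows "\<exists>(p :: bool pmf) g h. step F orc2 (c # cs, z) = map_pmf g p \<and>
     step F orc (map (tr sub) (c # cs), s) = map_pmf h p \<and>
     (\<forall>b. \<exists>cs' s' z'. g b = (cs', z') \<and> h b = (map (tr sub) cs', s') \<and> trrel \<sigma> s' z' \<and>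
       queries s' = queries s \<and> queries z' = queries z)"
proof -
  have det: ?thesis if "step F orc2 (c # cs, z) = return_pmf (cs', z')"
    "step F orc (map (tr sub) (c # cs), s) = return_pmf (map (tr sub) cs', s')" "trrel \<sigma> s' z'"
    "queries s' = queries s" "queries z' = queries z" for cs' z' s'
    using that by (intro exI[of _ "return_pmf True"] exI[of _ "\<lambda>_. (cs', z')"]
        exI[of _ "\<lambda>_. (map (tr sub) cs', s')"]) auto
  show ?thesis
  proof (cases c)
    case (Toss x)
    show ?thesis
      unfolding Toss using trrel_put[OF rel]
      by (intro exI[of _ "bernoulli_pmf (1/2)"] exI[of _ "\<lambda>b. (cs, put x 0 (of_bool b) z)"]
          exI[of _ "\<lambda>b. (map (tr sub) cs, put (bv x) 0 (of_bool b) s)"]) auto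
  next
    case (Const x v)
    show ?thesis
      by (rule det[of cs "put x 0 v z" "put (bv x) 0 v s"]) (auto simp: Const intro!: trrel_put rel)
  next
    case (Op f x y w)
    show ?thesis
      by (rule det[of cs "put x 0 (apply_op F f (var z y) (var z w)) z"
            "put (bv x) 0 (apply_op F f (var z y) (var z w)) s"])
        (auto simp: Op trrel_var[OF rel] intro!: trrel_put rel)
  next
    case (Load x a y)
    have "memory s (bv a) = memory z a" using rel by (simp add: trrel_def)
    then show ?thesis
      by (intro det[of cs "put x 0 (memory z a (var z y)) z" "put (bv x) 0 (memory z a (var z y)) s"])
        (auto simp: Load trrel_var[OF rel] intro!: trrel_put rel)
  next
    case (Store a y x)
    show ?thesis
      by (rule det[of cs "put a (var z y) (var z x) z" "put (bv a) (var z y) (var z x) s"])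
        (auto simp: Store trrel_var[OF rel] intro!: trrel_put rel)
  next
    case (Query a y)
    then show ?thesis using nq by blast
  next
    case (Emit x)
    show ?thesis
      by (rule det[of cs "z\<lparr>current := current z @ [var z x]\<rparr>" "s\<lparr>current := current s @ [var z x]\<rparr>"])
        (use rel in \<open>auto simp: Emit trrel_var[OF rel] trrel_def\<close>)
  next
    case EndItem
    show ?thesis
      by (rule det[of cs "z\<lparr>current := [], items := items z @ [current z]\<rparr>"
            "s\<lparr>current := [], items := items s @ [current s]\<rparr>"])
        (use rel in \<open>auto simp: EndItem trrel_def\<close>)
  next
    case Skip
    show ?thesis by (rule det[of cs z s]) (use rel in \<open>auto simp: Skip\<close>)
  next
    case (Seq d e)
    show ?thesis by (rule det[of "d # e # cs" z s]) (use rel in \<open>auto simp: Seq\<close>)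
  next
    case (Cond b d e)
    show ?thesis
      by (rule det[of "(if passes b z then d else e) # cs" z s])
        (use rel in \<open>auto simp: Cond trrel_passes[OF rel]\<close>)
  next
    case (While b d)
    show ?thesis
      by (rule det[of "if passes b z then d # While b d # cs else cs" z s])
        (use rel in \<open>auto simp: While trrel_passes[OF rel]\<close>)
  qed
qed

text \<open>Induction on the steps of the original program. A query is replaced by at most
  \<open>R\<close> steps, and \<open>q0 - queries z\<close> bounds the queries still to come, since
  the count never decreases and ends at most at \<open>q0\<close> on every run.\<close>

lemma tr_steps:
  assumes sub: "\<And>a y s. memory s 1 = \<sigma> \<Longrightarrow> \<exists>s' N. N \<le> R \<and>
      (\<forall>cs. steps F orc N (sub a y # cs, s) = return_pmf (cs, s')) \<and>
      memory s' 1 = \<sigma> \<and> items s' = items s \<and> current s' = current s \<and> queries s' \<le> queries s + Q \<and>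
      (\<forall>b. memory s' (bv b) = (if b = a then \<lambda>i. if i < length (orc2 (memory s (bv y) 0))
         then orc2 (memory s (bv y) 0) ! i else memory s (bv a) i else memory s (bv b)))"
  shows "trrel \<sigma> s z \<Longrightarrow> (\<And>cs' z'. (cs', z') \<in> set_pmf (steps F orc2 N (cs, z)) \<Longrightarrow> cs' = [] \<and> queries z' \<le> q0) \<Longrightarrow>
    N + (q0 - queries z) * R \<le> T' \<Longrightarrow>
    map_pmf (\<lambda>c. items (snd c)) (steps F orc T' (map (tr sub) cs, s)) =
      map_pmf (\<lambda>c. items (snd c)) (steps F orc2 N (cs, z)) \<and>
    (\<forall>(cs', s') \<in> set_pmf (steps F orc T' (map (tr sub) cs, s)).
       cs' = [] \<and> queries s' \<le> queries s + (q0 - queries z) * Q)"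
proof (induction N arbitrary: cs s z T')
  case 0
  then have "cs = []" by auto
  then show ?case using 0(1) by (simp add: trrel_def)
next
  case (Suc N)
  show ?case
  proof (cases cs)
    case Nil
    then show ?thesis using Suc.prems(1) by (simp add: trrel_def bind_return_pmf)
  next
    case (Cons c cs1)
    show ?thesis
    proof (cases "\<exists>a y. c = Query a y")
      case True
      then obtain a y where c: "c = Query a y" by blast
      define z1 where "z1 = ask orc2 a (var z y) z"
      have eqz: "steps F orc2 (Suc N) (cs, z) = steps F orc2 N (cs1, z1)"
        by (simp add: Cons c z1_def ask_def Let_def bind_return_pmf)
      have halt: "\<And>cs' z'. (cs', z') \<in> set_pmf (steps F orc2 N (cs1, z1)) \<Longrightarrow> cs' = [] \<and> queries z' \<le> q0"
        using Suc.prems(2) unfolding eqz by blast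
      \<comment> \<open>Some run from \<open>z1\<close> exists, and it ends with at most
        \<open>q0\<close> queries; so the budget covers the query just made.\<close>
      obtain cs' z' where "(cs', z') \<in> set_pmf (steps F orc2 N (cs1, z1))"
        using set_pmf_not_empty[of "steps F orc2 N (cs1, z1)"] by (metis equals0I surj_pair)
      then have "queries z1 \<le> q0" using halt steps_queries_mono order_trans by blast
      then have q: "q0 - queries z = Suc (q0 - queries z1)" by (simp add: z1_def)
      have "memory s 1 = \<sigma>" using Suc.prems(1) by (simp add: trrel_def)
      from sub[OF this, of a y] obtain s1 M where M: "M \<le> R"
        "\<And>cs. steps F orc M (sub a y # cs, s) = return_pmf (cs, s1)"
        and s1: "memory s1 1 = \<sigma>" "items s1 = items s" "current s1 = current s" "queries s1 \<le> queries s + Q"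
          "\<And>b. memory s1 (bv b) = (if b = a then \<lambda>i. if i < length (orc2 (memory s (bv y) 0))
             then orc2 (memory s (bv y) 0) ! i else memory s (bv a) i else memory s (bv b))" by blast
      have rel: "trrel \<sigma> s1 z1"
        using Suc.prems(1) s1 by (auto simp: trrel_def z1_def var_def)
      have T': "N + (q0 - queries z1) * R \<le> T' - M" "M \<le> T'"
        using Suc.prems(3) M(1) unfolding q by auto
      have "steps F orc T' (map (tr sub) cs, s) = steps F orc (M + (T' - M)) (sub a y # map (tr sub) cs1, s)"
        using T'(2) by (simp add: Cons c)
      also have "\<dots> = steps F orc (T' - M) (map (tr sub) cs1, s1)"
        by (simp only: steps_add M(2) bind_return_pmf)
      finally have eq: "steps F orc T' (map (tr sub) cs, s) = steps F orc (T' - M) (map (tr sub) cs1, s1)" .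
      have "(q0 - queries z) * Q = Q + (q0 - queries z1) * Q" by (simp add: q)
      then show ?thesis
        using Suc.IH[OF rel halt T'(1)] s1(4) unfolding eq eqz by force
    next
      case False
      then have nq: "c \<noteq> Query a y" for a y by blast
      have "\<exists>(p :: bool pmf) g h. step F orc2 (c # cs1, z) = map_pmf g p \<and>
        step F orc (map (tr sub) (c # cs1), s) = map_pmf h p \<and>
        (\<forall>b. \<exists>cs' s' z'. g b = (cs', z') \<and> h b = (map (tr sub) cs', s') \<and> trrel \<sigma> s' z' \<and>
          queries s' = queries s \<and> queries z' = queries z)"
        by (rule tr_step[OF Suc.prems(1) nq])
      then obtain p :: "bool pmf" and g h where gh: "step F orc2 (c # cs1, z) = map_pmf g p"
        "step F orc (map (tr sub) (c # cs1), s) = map_pmf h p"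
        and r: "\<forall>b. \<exists>cs' s' z'. g b = (cs', z') \<and> h b = (map (tr sub) cs', s') \<and> trrel \<sigma> s' z' \<and>
          queries s' = queries s \<and> queries z' = queries z"
        by blast
      obtain T1 where T1: "T' = Suc T1" "N + (q0 - queries z) * R \<le> T1"
        using Suc.prems(3) by (cases T') auto
      have eq1: "steps F orc T' (map (tr sub) cs, s) = bind_pmf p (\<lambda>b. steps F orc T1 (h b))"
        unfolding T1 Cons by (simp only: steps.simps gh(2) bind_map_pmf)
      have eq2: "steps F orc2 (Suc N) (cs, z) = bind_pmf p (\<lambda>b. steps F orc2 N (g b))"
        unfolding Cons by (simp only: steps.simps gh(1) bind_map_pmf)
      have IH: "map_pmf (\<lambda>c. items (snd c)) (steps F orc T1 (h b)) =
            map_pmf (\<lambda>c. items (snd c)) (steps F orc2 N (g b)) \<and>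
          (\<forall>(cs', s') \<in> set_pmf (steps F orc T1 (h b)). cs' = [] \<and> queries s' \<le> queries s + (q0 - queries z) * Q)"
        if b: "b \<in> set_pmf p" for b
      proof -
        obtain cs' s' z' where x: "g b = (cs', z')" "h b = (map (tr sub) cs', s')" "trrel \<sigma> s' z'"
          "queries s' = queries s" "queries z' = queries z" using r by blast
        have halt: "cs'' = [] \<and> queries z'' \<le> q0" if "(cs'', z'') \<in> set_pmf (steps F orc2 N (cs', z'))" for cs'' z''
          using Suc.prems(2)[of cs'' z''] that b x(1) unfolding eq2 by force
        have "N + (q0 - queries z') * R \<le> T1" using T1(2) x(5) by simp
        from Suc.IH[OF x(3) halt this] show ?thesis using x by simp
      qed
      show ?thesis
        unfolding eq1 eq2 map_bind_pmf using IH by (auto intro!: bind_pmf_cong)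
    qed
  qed
qed

context prog
begin

lemma run_tr:
  assumes lists_ok "descr rs J m'" "0 < t" "0 < m" "m' 0 0 = i" "i < khat"
    and lists_F: "answer rs J S \<in> strings (carrier F) (k ^ t)"
    and orc: "\<And>r. r < n ^ t \<Longrightarrow> orc r = sorted_list_of_set (S r) \<and> S r \<subseteq> carrier F \<and> card (S r) = l"
    and ld: "local_decoder F khat (k ^ t) Chat Qhat \<alpha>hat Bhat That"
  defines "p \<equiv> run F orc (That + Qhat * blockT) (tr block Bhat) m'"
  shows "\<forall>(cs, s) \<in> set_pmf p. cs = [] \<and> queries s \<le> Qhat * blockQ"
    "\<And>x. x \<in> strings (carrier F) khat \<Longrightarrow> hdist (k ^ t) (answer rs J S) (Chat x) \<le> \<alpha>hat \<Longrightarrow>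
       2/3 \<le> measure_pmf.prob p {(cs, s). items s = [[x i]]}"
proof -
  let ?orc2 = "string_oracle (k ^ t) (answer rs J S)"
  define s where "s = \<lparr>memory = m', queries = 0, current = [], items = []\<rparr>"
  define z where "z = \<lparr>memory = (\<lambda>x. m' (bv x)), queries = 0, current = [], items = []\<rparr>"
  have sub: "\<exists>s' N. N \<le> blockT \<and>
      (\<forall>cs. steps F orc N (block a y # cs, s) = return_pmf (cs, s')) \<and>
      memory s' 1 = m' 1 \<and> items s' = items s \<and> current s' = current s \<and> queries s' \<le> queries s + blockQ \<and>
      (\<forall>b. memory s' (bv b) = (if b = a then \<lambda>i. if i < length (?orc2 (memory s (bv y) 0))
         then ?orc2 (memory s (bv y) 0) ! i else memory s (bv a) i else memory s (bv b)))"
    if s1: "memory s 1 = m' 1" for a y s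
  proof -
    note ok = ok_block[OF assms(3,4), of a y]
    then have okd: "determ (block a y)" "silent (block a y)" "nq (block a y) \<le> blockQ" "tm (block a y) \<le> blockT"
      by (auto simp: ok_def)
    define s' where "s' = exec F orc (block a y) s"
    obtain N where N: "N \<le> tm (block a y)" "\<forall>cs. steps F orc N (block a y # cs, s) = return_pmf (cs, s')"
      using steps_determ[OF okd(1)] s'_def by blast
    have "descr rs J (memory s)" using assms(2) s1 by (simp add: descr_def)
    note e = exec_block[OF s'_def assms(1) this assms(3,4) orc]
    have "queries s' \<le> queries s + blockQ"
      using exec_queries[of F orc "block a y" s] okd(3) by (simp add: s'_def)
    moreover have "N \<le> blockT" using N(1) okd(4) by simp
    moreover have "\<forall>b. memory s' (bv b) = (if b = a then \<lambda>i. if i < length (?orc2 (memory s (bv y) 0))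
         then ?orc2 (memory s (bv y) 0) ! i else memory s (bv a) i else memory s (bv b))"
      using e(1) by blast
    ultimately show ?thesis
      using N(2) e(2) s1 exec_silent[OF okd(2), of F orc s] by (intro exI[of _ s'] exI[of _ N]) (simp add: s'_def)
  qed
  have rel: "trrel (m' 1) s z" by (simp add: trrel_def s_def z_def)
  \<comment> \<open>Array 1 of the simulated decoder is \<open>bv 1\<close> and holds arbitrary
    data. This is allowed, as a local decoder has the empty description as its input.\<close>
  have inp: "input_mem i [] (memory z)"
    using assms(5) by (simp add: input_mem_def input_array_def z_def bv_def)
  have runz: "run F ?orc2 That Bhat (memory z) = steps F ?orc2 That ([Bhat], z)"
    by (simp add: run_def z_def)
  have halt: "cs' = [] \<and> queries z' \<le> Qhat" if "(cs', z') \<in> set_pmf (steps F ?orc2 That ([Bhat], z))" for cs' z'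
    using ld lists_F assms(6) inp that unfolding local_decoder_def runz[symmetric] by blast
  have sim: "map_pmf (\<lambda>c. items (snd c)) (steps F orc (That + Qhat * blockT) (map (tr block) [Bhat], s)) =
      map_pmf (\<lambda>c. items (snd c)) (steps F ?orc2 That ([Bhat], z)) \<and>
    (\<forall>(cs', s') \<in> set_pmf (steps F orc (That + Qhat * blockT) (map (tr block) [Bhat], s)).
       cs' = [] \<and> queries s' \<le> queries s + (Qhat - queries z) * blockQ)"
    by (rule tr_steps[OF sub rel halt]) (simp_all add: z_def)
  have p: "p = steps F orc (That + Qhat * blockT) (map (tr block) [Bhat], s)"
    by (simp add: p_def run_def s_def)
  show "\<forall>(cs, s) \<in> set_pmf p. cs = [] \<and> queries s \<le> Qhat * blockQ"
    using sim unfolding p by (simp add: s_def z_def)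
  fix x assume x: "x \<in> strings (carrier F) khat" "hdist (k ^ t) (answer rs J S) (Chat x) \<le> \<alpha>hat"
  have eq: "{(cs, s). items s = [[x i]]} = {c :: config. items (snd c) = [[x i]]}" by auto
  have "measure_pmf.prob p {(cs, s). items s = [[x i]]} =
      measure_pmf.prob (map_pmf (\<lambda>c. items (snd c)) p) {[[x i]]}"
    by (simp add: measure_map_pmf vimage_def eq)
  also have "\<dots> = measure_pmf.prob (map_pmf (\<lambda>c. items (snd c)) (steps F ?orc2 That ([Bhat], z))) {[[x i]]}"
    unfolding p using sim by simp
  also have "\<dots> = measure_pmf.prob (run F ?orc2 That Bhat (memory z)) {(cs, s). items s = [[x i]]}"
    by (simp add: measure_map_pmf vimage_def eq runz)
  also have "\<dots> \<ge> 2/3"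
    using ld lists_F assms(6) inp x unfolding local_decoder_def by blast
  finally show "2/3 \<le> measure_pmf.prob p {(cs, s). items s = [[x i]]}" .
qed

end

section \<open>Samples\<close>

lemma integrable_pmf_bounded:
  fixes f :: "'a \<Rightarrow> real"
  assumes "\<And>x. \<bar>f x\<bar> \<le> B"
  shows "integrable (measure_pmf p) f"
  using assms by (intro measure_pmf.integrable_const_bound[where B=B]) auto

lemma prob_bind_pmf:
  "measure_pmf.prob (bind_pmf p f) A = measure_pmf.expectation p (\<lambda>x. measure_pmf.prob (f x) A)"
proof -
  have "ennreal (measure_pmf.prob (bind_pmf p f) A) = emeasure (bind_pmf p f) A"
    by (simp add: measure_pmf.emeasure_eq_measure)
  also have "\<dots> = (\<integral>\<^sup>+x. ennreal (measure_pmf.prob (f x) A) \<partial>p)"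
    by (subst emeasure_bind_pmf) (simp only: measure_pmf.emeasure_eq_measure)
  also have "\<dots> = ennreal (measure_pmf.expectation p (\<lambda>x. measure_pmf.prob (f x) A))"
    by (intro nn_integral_eq_integral integrable_pmf_bounded[where B=1]) auto
  finally show ?thesis by (simp add: integral_nonneg_AE)
qed

lemma expectation_mono_pmf:
  fixes f g :: "'a \<Rightarrow> real"
  assumes "\<And>x. \<bar>f x\<bar> \<le> B" "\<And>x. \<bar>g x\<bar> \<le> B'" "\<And>x. x \<in> set_pmf p \<Longrightarrow> f x \<le> g x"
  shows "measure_pmf.expectation p f \<le> measure_pmf.expectation p g"
  using assms by (intro integral_mono_AE integrable_pmf_bounded[where B=B] integrable_pmf_bounded[where B=B'])
    (auto simp: AE_measure_pmf_iff)

lemma expectation_two_values: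
  "measure_pmf.expectation p (\<lambda>x. if x \<in> E then a else b) = b + (a - b) * measure_pmf.prob p E" for a b :: real
proof -
  have "measure_pmf.expectation p (\<lambda>x. if x \<in> E then a else b) =
      measure_pmf.expectation p (\<lambda>x. b + (a - b) * indicator E x)"
    by (intro Bochner_Integration.integral_cong) (auto simp: indicator_def)
  also have "\<dots> = measure_pmf.expectation p (\<lambda>x. b) + measure_pmf.expectation p (\<lambda>x. (a - b) * indicator E x)"
    by (intro Bochner_Integration.integral_add integrable_pmf_bounded[where B="\<bar>b\<bar>"]
        integrable_pmf_bounded[where B="\<bar>a - b\<bar>"]) (auto simp: indicator_def)
  finally show ?thesis by simp
qed

lemma prob_pair_pmf:
  "measure_pmf.prob (pair_pmf A B) {(x, y). Q x y} =
     measure_pmf.expectation B (\<lambda>y. measure_pmf.prob A {x. Q x y})"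
proof -
  have "measure_pmf.prob (return_pmf (x, y)) {(x, y). Q x y} = indicator {x. Q x y} x" for x y
    by (simp add: indicator_def)
  moreover have "pair_pmf A B = bind_pmf B (\<lambda>y. bind_pmf A (\<lambda>x. return_pmf (x, y)))"
    unfolding pair_pmf_def by (rule bind_commute_pmf)
  ultimately show ?thesis by (simp add: prob_bind_pmf)
qed

text \<open>Markov's inequality for the number of events that occur; it needs no independence, which
  matters in \<open>badprob_step\<close>.\<close>

lemma prob_count_markov:
  fixes u m :: nat
  assumes "0 < u"
  shows "measure_pmf.prob p {w. u \<le> card {i. i < m \<and> Q i w}} \<le> (\<Sum>i<m. measure_pmf.prob p {w. Q i w}) / u"
proof -
  have "measure_pmf.prob p {w. u \<le> card {i. i < m \<and> Q i w}} =
      measure_pmf.expectation p (indicator {w. u \<le> card {i. i < m \<and> Q i w}})" by simp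
  also have "\<dots> \<le> measure_pmf.expectation p (\<lambda>w. \<Sum>i<m. indicator {w. Q i w} w / u)"
  proof (rule expectation_mono_pmf[where B=1 and B'="m / u"])
    show "\<bar>\<Sum>i<m. indicator {w. Q i w} w / real u\<bar> \<le> real m / real u" for w
    proof -
      have "\<bar>\<Sum>i<m. indicator {w. Q i w} w / real u\<bar> \<le> (\<Sum>i<m. 1 / real u)"
        by (rule order.trans[OF sum_abs]) (intro sum_mono, auto simp: indicator_def divide_right_mono)
      then show ?thesis by simp
    qed
    show "indicator {w. u \<le> card {i. i < m \<and> Q i w}} w \<le> (\<Sum>i<m. indicator {w. Q i w} w / real u)" for w
    proof -
      have "(\<Sum>i<m. indicator {w. Q i w} w / real u) = (\<Sum>i<m. of_bool (Q i w)) / real u"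
        by (simp add: sum_divide_distrib[symmetric] indicator_def)
      also have "(\<Sum>i<m. of_bool (Q i w)) = real (card ({..<m} \<inter> {i. Q i w}))"
        by (subst sum_of_bool_eq) (auto simp: finite_lessThan)
      also have "{..<m} \<inter> {i. Q i w} = {i. i < m \<and> Q i w}" by auto
      finally show ?thesis using assms by (auto simp: indicator_def)
    qed
  qed (auto simp: indicator_def)
  also have "\<dots> = (\<Sum>i<m. measure_pmf.expectation p (\<lambda>w. indicator {w. Q i w} w / u))"
    by (intro Bochner_Integration.integral_sum integrable_pmf_bounded[where B="1 / u"])
      (auto simp: indicator_def)
  also have "\<dots> = (\<Sum>i<m. measure_pmf.prob p {w. Q i w}) / u"
    by (simp add: sum_divide_distrib)
  finally show ?thesis .
qed

lemma prob_replicate_Suc: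
  "measure_pmf.prob (replicate_pmf (Suc m) D) {xs. Q xs} =
     measure_pmf.expectation D (\<lambda>x. measure_pmf.prob (replicate_pmf m D) {xs. Q (x # xs)})"
proof -
  have "measure_pmf.prob (return_pmf (x # xs)) {xs. Q xs} = indicator {xs. Q (x # xs)} xs" for x xs
    by (simp add: indicator_def)
  then show ?thesis by (simp add: prob_bind_pmf)
qed

text \<open>This is Markov's inequality for 2 to the power of minus the count, whose expectation is
  \<open>(1 - p / 2) ^ m\<close>. Letting \<open>v\<close> vary in the induction on \<open>m\<close>
  proves both facts at once.\<close>

lemma chernoff_lower:
  fixes p :: real and D :: "'a pmf" and E :: "'a set"
  defines "p \<equiv> measure_pmf.prob D E"
  shows "measure_pmf.prob (replicate_pmf m D) {xs. length (filter (\<lambda>x. x \<in> E) xs) < v} \<le> 2 ^ v * (1 - p / 2) ^ m"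
proof (induction m arbitrary: v)
  case 0
  have "{xs. length (filter (\<lambda>x. x \<in> E) xs) < v} \<subseteq> UNIV" by simp
  then show ?case by (auto simp: indicator_def)
next
  case (Suc m)
  have p: "0 \<le> p" "p \<le> 1" by (auto simp: p_def)
  show ?case
  proof (cases v)
    case 0
    then show ?thesis using p by simp
  next
    case v: (Suc v')
    define b where "b = 2 ^ v * (1 - p / 2) ^ m"
    have b: "0 \<le> b" using p by (simp add: b_def)
    have b': "2 ^ v' * (1 - p / 2) ^ m = b / 2" unfolding b_def v power_Suc by simp
    note IH = Suc.IH[of v, folded b_def] Suc.IH[of v', unfolded b']
    have "measure_pmf.prob (replicate_pmf (Suc m) D) {xs. length (filter (\<lambda>x. x \<in> E) xs) < v} \<le>
        measure_pmf.expectation D (\<lambda>x. if x \<in> E then b / 2 else b)"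
      unfolding prob_replicate_Suc
    proof (rule expectation_mono_pmf[where B=1 and B'=b])
      fix x
      show "measure_pmf.prob (replicate_pmf m D) {xs. length (filter (\<lambda>x. x \<in> E) (x # xs)) < v} \<le>
          (if x \<in> E then b / 2 else b)"
        using IH by (cases "x \<in> E") (simp_all add: v)
    qed (use b in auto)
    also have "\<dots> = b * (1 - p / 2)" by (simp add: expectation_two_values p_def[symmetric] algebra_simps)
    finally show ?thesis by (simp add: b_def mult_ac)
  qed
qed

text \<open>As before, with 4 to the power of the count, of expectation
  \<open>(1 + 3 * p) ^ m\<close>. The base 4 leaves room in \<open>tail_param\<close>, where this
  expectation is only known to be at most \<open>2 ^ u\<close>.\<close>

lemma chernoff_upper:
  fixes p :: real and D :: "'a pmf" and E :: "'a set"
  defines "p \<equiv> measure_pmf.prob D E"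
  shows "measure_pmf.prob (replicate_pmf m D) {xs. v \<le> length (filter (\<lambda>x. x \<in> E) xs)} \<le> (1 / 4) ^ v * (1 + 3 * p) ^ m"
proof (induction m arbitrary: v)
  case 0
  then show ?case by (cases v) (auto simp: indicator_def)
next
  case (Suc m)
  have p: "0 \<le> p" "p \<le> 1" by (auto simp: p_def)
  show ?case
  proof (cases v)
    case 0
    have "1 \<le> (1 + 3 * p) ^ Suc m" using p by (intro one_le_power) simp
    then show ?thesis unfolding 0 by (intro order.trans[OF measure_pmf.prob_le_1]) (simp only: power_0 mult_1)
  next
    case v: (Suc v')
    define b where "b = (1 / 4) ^ v * (1 + 3 * p) ^ m"
    have b: "0 \<le> b" using p by (simp add: b_def)
    have b': "(1 / 4) ^ v' * (1 + 3 * p) ^ m = 4 * b" unfolding b_def v power_Suc by simp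
    note IH = Suc.IH[of v, folded b_def] Suc.IH[of v', unfolded b']
    have "measure_pmf.prob (replicate_pmf (Suc m) D) {xs. v \<le> length (filter (\<lambda>x. x \<in> E) xs)} \<le>
        measure_pmf.expectation D (\<lambda>x. if x \<in> E then 4 * b else b)"
      unfolding prob_replicate_Suc
    proof (rule expectation_mono_pmf[where B=1 and B'="4 * b"])
      fix x
      show "measure_pmf.prob (replicate_pmf m D) {xs. v \<le> length (filter (\<lambda>x. x \<in> E) (x # xs))} \<le>
          (if x \<in> E then 4 * b else b)"
        using IH by (cases "x \<in> E") (simp_all add: v)
    qed (use b in auto)
    also have "\<dots> = b * (1 + 3 * p)" by (simp add: expectation_two_values p_def[symmetric] algebra_simps)
    finally show ?thesis by (simp add: b_def mult_ac)
  qed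
qed

lemma map_nth_replicate_pmf: "i < m \<Longrightarrow> map_pmf (\<lambda>xs. xs ! i) (replicate_pmf m D) = D"
proof (induction m arbitrary: i)
  case (Suc m)
  show ?case
  proof (cases i)
    case 0
    then show ?thesis by (simp add: map_bind_pmf bind_return_pmf')
  next
    case (Suc j)
    have "map_pmf (\<lambda>xs. xs ! i) (replicate_pmf (Suc m) D) = map_pmf (\<lambda>xs. xs ! j) (replicate_pmf m D)"
      by (simp add: Suc map_pmf_def bind_assoc_pmf bind_return_pmf)
    then show ?thesis using Suc.IH[of j] Suc.prems Suc by simp
  qed
qed simp

section \<open>Tensor powers\<close>

text \<open>\<open>linear_code\<close> minus injectivity, a property that tensor products inherit
  directly. Injectivity of the composed code is obtained from systematicity, in
  \<open>Tp_code\<close>.\<close>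

definition linmap :: "nat ring \<Rightarrow> nat \<Rightarrow> nat \<Rightarrow> ((nat \<Rightarrow> nat) \<Rightarrow> (nat \<Rightarrow> nat)) \<Rightarrow> bool" where
  "linmap F k n C \<longleftrightarrow>
     C \<in> strings (carrier F) k \<rightarrow> strings (carrier F) n \<and>
     (\<forall>x\<in>strings (carrier F) k. \<forall>y\<in>strings (carrier F) k. \<forall>i<n.
        C (\<lambda>j\<in>{..<k}. x j \<oplus>\<^bsub>F\<^esub> y j) i = C x i \<oplus>\<^bsub>F\<^esub> C y i) \<and>
     (\<forall>a\<in>carrier F. \<forall>x\<in>strings (carrier F) k. \<forall>i<n.
        C (\<lambda>j\<in>{..<k}. a \<otimes>\<^bsub>F\<^esub> x j) i = a \<otimes>\<^bsub>F\<^esub> C x i)"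

lemma linear_code_linmap: "linear_code F k n C \<Longrightarrow> linmap F k n C"
  unfolding linear_code_def linmap_def is_code_def by (elim conjE, intro conjI)

lemma strings_mem: "x \<in> strings A n \<Longrightarrow> i < n \<Longrightarrow> x i \<in> A"
  by (auto simp: strings_def)

lemma strings_restrict: "(\<And>i. i < n \<Longrightarrow> f i \<in> A) \<Longrightarrow> (\<lambda>i\<in>{..<n}. f i) \<in> strings A n"
  by (auto simp: strings_def)

lemma strings_eqI: "x \<in> strings A n \<Longrightarrow> y \<in> strings A n \<Longrightarrow> (\<And>i. i < n \<Longrightarrow> x i = y i) \<Longrightarrow> x = y"
  unfolding strings_def by (rule PiE_ext) auto

lemma finite_strings: "finite A \<Longrightarrow> finite (strings A n)"
  by (auto simp: strings_def intro: finite_PiE)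

locale nat_field = field F for F :: "nat ring" (structure)
begin

lemma linmap_strings: "linmap F k n C \<Longrightarrow> x \<in> strings (carrier F) k \<Longrightarrow> C x \<in> strings (carrier F) n"
  unfolding linmap_def by (elim conjE, erule funcset_mem)

lemma linmap_mem:
  assumes "linmap F k n C" "x \<in> strings (carrier F) k" "i < n"
  shows "C x i \<in> carrier F"
  using strings_mem[OF linmap_strings[OF assms(1,2)] assms(3)] .

lemma linmap_add:
  assumes "linmap F k n C" "x \<in> strings (carrier F) k" "y \<in> strings (carrier F) k" "i < n"
  shows "C (\<lambda>j\<in>{..<k}. x j \<oplus> y j) i = C x i \<oplus> C y i"
  using assms(1)[unfolded linmap_def, THEN conjunct2, THEN conjunct1] assms(2-4) by blast

lemma linmap_scale:
  assumes "linmap F k n C" "a \<in> carrier F" "x \<in> strings (carrier F) k" "i < n"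
  shows "C (\<lambda>j\<in>{..<k}. a \<otimes> x j) i = a \<otimes> C x i"
  using assms(1)[unfolded linmap_def, THEN conjunct2, THEN conjunct2] assms(2-4) by blast

lemma gen_mat_closed:
  assumes "linmap F k n C" "i < n"
  shows "gen_mat F k C i p \<in> carrier F"
  unfolding gen_mat_def by (rule linmap_mem[OF assms(1) _ assms(2)]) (rule strings_restrict, auto)

lemma esum_closed:
  "(\<And>p. p < N \<Longrightarrow> g p \<in> carrier F) \<Longrightarrow> (\<And>p. p < N \<Longrightarrow> x p \<in> carrier F) \<Longrightarrow> esum F g x N \<in> carrier F"
  by (induction N) auto

lemma esum_eq_finsum:
  "(\<And>p. p < N \<Longrightarrow> g p \<in> carrier F) \<Longrightarrow> (\<And>p. p < N \<Longrightarrow> x p \<in> carrier F) \<Longrightarrow>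
   esum F g x N = (\<Oplus>p\<in>{..<N}. g p \<otimes> x p)"
proof (induction N)
  case (Suc N)
  have "(\<Oplus>p\<in>{..<Suc N}. g p \<otimes> x p) = g N \<otimes> x N \<oplus> (\<Oplus>p\<in>{..<N}. g p \<otimes> x p)"
    unfolding lessThan_Suc using Suc.prems by (subst finsum_insert) auto
  also have "(\<Oplus>p\<in>{..<N}. g p \<otimes> x p) = esum F g x N" using Suc by simp
  finally show ?case using Suc.prems esum_closed[of N g x] by (simp add: a_comm)
qed simp

text \<open>The message is built up from 0 by its truncations \<open>tr N\<close>, one scaled unit
  vector at a time. The right-hand side is the sum in the form in which the compiled program
  computes it, with guarded field operations.\<close>

lemma linmap_esum:
  assumes C: "linmap F k n C" and x: "x \<in> strings (carrier F) k" and i: "i < n"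
  shows "C x i = esum F (gen_mat F k C i) x k"
proof -
  define tr where "tr N = (\<lambda>j\<in>{..<k}. if j < N then x j else \<zero>)" for N
  have tr: "tr N \<in> strings (carrier F) k" for N
    unfolding tr_def by (rule strings_restrict) (auto intro: strings_mem[OF x])
  have unit: "(\<lambda>j\<in>{..<k}. if j = p then \<one> else \<zero>) \<in> strings (carrier F) k" for p
    by (rule strings_restrict) auto
  have "N \<le> k \<Longrightarrow> C (tr N) i = esum F (gen_mat F k C i) x N" for N
  proof (induction N)
    case 0
    have "C (\<lambda>j\<in>{..<k}. \<zero> \<otimes> x j) i = \<zero> \<otimes> C x i" by (rule linmap_scale[OF C _ x i]) simp
    moreover have "(\<lambda>j\<in>{..<k}. \<zero> \<otimes> x j) = tr 0"
      by (auto simp: tr_def fun_eq_iff strings_mem[OF x])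
    ultimately show ?case using linmap_mem[OF C x i] by simp
  next
    case (Suc N)
    define e where "e = (\<lambda>j\<in>{..<k}. if j = N then \<one> else \<zero>)"
    have e: "e \<in> strings (carrier F) k" unfolding e_def by (rule unit)
    have xN: "x N \<in> carrier F" using strings_mem[OF x] Suc.prems by simp
    define e' where "e' = (\<lambda>j\<in>{..<k}. x N \<otimes> e j)"
    have e': "e' \<in> strings (carrier F) k"
      unfolding e'_def using xN strings_mem[OF e] by (intro strings_restrict) auto
    have trS: "tr (Suc N) = (\<lambda>j\<in>{..<k}. tr N j \<oplus> e' j)"
      using xN strings_mem[OF x] by (auto simp: tr_def e'_def e_def fun_eq_iff less_Suc_eq)
    have "C (tr (Suc N)) i = C (tr N) i \<oplus> C e' i"
      unfolding trS by (rule linmap_add[OF C tr e' i])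
    also have "C e' i = x N \<otimes> C e i"
      unfolding e'_def by (rule linmap_scale[OF C xN e i])
    also have "C e i = gen_mat F k C i N" by (simp add: gen_mat_def e_def)
    finally have eq: "C (tr (Suc N)) i = C (tr N) i \<oplus> x N \<otimes> gen_mat F k C i N" .
    have ec: "esum F (gen_mat F k C i) x N \<in> carrier F"
      using gen_mat_closed[OF C i] strings_mem[OF x] Suc.prems by (intro esum_closed) auto
    show ?case
      unfolding eq using Suc xN gen_mat_closed[OF C i] ec by (simp add: m_comm)
  qed
  from this[of k] have "C (tr k) i = esum F (gen_mat F k C i) x k" by simp
  moreover have "tr k = x"
    using x by (intro strings_eqI[OF tr x]) (auto simp: tr_def)
  ultimately show ?thesis by simp
qed

lemma finsum_swap:
  fixes f :: "nat \<Rightarrow> nat \<Rightarrow> nat"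
  assumes "\<And>p q. p < N \<Longrightarrow> q < M \<Longrightarrow> f p q \<in> carrier F"
  shows "(\<Oplus>p\<in>{..<N}. \<Oplus>q\<in>{..<M}. f p q) = (\<Oplus>q\<in>{..<M}. \<Oplus>p\<in>{..<N}. f p q)"
  using assms
proof (induction N)
  case 0
  then show ?case by (simp add: add.finprod_one)
next
  case (Suc N)
  have "(\<Oplus>p\<in>{..<Suc N}. \<Oplus>q\<in>{..<M}. f p q) = (\<Oplus>q\<in>{..<M}. f N q) \<oplus> (\<Oplus>q\<in>{..<M}. \<Oplus>p\<in>{..<N}. f p q)"
    unfolding lessThan_Suc using Suc by (subst finsum_insert) auto
  also have "\<dots> = (\<Oplus>q\<in>{..<M}. f N q \<oplus> (\<Oplus>p\<in>{..<N}. f p q))"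
    using Suc.prems by (subst finsum_addf) auto
  also have "\<dots> = (\<Oplus>q\<in>{..<M}. \<Oplus>p\<in>{..<Suc N}. f p q)"
  proof (rule finsum_cong')
    show "f N q \<oplus> (\<Oplus>p\<in>{..<N}. f p q) = (\<Oplus>p\<in>{..<Suc N}. f p q)" if "q \<in> {..<M}" for q
      unfolding lessThan_Suc using that Suc.prems by (subst finsum_insert) auto
  qed (use Suc.prems in auto)
  finally show ?case .
qed

end

text \<open>Row \<open>a\<close> of the product of the generating matrix of \<open>C\<close> with
  \<open>M\<close>, before the second factor of the tensor product is applied.\<close>

definition nrow :: "nat \<Rightarrow> ((nat \<Rightarrow> nat) \<Rightarrow> (nat \<Rightarrow> nat)) \<Rightarrow> nat \<Rightarrow> (nat \<Rightarrow> nat) \<Rightarrow> nat \<Rightarrow> (nat \<Rightarrow> nat)" where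
  "nrow k C K M a = (\<lambda>q\<in>{..<K}. C (\<lambda>p\<in>{..<k}. M (p * K + q)) a)"

lemma slice_strings:
  assumes "M \<in> strings A (k * K)" "q < K"
  shows "(\<lambda>p\<in>{..<k}. M (p * K + q)) \<in> strings A k"
proof (rule strings_restrict)
  fix p assume "p < k"
  then have "p * K + q < Suc p * K" using assms(2) by simp
  also have "\<dots> \<le> k * K" using \<open>p < k\<close> by (intro mult_le_mono1) simp
  finally show "M (p * K + q) \<in> A" by (rule strings_mem[OF assms(1)])
qed

lemma (in nat_field) nrow_strings:
  assumes "linmap F k n C" "M \<in> strings (carrier F) (k * K)" "a < n"
  shows "nrow k C K M a \<in> strings (carrier F) K"
  unfolding nrow_def by (rule strings_restrict) (rule linmap_mem[OF assms(1) slice_strings[OF assms(2)] assms(3)])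

text \<open>Exchanging the two sums turns row \<open>a\<close> of \<open>G1 M G2^T\<close> into the
  encoding by \<open>T\<close> of row \<open>a\<close> of \<open>G1 M\<close>.\<close>

lemma (in nat_field) tensor_code_row:
  assumes C: "linmap F k n C" and T: "linmap F K N T" and M: "M \<in> strings (carrier F) (k * K)"
    and a: "a < n" and b: "b < N"
  shows "tensor_code F k n C K N T M (a * N + b) = T (nrow k C K M a) b"
proof -
  let ?G = "gen_mat F k C a" and ?H = "gen_mat F K T b"
  have lt: "a * N + b < n * N"
  proof -
    have "a * N + b < Suc a * N" using b by simp
    also have "\<dots> \<le> n * N" using a by (intro mult_le_mono1) simp
    finally show ?thesis .
  qed
  have G: "?G p \<in> carrier F" and H: "?H q \<in> carrier F" for p q
    using gen_mat_closed C T a b by auto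
  have Mc: "M (p * K + q) \<in> carrier F" if "p < k" "q < K" for p q
    using strings_mem[OF slice_strings[OF M that(2)] that(1)] that by simp
  have "tensor_code F k n C K N T M (a * N + b) =
      (\<Oplus>p\<in>{..<k}. \<Oplus>q\<in>{..<K}. ?G p \<otimes> M (p * K + q) \<otimes> ?H q)"
    using lt b by (simp add: tensor_code_def)
  also have "\<dots> = (\<Oplus>q\<in>{..<K}. \<Oplus>p\<in>{..<k}. ?G p \<otimes> M (p * K + q) \<otimes> ?H q)"
    using G H Mc by (intro finsum_swap) auto
  also have "\<dots> = (\<Oplus>q\<in>{..<K}. ?H q \<otimes> nrow k C K M a q)"
  proof (rule finsum_cong')
    fix q assume q: "q \<in> {..<K}"
    define x where "x = (\<lambda>p\<in>{..<k}. M (p * K + q))"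
    have x: "x \<in> strings (carrier F) k" unfolding x_def using q by (intro slice_strings[OF M]) auto
    have "nrow k C K M a q = (\<Oplus>p\<in>{..<k}. ?G p \<otimes> x p)"
      using q linmap_esum[OF C x a] G strings_mem[OF x]
      by (simp add: nrow_def x_def[symmetric] esum_eq_finsum)
    also have "\<dots> = (\<Oplus>p\<in>{..<k}. ?G p \<otimes> M (p * K + q))"
      using G Mc q by (intro finsum_cong') (auto simp: x_def)
    finally have n: "nrow k C K M a q = (\<Oplus>p\<in>{..<k}. ?G p \<otimes> M (p * K + q))" .
    show "(\<Oplus>p\<in>{..<k}. ?G p \<otimes> M (p * K + q) \<otimes> ?H q) = ?H q \<otimes> nrow k C K M a q"
      unfolding n using G H Mc q
      by (subst finsum_ldistr[symmetric]) (auto simp: m_comm)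
  qed (use H strings_mem[OF nrow_strings[OF C M a]] in auto)
  also have "\<dots> = T (nrow k C K M a) b"
    using linmap_esum[OF T nrow_strings[OF C M a] b] H strings_mem[OF nrow_strings[OF C M a]]
    by (simp add: esum_eq_finsum)
  finally show ?thesis .
qed

lemma (in nat_field) linmap_tensor_code:
  assumes C: "linmap F k n C" and T: "linmap F K N T"
  shows "linmap F (k * K) (n * N) (tensor_code F k n C K N T)"
proof -
  let ?T = "tensor_code F k n C K N T"
  have idx: "r div N < n" "r mod N < N" "r = r div N * N + r mod N" if "r < n * N" for r
    using that by (auto simp: less_mult_imp_div_less) (metis gr0I mod_less_divisor mult_0_right not_less0)
  have row: "?T M r = T (nrow k C K M (r div N)) (r mod N)"
    if "M \<in> strings (carrier F) (k * K)" "r < n * N" for M r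
    using tensor_code_row[OF C T that(1) idx(1,2)[OF that(2)]] idx(3)[OF that(2)] by simp
  have lt: "p * K + q < k * K" if "p < k" "q < K" for p q
  proof -
    have "p * K + q < Suc p * K" using that by simp
    also have "\<dots> \<le> k * K" using that by (intro mult_le_mono1) simp
    finally show ?thesis .
  qed
  show ?thesis
    unfolding linmap_def
  proof (intro conjI ballI allI impI funcsetI)
    fix M assume M: "M \<in> strings (carrier F) (k * K)"
    have "?T M r \<in> carrier F" if "r < n * N" for r
      using row[OF M that] linmap_mem[OF T nrow_strings[OF C M idx(1)[OF that]] idx(2)[OF that]] by simp
    moreover have "?T M = (\<lambda>r\<in>{..<n * N}. ?T M r)" by (auto simp: tensor_code_def fun_eq_iff)
    ultimately show "?T M \<in> strings (carrier F) (n * N)"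
      by (metis strings_restrict)
  next
    fix x y r assume x: "x \<in> strings (carrier F) (k * K)" and y: "y \<in> strings (carrier F) (k * K)"
      and r: "r < n * N"
    define xy where "xy = (\<lambda>j\<in>{..<k * K}. x j \<oplus> y j)"
    have xy: "xy \<in> strings (carrier F) (k * K)"
      unfolding xy_def using strings_mem[OF x] strings_mem[OF y] by (intro strings_restrict) auto
    have "nrow k C K xy a = (\<lambda>j\<in>{..<K}. nrow k C K x a j \<oplus> nrow k C K y a j)" if "a < n" for a
    proof
      fix q
      have "(\<lambda>p\<in>{..<k}. xy (p * K + q)) =
          (\<lambda>p\<in>{..<k}. (\<lambda>p\<in>{..<k}. x (p * K + q)) p \<oplus> (\<lambda>p\<in>{..<k}. y (p * K + q)) p)" if "q < K"
        using lt that by (auto simp: xy_def fun_eq_iff)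
      then show "nrow k C K xy a q = (\<lambda>j\<in>{..<K}. nrow k C K x a j \<oplus> nrow k C K y a j) q"
        using linmap_add[OF C slice_strings[OF x] slice_strings[OF y] that]
        by (cases "q < K") (simp_all add: nrow_def)
    qed
    then show "?T (\<lambda>j\<in>{..<k * K}. x j \<oplus> y j) r = ?T x r \<oplus> ?T y r"
      using row[OF xy r] row[OF x r] row[OF y r] idx(1)[OF r]
        linmap_add[OF T nrow_strings[OF C x idx(1)[OF r]] nrow_strings[OF C y idx(1)[OF r]] idx(2)[OF r]]
      unfolding xy_def[symmetric] by simp
  next
    fix c x r assume c: "c \<in> carrier F" and x: "x \<in> strings (carrier F) (k * K)" and r: "r < n * N"
    define cx where "cx = (\<lambda>j\<in>{..<k * K}. c \<otimes> x j)"
    have cx: "cx \<in> strings (carrier F) (k * K)"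
      unfolding cx_def using strings_mem[OF x] c by (intro strings_restrict) auto
    have "nrow k C K cx a = (\<lambda>j\<in>{..<K}. c \<otimes> nrow k C K x a j)" if "a < n" for a
    proof
      fix q
      have "(\<lambda>p\<in>{..<k}. cx (p * K + q)) = (\<lambda>p\<in>{..<k}. c \<otimes> (\<lambda>p\<in>{..<k}. x (p * K + q)) p)" if "q < K"
        using lt that by (auto simp: cx_def fun_eq_iff)
      then show "nrow k C K cx a q = (\<lambda>j\<in>{..<K}. c \<otimes> nrow k C K x a j) q"
        using linmap_scale[OF C c slice_strings[OF x] that] by (cases "q < K") (simp_all add: nrow_def)
    qed
    then show "?T (\<lambda>j\<in>{..<k * K}. c \<otimes> x j) r = c \<otimes> ?T x r"
      using row[OF cx r] row[OF x r] idx(1)[OF r]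
        linmap_scale[OF T c nrow_strings[OF C x idx(1)[OF r]] idx(2)[OF r]]
      unfolding cx_def[symmetric] by simp
  qed
qed

lemma (in nat_field) linmap_tensor_pow:
  assumes "linmap F k n C" "0 < s"
  shows "linmap F (k ^ s) (n ^ s) (tensor_pow F k n C s)"
  using assms(2)
proof (induction s rule: induct_nat_012)
  case (ge2 s)
  then show ?case using linmap_tensor_code[OF assms(1) ge2(2)] by simp
qed (use assms in auto)

section \<open>The decoder\<close>

lemma mod_power_Suc: "y mod k ^ Suc s = (y div k ^ s mod k) * k ^ s + y mod k ^ s" for y k :: nat
  by (simp only: power_Suc mult.commute[of k] mod_mult2_eq) (simp add: mult.commute)

lemma conv_inj: "0 < k \<Longrightarrow> k \<le> n \<Longrightarrow> inj_on (conv k n s) {..<k ^ s}"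
proof (induction s)
  case (Suc s)
  show ?case
  proof (rule inj_onI)
    fix y y' assume y: "y \<in> {..<k ^ Suc s}" "y' \<in> {..<k ^ Suc s}" and eq: "conv k n (Suc s) y = conv k n (Suc s) y'"
    have pos: "0 < n ^ s" using Suc.prems by simp
    have lt: "conv k n s x < n ^ s" for x by (rule conv_less[OF Suc.prems])
    have "conv k n (Suc s) x div n ^ s = x div k ^ s mod k" "conv k n (Suc s) x mod n ^ s = conv k n s x" for x
      using lt[of x] pos by (simp_all add: conv_Suc)
    then have d: "y div k ^ s mod k = y' div k ^ s mod k" and c: "conv k n s y = conv k n s y'"
      using eq by metis+
    have "conv k n s (y mod k ^ s) = conv k n s (y' mod k ^ s)" using c by (simp add: conv_mod)
    then have "y mod k ^ s = y' mod k ^ s"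
      using Suc.IH[OF Suc.prems] Suc.prems by (auto dest!: inj_onD)
    then have "y mod k ^ Suc s = y' mod k ^ Suc s" using d by (simp only: mod_power_Suc)
    then show "y = y'" using y by simp
  qed
qed (auto simp: inj_on_def)

lemma div_mult_add_less: "b < N \<Longrightarrow> (a * N + b) div N = (a :: nat)"
  by (rule div_nat_eqI) auto

lemma fold_unique:
  assumes "x0 \<in> set xs" "P x0" "\<And>x. x \<in> set xs \<Longrightarrow> P x \<Longrightarrow> x = x0"
  shows "fold (\<lambda>x acc. if P x then g x else acc) xs d = g x0"
  using assms
proof (induction xs rule: rev_induct)
  case (snoc x xs)
  show ?case
  proof (cases "P x")
    case True
    then have "x = x0" by (intro snoc.prems(3)) auto
    then show ?thesis using True by simp
  next
    case False
    have "x0 \<in> set xs" using snoc.prems(1,2) False by auto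
    moreover have "y = x0" if "y \<in> set xs" "P y" for y using that by (intro snoc.prems(3)) auto
    ultimately have "fold (\<lambda>x acc. if P x then g x else acc) xs d = g x0"
      using snoc.prems(2) by (intro snoc.IH)
    then show ?thesis using False by simp
  qed
qed simp

section \<open>Correctness of the decoder for right advice and good samples\<close>

definition zone :: "nat set \<Rightarrow> nat \<Rightarrow> (nat \<Rightarrow> nat set) \<Rightarrow> nat \<Rightarrow> nat \<Rightarrow> bool" where
  "zone A l S z N \<longleftrightarrow> (\<forall>r<N. S (z + r) \<subseteq> A \<and> card (S (z + r)) = l)"

definition col :: "nat \<Rightarrow> nat \<Rightarrow> (nat \<Rightarrow> nat) \<Rightarrow> nat \<Rightarrow> (nat \<Rightarrow> nat)" where
  "col k s M y = (\<lambda>p\<in>{..<k}. M (p * k ^ s + y mod k ^ s))"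

locale decoder = nat_field F for F :: "nat ring" (structure) +
  fixes k n l m \<theta> L :: nat and C :: "(nat \<Rightarrow> nat) \<Rightarrow> (nat \<Rightarrow> nat)" and \<alpha> :: real
    and lst :: "(nat \<Rightarrow> nat set) \<Rightarrow> nat list list"
  assumes finF: "finite (carrier F)" and lin: "linear_code F k n C" and sys: "systematic (carrier F) k n C"
    and k: "0 < k"
    and lst: "\<And>f. f \<in> list_strings (carrier F) l n \<Longrightarrow>
      set (lst f) = (\<lambda>x. map x [0..<k]) ` close_messages (carrier F) k n C \<alpha> f"
    and len: "\<And>f. f \<in> list_strings (carrier F) l n \<Longrightarrow> length (lst f) \<le> L"
begin

lemma kn: "k \<le> n" using sys by (simp add: systematic_def)

lemma npos: "0 < n" using k kn by simp

lemma C_lin: "linmap F k n C" by (rule linear_code_linmap[OF lin])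

abbreviation "G \<equiv> gen_mat F k C"
abbreviation "Tp s \<equiv> tensor_pow F k n C s"
abbreviation "nr s M a \<equiv> nrow k C (k ^ Suc s) M a"

lemma Tp_lin: "0 < s \<Longrightarrow> linmap F (k ^ s) (n ^ s) (Tp s)"
  by (rule linmap_tensor_pow[OF C_lin])

lemma nr_strings:
  assumes "M \<in> strings (carrier F) (k ^ Suc (Suc s))" "a < n"
  shows "nr s M a \<in> strings (carrier F) (k ^ Suc s)"
  by (rule nrow_strings[OF C_lin _ assms(2)]) (use assms(1) in simp)

lemma Tp_row:
  assumes "M \<in> strings (carrier F) (k ^ Suc (Suc s))" "a < n" "b < n ^ Suc s"
  shows "Tp (Suc (Suc s)) M (a * n ^ Suc s + b) = Tp (Suc s) (nr s M a) b"
  unfolding tensor_pow.simps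
  by (rule tensor_code_row[OF C_lin Tp_lin _ assms(2,3)]) (use assms(1) in simp_all)

lemma col_strings: "M \<in> strings (carrier F) (k ^ Suc s) \<Longrightarrow> col k s M y \<in> strings (carrier F) k"
  unfolding col_def using k by (intro slice_strings) auto

text \<open>Systematicity passes to tensor powers: at a systematic top digit, the row of the product
  matrix is a row of \<open>M\<close> itself.\<close>

lemma Tp_conv:
  assumes "M \<in> strings (carrier F) (k ^ s)" "0 < s"
  shows "Tp s M (conv k n s y) = M (y mod k ^ s)"
  using assms(2,1)
proof (induction s arbitrary: M y rule: induct_nat_012)
  case 1
  have "conv k n 1 y = y mod k" by (simp add: conv_def)
  then show ?case using 1 sys k by (simp add: systematic_def)
next
  case (ge2 s)
  let ?K = "k ^ Suc s" and ?a = "y div k ^ Suc s mod k"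
  have a: "?a < k" "?a < n" using k kn by (auto intro: order_less_le_trans[of _ k])
  have "Tp (Suc (Suc s)) M (conv k n (Suc (Suc s)) y) = Tp (Suc s) (nr s M ?a) (conv k n (Suc s) y)"
    unfolding conv_Suc[of k n "Suc s"] add.commute[of "conv k n (Suc s) y"]
    by (rule Tp_row[OF ge2.prems(2) a(2) conv_less[OF k kn]])
  also have "\<dots> = nr s M ?a (y mod ?K)"
    by (rule ge2.IH(2)) (use nr_strings[OF ge2.prems(2) a(2)] in auto)
  also have "\<dots> = C (col k (Suc s) M y) ?a" using k by (simp add: nrow_def col_def)
  also have "\<dots> = col k (Suc s) M y ?a"
    using sys a(1) col_strings[OF ge2.prems(2)] by (simp add: systematic_def)
  also have "\<dots> = M (y mod k ^ Suc (Suc s))" using a(1) by (simp only: col_def mod_power_Suc) simp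
  finally show ?case .
qed simp

text \<open>Row \<open>p\<close> is a codeword of the lower power. Reading it at a systematic
  position gives an entry of its message, which is symbol \<open>p\<close> of an encoded column; so
  the fibers through systematic positions are codewords of \<open>C\<close>.\<close>

lemma Tp_col:
  assumes M: "M \<in> strings (carrier F) (k ^ Suc s)" and p: "p < n"
  shows "Tp (Suc s) M (p * n ^ s + conv k n s y) = C (col k s M y) p"
proof (cases s)
  case 0
  have "col k 0 M y = M"
    using M by (intro strings_eqI[OF col_strings[of M 0]]) (auto simp: col_def 0)
  then show ?thesis by (simp add: 0 conv_def)
next
  case (Suc s')
  have "Tp (Suc s) M (p * n ^ s + conv k n s y) = Tp (Suc s') (nr s' M p) (conv k n (Suc s') y)"
    unfolding Suc by (rule Tp_row[OF _ p conv_less[OF k kn]]) (use M Suc in simp)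
  also have "\<dots> = nr s' M p (y mod k ^ Suc s')"
    by (rule Tp_conv) (use nr_strings[OF _ p] M Suc in simp_all)
  also have "\<dots> = C (col k s M y) p" using k by (simp add: nrow_def col_def Suc)
  finally show ?thesis .
qed

definition clo :: "(nat \<Rightarrow> nat set) \<Rightarrow> nat \<Rightarrow> nat \<Rightarrow> (nat \<Rightarrow> nat) \<Rightarrow> nat \<Rightarrow> bool" where
  "clo S s z M y \<longleftrightarrow> list_dist n (C (col k s M y)) (fib k n S (Suc s) z y) \<le> \<alpha>"

text \<open>Twice the threshold of \<open>pick\<close>: fewer than \<open>\<theta>\<close> wrong
  recursive values then leave the right column below \<open>\<theta>\<close> mismatches and every
  competitor at \<open>\<theta>\<close> or more.\<close>

definition sep :: "(nat \<Rightarrow> nat) \<Rightarrow> (nat \<Rightarrow> nat set) \<Rightarrow> (nat \<Rightarrow> nat) \<Rightarrow> bool" where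
  "sep R f x0 \<longleftrightarrow> (\<forall>x\<in>close_messages (carrier F) k n C \<alpha> f. x \<noteq> x0 \<longrightarrow>
     2 * \<theta> \<le> card {i. i < m \<and> C x (R i) \<noteq> C x0 (R i)})"

text \<open>The event that the decoder may fail at \<open>y\<close> although the advice is right. It does not depend on
  the advice.\<close>

fun bad :: "(nat \<Rightarrow> nat set) \<Rightarrow> nat \<Rightarrow> (nat \<Rightarrow> nat) \<Rightarrow> nat \<Rightarrow> (nat \<Rightarrow> nat) \<Rightarrow> nat \<Rightarrow> bool" where
  "bad S 0 rs z M y = False"
| "bad S (Suc 0) rs z M y = (\<not> clo S 0 z M y)"
| "bad S (Suc (Suc s)) rs z M y =
     (\<not> clo S (Suc s) z M y \<or>
      \<not> sep (\<lambda>i. rs (s * m + i)) (fib k n S (Suc (Suc s)) z y) (col k (Suc s) M y) \<or>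
      \<theta> \<le> card {i. i < m \<and> bad S (Suc s) rs (z + rs (s * m + i) * n ^ Suc s) (nr s M (rs (s * m + i))) y})"

text \<open>At a leaf the fiber is the whole one-dimensional block, the same for all
  \<open>y\<close>, so 0 stands for any position. This is why one index per leaf serves every
  position of the message at once.\<close>

fun good :: "(nat \<Rightarrow> nat set) \<Rightarrow> (nat \<Rightarrow> nat) \<Rightarrow> nat \<Rightarrow> (nat \<Rightarrow> nat) \<Rightarrow> nat \<Rightarrow> nat \<Rightarrow> (nat \<Rightarrow> nat) \<Rightarrow> bool" where
  "good S J 0 rs off z M = True"
| "good S J (Suc 0) rs off z M = (clo S 0 z M 0 \<longrightarrow>
     J off < length (lst (fib k n S 1 z 0)) \<and> lst (fib k n S 1 z 0) ! J off = map M [0..<k])"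
| "good S J (Suc (Suc s)) rs off z M = (\<forall>i<m. good S J (Suc s) rs (off + i * m ^ s)
     (z + rs (s * m + i) * n ^ Suc s) (nr s M (rs (s * m + i))))"

lemma fib_list_strings:
  assumes "zone (carrier F) l S z (n ^ Suc s)"
  shows "fib k n S (Suc s) z y \<in> list_strings (carrier F) l n"
proof -
  have "conv k n s y + p * n ^ s < n ^ Suc s" if "p < n" for p
  proof -
    have "conv k n s y + p * n ^ s < Suc p * n ^ s" using conv_less[OF k kn, of s y] by simp
    also have "\<dots> \<le> n * n ^ s" using that by (intro mult_le_mono1) simp
    finally show ?thesis by simp
  qed
  then show ?thesis
    using assms unfolding list_strings_def fib_def zone_def by (auto simp: add.assoc)
qed

lemma zone_sub:
  assumes "zone A l S z (n ^ Suc (Suc s))" "a < n"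
  shows "zone A l S (z + a * n ^ Suc s) (n ^ Suc s)"
  unfolding zone_def
proof (intro allI impI)
  fix r assume "r < n ^ Suc s"
  then have "a * n ^ Suc s + r < Suc a * n ^ Suc s" by simp
  also have "\<dots> \<le> n * n ^ Suc s" using assms(2) by (intro mult_le_mono1) simp
  finally have "a * n ^ Suc s + r < n ^ Suc (Suc s)" by simp
  then show "S (z + a * n ^ Suc s + r) \<subseteq> A \<and> card (S (z + a * n ^ Suc s + r)) = l"
    using assms(1) by (simp add: zone_def add.assoc)
qed

lemma mismatches_eq:
  assumes "x \<in> strings (carrier F) k" "\<And>i. i < m \<Longrightarrow> R i < n"
  shows "mismatches F G k m R v (map x [0..<k]) = card {i. i < m \<and> C x (R i) \<noteq> v i}"
proof -
  have "esum F (G (R i)) (\<lambda>p. map x [0..<k] ! p) k = C x (R i)" if "i < m" for i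
    unfolding linmap_esum[OF C_lin assms(1) assms(2)[OF that]] by (intro esum_cong) simp
  then show ?thesis unfolding mismatches_def by (metis (lifting))
qed

lemma map_inj: "x \<in> strings A k \<Longrightarrow> x' \<in> strings A k \<Longrightarrow> map x [0..<k] = map x' [0..<k] \<Longrightarrow> x = x'"
  by (intro strings_eqI) auto

lemma dec_correct:
  assumes "0 < s" "zone (carrier F) l S z (n ^ s)" "M \<in> strings (carrier F) (k ^ s)"
    "\<And>e. e < (s - 1) * m \<Longrightarrow> rs e < n" "good S J s rs off z M" "\<not> bad S s rs z M y"
  shows "dec F G k n m \<theta> lst rs J S s off z y = M (y mod k ^ s)"
  using assms
proof (induction s arbitrary: z M off rule: induct_nat_012)
  case 1
  have M: "M \<in> strings (carrier F) (k ^ Suc 0)" using 1 by simp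
  have f: "fib k n S (Suc 0) z y = fib k n S (Suc 0) z 0" "clo S 0 z M y = clo S 0 z M 0"
    by (simp_all add: fib_def conv_def clo_def col_def)
  show ?case using 1(5,6) k by (simp add: f Let_def)
next
  case (ge2 s)
  define R where "R i = rs (s * m + i)" for i
  define f where "f = fib k n S (Suc (Suc s)) z y"
  define x0 where "x0 = col k (Suc s) M y"
  define v where "v i = dec F G k n m \<theta> lst rs J S (Suc s) (off + i * m ^ s) (z + R i * n ^ Suc s) y" for i
  define B where "B = {i. i < m \<and> bad S (Suc s) rs (z + R i * n ^ Suc s) (nr s M (R i)) y}"
  have R: "R i < n" if "i < m" for i
    using ge2.prems(4)[of "s * m + i"] that by (simp add: R_def)
  have x0: "x0 \<in> strings (carrier F) k" unfolding x0_def by (rule col_strings[OF ge2.prems(3)])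
  have f: "f \<in> list_strings (carrier F) l n" unfolding f_def by (rule fib_list_strings[OF ge2.prems(2)])
  have clo: "x0 \<in> close_messages (carrier F) k n C \<alpha> f" and sep: "sep R f x0" and B: "card B < \<theta>"
    using ge2.prems(6) x0 by (simp_all add: clo_def close_messages_def x0_def f_def R_def[abs_def] B_def not_le)
  have v: "v i = C x0 (R i)" if i: "i < m" "i \<notin> B" for i
  proof -
    have "v i = nr s M (R i) (y mod k ^ Suc s)"
      unfolding v_def
    proof (rule ge2.IH(2))
      show "zone (carrier F) l S (z + R i * n ^ Suc s) (n ^ Suc s)" by (rule zone_sub[OF ge2.prems(2) R[OF i(1)]])
      show "nr s M (R i) \<in> strings (carrier F) (k ^ Suc s)" by (rule nr_strings[OF ge2.prems(3) R[OF i(1)]])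
      show "rs e < n" if "e < (Suc s - 1) * m" for e using that by (intro ge2.prems(4)) simp
      show "good S J (Suc s) rs (off + i * m ^ s) (z + R i * n ^ Suc s) (nr s M (R i))"
        using ge2.prems(5) i(1) by (simp add: R_def)
      show "\<not> bad S (Suc s) rs (z + R i * n ^ Suc s) (nr s M (R i)) y" using i by (simp add: B_def)
    qed simp
    then show ?thesis using k by (simp add: nrow_def x0_def col_def)
  qed
  have finB: "finite B" by (simp add: B_def)
  have "{i. i < m \<and> C x0 (R i) \<noteq> v i} \<subseteq> B"
  proof
    fix i assume "i \<in> {i. i < m \<and> C x0 (R i) \<noteq> v i}"
    then show "i \<in> B" using v[of i] by (cases "i \<in> B") auto
  qed
  then have m0: "card {i. i < m \<and> C x0 (R i) \<noteq> v i} < \<theta>"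
    using B by (meson card_mono[OF finB] le_less_trans)
  have mx: "\<not> card {i. i < m \<and> C x (R i) \<noteq> v i} < \<theta>"
    if x: "x \<in> close_messages (carrier F) k n C \<alpha> f" "x \<noteq> x0" for x
  proof -
    \<comment> \<open>The triangle inequality: a row that separates \<open>x\<close> from
      \<open>x0\<close> is a mismatch of \<open>x\<close>, or its value \<open>v i\<close> is
      wrong.\<close>
    have "{i. i < m \<and> C x (R i) \<noteq> C x0 (R i)} \<subseteq> {i. i < m \<and> C x (R i) \<noteq> v i} \<union> B"
    proof
      fix i assume "i \<in> {i. i < m \<and> C x (R i) \<noteq> C x0 (R i)}"
      then show "i \<in> {i. i < m \<and> C x (R i) \<noteq> v i} \<union> B" using v[of i] by (cases "i \<in> B") auto
    qed
    then have "card {i. i < m \<and> C x (R i) \<noteq> C x0 (R i)} \<le> card ({i. i < m \<and> C x (R i) \<noteq> v i} \<union> B)"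
      using finB by (intro card_mono) auto
    also have "\<dots> \<le> card {i. i < m \<and> C x (R i) \<noteq> v i} + card B" by (rule card_Un_le)
    finally have "card {i. i < m \<and> C x (R i) \<noteq> C x0 (R i)} \<le> card {i. i < m \<and> C x (R i) \<noteq> v i} + card B" .
    moreover have "2 * \<theta> \<le> card {i. i < m \<and> C x (R i) \<noteq> C x0 (R i)}"
      using sep x unfolding sep_def by blast
    ultimately show ?thesis using B by linarith
  qed
  have "pick F G k m \<theta> (lst f) R v (y div k ^ Suc s mod k) = map x0 [0..<k] ! (y div k ^ Suc s mod k)"
    unfolding pick_def
  proof (rule fold_unique)
    show "map x0 [0..<k] \<in> set (lst f)" using lst[OF f] clo by blast
    show "mismatches F G k m R v (map x0 [0..<k]) < \<theta>" using m0 by (simp add: mismatches_eq[OF x0 R])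
    fix xl assume "xl \<in> set (lst f)" and lt: "mismatches F G k m R v xl < \<theta>"
    then obtain x where x: "x \<in> close_messages (carrier F) k n C \<alpha> f" "xl = map x [0..<k]" using lst[OF f] by blast
    then have "x \<in> strings (carrier F) k" by (simp add: close_messages_def)
    then have "x = x0" using lt mx[OF x(1)] by (auto simp: x(2) mismatches_eq[OF _ R])
    then show "xl = map x0 [0..<k]" using x(2) by simp
  qed
  moreover have "y div k ^ Suc s mod k < k" using k by simp
  ultimately have "pick F G k m \<theta> (lst f) R v (y div k ^ Suc s mod k) = M (y mod k ^ Suc (Suc s))"
    by (simp only: x0_def col_def mod_power_Suc[of y k "Suc s"]) simp
  then show ?case by (simp add: f_def R_def[abs_def] v_def[abs_def])
qed simp

lemma good_cong:
  "(\<And>j. off \<le> j \<Longrightarrow> j < off + m ^ (s - 1) \<Longrightarrow> J j = J' j) \<Longrightarrow> good S J s rs off z M = good S J' s rs off z M"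
proof (induction s arbitrary: off z M rule: induct_nat_012)
  case (ge2 s)
  have "good S J (Suc s) rs (off + i * m ^ s) z' M' = good S J' (Suc s) rs (off + i * m ^ s) z' M'"
    if "i < m" for i z' M'
  proof (rule ge2.IH(2))
    fix j assume j: "off + i * m ^ s \<le> j" "j < off + i * m ^ s + m ^ (Suc s - 1)"
    have "i * m ^ s + m ^ s = Suc i * m ^ s" by simp
    also have "\<dots> \<le> m * m ^ s" using that by (intro mult_le_mono1) simp
    finally show "J j = J' j" using j by (intro ge2.prems) auto
  qed
  then show ?case by simp
qed auto

lemma good_exists:
  assumes "0 < L" "0 < s" "zone (carrier F) l S z (n ^ s)" "M \<in> strings (carrier F) (k ^ s)"
    "\<And>e. e < (s - 1) * m \<Longrightarrow> rs e < n"
  shows "\<exists>J. (\<forall>j. J j < L) \<and> good S J s rs off z M"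
  using assms(2-)
proof (induction s arbitrary: off z M rule: induct_nat_012)
  case 1
  define f where "f = fib k n S (Suc 0) z 0"
  have f: "f \<in> list_strings (carrier F) l n" unfolding f_def by (rule fib_list_strings) (use 1 in simp)
  have M: "col k 0 M 0 = M"
    using 1 by (intro strings_eqI[OF col_strings[of M 0], of M]) (auto simp: col_def)
  have "\<exists>j<L. clo S 0 z M 0 \<longrightarrow> j < length (lst f) \<and> lst f ! j = map M [0..<k]"
  proof (cases "clo S 0 z M 0")
    case True
    then have "M \<in> close_messages (carrier F) k n C \<alpha> f"
      using 1 M by (simp add: clo_def close_messages_def f_def)
    then have "map M [0..<k] \<in> set (lst f)" using lst[OF f] by blast
    then show ?thesis using len[OF f] by (metis in_set_conv_nth order_less_le_trans)
  qed (use assms(1) in auto)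
  then obtain j where "j < L" "clo S 0 z M 0 \<longrightarrow> j < length (lst f) \<and> lst f ! j = map M [0..<k]" by blast
  then show ?case by (intro exI[of _ "\<lambda>_. j"]) (simp add: f_def)
next
  case (ge2 s)
  define z' where "z' i = z + rs (s * m + i) * n ^ Suc s" for i
  define M' where "M' i = nr s M (rs (s * m + i))" for i
  have "\<exists>J. (\<forall>j. J j < L) \<and> good S J (Suc s) rs (off + i * m ^ s) (z' i) (M' i)" if "i < m" for i
  proof -
    have r: "rs (s * m + i) < n" using ge2.prems(4)[of "s * m + i"] that by simp
    show ?thesis
      unfolding z'_def M'_def
      by (rule ge2.IH(2)[OF _ zone_sub[OF ge2.prems(2) r] nr_strings[OF ge2.prems(3) r]])
        (use ge2.prems(4) in auto)
  qed
  then obtain J where J: "\<And>i. i < m \<Longrightarrow> (\<forall>j. J i j < L) \<and> good S (J i) (Suc s) rs (off + i * m ^ s) (z' i) (M' i)"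
    by metis
  \<comment> \<open>The windows of length \<open>m ^ s\<close> used by the \<open>m\<close> calls
    are disjoint, so their advice is glued together by the quotient. The value 0 outside all windows
    is below \<open>L\<close> because \<open>0 < L\<close>.\<close>
  define JJ where "JJ j = (let i = (j - off) div m ^ s in if i < m then J i j else 0)" for j
  have "good S JJ (Suc s) rs (off + i * m ^ s) (z' i) (M' i)" if i: "i < m" for i
  proof -
    have "JJ j = J i j" if "off + i * m ^ s \<le> j" "j < off + i * m ^ s + m ^ (Suc s - 1)" for j
    proof -
      have "(j - off) div m ^ s = i"
        by (rule div_nat_eqI) (use that in \<open>simp_all add: mult.commute\<close>)
      then show ?thesis using i by (simp add: JJ_def)
    qed
    then show ?thesis using J[OF i] good_cong[of "off + i * m ^ s" "Suc s" JJ "J i"] by blast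
  qed
  moreover have "JJ j < L" for j using J assms(1) by (auto simp: JJ_def Let_def)
  ultimately show ?case by (intro exI[of _ JJ]) (simp add: z'_def M'_def)
qed simp

lemma bad_cong:
  "(\<And>e. e < (s - 1) * m \<Longrightarrow> rs e = rs' e) \<Longrightarrow> bad S s rs z M y = bad S s rs' z M y"
proof (induction s arbitrary: z M rule: induct_nat_012)
  case (ge2 s)
  have eq: "rs (s * m + i) = rs' (s * m + i)" if "i < m" for i using ge2.prems[of "s * m + i"] that by simp
  have "bad S (Suc s) rs z' M' y = bad S (Suc s) rs' z' M' y" for z' M'
    by (rule ge2.IH(2)) (use ge2.prems in auto)
  moreover have "sep (\<lambda>i. rs (s * m + i)) f x = sep (\<lambda>i. rs' (s * m + i)) f x" for f x
    unfolding sep_def using eq by (simp cong: conj_cong)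
  ultimately show ?case using eq by (simp cong: conj_cong)
qed auto

text \<open>The top digit of \<open>y\<close> only selects an entry of the recovered column;
  closeness, separation and the recursive calls concern the fiber, which the lower digits determine.
  Averages over positions thus reduce to averages over \<open>k ^ s\<close> fibers.\<close>

lemma bad_mod: "bad S (Suc s) rs z M (y mod k ^ s) = bad S (Suc s) rs z M y"
proof -
  have "clo S s' z M (y mod k ^ s) = clo S s' z M y" "col k s' M (y mod k ^ s) = col k s' M y"
    "fib k n S (Suc s') z (y mod k ^ s) = fib k n S (Suc s') z y" if "s' \<le> s" for z s' M
  proof -
    have "y mod k ^ s mod k ^ s' = y mod k ^ s'" using that by (simp add: le_imp_power_dvd mod_mod_cancel)
    then show "col k s' M (y mod k ^ s) = col k s' M y"
      "fib k n S (Suc s') z (y mod k ^ s) = fib k n S (Suc s') z y"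
      "clo S s' z M (y mod k ^ s) = clo S s' z M y"
      using that by (simp_all add: col_def fib_def clo_def conv_mod')
  qed note * = this
  have "s' \<le> s \<Longrightarrow> bad S (Suc s') rs z M (y mod k ^ s) = bad S (Suc s') rs z M y" for s'
  proof (induction s' arbitrary: z M)
    case (Suc s')
    then show ?case using *[of "Suc s'"] by simp
  qed (simp add: *)
  then show ?thesis by simp
qed

section \<open>Errors along rows and along fibers\<close>

definition errs :: "(nat \<Rightarrow> nat set) \<Rightarrow> nat \<Rightarrow> nat \<Rightarrow> (nat \<Rightarrow> nat) \<Rightarrow> nat" where
  "errs S z s M = card {r. r < n ^ s \<and> Tp s M r \<notin> S (z + r)}"

lemma errs_rows:
  assumes M: "M \<in> strings (carrier F) (k ^ Suc (Suc s))"
  shows "(\<Sum>a<n. errs S (z + a * n ^ Suc s) (Suc s) (nr s M a)) = errs S z (Suc (Suc s)) M"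
proof -
  let ?N = "n ^ Suc s"
  let ?A = "\<lambda>a. {b. b < ?N \<and> Tp (Suc s) (nr s M a) b \<notin> S (z + a * ?N + b)}"
  have "(\<Sum>a<n. errs S (z + a * ?N) (Suc s) (nr s M a)) = card (SIGMA a:{..<n}. ?A a)"
    by (simp add: errs_def)
  also have "\<dots> = errs S z (Suc (Suc s)) M"
    unfolding errs_def
  proof (rule bij_betw_same_card[of "\<lambda>(a, b). a * ?N + b"], rule bij_betw_imageI)
    show "inj_on (\<lambda>(a, b). a * ?N + b) (SIGMA a:{..<n}. ?A a)"
    proof (rule inj_onI, clarsimp simp del: power_Suc)
      fix a b a' b' assume b: "b < ?N" "b' < ?N" and eq: "a * ?N + b = a' * ?N + b'"
      have "(a * ?N + b) div ?N = a" "(a' * ?N + b') div ?N = a'" using b by (simp_all only: div_mult_add_less)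
      then have "a = a'" using eq by metis
      then show "a = a' \<and> b = b'" using eq by simp
    qed
    show "(\<lambda>(a, b). a * ?N + b) ` (SIGMA a:{..<n}. ?A a) =
        {r. r < n ^ Suc (Suc s) \<and> Tp (Suc (Suc s)) M r \<notin> S (z + r)}" (is "?l = ?r")
    proof
      show "?l \<subseteq> ?r"
      proof (clarsimp simp del: power_Suc tensor_pow.simps)
        fix a b assume ab: "a < n" "b < ?N" "Tp (Suc s) (nr s M a) b \<notin> S (z + a * ?N + b)"
        have "a * ?N + b < Suc a * ?N" using ab by simp
        also have "\<dots> \<le> n * ?N" using ab by (intro mult_le_mono1) simp
        finally show "a * ?N + b < n ^ Suc (Suc s) \<and> Tp (Suc (Suc s)) M (a * ?N + b) \<notin> S (z + (a * ?N + b))"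
          using ab(3) Tp_row[OF M ab(1,2)] by (simp add: add.assoc)
      qed
      show "?r \<subseteq> ?l"
      proof
        fix r assume r: "r \<in> ?r"
        have "r div ?N < n" using r by (simp add: less_mult_imp_div_less)
        moreover have "r mod ?N < ?N" using npos by simp
        moreover have "r div ?N * ?N + r mod ?N = r" by (rule div_mult_mod_eq)
        ultimately have "r = (\<lambda>(a, b). a * ?N + b) (r div ?N, r mod ?N)"
            "(r div ?N, r mod ?N) \<in> (SIGMA a:{..<n}. ?A a)"
          using r Tp_row[OF M, of "r div ?N" "r mod ?N"] by (auto simp: add.assoc simp del: power_Suc tensor_pow.simps)
        then show "r \<in> ?l" by blast
      qed
    qed
  qed
  finally show ?thesis .
qed

text \<open>Fibers through different \<open>y\<close> are disjoint, as \<open>conv\<close> is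
  injective, and each fiber that is not close contributes more than \<open>\<alpha> * n\<close>
  errors. All errors may lie on these \<open>k ^ s\<close> of the \<open>n ^ s\<close> fibers, so
  they are compared with \<open>k ^ s\<close>.\<close>

lemma errs_cols:
  assumes M: "M \<in> strings (carrier F) (k ^ Suc s)" and \<alpha>: "0 < \<alpha>"
  shows "card {y. y < k ^ s \<and> \<not> clo S s z M y} * (\<alpha> * n) \<le> errs S z (Suc s) M"
proof -
  define A where "A y = {p. p < n \<and> C (col k s M y) p \<notin> S (z + conv k n s y + p * n ^ s)}" for y
  have "real (card (A y)) \<ge> of_bool (\<not> clo S s z M y) * (\<alpha> * n)" for y
  proof (cases "clo S s z M y")
    case False
    have "{i. i < n \<and> C (col k s M y) i \<notin> fib k n S (Suc s) z y i} = A y" by (auto simp: A_def fib_def)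
    then show ?thesis using False npos by (simp add: clo_def list_dist_def field_simps not_le)
  qed simp
  then have "(\<Sum>y<k ^ s. of_bool (\<not> clo S s z M y) * (\<alpha> * n)) \<le> (\<Sum>y<k ^ s. real (card (A y)))"
    by (intro sum_mono)
  also have "(\<Sum>y<k ^ s. of_bool (\<not> clo S s z M y) * (\<alpha> * n)) = card {y. y < k ^ s \<and> \<not> clo S s z M y} * (\<alpha> * n)"
  proof -
    have "(\<Sum>y<k ^ s. of_bool (\<not> clo S s z M y)) = real (card ({..<k ^ s} \<inter> {y. \<not> clo S s z M y}))"
      by (subst sum_of_bool_eq) (auto simp: finite_lessThan)
    also have "{..<k ^ s} \<inter> {y. \<not> clo S s z M y} = {y. y < k ^ s \<and> \<not> clo S s z M y}" by auto
    finally show ?thesis by (simp only: sum_distrib_right[symmetric])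
  qed
  also have "(\<Sum>y<k ^ s. real (card (A y))) = real (card (SIGMA y:{..<k ^ s}. A y))"
    by (simp add: A_def)
  also have "\<dots> \<le> real (errs S z (Suc s) M)"
  proof -
    have "card (SIGMA y:{..<k ^ s}. A y) \<le> errs S z (Suc s) M"
      unfolding errs_def
    proof (rule card_inj_on_le[of "\<lambda>(y, p). p * n ^ s + conv k n s y"])
      have lt: "conv k n s y < n ^ s" for y by (rule conv_less[OF k kn])
      show "inj_on (\<lambda>(y, p). p * n ^ s + conv k n s y) (SIGMA y:{..<k ^ s}. A y)"
      proof (rule inj_onI, clarsimp)
        fix y p y' p' assume y: "y < k ^ s" "y' < k ^ s" and eq: "p * n ^ s + conv k n s y = p' * n ^ s + conv k n s y'"
        have d: "(p * n ^ s + conv k n s y) div n ^ s = p" for p y by (rule div_mult_add_less[OF lt])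
        have "p = p'" using eq d by metis
        moreover have "conv k n s y = conv k n s y'" using eq \<open>p = p'\<close> by simp
        then have "y = y'" using conv_inj[OF k kn, of s] y by (auto dest: inj_onD)
        ultimately show "y = y' \<and> p = p'" by simp
      qed
      show "(\<lambda>(y, p). p * n ^ s + conv k n s y) ` (SIGMA y:{..<k ^ s}. A y) \<subseteq>
          {r. r < n ^ Suc s \<and> Tp (Suc s) M r \<notin> S (z + r)}"
      proof (clarsimp simp: A_def simp del: power_Suc)
        fix y p assume y: "y < k ^ s" "p < n" "C (col k s M y) p \<notin> S (z + conv k n s y + p * n ^ s)"
        have "p * n ^ s + conv k n s y < Suc p * n ^ s" using lt[of y] by simp
        also have "\<dots> \<le> n * n ^ s" using y by (intro mult_le_mono1) simp
        finally show "p * n ^ s + conv k n s y < n ^ Suc s \<and>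
            Tp (Suc s) M (p * n ^ s + conv k n s y) \<notin> S (z + (p * n ^ s + conv k n s y))"
          using y(3) Tp_col[OF M y(2), of y] by (simp add: add_ac)
      qed
    qed simp
    then show ?thesis by simp
  qed
  finally show ?thesis .
qed

end

section \<open>The expected number of bad positions\<close>

lemma prob_mono_support:
  assumes "\<And>x. x \<in> set_pmf p \<Longrightarrow> x \<in> A \<Longrightarrow> x \<in> B"
  shows "measure_pmf.prob p A \<le> measure_pmf.prob p B"
proof -
  have "measure_pmf.prob p A = measure_pmf.prob p (A \<inter> set_pmf p)" by (simp add: measure_Int_set_pmf)
  also have "\<dots> \<le> measure_pmf.prob p B" using assms by (intro measure_pmf.finite_measure_mono) auto
  finally show ?thesis .
qed

lemma prob_pair_snd: "measure_pmf.prob (pair_pmf A B) {(x, y). Q y} = measure_pmf.prob B {y. Q y}"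
proof -
  have "measure_pmf.prob (pair_pmf A B) {(x, y). Q y} = measure_pmf.prob (map_pmf snd (pair_pmf A B)) {y. Q y}"
    by (simp add: measure_map_pmf vimage_def case_prod_unfold)
  then show ?thesis by (simp add: map_snd_pair_pmf)
qed

lemma prob_pair_nth:
  assumes "i < m"
  shows "measure_pmf.prob (pair_pmf A (replicate_pmf m D)) {(xs, ys). H xs (ys ! i)} =
    measure_pmf.expectation D (\<lambda>a. measure_pmf.prob A {xs. H xs a})"
proof -
  have "measure_pmf.prob (pair_pmf A (replicate_pmf m D)) {(xs, ys). H xs (ys ! i)} =
      measure_pmf.expectation (replicate_pmf m D) (\<lambda>ys. measure_pmf.prob A {xs. H xs (ys ! i)})"
    by (rule prob_pair_pmf)
  also have "\<dots> = measure_pmf.expectation (map_pmf (\<lambda>ys. ys ! i) (replicate_pmf m D)) (\<lambda>a. measure_pmf.prob A {xs. H xs a})"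
    by simp
  finally show ?thesis by (simp only: map_nth_replicate_pmf[OF assms])
qed

lemma replicate_pmf_append:
  "replicate_pmf (a + b) D = map_pmf (\<lambda>(xs, ys). xs @ ys) (pair_pmf (replicate_pmf a D) (replicate_pmf b D))"
  by (simp add: replicate_pmf_distrib pair_pmf_def map_bind_pmf)

lemma sum_mod_real: "(\<Sum>y<j * N. f (y mod N)) = real j * (\<Sum>y<N. f y)" for f :: "nat \<Rightarrow> real"
proof (induction j)
  case (Suc j)
  have "(\<Sum>y<Suc j * N. f (y mod N)) = (\<Sum>y<j * N. f (y mod N)) + (\<Sum>y\<in>{j * N..<j * N + N}. f (y mod N))"
    by (subst sum.union_disjoint[symmetric]) (auto intro!: sum.cong)
  also have "(\<Sum>y\<in>{j * N..<j * N + N}. f (y mod N)) = (\<Sum>y<N. f (y mod N))"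
    using sum.shift_bounds_nat_ivl[of "\<lambda>y. f (y mod N)" 0 "j * N" N]
    by (simp add: atLeast0LessThan add.commute)
  also have "(\<Sum>y<N. f (y mod N)) = (\<Sum>y<N. f y)" by (rule sum.cong) auto
  finally show ?case using Suc by (simp add: algebra_simps)
qed simp

lemma replicate_pmf_support:
  "xs \<in> set_pmf (replicate_pmf m D) \<Longrightarrow> length xs = m \<and> (\<forall>i<m. xs ! i \<in> set_pmf D)"
  by (auto simp: set_replicate_pmf in_lists_conv_set)

lemma card_nth_filter: "length xs = m \<Longrightarrow> card {i. i < m \<and> P (xs ! i)} = length (filter P xs)"
  by (simp add: length_filter_conv_card)

context decoder
begin

definition badprob :: "nat pmf \<Rightarrow> (nat \<Rightarrow> nat set) \<Rightarrow> nat \<Rightarrow> nat \<Rightarrow> (nat \<Rightarrow> nat) \<Rightarrow> nat \<Rightarrow> real" where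
  "badprob D S s z M y = measure_pmf.prob (replicate_pmf ((s - 1) * m) D) {xs. bad S s (\<lambda>e. xs ! e) z M y}"

lemma card_close:
  assumes "f \<in> list_strings (carrier F) l n"
  shows "finite (close_messages (carrier F) k n C \<alpha> f)" "card (close_messages (carrier F) k n C \<alpha> f) \<le> L"
proof -
  let ?X = "close_messages (carrier F) k n C \<alpha> f"
  show "finite ?X" by (rule finite_subset[OF _ finite_strings[OF finF]]) (auto simp: close_messages_def)
  have "inj_on (\<lambda>x. map x [0..<k]) ?X"
    by (rule inj_onI, rule map_inj[of _ "carrier F"]) (auto simp: close_messages_def)
  then have "card ?X = card (set (lst f))" by (simp add: lst[OF assms] card_image)
  also have "\<dots> \<le> L" using card_length[of "lst f"] len[OF assms] by simp
  finally show "card ?X \<le> L" .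
qed

text \<open>A union bound over at most \<open>L\<close> competitors. \<open>\<delta>\<close> becomes
  \<open>\<delta> / 4\<close> by the factor 2 that the sampling distribution loses and by the
  \<open>p / 2\<close> in \<open>chernoff_lower\<close>.\<close>

lemma not_sep_prob:
  fixes \<delta> :: real
  assumes D: "set_pmf D \<subseteq> {..<n}" "\<And>E. E \<subseteq> {..<n} \<Longrightarrow> card E / (2 * n) \<le> measure_pmf.prob D E"
    and dist: "\<And>x x'. x \<in> strings (carrier F) k \<Longrightarrow> x' \<in> strings (carrier F) k \<Longrightarrow> x \<noteq> x' \<Longrightarrow>
      \<delta> * n \<le> card {i. i < n \<and> C x i \<noteq> C x' i}"
    and f: "f \<in> list_strings (carrier F) l n" and x0: "x0 \<in> strings (carrier F) k"
  shows "measure_pmf.prob (replicate_pmf m D) {ys. \<not> sep (\<lambda>i. ys ! i) f x0} \<le> L * (2 ^ (2 * \<theta>) * (1 - \<delta> / 4) ^ m)"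
proof (cases "L = 0 \<or> close_messages (carrier F) k n C \<alpha> f - {x0} = {}")
  case True
  then have "sep R f x0" for R
    using card_close[OF f] by (auto simp: sep_def)
  \<comment> \<open>The probability is 0 in this case, and only the sign of the bound is at issue.
    The constant messages 0 and 1 witness that \<open>\<delta>\<close> is not too large.\<close>
  moreover have "\<delta> / 4 \<le> 1" if "L \<noteq> 0"
  proof -
    have s: "(\<lambda>j\<in>{..<k}. \<zero>) \<in> strings (carrier F) k" "(\<lambda>j\<in>{..<k}. \<one>) \<in> strings (carrier F) k"
      by (auto intro!: strings_restrict)
    have "(\<lambda>j\<in>{..<k}. \<zero>) 0 \<noteq> (\<lambda>j\<in>{..<k}. \<one>) 0" using k by simp
    then have "(\<lambda>j\<in>{..<k}. \<zero>) \<noteq> (\<lambda>j\<in>{..<k}. \<one>)" by metis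
    from dist[OF s this] have "\<delta> * n \<le> real (card {i. i < n \<and> C (\<lambda>j\<in>{..<k}. \<zero>) i \<noteq> C (\<lambda>j\<in>{..<k}. \<one>) i})" .
    also have "\<dots> \<le> real (card {..<n})" by (intro of_nat_mono card_mono) auto
    finally show ?thesis using npos by simp
  qed
  ultimately show ?thesis by (cases "L = 0") auto
next
  case False
  let ?X = "close_messages (carrier F) k n C \<alpha> f - {x0}" and ?P = "replicate_pmf m D"
  have fin: "finite ?X" using card_close[OF f] by simp
  define Q where "Q x = {ys. length (filter (\<lambda>a. a \<in> {a. a < n \<and> C x a \<noteq> C x0 a}) ys) < 2 * \<theta>}" for x
  have "measure_pmf.prob ?P {ys. \<not> sep (\<lambda>i. ys ! i) f x0} \<le> measure_pmf.prob ?P (\<Union>x\<in>?X. Q x)"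
  proof (rule prob_mono_support)
    fix ys assume ys: "ys \<in> set_pmf ?P" "ys \<in> {ys. \<not> sep (\<lambda>i. ys ! i) f x0}"
    then obtain x where x: "x \<in> ?X" "card {i. i < m \<and> C x (ys ! i) \<noteq> C x0 (ys ! i)} < 2 * \<theta>"
      by (auto simp: sep_def not_le)
    have l: "length ys = m" "\<forall>i<m. ys ! i < n" using replicate_pmf_support[OF ys(1)] D(1) by auto
    have "card {i. i < m \<and> C x (ys ! i) \<noteq> C x0 (ys ! i)} =
        card {i. i < m \<and> ys ! i \<in> {a. a < n \<and> C x a \<noteq> C x0 a}}"
      using l(2) by (intro arg_cong[of _ _ card]) auto
    also have "\<dots> = length (filter (\<lambda>a. a \<in> {a. a < n \<and> C x a \<noteq> C x0 a}) ys)"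
      by (rule card_nth_filter[OF l(1)])
    finally show "ys \<in> (\<Union>x\<in>?X. Q x)" using x by (auto simp: Q_def)
  qed
  also have "\<dots> \<le> (\<Sum>x\<in>?X. measure_pmf.prob ?P (Q x))"
    by (rule measure_pmf.finite_measure_subadditive_finite[OF fin]) auto
  also have "\<dots> \<le> (\<Sum>x\<in>?X. 2 ^ (2 * \<theta>) * (1 - \<delta> / 4) ^ m)"
  proof (rule sum_mono)
    fix x assume x: "x \<in> ?X"
    let ?E = "{a. a < n \<and> C x a \<noteq> C x0 a}"
    have "\<delta> * n \<le> card ?E" using x x0 by (intro dist) (auto simp: close_messages_def)
    then have "\<delta> / 2 \<le> card ?E / (2 * n)" using npos by (simp add: field_simps)
    also have "\<dots> \<le> measure_pmf.prob D ?E" by (intro D(2)) auto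
    finally have p: "\<delta> / 2 \<le> measure_pmf.prob D ?E" .
    have "measure_pmf.prob ?P (Q x) \<le> 2 ^ (2 * \<theta>) * (1 - measure_pmf.prob D ?E / 2) ^ m"
      unfolding Q_def by (rule chernoff_lower)
    also have "\<dots> \<le> 2 ^ (2 * \<theta>) * (1 - \<delta> / 4) ^ m"
      using p measure_pmf.prob_le_1[of D ?E] by (intro mult_left_mono power_mono; linarith?) simp
    finally show "measure_pmf.prob ?P (Q x) \<le> 2 ^ (2 * \<theta>) * (1 - \<delta> / 4) ^ m" .
  qed
  also have "\<dots> = card ?X * (2 ^ (2 * \<theta>) * (1 - \<delta> / 4) ^ m)" by simp
  also have "\<dots> \<le> L * (2 ^ (2 * \<theta>) * (1 - \<delta> / 4) ^ m)"
  proof (rule mult_right_mono)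
    have "card ?X \<le> card (close_messages (carrier F) k n C \<alpha> f)" using card_close[OF f] by (intro card_mono) auto
    then show "real (card ?X) \<le> L" using card_close(2)[OF f] by simp
    obtain x where x: "x \<in> ?X" using False by blast
    have "\<delta> * n \<le> card {i. i < n \<and> C x i \<noteq> C x0 i}" using x x0 by (intro dist) (auto simp: close_messages_def)
    also have "\<dots> \<le> real (card {..<n})" by (intro of_nat_mono card_mono) auto
    finally have "\<delta> \<le> 1" using npos by simp
    then show "0 \<le> 2 ^ (2 * \<theta>) * (1 - \<delta> / 4) ^ m" by simp
  qed
  finally show ?thesis .
qed

text \<open>The \<open>m\<close> recursive values at \<open>y\<close> share the rows of the lower
  dimensions, so their failures are dependent and only Markov's inequality applies to them, at the
  cost of the factor \<open>m / u\<close>. Overfull rows, the set \<open>Bd\<close>, must stay out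
  of that term, as the induction hypothesis says nothing about them. Whether a draw hits
  \<open>Bd\<close> depends on that draw alone, so independence gives a tail bound for the number of
  hits.\<close>

lemma badprob_step:
  fixes u :: nat and E' p \<beta> \<delta> :: real
  assumes D: "set_pmf D \<subseteq> {..<n}" "\<And>E. E \<subseteq> {..<n} \<Longrightarrow> card E / (2 * n) \<le> measure_pmf.prob D E"
      "\<And>E. E \<subseteq> {..<n} \<Longrightarrow> measure_pmf.prob D E \<le> 2 * card E / n"
    and dist: "\<And>x x'. x \<in> strings (carrier F) k \<Longrightarrow> x' \<in> strings (carrier F) k \<Longrightarrow> x \<noteq> x' \<Longrightarrow>
      \<delta> * n \<le> card {i. i < n \<and> C x i \<noteq> C x' i}"
    and M: "M \<in> strings (carrier F) (k ^ Suc (Suc s))" and zone: "zone (carrier F) l S z (n ^ Suc (Suc s))"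
    and \<alpha>: "0 < \<alpha>" and u: "0 < u" "\<theta> = 2 * u" and E': "0 < E'" and \<beta>: "0 \<le> \<beta>"
    and p: "2 * errs S z (Suc (Suc s)) M / (n * E') \<le> p"
    and IH: "\<And>z' M'. M' \<in> strings (carrier F) (k ^ Suc s) \<Longrightarrow> zone (carrier F) l S z' (n ^ Suc s) \<Longrightarrow>
      errs S z' (Suc s) M' \<le> E' \<Longrightarrow> (\<Sum>y<k ^ s. badprob D S (Suc s) z' M' y) \<le> \<beta> * k ^ s"
  shows "(\<Sum>y<k ^ Suc s. badprob D S (Suc (Suc s)) z M y) \<le> errs S z (Suc (Suc s)) M / (\<alpha> * n) +
    k ^ Suc s * (L * (2 ^ (2 * \<theta>) * (1 - \<delta> / 4) ^ m) + (1 / 4) ^ u * (1 + 3 * p) ^ m + m / u * \<beta>)"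
proof -
  define A where "A = replicate_pmf (s * m) D"
  define B where "B = replicate_pmf m D"
  define z' where "z' a = z + a * n ^ Suc s" for a
  define Bd where "Bd = {a. a < n \<and> E' < errs S (z' a) (Suc s) (nr s M a)}"
  define H where "H y xs a \<longleftrightarrow> a < n \<and> a \<notin> Bd \<and> bad S (Suc s) (\<lambda>e. xs ! e) (z' a) (nr s M a) y" for y xs a
  define h where "h a y = measure_pmf.prob A {xs. H y xs a}" for a y
  define c2 where "c2 = L * (2 ^ (2 * \<theta>) * (1 - \<delta> / 4) ^ m)"
  define c3 where "c3 = (1 / 4) ^ u * (1 + 3 * p) ^ m"

  \<comment> \<open>Dimension \<open>s + 2\<close> uses the last \<open>m\<close> draws; the lower
    dimensions see only \<open>xs\<close>, and the rows \<open>ys\<close> are independent of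
    it.\<close>
  have split: "replicate_pmf ((Suc (Suc s) - 1) * m) D = map_pmf (\<lambda>(xs, ys). xs @ ys) (pair_pmf A B)"
    unfolding A_def B_def replicate_pmf_append[symmetric] by (simp add: add.commute)

  have "card Bd * E' \<le> (\<Sum>a\<in>Bd. real (errs S (z' a) (Suc s) (nr s M a)))"
    using sum_mono[of Bd "\<lambda>_. E'" "\<lambda>a. real (errs S (z' a) (Suc s) (nr s M a))"] by (auto simp: Bd_def)
  also have "\<dots> \<le> (\<Sum>a<n. real (errs S (z' a) (Suc s) (nr s M a)))"
    by (rule sum_mono2) (auto simp: Bd_def)
  also have "\<dots> = errs S z (Suc (Suc s)) M"
    using errs_rows[OF M, of S z] by (simp only: z'_def of_nat_sum[symmetric])
  finally have cardBd: "card Bd * E' \<le> errs S z (Suc (Suc s)) M" .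
  have pB: "measure_pmf.prob D Bd \<le> p"
  proof -
    have "measure_pmf.prob D Bd \<le> 2 * card Bd / n" by (rule D(3)) (auto simp: Bd_def)
    also have "\<dots> \<le> 2 * errs S z (Suc (Suc s)) M / (n * E')"
      using cardBd E' npos by (simp add: field_simps)
    also have "\<dots> \<le> p" by (rule p)
    finally show ?thesis .
  qed

  have each: "badprob D S (Suc (Suc s)) z M y \<le> of_bool (\<not> clo S (Suc s) z M y) + c2 + c3 +
      (\<Sum>i<m. measure_pmf.expectation D (\<lambda>a. h a y)) / u" for y
  proof -
    let ?f = "fib k n S (Suc (Suc s)) z y" and ?x0 = "col k (Suc s) M y"
    define N1 where "N1 = (if clo S (Suc s) z M y then {} else UNIV :: (nat list \<times> nat list) set)"
    define N2 where "N2 = {(xs :: nat list, ys). \<not> sep (\<lambda>i. ys ! i) ?f ?x0}"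
    define N3 where "N3 = {(xs :: nat list, ys). u \<le> length (filter (\<lambda>a. a \<in> Bd) ys)}"
    define N4 where "N4 = {w. u \<le> card {i. i < m \<and> (case w of (xs, ys) \<Rightarrow> H y xs (ys ! i))}}"
    have "badprob D S (Suc (Suc s)) z M y =
        measure_pmf.prob (pair_pmf A B) {(xs, ys). bad S (Suc (Suc s)) (\<lambda>e. (xs @ ys) ! e) z M y}"
      unfolding badprob_def split by (simp add: measure_map_pmf vimage_def case_prod_unfold del: bad.simps)
    also have "\<dots> \<le> measure_pmf.prob (pair_pmf A B) (N1 \<union> N2 \<union> N3 \<union> N4)"
    proof (rule prob_mono_support)
      fix w assume w: "w \<in> set_pmf (pair_pmf A B)"
        "w \<in> {(xs, ys). bad S (Suc (Suc s)) (\<lambda>e. (xs @ ys) ! e) z M y}"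
      obtain xs ys where w_eq: "w = (xs, ys)" by (cases w)
      have xs: "length xs = s * m" and ys: "length ys = m" "\<forall>i<m. ys ! i < n"
        using w(1) replicate_pmf_support[of xs "s * m" D] replicate_pmf_support[of ys m D] D(1)
        by (auto simp: w_eq A_def B_def)
      have nth: "(xs @ ys) ! (s * m + i) = ys ! i" for i by (simp add: nth_append xs)
      have bd: "bad S (Suc s) (\<lambda>e. (xs @ ys) ! e) zz MM y = bad S (Suc s) (\<lambda>e. xs ! e) zz MM y" for zz MM
        by (rule bad_cong) (simp add: nth_append xs)
      have "\<not> clo S (Suc s) z M y \<or> \<not> sep (\<lambda>i. ys ! i) ?f ?x0 \<or>
          \<theta> \<le> card {i. i < m \<and> bad S (Suc s) (\<lambda>e. xs ! e) (z' (ys ! i)) (nr s M (ys ! i)) y}"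
        using w(2) by (simp only: w_eq mem_Collect_eq case_prod_conv bad.simps nth bd z'_def)
      moreover have "(xs, ys) \<in> N3 \<union> N4"
        if "\<theta> \<le> card {i. i < m \<and> bad S (Suc s) (\<lambda>e. xs ! e) (z' (ys ! i)) (nr s M (ys ! i)) y}"
      proof -
        let ?I = "{i. i < m \<and> bad S (Suc s) (\<lambda>e. xs ! e) (z' (ys ! i)) (nr s M (ys ! i)) y}"
        let ?J = "{i. i < m \<and> ys ! i \<in> Bd}" and ?K = "{i. i < m \<and> H y xs (ys ! i)}"
        have "card ?I \<le> card (?J \<union> ?K)" using ys(2) by (intro card_mono) (auto simp: H_def)
        also have "\<dots> \<le> card ?J + card ?K" by (rule card_Un_le)
        finally have "u \<le> card ?J \<or> u \<le> card ?K" using that u(2) by linarith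
        then show ?thesis using card_nth_filter[OF ys(1), of "\<lambda>a. a \<in> Bd"] by (auto simp: N3_def N4_def)
      qed
      ultimately show "w \<in> N1 \<union> N2 \<union> N3 \<union> N4" by (auto simp: w_eq N1_def N2_def)
    qed
    also have "\<dots> \<le> measure_pmf.prob (pair_pmf A B) N1 + measure_pmf.prob (pair_pmf A B) N2 +
        measure_pmf.prob (pair_pmf A B) N3 + measure_pmf.prob (pair_pmf A B) N4"
      by (intro order.trans[OF measure_Un_le] add_mono order_refl) auto
    also have "measure_pmf.prob (pair_pmf A B) N1 = of_bool (\<not> clo S (Suc s) z M y)"
      by (simp add: N1_def)
    also have "measure_pmf.prob (pair_pmf A B) N2 \<le> c2"
      unfolding N2_def prob_pair_snd B_def c2_def
      by (rule not_sep_prob[OF D(1,2) dist fib_list_strings[OF zone] col_strings[OF M]])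
    also have "measure_pmf.prob (pair_pmf A B) N3 \<le> c3"
    proof -
      have "measure_pmf.prob (pair_pmf A B) N3 \<le> (1 / 4) ^ u * (1 + 3 * measure_pmf.prob D Bd) ^ m"
        unfolding N3_def prob_pair_snd B_def by (rule chernoff_upper)
      also have "\<dots> \<le> c3" unfolding c3_def using pB by (intro mult_left_mono power_mono) auto
      finally show ?thesis .
    qed
    also have "measure_pmf.prob (pair_pmf A B) N4 \<le>
        (\<Sum>i<m. measure_pmf.prob (pair_pmf A B) {w. case w of (xs, ys) \<Rightarrow> H y xs (ys ! i)}) / u"
      unfolding N4_def by (rule prob_count_markov[OF u(1)])
    also have "(\<Sum>i<m. measure_pmf.prob (pair_pmf A B) {w. case w of (xs, ys) \<Rightarrow> H y xs (ys ! i)}) =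
        (\<Sum>i<m. measure_pmf.expectation D (\<lambda>a. h a y))"
      unfolding B_def h_def by (intro sum.cong refl prob_pair_nth) simp
    finally show ?thesis by simp
  qed

  \<comment> \<open>The sum over \<open>y\<close> is moved inside the expectation, since for a fixed
    row the induction hypothesis bounds only a sum over positions.\<close>
  have hsum: "(\<Sum>y<k ^ Suc s. measure_pmf.expectation D (\<lambda>a. h a y)) \<le> \<beta> * k ^ Suc s"
  proof -
    have "(\<Sum>y<k ^ Suc s. measure_pmf.expectation D (\<lambda>a. h a y)) =
        measure_pmf.expectation D (\<lambda>a. \<Sum>y<k ^ Suc s. h a y)"
      by (rule Bochner_Integration.integral_sum[symmetric], rule integrable_pmf_bounded[where B=1])
        (simp add: h_def)
    also have "\<dots> \<le> measure_pmf.expectation D (\<lambda>a. \<beta> * k ^ Suc s)"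
    proof (rule expectation_mono_pmf[where B="real (k ^ Suc s)" and B'="\<bar>\<beta> * k ^ Suc s\<bar>"])
      fix a
      have "\<bar>\<Sum>y<k ^ Suc s. h a y\<bar> \<le> (\<Sum>y<k ^ Suc s. 1)"
        by (rule order.trans[OF sum_abs]) (intro sum_mono, simp add: h_def)
      then show "\<bar>\<Sum>y<k ^ Suc s. h a y\<bar> \<le> real (k ^ Suc s)" by simp
      show "(\<Sum>y<k ^ Suc s. h a y) \<le> \<beta> * k ^ Suc s"
      proof (cases "a < n \<and> a \<notin> Bd")
        case False
        then have "{xs. H y xs a} = {}" for y by (auto simp: H_def)
        then have "h a y = 0" for y by (simp add: h_def)
        then show ?thesis using \<beta> by simp
      next
        case True
        have hb: "h a y = badprob D S (Suc s) (z' a) (nr s M a) y" for y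
          using True by (simp add: h_def H_def badprob_def A_def)
        have "h a (y mod k ^ s) = h a y" for y
          unfolding hb badprob_def bad_mod ..
        then have "(\<Sum>y<k ^ Suc s. h a y) = (\<Sum>y<k * k ^ s. h a (y mod k ^ s))" by simp
        also have "\<dots> = k * (\<Sum>y<k ^ s. h a y)" by (rule sum_mod_real)
        finally have eq: "(\<Sum>y<k ^ Suc s. h a y) = k * (\<Sum>y<k ^ s. h a y)" .
        have le: "(\<Sum>y<k ^ s. h a y) \<le> \<beta> * k ^ s"
          unfolding hb
        proof (rule IH)
          show "nr s M a \<in> strings (carrier F) (k ^ Suc s)" using nr_strings[OF M] True by blast
          show "zone (carrier F) l S (z' a) (n ^ Suc s)" unfolding z'_def using zone_sub[OF zone] True by blast
          show "errs S (z' a) (Suc s) (nr s M a) \<le> E'" using True by (auto simp: Bd_def)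
        qed
        show ?thesis unfolding eq using mult_left_mono[OF le, of "real k"] by (simp add: mult_ac)
      qed
    qed simp
    finally show ?thesis by simp
  qed

  have "(\<Sum>y<k ^ Suc s. badprob D S (Suc (Suc s)) z M y) \<le>
      (\<Sum>y<k ^ Suc s. of_bool (\<not> clo S (Suc s) z M y) + c2 + c3 + m * measure_pmf.expectation D (\<lambda>a. h a y) / u)"
    using each by (intro sum_mono) simp
  also have "\<dots> = (\<Sum>y<k ^ Suc s. of_bool (\<not> clo S (Suc s) z M y)) + k ^ Suc s * c2 + k ^ Suc s * c3 +
      m / u * (\<Sum>y<k ^ Suc s. measure_pmf.expectation D (\<lambda>a. h a y))"
    by (simp add: sum.distrib sum_distrib_left mult.commute)
  also have "(\<Sum>y<k ^ Suc s. of_bool (\<not> clo S (Suc s) z M y)) \<le> errs S z (Suc (Suc s)) M / (\<alpha> * n)"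
  proof -
    have "(\<Sum>y<k ^ Suc s. of_bool (\<not> clo S (Suc s) z M y)) = real (card ({..<k ^ Suc s} \<inter> {y. \<not> clo S (Suc s) z M y}))"
      by (subst sum_of_bool_eq) (auto simp: finite_lessThan)
    also have "{..<k ^ Suc s} \<inter> {y. \<not> clo S (Suc s) z M y} = {y. y < k ^ Suc s \<and> \<not> clo S (Suc s) z M y}" by auto
    finally show ?thesis using errs_cols[OF M \<alpha>, of S z] \<alpha> npos by (simp add: field_simps)
  qed
  also have "m / u * (\<Sum>y<k ^ Suc s. measure_pmf.expectation D (\<lambda>a. h a y)) \<le> m / u * (\<beta> * k ^ Suc s)"
    using hsum by (rule mult_left_mono) simp
  finally show ?thesis by (simp add: c2_def c3_def algebra_simps)
qed

text \<open>In dimension 1 the number of errors alone decides, so nothing random is left and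
  \<open>\<beta> 1\<close> only has to be nonnegative.\<close>

lemma clo_base:
  assumes M: "M \<in> strings (carrier F) (k ^ Suc 0)" and e: "errs S z (Suc 0) M \<le> \<alpha> * n"
  shows "clo S 0 z M y"
proof -
  have "{i. i < n \<and> C (col k 0 M y) i \<notin> fib k n S (Suc 0) z y i} = {r. r < n ^ Suc 0 \<and> Tp (Suc 0) M r \<notin> S (z + r)}"
    using Tp_col[OF M, of _ y] by (auto simp: fib_def conv_def)
  then show ?thesis using e npos by (simp add: clo_def list_dist_def errs_def field_simps)
qed

text \<open>\<open>Eb s\<close> is the number of errors tolerated in dimension \<open>s\<close>, and
  \<open>\<beta> s\<close> the average failure probability there. The conditions \<open>st1\<close>
  to \<open>st4\<close> allot a quarter of \<open>\<beta> (Suc s)\<close> to each term of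
  \<open>badprob_step\<close>.\<close>

theorem badprob_main:
  fixes u t :: nat and Eb \<beta> :: "nat \<Rightarrow> real" and \<delta> :: real
  assumes D: "set_pmf D \<subseteq> {..<n}" "\<And>E. E \<subseteq> {..<n} \<Longrightarrow> card E / (2 * n) \<le> measure_pmf.prob D E"
      "\<And>E. E \<subseteq> {..<n} \<Longrightarrow> measure_pmf.prob D E \<le> 2 * card E / n"
    and dist: "\<And>x x'. x \<in> strings (carrier F) k \<Longrightarrow> x' \<in> strings (carrier F) k \<Longrightarrow> x \<noteq> x' \<Longrightarrow>
      \<delta> * n \<le> card {i. i < n \<and> C x i \<noteq> C x' i}"
    and \<alpha>: "0 < \<alpha>" and u: "0 < u" "\<theta> = 2 * u"
    and base: "Eb 1 \<le> \<alpha> * n" "0 \<le> \<beta> 1"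
    and pos: "\<And>s. 1 \<le> s \<Longrightarrow> s \<le> t \<Longrightarrow> 0 < Eb s \<and> 0 \<le> \<beta> s"
    and st1: "\<And>s. 1 \<le> s \<Longrightarrow> s < t \<Longrightarrow> Eb (Suc s) / (\<alpha> * n) \<le> \<beta> (Suc s) / 4 * k ^ s"
    and st2: "\<And>s. 1 \<le> s \<Longrightarrow> s < t \<Longrightarrow> L * (2 ^ (2 * \<theta>) * (1 - \<delta> / 4) ^ m) \<le> \<beta> (Suc s) / 4"
    and st3: "\<And>s. 1 \<le> s \<Longrightarrow> s < t \<Longrightarrow> (1 / 4) ^ u * (1 + 3 * (2 * Eb (Suc s) / (n * Eb s))) ^ m \<le> \<beta> (Suc s) / 4"
    and st4: "\<And>s. 1 \<le> s \<Longrightarrow> s < t \<Longrightarrow> m / u * \<beta> s \<le> \<beta> (Suc s) / 4"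
  shows "1 \<le> s \<Longrightarrow> s \<le> t \<Longrightarrow> M \<in> strings (carrier F) (k ^ s) \<Longrightarrow> zone (carrier F) l S z (n ^ s) \<Longrightarrow>
    errs S z s M \<le> Eb s \<Longrightarrow> (\<Sum>y<k ^ (s - 1). badprob D S s z M y) \<le> \<beta> s * k ^ (s - 1)"
proof (induction s arbitrary: z M rule: induct_nat_012)
  case 1
  have "clo S 0 z M y" for y by (rule clo_base) (use 1 base in auto)
  then show ?case using base by (simp add: badprob_def)
next
  case (ge2 s)
  have s: "1 \<le> Suc s" "Suc s < t" using ge2.prems by auto
  let ?p = "2 * Eb (Suc (Suc s)) / (n * Eb (Suc s))"
  have "(\<Sum>y<k ^ Suc s. badprob D S (Suc (Suc s)) z M y) \<le> errs S z (Suc (Suc s)) M / (\<alpha> * n) +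
    k ^ Suc s * (L * (2 ^ (2 * \<theta>) * (1 - \<delta> / 4) ^ m) + (1 / 4) ^ u * (1 + 3 * ?p) ^ m + m / u * \<beta> (Suc s))"
  proof (rule badprob_step[OF D dist ge2.prems(3,4) \<alpha> u])
    show "0 < Eb (Suc s)" "0 \<le> \<beta> (Suc s)" using pos[of "Suc s"] s by auto
    then show "2 * errs S z (Suc (Suc s)) M / (n * Eb (Suc s)) \<le> ?p"
      using ge2.prems(5) npos by (intro divide_right_mono) auto
    show "(\<Sum>y<k ^ s. badprob D S (Suc s) z' M' y) \<le> \<beta> (Suc s) * k ^ s"
      if "M' \<in> strings (carrier F) (k ^ Suc s)" "zone (carrier F) l S z' (n ^ Suc s)" "errs S z' (Suc s) M' \<le> Eb (Suc s)"
      for z' M'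
      using ge2.IH(2)[OF _ _ that] s by simp
  qed
  also have "\<dots> \<le> \<beta> (Suc (Suc s)) / 4 * k ^ Suc s + k ^ Suc s * (\<beta> (Suc (Suc s)) / 4 + \<beta> (Suc (Suc s)) / 4 + \<beta> (Suc (Suc s)) / 4)"
  proof (intro add_mono mult_left_mono)
    have "errs S z (Suc (Suc s)) M / (\<alpha> * n) \<le> Eb (Suc (Suc s)) / (\<alpha> * n)"
      using ge2.prems(5) \<alpha> npos by (intro divide_right_mono) auto
    also have "\<dots> \<le> \<beta> (Suc (Suc s)) / 4 * k ^ Suc s" by (rule st1[OF s])
    finally show "errs S z (Suc (Suc s)) M / (\<alpha> * n) \<le> \<beta> (Suc (Suc s)) / 4 * k ^ Suc s" .
  qed (use st2[OF s] st3[OF s] st4[OF s] in auto)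
  also have "\<dots> = \<beta> (Suc (Suc s)) * k ^ Suc s" by (simp add: field_simps)
  finally show ?case by simp
qed simp

end

section \<open>The preprocessing\<close>

fun unif :: "nat \<Rightarrow> nat pmf" where
  "unif 0 = return_pmf 0"
| "unif (Suc q) = bind_pmf (bernoulli_pmf (1/2)) (\<lambda>b. map_pmf (\<lambda>u. 2 * u + of_bool b) (unif q))"

lemma prob_unif: "measure_pmf.prob (unif q) X = card (X \<inter> {..<2 ^ q}) / 2 ^ q"
proof (induction q arbitrary: X)
  case 0
  then show ?case by (auto simp: indicator_def lessThan_Suc)
next
  case (Suc q)
  let ?A = "\<lambda>b. {u. 2 * u + of_bool b \<in> X} \<inter> {..<2 ^ q}"
  have "X \<inter> {..<2 ^ Suc q} = (\<lambda>u. 2 * u) ` ?A False \<union> (\<lambda>u. 2 * u + 1) ` ?A True"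
  proof
    show "X \<inter> {..<2 ^ Suc q} \<subseteq> (\<lambda>u. 2 * u) ` ?A False \<union> (\<lambda>u. 2 * u + 1) ` ?A True"
    proof
      fix v assume v: "v \<in> X \<inter> {..<2 ^ Suc q}"
      show "v \<in> (\<lambda>u. 2 * u) ` ?A False \<union> (\<lambda>u. 2 * u + 1) ` ?A True"
      proof (cases "even v")
        case True
        then obtain w where "v = 2 * w" by blast
        then show ?thesis using v by auto
      next
        case False
        then obtain w where "v = 2 * w + 1" using oddE by blast
        then show ?thesis using v by auto
      qed
    qed
  qed auto
  moreover have "card ((\<lambda>u. 2 * u) ` ?A False \<union> (\<lambda>u. 2 * u + 1) ` ?A True) =
      card ((\<lambda>u. 2 * u) ` ?A False) + card ((\<lambda>u. 2 * u + 1) ` ?A True)"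
    by (rule card_Un_disjoint) (auto, presburger)
  moreover have "card ((\<lambda>u. 2 * u) ` ?A False) = card (?A False)" "card ((\<lambda>u. 2 * u + 1) ` ?A True) = card (?A True)"
    by (rule card_image, simp add: inj_on_def)+
  ultimately have c: "card (X \<inter> {..<2 ^ Suc q}) = card (?A False) + card (?A True)" by simp
  have "measure_pmf.prob (unif (Suc q)) X =
      measure_pmf.expectation (bernoulli_pmf (1/2)) (\<lambda>b. card (?A b) / 2 ^ q)"
    by (simp add: prob_bind_pmf measure_map_pmf vimage_def Suc.IH)
  also have "\<dots> = (card (?A True) + card (?A False)) / 2 ^ Suc q"
    by (simp add: field_simps)
  finally show ?case using c by simp
qed

definition samp :: "nat \<Rightarrow> nat \<Rightarrow> nat pmf" where
  "samp q n = map_pmf (\<lambda>u. u mod n) (unif q)"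

text \<open>A bounded number of fair coins gives an exactly uniform row only for powers of 2.
  Reducing \<open>q\<close> random bits modulo \<open>n\<close> gives every residue \<open>Q\<close>
  or \<open>Suc Q\<close> preimages, and \<open>1 \<le> Q\<close> makes this uniform up to a factor
  2.\<close>

lemma samp_bounds:
  assumes n: "0 < n" "n \<le> 2 ^ q"
  shows "set_pmf (samp q n) \<subseteq> {..<n}"
    "\<And>E. E \<subseteq> {..<n} \<Longrightarrow> real (card E) / real (2 * n) \<le> measure_pmf.prob (samp q n) E"
    "\<And>E. E \<subseteq> {..<n} \<Longrightarrow> measure_pmf.prob (samp q n) E \<le> real (2 * card E) / real n"
proof -
  show "set_pmf (samp q n) \<subseteq> {..<n}" using n by (auto simp: samp_def)
  define Q where "Q = 2 ^ q div n"
  have Q1: "1 \<le> Q" using n by (simp add: Q_def Suc_le_eq div_greater_zero_iff)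
  have Q: "Q * n \<le> 2 ^ q" "2 ^ q < Suc Q * n"
    using dividend_less_div_times[OF n(1), of "2 ^ q"] by (auto simp: Q_def algebra_simps)
  have main: "real (card E) / (2 * real n) \<le> measure_pmf.prob (samp q n) E \<and> measure_pmf.prob (samp q n) E \<le> 2 * real (card E) / real n"
    if E: "E \<subseteq> {..<n}" for E
  proof -
  have finE: "finite E" using E by (meson finite_lessThan finite_subset)
  define X where "X = {u. u mod n \<in> E} \<inter> {..<2 ^ q}"
  have prob: "measure_pmf.prob (samp q n) E = card X / 2 ^ q"
    by (simp add: samp_def measure_map_pmf prob_unif X_def vimage_def)
  have "inj_on (\<lambda>(a, j). j * n + a) (E \<times> {..<N})" for N
  proof (rule inj_onI, clarsimp)
    fix a j a' j' assume a: "a \<in> E" "a' \<in> E" and eq: "j * n + a = j' * n + a'"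
    have "a < n" "a' < n" using a E by auto
    then have "j = j'" using div_mult_add_less[of a n j] div_mult_add_less[of a' n j'] eq by simp
    then show "a = a' \<and> j = j'" using eq by simp
  qed
  then have c: "card ((\<lambda>(a, j). j * n + a) ` (E \<times> {..<N})) = card E * N" for N
    by (simp add: card_image card_cartesian_product)
  have "(\<lambda>(a, j). j * n + a) ` (E \<times> {..<Q}) \<subseteq> X"
  proof clarsimp
    fix a j assume a: "a \<in> E" and j: "j < Q"
    have "a < n" using a E by auto
    then have "j * n + a < Suc j * n" by simp
    also have "\<dots> \<le> Q * n" using j by (intro mult_le_mono1) simp
    finally show "j * n + a \<in> X" using Q \<open>a < n\<close> a by (simp add: X_def)
  qed
  then have lo: "card E * Q \<le> card X" unfolding c[symmetric] by (intro card_mono) (auto simp: X_def)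
  have "X \<subseteq> (\<lambda>(a, j). j * n + a) ` (E \<times> {..<Suc Q})"
  proof
    fix v assume v: "v \<in> X"
    then have "v div n < Suc Q" using Q(2) by (auto simp: X_def intro: less_mult_imp_div_less)
    moreover have "v div n * n + v mod n = v" by (rule div_mult_mod_eq)
    ultimately have "v = (\<lambda>(a, j). j * n + a) (v mod n, v div n)" "(v mod n, v div n) \<in> E \<times> {..<Suc Q}"
      using v by (auto simp: X_def)
    then show "v \<in> (\<lambda>(a, j). j * n + a) ` (E \<times> {..<Suc Q})" by blast
  qed
  then have hi: "card X \<le> card E * Suc Q" unfolding c[symmetric] by (intro card_mono) (use finE in auto)
  have "(2::nat) ^ q \<le> 2 * Q * n"
  proof -
    have "Suc Q * n \<le> 2 * Q * n" using Q1 by (intro mult_le_mono1) simp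
    then show ?thesis using Q(2) by linarith
  qed
  then have q1: "(2::real) ^ q \<le> 2 * real Q * n"
    by (metis of_nat_le_iff of_nat_mult of_nat_numeral of_nat_power)
  have q2: "real Q * n \<le> 2 ^ q" using Q(1) by (metis of_nat_le_iff of_nat_mult of_nat_numeral of_nat_power)
  have lo': "real (card E) * Q \<le> card X" using lo by (metis of_nat_le_iff of_nat_mult)
  have "real (card E) * 2 ^ q \<le> real (card E) * (2 * real Q * n)" using q1 by (intro mult_left_mono) auto
  also have "\<dots> = 2 * n * (real (card E) * Q)" by simp
  also have "\<dots> \<le> 2 * n * real (card X)" using lo' by (intro mult_left_mono) auto
  finally have 1: "real (card E) / (2 * real n) \<le> measure_pmf.prob (samp q n) E"
    using n by (simp add: prob field_simps)
  have "card E * Suc Q \<le> card E * (2 * Q)" using Q1 by (intro mult_le_mono2) simp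
  with hi have "card X \<le> card E * (2 * Q)" by (rule order_trans)
  then have "real (card X) \<le> real (card E * (2 * Q))" by (simp only: of_nat_le_iff)
  then have "real (card X) * n \<le> real (card E * (2 * Q)) * n" by (intro mult_right_mono) auto
  also have "\<dots> \<le> 2 * real (card E) * 2 ^ q" using mult_left_mono[OF q2, of "2 * real (card E)"] by (simp add: mult_ac)
  finally have "measure_pmf.prob (samp q n) E \<le> 2 * real (card E) / real n"
    using n by (simp add: prob field_simps)
  with 1 show ?thesis by simp
  qed
  show "real (card E) / real (2 * n) \<le> measure_pmf.prob (samp q n) E"
    "measure_pmf.prob (samp q n) E \<le> real (2 * card E) / real n" if "E \<subseteq> {..<n}" for E
    using main[OF that] by simp_all
qed

text \<open>A decision tree over \<open>q\<close> coins whose leaves load constants, so reduction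
  modulo \<open>n\<close> and multiplication by the stride happen in the program text. All branches
  take the same time, and the leaves reset the scratch variables, so the final state depends on
  \<open>f u\<close> alone.\<close>

primrec sampler :: "nat \<Rightarrow> nat \<Rightarrow> nat \<Rightarrow> nat \<Rightarrow> (nat \<Rightarrow> nat) \<Rightarrow> com" where
  "sampler v b z 0 f = seqs [Const v (f 0), Const b 0, Const z 0]"
| "sampler v b z (Suc q) f = seqs [Toss b, Const z 0,
     Cond (Eq b z) (sampler v b z q (\<lambda>u. f (2 * u))) (sampler v b z q (\<lambda>u. f (2 * u + 1)))]"

definition fin :: "nat \<Rightarrow> nat \<Rightarrow> nat \<Rightarrow> nat \<Rightarrow> state \<Rightarrow> state" where
  "fin v b z a s = put z 0 0 (put b 0 0 (put v 0 a s))"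

lemma steps_sampler:
  assumes "v \<noteq> b" "v \<noteq> z" "b \<noteq> z"
  shows "steps F orc (5 * q + 5) (sampler v b z q f # cs, s) =
    map_pmf (\<lambda>u. (cs, fin v b z (f u) s)) (unif q)"
proof (induction q arbitrary: f s)
  case 0
  then show ?case by (simp add: numeral_eq_Suc bind_return_pmf fin_def)
next
  case (Suc q)
  have [simp]: "put z 0 0 (put b 0 0 (put v 0 a (put z 0 0 (put b 0 c s)))) =
      put z 0 0 (put b 0 0 (put v 0 a s))" for a c s
    using assms by (auto simp: put_def fun_eq_iff intro!: state.equality)
  have five: "5 * Suc q + 5 = Suc (Suc (Suc (Suc (Suc (5 * q + 5)))))" by simp
  have "steps F orc (5 * Suc q + 5) (sampler v b z (Suc q) f # cs, s) =
      bind_pmf (bernoulli_pmf (1/2)) (\<lambda>c. steps F orc (5 * q + 5)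
        (sampler v b z q (\<lambda>u. f (2 * u + of_bool c)) # cs, put z 0 0 (put b 0 (of_bool c) s)))"
    unfolding five steps.simps(2)
    by (auto simp del: steps.simps(2) simp add: steps.simps(2) bind_return_pmf bind_map_pmf var_def assms intro!: bind_pmf_cong)
  also have "\<dots> = bind_pmf (bernoulli_pmf (1/2)) (\<lambda>c. map_pmf (\<lambda>u. (cs, fin v b z (f (2 * u + of_bool c)) s)) (unif q))"
    by (intro bind_pmf_cong refl) (simp add: Suc.IH fin_def)
  finally show ?case by (simp add: map_bind_pmf pmf.map_comp o_def)
qed

definition wgt :: "nat \<Rightarrow> nat \<Rightarrow> nat \<Rightarrow> nat" where
  "wgt n m e = n ^ Suc (e div m)"

fun fins :: "nat \<Rightarrow> nat \<Rightarrow> nat \<Rightarrow> nat \<Rightarrow> nat list \<Rightarrow> state \<Rightarrow> state" where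
  "fins n m N0 0 rs s = s"
| "fins n m N0 (Suc N) rs s = fin N (N0 + 1) (N0 + 2) (rs ! N * wgt n m N) (fins n m N0 N rs s)"

lemma fins_append: "N \<le> length xs \<Longrightarrow> fins n m N0 N (xs @ ys) s = fins n m N0 N xs s"
  by (induction N) (auto simp: nth_append)

lemma steps_samplers:
  assumes "N \<le> N0"
  shows "steps F orc (N * (5 * q + 6) + 1)
      (loop N (\<lambda>e. sampler e (N0 + 1) (N0 + 2) q (\<lambda>u. (u mod n) * wgt n m e)) # cs, s) =
    map_pmf (\<lambda>rs. (cs, fins n m N0 N rs s)) (replicate_pmf N (samp q n))"
  using assms
proof (induction N arbitrary: cs)
  case 0
  then show ?case by (simp add: bind_return_pmf)
next
  case (Suc N)
  let ?b = "\<lambda>e. sampler e (N0 + 1) (N0 + 2) q (\<lambda>u. (u mod n) * wgt n m e)"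
  have n: "Suc N * (5 * q + 6) + 1 = Suc ((N * (5 * q + 6) + 1) + (5 * q + 5))" by simp
  have "steps F orc (Suc N * (5 * q + 6) + 1) (loop (Suc N) ?b # cs, s) =
      bind_pmf (steps F orc (N * (5 * q + 6) + 1) (loop N ?b # ?b N # cs, s)) (steps F orc (5 * q + 5))"
    unfolding n by (subst steps_add[symmetric], simp only: steps.simps loop.simps step.simps bind_return_pmf)
  also have "\<dots> = bind_pmf (replicate_pmf N (samp q n)) (\<lambda>rs. steps F orc (5 * q + 5) (?b N # cs, fins n m N0 N rs s))"
    using Suc by (simp add: bind_map_pmf)
  also have "\<dots> = bind_pmf (replicate_pmf N (samp q n)) (\<lambda>rs. bind_pmf (samp q n) (\<lambda>r.
      return_pmf (cs, fin N (N0 + 1) (N0 + 2) (r * wgt n m N) (fins n m N0 N rs s))))"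
    using Suc.prems by (subst steps_sampler) (auto simp: samp_def map_pmf_def[symmetric] pmf.map_comp o_def)
  also have "\<dots> = map_pmf (\<lambda>rs. (cs, fins n m N0 (Suc N) rs s)) (replicate_pmf (N + 1) (samp q n))"
    unfolding replicate_pmf_distrib replicate_pmf_1 map_bind_pmf bind_map_pmf
    by (intro bind_pmf_cong refl)
      (auto simp: replicate_pmf_1 bind_map_pmf fins_append nth_append dest!: replicate_pmf_support)
  finally show ?case by simp
qed

lemma fins_facts:
  assumes "N \<le> N0"
  shows "e < N \<Longrightarrow> var (fins n m N0 N rs s) e = rs ! e * wgt n m e"
    "items (fins n m N0 N rs s) = items s" "current (fins n m N0 N rs s) = current s"
  using assms by (induction N) (auto simp: fin_def var_def less_Suc_eq)

definition emitdesc :: "nat \<Rightarrow> nat \<Rightarrow> nat list \<Rightarrow> com" where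
  "emitdesc k N0 adv = seqs [loop N0 Emit,
     loop (length adv) (\<lambda>j. Seq (Const N0 (adv ! j * k)) (Emit N0)), EndItem]"

definition emitall :: "nat \<Rightarrow> nat \<Rightarrow> nat list list \<Rightarrow> com" where
  "emitall k N0 advs = foldr (\<lambda>adv. Seq (emitdesc k N0 adv)) advs Skip"

lemma exec_emitdesc:
  assumes "current s = []"
  shows "items (exec F orc (emitdesc k N0 adv) s) =
      items s @ [map (var s) [0..<N0] @ map (\<lambda>j. adv ! j * k) [0..<length adv]]"
    "current (exec F orc (emitdesc k N0 adv) s) = []"
    "e < N0 \<Longrightarrow> var (exec F orc (emitdesc k N0 adv) s) e = var s e"
proof -
  define I1 where "I1 N st \<longleftrightarrow> items st = items s \<and> current st = map (var s) [0..<N] \<and> memory st = memory s"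
    for N and st :: state
  define s1 where "s1 = exec F orc (loop N0 Emit) s"
  have 1: "I1 N0 s1"
    unfolding s1_def by (rule loop_inv) (auto simp: I1_def assms var_def)
  define I2 where "I2 N st \<longleftrightarrow> items st = items s \<and>
      current st = map (var s) [0..<N0] @ map (\<lambda>j. adv ! j * k) [0..<N] \<and> (\<forall>e<N0. var st e = var s e)"
    for N and st :: state
  define s2 where "s2 = exec F orc (loop (length adv) (\<lambda>j. Seq (Const N0 (adv ! j * k)) (Emit N0))) s1"
  have 2: "I2 (length adv) s2"
    unfolding s2_def
  proof (rule loop_inv)
    show "I2 0 s1" using 1 by (simp add: I1_def I2_def var_def)
  qed (auto simp: I2_def var_def)
  have "exec F orc (emitdesc k N0 adv) s = s2\<lparr>current := [], items := items s2 @ [current s2]\<rparr>"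
    by (simp add: emitdesc_def s1_def s2_def)
  then show "items (exec F orc (emitdesc k N0 adv) s) =
      items s @ [map (var s) [0..<N0] @ map (\<lambda>j. adv ! j * k) [0..<length adv]]"
    "current (exec F orc (emitdesc k N0 adv) s) = []"
    "e < N0 \<Longrightarrow> var (exec F orc (emitdesc k N0 adv) s) e = var s e"
    using 2 by (auto simp: I2_def var_def)
qed

lemma exec_emitall:
  assumes "current s = []"
  shows "items (exec F orc (emitall k N0 advs) s) =
      items s @ map (\<lambda>adv. map (var s) [0..<N0] @ map (\<lambda>j. adv ! j * k) [0..<length adv]) advs"
  using assms
proof (induction advs arbitrary: s)
  case (Cons adv advs)
  define s1 where "s1 = exec F orc (emitdesc k N0 adv) s"
  note e = exec_emitdesc[OF Cons.prems, where F=F and orc=orc and k=k and ?N0.0=N0 and adv=adv, folded s1_def]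
  have "map (var s1) [0..<N0] = map (var s) [0..<N0]" using e(3) by simp
  then show ?case using Cons.IH[OF e(2)] e(1) by (simp add: emitall_def s1_def[symmetric])
qed (simp add: emitall_def)

lemma loop_determ: "(\<And>i. i < N \<Longrightarrow> determ (body i)) \<Longrightarrow> determ (loop N body)"
  by (induction N) auto

lemma loop_tm: "(\<And>i. i < N \<Longrightarrow> tm (body i) \<le> B) \<Longrightarrow> tm (loop N body) \<le> N * Suc B + 1"
proof (induction N)
  case (Suc N)
  have "tm (loop N body) \<le> N * Suc B + 1" "tm (body N) \<le> B" using Suc by auto
  then show ?case by simp
qed simp

lemma emitall_cost:
  assumes "\<And>adv. adv \<in> set advs \<Longrightarrow> length adv = Lf"
  shows "determ (emitall k N0 advs)" "tm (emitall k N0 advs) \<le> length advs * (2 * N0 + 4 * Lf + 10) + 1"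
proof -
  have d: "determ (emitdesc k N0 adv)" for adv
    by (auto simp: emitdesc_def intro!: loop_determ)
  have c: "tm (emitdesc k N0 adv) \<le> 2 * N0 + 4 * length adv + 7" for adv
    using loop_tm[of N0 Emit 1] loop_tm[of "length adv" "\<lambda>j. Seq (Const N0 (adv ! j * k)) (Emit N0)" 3]
    by (simp add: emitdesc_def)
  show "determ (emitall k N0 advs)" by (induction advs) (simp_all add: emitall_def d)
  show "tm (emitall k N0 advs) \<le> length advs * (2 * N0 + 4 * Lf + 10) + 1"
    using assms
  proof (induction advs)
    case (Cons adv advs)
    have "tm (emitall k N0 (adv # advs)) = 1 + tm (emitdesc k N0 adv) + tm (emitall k N0 advs)"
      by (simp add: emitall_def)
    moreover have "tm (emitall k N0 advs) \<le> length advs * (2 * N0 + 4 * Lf + 10) + 1"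
      using Cons by simp
    moreover have "length adv = Lf" using Cons.prems by simp
    ultimately show ?case using c[of adv] by simp
  qed (simp add: emitall_def)
qed

section \<open>The output of a list recovery program\<close>

definition inp :: "nat \<Rightarrow> (nat \<Rightarrow> nat set) \<Rightarrow> nat list" where
  "inp n f = concat (map (\<lambda>p. sorted_list_of_set (f p)) [0..<n])"

lemma lister_set:
  assumes P: "list_recovery_alg F k n C \<alpha> l P T" and f: "f \<in> list_strings (carrier F) l n"
  shows "distinct (lister F T P (inp n f))"
    "set (lister F T P (inp n f)) = (\<lambda>x. map x [0..<k]) ` close_messages (carrier F) k n C \<alpha> f"
proof -
  have "input_array (inp n f) (imem (inp n f))" by (simp add: input_array_def imem_def)
  moreover have "(dstep F ^^ T) ([P], start (inp n f)) \<in> set_pmf (run F no_oracle T P (imem (inp n f)))"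
    unfolding run_def start_def by (rule dsteps_in_steps)
  ultimately show "distinct (lister F T P (inp n f))"
    "set (lister F T P (inp n f)) = (\<lambda>x. map x [0..<k]) ` close_messages (carrier F) k n C \<alpha> f"
    using P f unfolding list_recovery_alg_def lister_def inp_def by fastforce+
qed

lemma dstep_output:
  "length (concat (items (snd (dstep F cfg)))) + length (items (snd (dstep F cfg))) + length (current (snd (dstep F cfg)))
   \<le> length (concat (items (snd cfg))) + length (items (snd cfg)) + length (current (snd cfg)) + 1"
proof (cases cfg)
  case (Pair cs s)
  then show ?thesis
  proof (cases cs)
    case (Cons c cs')
    then show ?thesis unfolding Pair by (cases c) auto
  qed (simp add: Pair)
qed

text \<open>A step emits at most one symbol or closes one item, so no program is faster than the
  size of its output. This is what allows the work on the recovered list to be charged to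
  \<open>T\<close>.\<close>

lemma lister_time:
  assumes "\<forall>x\<in>set (lister F T P xs). length x = k"
  shows "length (lister F T P xs) * (k + 1) \<le> T"
proof -
  have "length (concat (items (snd ((dstep F ^^ N) cfg)))) + length (items (snd ((dstep F ^^ N) cfg))) +
      length (current (snd ((dstep F ^^ N) cfg)))
      \<le> length (concat (items (snd cfg))) + length (items (snd cfg)) + length (current (snd cfg)) + N" for N cfg
  proof (induction N)
    case (Suc N)
    then show ?case using dstep_output[of F "(dstep F ^^ N) cfg"] by simp
  qed simp
  from this[of T "([P], start xs)"] have "length (concat (lister F T P xs)) + length (lister F T P xs) \<le> T"
    by (simp add: lister_def start_def)
  then show ?thesis by (simp add: length_concat_equal[OF assms])
qed

text \<open>All sets have the same size, so the concatenation can be cut apart again.\<close>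

lemma inp_inj:
  assumes "f \<in> list_strings A l n" "f' \<in> list_strings A l n" "finite A" "inp n f = inp n f'"
  shows "f = f'"
proof -
  have "f i = f' i" if i: "i < n" for i
  proof -
    have l: "finite (g i) \<and> card (g i) = l" if "g \<in> list_strings A l n" "i < n" for g i
      using that assms(3) by (auto simp: list_strings_def dest!: PiE_mem intro: finite_subset)
    have s: "sorted_list_of_set (g i) ! j = inp n g ! (i * l + j)" if g: "g \<in> list_strings A l n" and j: "j < l" for g j
    proof -
      have "\<forall>x\<in>set (map (\<lambda>p. sorted_list_of_set (g p)) [0..<n]). length x = l" using l[OF g] by auto
      from nth_concat_equal[OF this, of i j] show ?thesis using i j by (simp add: inp_def)
    qed
    have "sorted_list_of_set (f i) = sorted_list_of_set (f' i)"
      by (rule nth_equalityI) (use l[OF assms(1) i] l[OF assms(2) i] s[OF assms(1)] s[OF assms(2)] assms(4) in auto)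
    then show ?thesis using l[OF assms(1) i] l[OF assms(2) i] by (metis sorted_list_of_set.set_sorted_key_list_of_set)
  qed
  then show ?thesis using assms(1,2) unfolding list_strings_def by (intro PiE_ext) auto
qed

primrec matchcom :: "nat list \<Rightarrow> nat \<Rightarrow> com \<Rightarrow> com \<Rightarrow> com" where
  "matchcom [] r c d = c"
| "matchcom (v # vs) r c d = seqs [Const 2 r, Load 3 1 2, Const 4 v, Cond (Eq 3 4) (matchcom vs (Suc r) c d) d]"

primrec emitlists :: "nat list list \<Rightarrow> com" where
  "emitlists [] = Skip"
| "emitlists (x # xs) = seqs [loop (length x) (\<lambda>j. Seq (Const 2 (x ! j)) (Emit 2)), EndItem, emitlists xs]"

lemma exec_matchcom:
  "\<exists>s'. exec F orc (matchcom vs r c d) s = exec F orc (if \<forall>j<length vs. memory s 1 (r + j) = vs ! j then c else d) s' \<and>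
     memory s' 1 = memory s 1 \<and> items s' = items s \<and> current s' = current s"
proof (induction vs arbitrary: r s)
  case (Cons v vs)
  define s1 where "s1 = put 4 0 v (put 3 0 (memory s 1 r) (put 2 0 r s))"
  have all: "(\<forall>j<length (v # vs). memory s 1 (r + j) = (v # vs) ! j) \<longleftrightarrow>
      memory s 1 r = v \<and> (\<forall>j<length vs. memory s 1 (Suc r + j) = vs ! j)"
    by (auto simp: All_less_Suc2)
  have ex: "exec F orc (matchcom (v # vs) r c d) s =
      (if memory s 1 r = v then exec F orc (matchcom vs (Suc r) c d) s1 else exec F orc d s1)"
    by (simp add: s1_def var_def)
  have s1: "memory s1 1 = memory s 1" "items s1 = items s" "current s1 = current s" by (simp_all add: s1_def)
  show ?case
  proof (cases "memory s 1 r = v")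
    case True
    then show ?thesis unfolding all ex using Cons.IH[of "Suc r" s1] s1 by auto
  next
    case False
    then show ?thesis unfolding all ex using s1 by auto
  qed
qed auto

lemma exec_emitlists: "current s = [] \<Longrightarrow> items (exec F orc (emitlists xs) s) = items s @ xs"
proof (induction xs arbitrary: s)
  case (Cons x xs)
  define I where "I N st \<longleftrightarrow> items st = items s \<and> current st = take N x" for N and st :: state
  define s1 where "s1 = exec F orc (loop (length x) (\<lambda>j. Seq (Const 2 (x ! j)) (Emit 2))) s"
  have "I (length x) s1"
    unfolding s1_def by (rule loop_inv) (auto simp: I_def Cons.prems var_def take_Suc_conv_app_nth)
  then have "items s1 = items s" "current s1 = x" by (auto simp: I_def)
  then show ?case using Cons.IH[of "s1\<lparr>current := [], items := items s @ [x]\<rparr>"] by (simp add: s1_def[symmetric])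
qed simp

lemma determ_emitlists: "determ (emitlists xs)"
  by (induction xs) (auto intro!: loop_determ)

lemma determ_matchcom: "determ c \<Longrightarrow> determ d \<Longrightarrow> determ (matchcom vs r c d)"
  by (induction vs arbitrary: r) auto

primrec tablecom :: "(nat list \<Rightarrow> nat list list) \<Rightarrow> nat list list \<Rightarrow> com" where
  "tablecom g [] = Skip"
| "tablecom g (vs # rest) = matchcom vs 0 (emitlists (g vs)) (tablecom g rest)"

lemma determ_tablecom: "determ (tablecom g vss)"
  by (induction vss) (auto intro!: determ_matchcom determ_emitlists)

lemma exec_tablecom:
  assumes "xs \<in> set vss" "\<And>vs. vs \<in> set vss \<Longrightarrow> length vs = length xs" "\<forall>r<length xs. memory s 1 r = xs ! r"
    "items s = []" "current s = []"
  shows "items (exec F orc (tablecom g vss) s) = g xs"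
  using assms
proof (induction vss arbitrary: s)
  case (Cons vs rest)
  have eq: "(\<forall>j<length vs. memory s 1 (0 + j) = vs ! j) \<longleftrightarrow> vs = xs"
    using Cons.prems(2)[of vs] Cons.prems(3) by (auto simp: list_eq_iff_nth_eq)
  obtain s' where s': "exec F orc (tablecom g (vs # rest)) s =
      exec F orc (if vs = xs then emitlists (g vs) else tablecom g rest) s'"
    "memory s' 1 = memory s 1" "items s' = items s" "current s' = current s"
    using exec_matchcom[of F orc vs 0 "emitlists (g vs)" "tablecom g rest" s] unfolding eq tablecom.simps by blast
  show ?case
  proof (cases "vs = xs")
    case True
    have "current s' = []" "items s' = []" using s'(3,4) Cons.prems(4,5) by simp_all
    then show ?thesis unfolding s'(1) using True exec_emitlists[of s' F orc "g vs"] by simp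
  next
    case False
    have "items (exec F orc (tablecom g rest) s') = g xs"
    proof (rule Cons.IH)
      show "xs \<in> set rest" using Cons.prems(1) False by simp
      show "\<And>vs. vs \<in> set rest \<Longrightarrow> length vs = length xs" using Cons.prems(2) by simp
      show "\<forall>r<length xs. memory s' 1 r = xs ! r" using Cons.prems(3) s'(2) by (simp only: simp_thms)
    qed (use s'(3,4) Cons.prems(4,5) in simp_all)
    then show ?thesis unfolding s'(1) using False by simp
  qed
qed simp

text \<open>List recoverability is a combinatorial property and comes without an algorithm, yet a
  local algorithm is claimed to exist. As there are only finitely many inputs, a lookup table
  serves; its running time does not enter the bounds on queries, list size and
  preprocessing.\<close>

lemma list_recovery_alg_exists:
  assumes fin: "finite (carrier F)"
  shows "\<exists>P T. list_recovery_alg F k n C \<alpha> l P T"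
proof -
  define LS where "LS = list_strings (carrier F) l n"
  have fLS: "finite LS" 
    unfolding LS_def list_strings_def
    by (rule finite_PiE, simp) (rule finite_subset[OF _ finite_Pow_iff[THEN iffD2, OF fin]], blast)
  obtain vss where vss: "set vss = inp n ` LS"
    using finite_list[OF finite_imageI[OF fLS, of "inp n"]] by blast
  define close where "close f = close_messages (carrier F) k n C \<alpha> f" for f
  have fcl: "finite (close f)" for f
    by (rule finite_subset[OF _ finite_strings[OF fin]]) (auto simp: close_def close_messages_def)
  have "\<exists>ys. distinct ys \<and> set ys = (\<lambda>x. map x [0..<k]) ` close f" for f
    using finite_distinct_list[OF finite_imageI[OF fcl[of f], of "\<lambda>x. map x [0..<k]"]] by blast
  then obtain outs where outs: "\<And>f. distinct (outs f) \<and> set (outs f) = (\<lambda>x. map x [0..<k]) ` close f"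
    using choice[of "\<lambda>f ys. distinct ys \<and> set ys = (\<lambda>x. map x [0..<k]) ` close f"] by blast
  define g where "g vs = outs (inv_into LS (inp n) vs)" for vs
  have "inj_on (inp n) LS" unfolding LS_def by (rule inj_onI) (rule inp_inj[OF _ _ fin])
  then have g: "g (inp n f) = outs f" if "f \<in> LS" for f using that by (simp add: g_def)
  define P where "P = tablecom g vss"
  have "length (inp n f) = n * l" if "f \<in> LS" for f
  proof -
    have "\<forall>x\<in>set (map (\<lambda>p. sorted_list_of_set (f p)) [0..<n]). length x = l"
      using that by (auto simp: LS_def list_strings_def dest!: PiE_mem)
    then show ?thesis using length_concat_equal[of "map (\<lambda>p. sorted_list_of_set (f p)) [0..<n]" l] by (simp add: inp_def)
  qed
  then have len: "length vs = length (inp n f)" if "vs \<in> set vss" "f \<in> LS" for vs f using that vss by auto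
  have "list_recovery_alg F k n C \<alpha> l P (tm P)"
    unfolding list_recovery_alg_def inp_def[symmetric]
  proof (intro ballI allI impI)
    fix f m x assume f: "f \<in> list_strings (carrier F) l n" and m: "input_array (inp n f) m"
      and x: "x \<in> set_pmf (run F no_oracle (tm P) P m)"
    have fL: "f \<in> LS" using f by (simp add: LS_def)
    define s where "s = \<lparr>memory = m, queries = 0, current = [], items = []\<rparr>"
    have "run F no_oracle (tm P) P m = return_pmf ([], exec F no_oracle P s)"
      unfolding run_def s_def by (rule steps_determ_halts) (simp_all add: P_def determ_tablecom)
    then have xe: "x = ([], exec F no_oracle P s)" using x by simp
    have "items (exec F no_oracle P s) = g (inp n f)"
      unfolding P_def
    proof (rule exec_tablecom)
      show "inp n f \<in> set vss" using fL vss by blast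
      show "\<And>vs. vs \<in> set vss \<Longrightarrow> length vs = length (inp n f)" using len[OF _ fL] .
      show "\<forall>r<length (inp n f). memory s 1 r = inp n f ! r" using m by (simp add: s_def input_array_def)
    qed (simp_all add: s_def)
    then have it: "items (exec F no_oracle P s) = outs f" by (simp only: g[OF fL])
    show "case x of (cs, s) \<Rightarrow> cs = [] \<and> distinct (items s) \<and>
        set (items s) = (\<lambda>x. map x [0..<k]) ` close_messages (carrier F) k n C \<alpha> f"
      unfolding xe using outs[of f] by (simp only: it close_def split simp_thms)
  qed
  then show ?thesis by blast
qed

section \<open>Assembling the local list recovery algorithm\<close>

context decoder
begin

text \<open>The simulated oracle has to be a string over the field even where decoding fails, since
  a local decoder keeps its bounds on time and queries only for such strings.\<close>

lemma dec_carrier: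
  assumes "zone (carrier F) l S z (n ^ s)"
  shows "dec F G k n m \<theta> lst rs J S s off z y \<in> carrier F"
proof -
  have mem: "x ! a \<in> carrier F" if "x \<in> set (lst (fib k n S (Suc s') z y))" "a < k" "s = Suc s'" for x a s'
  proof -
    have "fib k n S (Suc s') z y \<in> list_strings (carrier F) l n"
      by (rule fib_list_strings) (use assms that in simp)
    then have "x \<in> (\<lambda>x. map x [0..<k]) ` close_messages (carrier F) k n C \<alpha> (fib k n S (Suc s') z y)"
      using lst that(1) by blast
    then obtain x' where "x' \<in> strings (carrier F) k" "x = map x' [0..<k]"
      by (auto simp: close_messages_def)
    then show ?thesis using that(2) strings_mem by auto
  qed
  have pick: "pick F G k m \<theta> xs R v a \<in> carrier F" if "\<And>x. x \<in> set xs \<Longrightarrow> x ! a \<in> carrier F" for xs R v a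
    unfolding pick_def using that by (induction xs rule: rev_induct) auto
  show ?thesis
  proof (cases s)
    case 0
    then show ?thesis by simp
  next
    case (Suc s')
    show ?thesis
    proof (cases s')
      case 0
      then show ?thesis using mem[of _ 0 "y mod k"] Suc k by (simp add: Let_def)
    next
      case (Suc s'')
      show ?thesis
        unfolding \<open>s = Suc s'\<close> Suc dec.simps
        by (rule pick, rule mem) (use k Suc \<open>s = Suc s'\<close> in simp_all)
    qed
  qed
qed

definition descs :: "nat \<Rightarrow> nat list \<Rightarrow> nat list \<Rightarrow> nat list" where
  "descs N0 rs adv = map (\<lambda>e. rs ! e * wgt n m e) [0..<N0] @ map (\<lambda>j. adv ! j * k) [0..<length adv]"

lemma run_pre:
  fixes mem :: "nat \<Rightarrow> nat \<Rightarrow> nat"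
  assumes adv: "\<And>adv. adv \<in> set advs \<Longrightarrow> length adv = Lf"
    and T: "N0 * (5 * q + 6) + length advs * (2 * N0 + 4 * Lf + 10) + 3 \<le> Tpre"
  defines "A \<equiv> Seq (loop N0 (\<lambda>e. sampler e (N0 + 1) (N0 + 2) q (\<lambda>u. (u mod n) * wgt n m e))) (emitall k N0 advs)"
  shows "\<exists>st. run F no_oracle Tpre A mem = map_pmf (\<lambda>rs. ([], st rs)) (replicate_pmf N0 (samp q n)) \<and>
    (\<forall>rs. items (st rs) = map (descs N0 rs) advs)"
proof -
  let ?lp = "loop N0 (\<lambda>e. sampler e (N0 + 1) (N0 + 2) q (\<lambda>u. (u mod n) * wgt n m e))" and ?em = "emitall k N0 advs"
  define s0 where "s0 = \<lparr>memory = mem, queries = 0, current = [], items = []\<rparr>"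
  define st where "st rs = exec F no_oracle ?em (fins n m N0 N0 rs s0)" for rs
  define c1 where "c1 = N0 * (5 * q + 6) + 1"
  define c2 where "c2 = Tpre - Suc c1"
  have Tpre: "Tpre = Suc (c1 + c2)" using T by (simp add: c1_def c2_def)
  have cost: "determ (emitall k N0 advs)" "tm (emitall k N0 advs) \<le> length advs * (2 * N0 + 4 * Lf + 10) + 1"
    using emitall_cost[of advs Lf] adv by blast+
  have c2: "tm ?em \<le> c2" using cost(2) T by (simp add: c1_def c2_def)
  have "run F no_oracle Tpre A mem = bind_pmf (steps F no_oracle c1 (?lp # [?em], s0)) (steps F no_oracle c2)"
    unfolding run_def s0_def[symmetric] Tpre A_def steps_add[symmetric]
    by (simp only: steps.simps step.simps bind_return_pmf)
  also have "\<dots> = bind_pmf (replicate_pmf N0 (samp q n)) (\<lambda>rs. steps F no_oracle c2 ([?em], fins n m N0 N0 rs s0))"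
    unfolding c1_def by (subst steps_samplers) (simp_all add: bind_map_pmf)
  also have "\<dots> = bind_pmf (replicate_pmf N0 (samp q n)) (\<lambda>rs. return_pmf ([], st rs))"
    unfolding st_def by (subst steps_determ_halts[OF cost(1) c2]) simp_all
  finally have 1: "run F no_oracle Tpre A mem = map_pmf (\<lambda>rs. ([], st rs)) (replicate_pmf N0 (samp q n))"
    by (simp add: map_pmf_def)
  have "items (st rs) = map (descs N0 rs) advs" for rs
  proof -
    have "map (var (fins n m N0 N0 rs s0)) [0..<N0] = map (\<lambda>e. rs ! e * wgt n m e) [0..<N0]"
      by (simp add: fins_facts)
    then show ?thesis
      unfolding st_def descs_def by (subst exec_emitall) (simp_all add: fins_facts s0_def)
  qed
  with 1 show ?thesis by blast
qed

text \<open>\<open>N'\<close> is separate from \<open>n ^ t\<close> because for \<open>k = 1\<close>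
  this is applied in dimension 1 to a code of the full length. The analysis of the samples enters
  through \<open>H\<close> alone.\<close>

theorem core:
  fixes t q T khat Qhat That N' :: nat and P Bhat :: com and \<alpha>hat \<alpha>t :: real
    and Ct Chat :: "(nat \<Rightarrow> nat) \<Rightarrow> (nat \<Rightarrow> nat)"
  assumes t: "0 < t" and m: "0 < m" and L: "0 < L"
    and lstP: "\<And>f. lst f = lister F T P (inp n f)"
    and ld: "local_decoder F khat (k ^ t) Chat Qhat \<alpha>hat Bhat That"
    and Chat: "\<And>x. x \<in> strings (carrier F) khat \<Longrightarrow> Chat x \<in> strings (carrier F) (k ^ t)"
    and N': "n ^ t \<le> N'" and q: "n \<le> 2 ^ q"
    and H: "\<And>S x. S \<in> list_strings (carrier F) l N' \<Longrightarrow> x \<in> strings (carrier F) khat \<Longrightarrow>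
      list_dist N' (Ct x) S \<le> \<alpha>t \<Longrightarrow> 2/3 \<le> measure_pmf.prob (replicate_pmf ((t - 1) * m) (samp q n))
        {rs. card {y. y < k ^ t \<and> bad S t (\<lambda>e. rs ! e) 0 (Chat x) y} \<le> \<alpha>hat * k ^ t}"
    and Tpre: "(t - 1) * m * (5 * q + 6) + L ^ (m ^ (t - 1)) * (2 * ((t - 1) * m) + 4 * m ^ (t - 1) + 10) + 3 \<le> Tpre"
  shows "\<exists>A B. local_list_recovery_alg F khat N' Ct (Qhat * (t * m ^ (t - 1) * n)) \<alpha>t l (L ^ (m ^ (t - 1))) A B
    Tpre (That + Qhat * prog.blockT k n l t m L T)"
proof -
  interpret pr: prog F k n l t m L \<theta> T P G by unfold_locales (rule k, rule kn)
  define N0 where "N0 = (t - 1) * m"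
  define Lf where "Lf = m ^ (t - 1)"
  define advs where "advs = List.n_lists Lf [0..<L]"
  have advs: "set advs = {adv. length adv = Lf \<and> set adv \<subseteq> {..<L}}"
    by (auto simp: advs_def set_n_lists)
  have lenadvs: "length advs = L ^ Lf" by (simp add: advs_def length_n_lists)
  define A where "A = Seq (loop N0 (\<lambda>e. sampler e (N0 + 1) (N0 + 2) q (\<lambda>u. (u mod n) * wgt n m e))) (emitall k N0 advs)"
  define B where "B = tr pr.block Bhat"
  have prlst: "pr.lst = lst" by (intro ext) (simp add: pr.lst_def lstP inp_def)
  have lo: pr.lists_ok
    unfolding pr.lists_ok_def prlst
  proof (intro allI impI)
    fix f assume f: "\<forall>p<n. f p \<subseteq> carrier F \<and> card (f p) = l"
    have "(\<lambda>p\<in>{..<n}. f p) \<in> list_strings (carrier F) l n" using f by (auto simp: list_strings_def)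
    moreover have "lst (\<lambda>p\<in>{..<n}. f p) = lst f"
      unfolding lstP inp_def by (intro arg_cong[of _ _ "lister F T P"] arg_cong[of _ _ concat] map_cong) auto
    ultimately show "length (lst f) \<le> L \<and> (\<forall>x\<in>set (lst f). length x = k)"
      using len[of "\<lambda>p\<in>{..<n}. f p"] lst[of "\<lambda>p\<in>{..<n}. f p"] by auto
  qed
  have pre: "\<exists>st. run F no_oracle Tpre A mem = map_pmf (\<lambda>rs. ([], st rs)) (replicate_pmf N0 (samp q n)) \<and>
    (\<forall>rs. items (st rs) = map (descs N0 rs) advs)" for mem
    unfolding A_def
    by (rule run_pre[of advs Lf]) (use advs Tpre in \<open>simp_all add: lenadvs N0_def Lf_def\<close>)
  have supp: "length rs = N0 \<and> (\<forall>e<N0. rs ! e < n)" if "rs \<in> set_pmf (replicate_pmf N0 (samp q n))" for rs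
    using replicate_pmf_support[OF that] samp_bounds(1)[OF npos q] by auto
  have zone: "zone (carrier F) l S 0 (n ^ t)" if "S \<in> list_strings (carrier F) l N'" for S
    unfolding zone_def
  proof (intro allI impI)
    fix r assume "r < n ^ t"
    then show "S (0 + r) \<subseteq> carrier F \<and> card (S (0 + r)) = l"
      using PiE_mem[OF that[unfolded list_strings_def], of r] N' by simp
  qed
  have orc: "list_oracle N' S r = sorted_list_of_set (S r) \<and> S r \<subseteq> carrier F \<and> card (S r) = l"
    if "S \<in> list_strings (carrier F) l N'" "r < n ^ t" for S r
    using zone[OF that(1)] that(2) N' by (simp add: zone_def list_oracle_def)
  have descr: "pr.descr (\<lambda>e. rs ! e) (\<lambda>j. adv ! j) m'"
    if rs: "rs \<in> set_pmf (replicate_pmf N0 (samp q n))" and adv: "adv \<in> set advs"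
      and inp: "input_mem i (descs N0 rs adv) m'" for rs adv m' i
  proof -
    have la: "length adv = Lf" using adv advs by simp
    have len: "length (descs N0 rs adv) = N0 + Lf" by (simp add: descs_def la)
    have ia: "m' 1 r = descs N0 rs adv ! r" if "r < N0 + Lf" for r
      using inp that by (simp add: input_mem_def input_array_def len)
    show ?thesis
      unfolding pr.descr_def N0_def[symmetric] Lf_def[symmetric]
    proof (intro conjI allI impI)
      fix e assume e: "e < N0"
      show "m' 1 e = rs ! e * n ^ Suc (e div m)" using ia[of e] e by (simp add: descs_def nth_append wgt_def)
      show "rs ! e < n" using supp[OF rs] e by blast
    next
      fix j assume j: "j < Lf"
      show "m' 1 (N0 + j) = adv ! j * k" using ia[of "N0 + j"] j by (simp add: descs_def nth_append la)
    qed
  qed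
  have ans: "pr.answer R J S \<in> strings (carrier F) (k ^ t)" if "S \<in> list_strings (carrier F) l N'" for R J S
    unfolding pr.answer_def prlst by (rule strings_restrict) (rule dec_carrier[OF zone[OF that]])
  have bq: "pr.blockQ = t * m ^ (t - 1) * n" by (simp add: pr.blockQ_def)
  have "local_list_recovery_alg F khat N' Ct (Qhat * (t * m ^ (t - 1) * n)) \<alpha>t l (L ^ (m ^ (t - 1))) A B
    Tpre (That + Qhat * pr.blockT)"
    unfolding local_list_recovery_alg_def
  proof (intro conjI allI ballI impI)
    fix mem x assume x: "x \<in> set_pmf (run F no_oracle Tpre A mem)"
    obtain st where st: "run F no_oracle Tpre A mem = map_pmf (\<lambda>rs. ([], st rs)) (replicate_pmf N0 (samp q n))"
      "\<And>rs. items (st rs) = map (descs N0 rs) advs" using pre[of mem] by blast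
    obtain rs where rs: "rs \<in> set_pmf (replicate_pmf N0 (samp q n))" "x = ([], st rs)"
      using x unfolding st(1) by auto
    have main: "\<forall>(cs', s')\<in>set_pmf (run F (list_oracle N' S) (That + Qhat * pr.blockT) B m').
        cs' = [] \<and> queries s' \<le> Qhat * (t * m ^ (t - 1) * n)"
      if \<sigma>: "\<sigma> \<in> set (items (st rs))" and S: "S \<in> list_strings (carrier F) l N'" and i': "i < khat" and inp: "input_mem i \<sigma> m'" for \<sigma> S i m'
    proof -
      obtain adv where adv: "adv \<in> set advs" "\<sigma> = descs N0 rs adv" using \<sigma> by (auto simp: st(2))
      have i: "m' 0 0 = i" using inp by (simp add: input_mem_def)
      show ?thesis
        unfolding B_def bq[symmetric]
        by (rule pr.run_tr(1)[OF lo descr[OF rs(1) adv(1) inp[unfolded adv(2)]] t m i i' ans[OF S] orc[OF S] ld])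
    qed
    show "case x of (cs, s) \<Rightarrow> cs = [] \<and> length (items s) = L ^ m ^ (t - 1) \<and>
        (\<forall>\<sigma>\<in>set (items s). \<forall>S\<in>list_strings (carrier F) l N'. \<forall>i<khat. \<forall>m'. input_mem i \<sigma> m' \<longrightarrow>
          (\<forall>(cs', s')\<in>set_pmf (run F (list_oracle N' S) (That + Qhat * pr.blockT) B m').
            cs' = [] \<and> queries s' \<le> Qhat * (t * m ^ (t - 1) * n)))"
      unfolding rs(2) case_prod_conv
    proof (intro conjI ballI allI impI)
      show "length (items (st rs)) = L ^ m ^ (t - 1)" by (simp add: st(2) lenadvs Lf_def)
    qed (use main in \<open>blast+\<close>)
  next
    fix S x mem
    assume S: "S \<in> list_strings (carrier F) l N'" and x: "x \<in> strings (carrier F) khat"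
      and d: "list_dist N' (Ct x) S \<le> \<alpha>t"
    obtain st where st: "run F no_oracle Tpre A mem = map_pmf (\<lambda>rs. ([], st rs)) (replicate_pmf N0 (samp q n))"
      "\<And>rs. items (st rs) = map (descs N0 rs) advs" using pre[of mem] by blast
    let ?Good = "\<lambda>rs. \<exists>j<L ^ m ^ (t - 1). \<forall>i<khat. \<forall>m'. input_mem i (items (st rs) ! j) m' \<longrightarrow>
        2/3 \<le> measure_pmf.prob (run F (list_oracle N' S) (That + Qhat * pr.blockT) B m') {(cs', s'). items s' = [[x i]]}"
    have "2/3 \<le> measure_pmf.prob (replicate_pmf N0 (samp q n))
        {rs. card {y. y < k ^ t \<and> bad S t (\<lambda>e. rs ! e) 0 (Chat x) y} \<le> \<alpha>hat * k ^ t}"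
      using H[OF S x d] by (simp only: N0_def)
    also have "\<dots> \<le> measure_pmf.prob (replicate_pmf N0 (samp q n)) {rs. ?Good rs}"
    proof (rule prob_mono_support)
      fix rs assume rs: "rs \<in> set_pmf (replicate_pmf N0 (samp q n))"
        and "rs \<in> {rs. card {y. y < k ^ t \<and> bad S t (\<lambda>e. rs ! e) 0 (Chat x) y} \<le> \<alpha>hat * k ^ t}"
      then have few: "card {y. y < k ^ t \<and> bad S t (\<lambda>e. rs ! e) 0 (Chat x) y} \<le> \<alpha>hat * k ^ t" by simp
      let ?R = "\<lambda>e. rs ! e"
      have R: "\<And>e. e < (t - 1) * m \<Longrightarrow> rs ! e < n" using supp[OF rs] by (simp add: N0_def)
      \<comment> \<open>The right advice depends on the drawn rows, but it exists for each draw, and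
        the preprocessing lists all advice.\<close>
      obtain J where J: "\<And>j. J j < L" "good S J t ?R 0 0 (Chat x)"
        using good_exists[where rs="?R" and off=0, OF L t zone[OF S] Chat[OF x]] R by blast
      define adv where "adv = map J [0..<Lf]"
      have adv: "adv \<in> set advs" using J(1) by (auto simp: advs adv_def)
      have gd: "good S (\<lambda>j. adv ! j) t ?R 0 0 (Chat x)"
        using good_cong[of 0 t "\<lambda>j. adv ! j" J S ?R 0 "Chat x"] J(2) by (simp add: adv_def Lf_def)
      have dec: "pr.answer ?R (\<lambda>j. adv ! j) S y = Chat x y"
        if "y < k ^ t" "\<not> bad S t ?R 0 (Chat x) y" for y
        using dec_correct[where rs="?R", OF t zone[OF S] Chat[OF x] _ gd that(2)] R that(1) by (simp add: pr.answer_def prlst)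
      have "card {y. y < k ^ t \<and> pr.answer ?R (\<lambda>j. adv ! j) S y \<noteq> Chat x y} \<le>
          card {y. y < k ^ t \<and> bad S t ?R 0 (Chat x) y}"
        using dec by (intro card_mono) auto
      then have "real (card {y. y < k ^ t \<and> pr.answer ?R (\<lambda>j. adv ! j) S y \<noteq> Chat x y}) \<le> \<alpha>hat * k ^ t"
        using few by linarith
      then have hd: "hdist (k ^ t) (pr.answer ?R (\<lambda>j. adv ! j) S) (Chat x) \<le> \<alpha>hat"
        using k by (simp add: hdist_def divide_le_eq)
      obtain j where j: "j < length advs" "advs ! j = adv" using adv by (auto simp: in_set_conv_nth)
      have "2/3 \<le> measure_pmf.prob (run F (list_oracle N' S) (That + Qhat * pr.blockT) B m') {(cs', s'). items s' = [[x i]]}"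
        if i: "i < khat" and inp: "input_mem i (items (st rs) ! j) m'" for i m'
      proof -
        have inp': "input_mem i (descs N0 rs adv) m'" using inp j by (simp add: st(2))
        have i0: "m' 0 0 = i" using inp by (simp add: input_mem_def)
        show ?thesis
          unfolding B_def
        proof (rule pr.run_tr(2)[where rs="(!) rs" and J="(!) adv" and S=S and Chat=Chat and \<alpha>hat=\<alpha>hat and khat=khat and i=i and x=x])
          show "pr.descr ((!) rs) ((!) adv) m'" by (rule descr[OF rs adv inp'])
          show "list_oracle N' S r = sorted_list_of_set (S r) \<and> S r \<subseteq> carrier F \<and> card (S r) = l"
            if "r < n ^ t" for r by (rule orc[OF S that])
        qed (fact lo t m i0 i ans[OF S] ld x hd)+
      qed
      then have gd: "\<forall>i<khat. \<forall>m'. input_mem i (items (st rs) ! j) m' \<longrightarrow>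
        2/3 \<le> measure_pmf.prob (run F (list_oracle N' S) (That + Qhat * pr.blockT) B m') {(cs', s'). items s' = [[x i]]}"
        by blast
      have jl: "j < L ^ m ^ (t - 1)" using j(1) lenadvs by (simp add: Lf_def)
      show "rs \<in> {rs. ?Good rs}"
        unfolding mem_Collect_eq by (rule exI[of _ j], rule conjI, rule jl, rule gd)
    qed
    also have "\<dots> = measure_pmf.prob (run F no_oracle Tpre A mem)
           {(cs, s). \<exists>j<L ^ m ^ (t - 1). \<forall>i<khat. \<forall>m'. input_mem i (items s ! j) m' \<longrightarrow>
              2/3 \<le> measure_pmf.prob (run F (list_oracle N' S) (That + Qhat * pr.blockT) B m') {(cs', s'). items s' = [[x i]]}}"
      unfolding st(1) measure_map_pmf vimage_def mem_Collect_eq case_prod_conv ..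
    finally show "2/3 \<le> measure_pmf.prob (run F no_oracle Tpre A mem)
           {(cs, s). \<exists>j<L ^ m ^ (t - 1). \<forall>i<khat. \<forall>m'. input_mem i (items s ! j) m' \<longrightarrow>
              2/3 \<le> measure_pmf.prob (run F (list_oracle N' S) (That + Qhat * pr.blockT) B m') {(cs', s'). items s' = [[x i]]}}" .
  qed
  then show ?thesis by blast
qed

lemma few_bad:
  fixes t :: nat and \<beta> \<alpha>hat :: real
  assumes t: "0 < t" and b: "(\<Sum>y<k ^ (t - 1). badprob D S t 0 M y) \<le> \<beta> * k ^ (t - 1)"
    and \<beta>: "\<beta> \<le> \<alpha>hat / 3" and \<alpha>hat: "0 < \<alpha>hat"
  shows "2/3 \<le> measure_pmf.prob (replicate_pmf ((t - 1) * m) D)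
    {rs. card {y. y < k ^ t \<and> bad S t (\<lambda>e. rs ! e) 0 M y} \<le> \<alpha>hat * k ^ t}"
proof -
  let ?p = "replicate_pmf ((t - 1) * m) D" and ?c = "\<lambda>rs. card {y. y < k ^ t \<and> bad S t (\<lambda>e. rs ! e) 0 M y}"
  \<comment> \<open>The least integer above \<open>\<alpha>hat * k ^ t\<close>: the event that the
    count reaches \<open>u\<close> is exactly the complement of the wanted one.\<close>
  define u where "u = nat \<lfloor>\<alpha>hat * k ^ t\<rfloor> + 1"
  have a: "0 \<le> \<alpha>hat * k ^ t" using \<alpha>hat by simp
  have u: "\<alpha>hat * k ^ t \<le> u" unfolding u_def using a by linarith
  obtain s where s: "t = Suc s" using t by (cases t) auto
  have per: "badprob D S t 0 M (y mod k ^ s) = badprob D S t 0 M y" for y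
    unfolding badprob_def s bad_mod ..
  have "(\<Sum>y<k ^ t. badprob D S t 0 M y) = (\<Sum>y<k * k ^ s. badprob D S t 0 M (y mod k ^ s))"
    by (simp only: per) (simp add: s)
  also have "\<dots> = k * (\<Sum>y<k ^ s. badprob D S t 0 M y)" by (rule sum_mod_real)
  also have "\<dots> \<le> k * (\<beta> * k ^ s)" using b by (intro mult_left_mono) (simp_all add: s)
  also have "\<dots> = \<beta> * k ^ t" by (simp add: s)
  finally have sum: "(\<Sum>y<k ^ t. badprob D S t 0 M y) \<le> \<beta> * k ^ t" .
  have kt: "0 < real k ^ t" using k by simp
  have "measure_pmf.prob ?p {rs. u \<le> ?c rs} \<le> (\<Sum>y<k ^ t. badprob D S t 0 M y) / u"
    unfolding badprob_def by (rule prob_count_markov) (simp add: u_def)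
  also have "\<dots> \<le> \<beta> * k ^ t / u" using sum by (intro divide_right_mono) auto
  also have "\<dots> \<le> 1/3"
  proof -
    have "\<beta> * k ^ t \<le> \<alpha>hat / 3 * k ^ t" using \<beta> by (intro mult_right_mono) auto
    also have "\<dots> \<le> u / 3" using u by simp
    finally show ?thesis by (simp add: u_def divide_le_eq)
  qed
  finally have "measure_pmf.prob ?p {rs. u \<le> ?c rs} \<le> 1/3" .
  moreover have "measure_pmf.prob ?p {rs. real (?c rs) \<le> \<alpha>hat * k ^ t} = 1 - measure_pmf.prob ?p {rs. u \<le> ?c rs}"
  proof -
    have "{rs. real (?c rs) \<le> \<alpha>hat * k ^ t} = space (measure_pmf ?p) - {rs. u \<le> ?c rs}"
    proof -
      have "real (?c rs) \<le> \<alpha>hat * k ^ t \<longleftrightarrow> \<not> u \<le> ?c rs" for rs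
        unfolding u_def using a by linarith
      then show ?thesis by auto
    qed
    then show ?thesis by (simp only: measure_pmf.prob_compl sets_measure_pmf UNIV_I)
  qed
  ultimately show ?thesis by simp
qed

text \<open>For \<open>k = 1\<close> row 0 of the product is \<open>M\<close> again, since
  \<open>C\<close> is systematic; so the first \<open>n\<close> symbols of any power form a plain
  codeword of \<open>C\<close>.\<close>

lemma Tp_k1:
  assumes "k = 1" "M \<in> strings (carrier F) (k ^ Suc s)" "r < n"
  shows "Tp (Suc s) M r = C M r"
  using assms(2)
proof (induction s arbitrary: M)
  case (Suc s)
  have "n \<le> n ^ Suc s" by (rule self_le_power) (use npos in simp_all)
  then have "r < n ^ Suc s" using assms(3) by (rule order_less_le_trans[rotated])
  from Tp_row[OF Suc.prems npos this] have eq: "Tp (Suc (Suc s)) M r = Tp (Suc s) (nr s M 0) r" by simp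
  have M1: "M \<in> strings (carrier F) (k ^ Suc s)" "M \<in> strings (carrier F) k" using Suc.prems assms(1) by auto
  have "nr s M 0 = M"
  proof (rule strings_eqI[OF nr_strings[OF Suc.prems npos] M1(1)])
    fix i assume "i < k ^ Suc s"
    then have i: "i = 0" using assms(1) by simp
    have "(\<lambda>p\<in>{..<k}. M (p * k ^ Suc s)) = M"
      by (rule strings_eqI[OF _ M1(2)])
        (use M1(2) assms(1) in \<open>auto intro!: strings_restrict dest: strings_mem\<close>)
    then show "nr s M 0 i = M i" using sys k M1(2) by (simp add: nrow_def i systematic_def assms(1))
  qed
  then show ?case unfolding eq by (simp add: Suc.IH[OF M1(1)])
qed simp

text \<open>Injective because \<open>Chat x\<close> can be read off at the systematic
  positions.\<close>

lemma Tp_code: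
  assumes "0 < t" "is_code (carrier F) khat (k ^ t) Chat"
  shows "is_code (carrier F) khat (n ^ t) (\<lambda>x. Tp t (Chat x))"
proof -
  have Chat: "Chat x \<in> strings (carrier F) (k ^ t)" if "x \<in> strings (carrier F) khat" for x
    using assms(2) that unfolding is_code_def by blast
  have "inj_on (\<lambda>x. Tp t (Chat x)) (strings (carrier F) khat)"
  proof (rule inj_onI)
    fix x y assume x: "x \<in> strings (carrier F) khat" and y: "y \<in> strings (carrier F) khat"
      and eq: "Tp t (Chat x) = Tp t (Chat y)"
    have "Chat x = Chat y"
    proof (rule strings_eqI[OF Chat[OF x] Chat[OF y]])
      fix i assume "i < k ^ t"
      then show "Chat x i = Chat y i"
        using Tp_conv[OF Chat[OF x] assms(1), of i] Tp_conv[OF Chat[OF y] assms(1), of i] eq by simp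
    qed
    then show "x = y" using assms(2) x y unfolding is_code_def by (blast dest: inj_onD)
  qed
  moreover have "Tp t (Chat x) \<in> strings (carrier F) (n ^ t)" if "x \<in> strings (carrier F) khat" for x
    by (rule linmap_strings[OF Tp_lin[OF assms(1)] Chat[OF that]])
  ultimately show ?thesis unfolding is_code_def by blast
qed

end

section \<open>Parameters\<close>

text \<open>A geometric sum is compared with its smallest term. The point is that
  \<open>(1 - d) * d ^ N\<close> becomes small uniformly in \<open>d\<close>, even for
  \<open>d\<close> near 1.\<close>

lemma one_minus_power_bound:
  fixes d :: real
  assumes "0 \<le> d" "d \<le> 1"
  shows "(1 - d) * d ^ N * (N + 1) \<le> 1"
proof -
  have "d ^ N * (N + 1) = (\<Sum>i<Suc N. d ^ N)" by simp
  also have "\<dots> \<le> (\<Sum>i<Suc N. d ^ i)"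
    using assms by (intro sum_mono power_decreasing) auto
  finally have "(1 - d) * (d ^ N * (N + 1)) \<le> (1 - d) * (\<Sum>i<Suc N. d ^ i)"
    using assms by (intro mult_left_mono) auto
  also have "\<dots> = 1 - d ^ Suc N" by (rule one_diff_power_eq[symmetric])
  also have "\<dots> \<le> 1" using assms by simp
  finally show ?thesis by (simp add: mult.assoc)
qed

lemma le_two_powr: "0 \<le> x \<Longrightarrow> x \<le> 2 powr (2 * x)" for x :: real
proof -
  assume x: "0 \<le> x"
  have "x \<le> exp x" using exp_ge_add_one_self[of x] by linarith
  also have "\<dots> \<le> exp (2 * x * ln 2)"
    using mult_left_mono[of 1 "2 * ln 2" x] ln2_ge_two_thirds x by (simp add: mult_ac)
  finally show ?thesis by (simp add: powr_def)
qed

text \<open>The threshold for the number of disagreements among the \<open>m\<close> rows is \<open>\<theta> = 2 * u\<close>: one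
  half pays for rows with too many errors, the other for wrong recursive values.\<close>

definition usize :: "real \<Rightarrow> nat \<Rightarrow> real \<Rightarrow> real \<Rightarrow> nat" where
  "usize lg t ah d = nat \<lceil>289 * lg * t / (ah * d)\<rceil>"

definition msize :: "real \<Rightarrow> nat \<Rightarrow> real \<Rightarrow> real \<Rightarrow> nat" where
  "msize lg t ah d = nat \<lceil>32 * usize lg t ah d / d\<rceil>"

context
  fixes lg ah d :: real and t L u m :: nat
  assumes lg: "1 \<le> lg" and ah: "0 < ah" "ah \<le> 1" and d: "0 < d" "d \<le> 1" and t: "1 \<le> t"
    and L: "L \<le> 2 powr lg"
  defines "u \<equiv> usize lg t ah d" and "m \<equiv> msize lg t ah d"
begin

lemma quot_ge: "lg \<le> lg * t / (ah * d)" "1 / ah \<le> lg * t / (ah * d)" "t / d \<le> lg * t / (ah * d)"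
proof -
  have t1: "1 \<le> real t" using t by simp
  have lt: "1 \<le> lg * t" using lg t1 mult_mono[of 1 lg 1 "real t"] by simp
  have ad: "ah * d \<le> 1" "ah * d \<le> ah" "ah * d \<le> d" "0 < ah * d"
    using ah d mult_le_one[of ah d] mult_left_le[of d ah] mult_left_le_one_le[of d ah] by auto
  have "lg * (ah * d) \<le> lg * 1" using ad lg by (intro mult_left_mono) auto
  also have "\<dots> \<le> lg * t" using lg t1 by (intro mult_left_mono) auto
  finally show "lg \<le> lg * t / (ah * d)" using ad by (simp add: pos_le_divide_eq)
  show "1 / ah \<le> lg * t / (ah * d)" using ad lt ah d by (intro frac_le) auto
  have "t \<le> lg * t" using lg t1 mult_right_mono[of 1 lg "real t"] by simp
  then show "t / d \<le> lg * t / (ah * d)" using ad ah d t1 by (intro frac_le) auto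
qed

text \<open>289 = 1 + 24 + 264, the coefficients of the three terms in the first bound, which
  \<open>quot_ge\<close> compares with a single quotient. The ceiling raises 289 to 290.\<close>

lemma u_bounds: "lg + 24 / ah + 264 * t / d \<le> u" "u \<le> 290 * lg * t / (ah * d)" "1 \<le> u" "lg \<le> u"
proof -
  let ?x = "lg * t / (ah * d)"
  have x: "1 \<le> ?x" using quot_ge(1) lg by simp
  have u: "289 * ?x \<le> u" "u \<le> 289 * ?x + 1"
    using x unfolding u_def usize_def by (simp_all add: mult.assoc)
  show "lg + 24 / ah + 264 * t / d \<le> u" using u(1) quot_ge by simp
  show "u \<le> 290 * lg * t / (ah * d)" using u(2) x by simp
  show "1 \<le> u" "lg \<le> u" using u(1) x quot_ge(1) by linarith+
qed

text \<open>The ceiling raises 32 to 33, and 9570 = 33 * 290.\<close>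

lemma m_bounds: "32 * u / d \<le> m" "m / u \<le> 33 / d" "m \<le> 9570 * lg * t / (ah * d\<^sup>2)" "u \<le> m" "1 \<le> m"
proof -
  have ud: "u \<le> u / d" "1 \<le> u / d" using u_bounds(3) d
    by (simp_all add: pos_le_divide_eq mult_left_le)
  have m: "32 * u / d \<le> m" "m \<le> 32 * u / d + 1"
    using ud unfolding m_def msize_def u_def[symmetric] by linarith+
  show "32 * u / d \<le> m" by (rule m(1))
  have m33: "m \<le> 33 * u / d" using m(2) ud by simp
  then show "m / u \<le> 33 / d" using u_bounds(3) d by (simp add: field_simps)
  have "33 * u / d \<le> 33 * (290 * lg * t / (ah * d)) / d"
    using u_bounds(2) d by (intro divide_right_mono mult_left_mono) auto
  then show "m \<le> 9570 * lg * t / (ah * d\<^sup>2)" using m33 by (simp add: power2_eq_square mult_ac)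
  have "real u \<le> m" using m(1) ud by simp
  then show "u \<le> m" by simp
  then show "1 \<le> m" using u_bounds(3) by simp
qed

text \<open>\<open>2 ^ u\<close> has to outgrow a product of three factors, and each summand in the
  lower bound on \<open>u\<close> pays for one; \<open>le_two_powr\<close> doubles 12 and 132 to 24
  and 264.\<close>

lemma half_power:
  assumes "j \<le> t"
  shows "L * (1/2) ^ u \<le> ah / 3 * (d / 132) ^ j / 4"
proof -
  have d1: "1 \<le> 132 / d" using d by (simp add: pos_le_divide_eq)
  have "L * (12 / ah) * (132 / d) ^ t \<le> 2 powr lg * 2 powr (2 * (12 / ah)) * (2 powr (2 * (132 / d))) ^ t"
    using L ah d d1 by (intro mult_mono power_mono le_two_powr) auto
  also have "(2 powr (2 * (132 / d))) ^ t = 2 powr (264 * t / d)"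
    by (simp add: powr_realpow[symmetric] powr_powr mult_ac)
  also have "2 powr lg * 2 powr (2 * (12 / ah)) * 2 powr (264 * t / d) = 2 powr (lg + 24 / ah + 264 * t / d)"
    by (simp add: powr_add)
  also have "\<dots> \<le> 2 powr u" using u_bounds(1) by simp
  also have "\<dots> = 2 ^ u" by (simp add: powr_realpow)
  finally have *: "L * (12 / ah) * (132 / d) ^ t \<le> 2 ^ u" .
  have "(132 / d) ^ j \<le> (132 / d) ^ t" using d1 assms by (intro power_increasing) auto
  then have "L * (12 / ah) * (132 / d) ^ j \<le> L * (12 / ah) * (132 / d) ^ t" using ah by (intro mult_left_mono) auto
  with * have "L * (12 / ah) * (132 / d) ^ j \<le> 2 ^ u" by linarith
  then have "L * (12 / ah) * (132 / d) ^ j * ah \<le> 2 ^ u * ah" using ah by (intro mult_right_mono) auto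
  then have "L * 12 * (132 / d) ^ j \<le> 2 ^ u * ah" using ah by simp
  moreover have "(132 / d) ^ j * (d / 132) ^ j = 1" using d by (simp flip: power_mult_distrib)
  moreover have "0 \<le> (d / 132) ^ j" using d by simp
  ultimately have "L * 12 \<le> 2 ^ u * ah * (d / 132) ^ j"
    by (metis (no_types, opaque_lifting) mult.assoc mult.right_neutral mult_right_mono)
  then show ?thesis by (simp add: power_one_over field_simps)
qed

text \<open>\<open>m \<ge> 32 * u / d\<close> brings \<open>(1 - d / 4) ^ m\<close> below
  \<open>exp (- 8 * u)\<close>, hence below 32 to the power of minus \<open>u\<close>. This beats
  the \<open>16 ^ u\<close> that comes from the separation threshold.\<close>

lemma sep_param:
  assumes "j \<le> t"
  shows "L * (2 ^ (2 * (2 * u)) * (1 - d / 4) ^ m) \<le> ah / 3 * (d / 132) ^ j / 4"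
proof -
  have "(1 - d / 4) ^ m \<le> exp (- (d / 4)) ^ m"
    using d exp_ge_add_one_self[of "- (d / 4)"] by (intro power_mono) auto
  also have "\<dots> = exp (- (d / 4 * m))" by (simp add: exp_of_nat_mult[symmetric] mult.commute)
  also have "\<dots> \<le> exp (- (8 * u))" using m_bounds(1) d by (simp add: field_simps)
  also have "\<dots> = exp (- 8) ^ u" by (simp add: exp_of_nat_mult[symmetric] mult.commute)
  also have "\<dots> \<le> (1 / 32) ^ u"
  proof (rule power_mono)
    have "(2::real) \<le> exp 1" using exp_ge_add_one_self[of 1] by simp
    then have "(2::real) ^ 8 \<le> exp 1 ^ 8" by (intro power_mono) auto
    also have "\<dots> = exp 8" by (simp flip: exp_of_nat_mult)
    finally show "exp (- 8) \<le> (1 / 32 :: real)" by (simp add: exp_minus field_simps)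
  qed simp
  finally have e: "(1 - d / 4) ^ m \<le> (1 / 32) ^ u" .
  have "2 ^ (2 * (2 * u)) * (1 - d / 4) ^ m \<le> 16 ^ u * (1 / 32) ^ u"
    using e by (simp add: power_mult mult_left_mono)
  also have "\<dots> = (1/2) ^ u" by (simp flip: power_mult_distrib)
  finally have "L * (2 ^ (2 * (2 * u)) * (1 - d / 4) ^ m) \<le> L * (1/2) ^ u" by (intro mult_left_mono) auto
  also have "\<dots> \<le> ah / 3 * (d / 132) ^ j / 4" by (rule half_power[OF assms])
  finally show ?thesis .
qed

text \<open>With \<open>m * d \<le> 33 * u\<close> the growth factor is at most
  \<open>exp (99 * u / 200)\<close>, which is below \<open>2 ^ u\<close>.\<close>

lemma tail_param:
  assumes "j \<le> t" "1 \<le> L"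
  shows "(1 / 4) ^ u * (1 + 3 * (d / 200)) ^ m \<le> ah / 3 * (d / 132) ^ j / 4"
proof -
  have "(1 + 3 * (d / 200)) ^ m \<le> exp (3 * (d / 200)) ^ m"
    using d exp_ge_add_one_self[of "3 * (d / 200)"] by (intro power_mono) auto
  also have "\<dots> = exp (3 * d / 200 * m)" by (simp add: exp_of_nat_mult[symmetric] mult_ac)
  also have "\<dots> \<le> exp (u * ln 2)"
  proof -
    have "m * d \<le> 33 * u" using m_bounds(2) u_bounds(3) d by (simp add: field_simps)
    moreover have "3 * d / 200 * m = 3 / 200 * (m * d)" by simp
    ultimately have "3 * d / 200 * m \<le> u * (1 / 2)" using of_nat_0_le_iff[of u] by linarith
    also have "\<dots> \<le> u * ln 2" using ln2_ge_two_thirds by (intro mult_left_mono) auto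
    finally show ?thesis by simp
  qed
  also have "\<dots> = 2 ^ u" by (simp add: exp_of_nat_mult)
  finally have "(1 / 4) ^ u * (1 + 3 * (d / 200)) ^ m \<le> (1 / 4) ^ u * 2 ^ u" by (intro mult_left_mono) auto
  also have "\<dots> = 1 * (1 / 2 :: real) ^ u" by (simp flip: power_mult_distrib)
  also have "\<dots> \<le> L * (1/2) ^ u" using assms(2) by (intro mult_right_mono) auto
  also have "\<dots> \<le> ah / 3 * (d / 132) ^ j / 4" by (rule half_power[OF assms(1)])
  finally show ?thesis .
qed

text \<open>Everything but \<open>lg / ah\<close> is turned into a power of
  \<open>D = 1 / (r * d)\<close>. This works because \<open>r * d \<le> 9 / 16\<close> keeps
  \<open>D\<close> away from 1: \<open>D ^ 2 \<ge> 3\<close>, so a constant costs boundedly many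
  factors \<open>D\<close> and \<open>t\<close> costs at most \<open>2 * t\<close>.\<close>

lemma m_power_le:
  fixes r al :: real
  assumes r: "0 < r" "r \<le> 1" "r * d \<le> 9 / 16" and al: "0 < al" "al \<le> 1"
  shows "1000 * real t ^ 2 * real m ^ t * (1 / (r * d)) \<le>
    lg ^ t / ((al * ah) ^ (200000 * t) * (r * d) ^ (200000 * t\<^sup>2))"
proof -
  define D where "D = 1 / (r * d)"
  have rd: "0 < r * d" using r d by simp
  have D: "16 / 9 \<le> D" unfolding D_def using rd r(3) by (simp add: pos_le_divide_eq)
  have D2: "3 \<le> D ^ 2" using power_mono[OF D, of 2] by (simp add: power2_eq_square)
  have D1: "1 \<le> D" using D by simp
  have Dm: "D ^ a \<le> D ^ b" if "a \<le> b" for a b using that D1 by (rule power_increasing)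
  have tt: "t \<le> t * t" using t by simp
  have t2: "real t \<le> D ^ (2 * t)"
  proof -
    have "real t \<le> 2 ^ t" by (metis of_nat_less_two_power less_imp_le of_nat_power of_nat_numeral)
    also have "\<dots> \<le> (D ^ 2) ^ t" using D2 by (intro power_mono) auto
    finally show ?thesis by (simp add: power_mult)
  qed
  have dD: "1 / d \<le> D" unfolding D_def using r d rd by (intro frac_le) auto
  have "(9570::real) \<le> 3 ^ 9" by simp
  also have "\<dots> \<le> (D ^ 2) ^ 9" using D2 by (intro power_mono) auto
  finally have c1: "9570 \<le> D ^ 18" by (simp flip: power_mult)
  have "(1000::real) \<le> 3 ^ 7" by simp
  also have "\<dots> \<le> (D ^ 2) ^ 7" using D2 by (intro power_mono) auto
  finally have c2: "1000 \<le> D ^ 14" by (simp flip: power_mult)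
  have "m \<le> 9570 * lg * t / (ah * d\<^sup>2)" by (rule m_bounds(3))
  also have "\<dots> = (lg / ah) * (9570 * t * (1 / d) ^ 2)" by (simp add: power2_eq_square)
  also have "\<dots> \<le> (lg / ah) * (D ^ 18 * D ^ (2 * t) * D ^ 2)"
  proof (rule mult_left_mono)
    have "9570 * real t \<le> D ^ 18 * D ^ (2 * t)" using c1 t2 D1 by (intro mult_mono) auto
    moreover have "(1 / d) ^ 2 \<le> D ^ 2" using dD d by (intro power_mono) auto
    ultimately show "9570 * t * (1 / d) ^ 2 \<le> D ^ 18 * D ^ (2 * t) * D ^ 2"
      using D1 by (intro mult_mono) auto
  qed (use lg ah in auto)
  also have "\<dots> = (lg / ah) * D ^ (20 + 2 * t)" by (simp flip: power_add)
  also have "\<dots> \<le> (lg / ah) * D ^ (22 * t)" using lg ah t by (intro mult_left_mono Dm) auto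
  finally have "real m ^ t \<le> ((lg / ah) * D ^ (22 * t)) ^ t" by (intro power_mono) auto
  also have "\<dots> = (lg / ah) ^ t * D ^ (22 * t * t)" by (simp only: power_mult_distrib power_mult)
  finally have mt: "real m ^ t \<le> (lg / ah) ^ t * D ^ (22 * t * t)" .
  have "1000 * real t ^ 2 * real m ^ t * D \<le> D ^ 14 * (D ^ (2 * t)) ^ 2 * ((lg / ah) ^ t * D ^ (22 * t * t)) * D ^ 1"
    using c2 t2 mt D1 lg ah by (intro mult_mono power_mono mult_nonneg_nonneg) auto
  also have "\<dots> = (lg / ah) ^ t * D ^ (14 + 2 * t * 2 + 22 * t * t + 1)"
    by (simp only: power_add power_mult mult_ac)
  also have "\<dots> \<le> (lg / ah) ^ t * D ^ (200000 * t\<^sup>2)"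
  proof (rule mult_left_mono[OF Dm])
    have "1 \<le> t * t" using tt t by linarith
    then show "14 + 2 * t * 2 + 22 * t * t + 1 \<le> 200000 * t\<^sup>2"
      using tt unfolding power2_eq_square mult.assoc by linarith
  qed (use lg ah in auto)
  also have "\<dots> = lg ^ t / (ah ^ t * (r * d) ^ (200000 * t\<^sup>2))"
    by (simp add: D_def power_divide)
  also have "\<dots> \<le> lg ^ t / ((al * ah) ^ (200000 * t) * (r * d) ^ (200000 * t\<^sup>2))"
  proof (intro divide_left_mono mult_right_mono mult_pos_pos)
    have "(al * ah) ^ (200000 * t) \<le> (al * ah) ^ t"
      using al ah by (intro power_decreasing) (auto intro: mult_le_one)
    also have "\<dots> \<le> ah ^ t" using al ah by (intro power_mono) (auto intro: mult_left_le_one_le)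
    finally show "(al * ah) ^ (200000 * t) \<le> ah ^ t" .
  qed (use al ah rd lg in auto)
  finally show ?thesis by (simp add: D_def)
qed

end

text \<open>Each dimension costs a factor \<open>52800 * r / d\<^sup>2\<close>, where 52800 = 400 *
  132. It is paid by \<open>d ^ 200000\<close> although \<open>d\<close> may be close to 1:
  \<open>r \<le> 2 * (1 - d)\<close> and \<open>one_minus_power_bound\<close> give
  \<open>r * d ^ 199998 \<le> 2 / 199999\<close>. This is what calls for a final constant of this
  size.\<close>

lemma error_param:
  fixes d r ah :: real and t j :: nat
  assumes d: "0 < d" "d \<le> 1" and r: "0 < r" "r \<le> 2 * (1 - d)" and ah: "0 < ah" and j: "j < t"
  shows "ah * r * d ^ (200000 * t) * (400 * r / d) ^ j \<le> ah / 3 * (d / 132) ^ j / 4"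
proof -
  have small: "r * d ^ 199998 \<le> 1 / 52800"
  proof -
    have "r * d ^ 199998 \<le> 2 * (1 - d) * d ^ 199998" using r d by (intro mult_right_mono) auto
    also have "\<dots> \<le> 2 / 199999"
    proof -
      define y where "y = (1 - d) * d ^ 199998"
      have "y * 199999 \<le> 1" using one_minus_power_bound[of d 199998] d by (simp add: y_def)
      moreover have "2 * (1 - d) * d ^ 199998 = 2 * y" by (simp add: y_def)
      ultimately show ?thesis by linarith
    qed
    also have "\<dots> \<le> 1 / 52800" by simp
    finally show ?thesis .
  qed
  \<comment> \<open>One factor \<open>d ^ 200000\<close> for each of the \<open>j\<close> dimensions
    and one for \<open>12 * r\<close>, which is possible as \<open>j < t\<close>.\<close>
  have "d ^ (200000 * t) \<le> d ^ (200000 * j + 200000)" using d j by (intro power_decreasing) auto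
  then have "12 * r * d ^ (200000 * t) * (52800 * r / d\<^sup>2) ^ j \<le> 12 * r * d ^ (200000 * j + 200000) * (52800 * r / d\<^sup>2) ^ j"
    using r d by (intro mult_right_mono mult_left_mono) auto
  also have "\<dots> = 12 * r * d ^ 200000 * (52800 * r * d ^ 199998) ^ j"
  proof -
    have e: "d ^ 200000 * (52800 * r / d\<^sup>2) = 52800 * r * d ^ 199998"
    proof -
      have "d ^ 200000 = d ^ 199998 * d\<^sup>2" by (simp flip: power_add)
      moreover have "A * B * (52800 * r / B) = 52800 * r * A" if "B \<noteq> 0" for A B :: real using that by simp
      ultimately show ?thesis using d by (metis zero_less_power less_irrefl)
    qed
    have "d ^ (200000 * j + 200000) = (d ^ 200000) ^ j * d ^ 200000" by (simp only: power_add power_mult)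
    then have "12 * r * d ^ (200000 * j + 200000) * (52800 * r / d\<^sup>2) ^ j =
        12 * r * d ^ 200000 * (d ^ 200000 * (52800 * r / d\<^sup>2)) ^ j" by (simp only: power_mult_distrib mult_ac)
    then show ?thesis unfolding e .
  qed
  also have "\<dots> \<le> 1 * 1"
  proof (rule mult_mono)
    have "d ^ 200000 \<le> d ^ 199998" using d by (intro power_decreasing) auto
    then have "12 * r * d ^ 200000 \<le> 12 * (r * d ^ 199998)" using r by simp
    also have "\<dots> \<le> 1" using small by simp
    finally show "12 * r * d ^ 200000 \<le> 1" .
    show "(52800 * r * d ^ 199998) ^ j \<le> 1" using small r d by (intro power_le_one) auto
  qed (use r d in auto)
  finally have *: "12 * r * d ^ (200000 * t) * (52800 * r / d\<^sup>2) ^ j \<le> 1" by simp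
  have "(400 * r / d) ^ j = (52800 * r / d\<^sup>2) ^ j * (d / 132) ^ j"
    using d by (simp add: power_mult_distrib[symmetric] power2_eq_square)
  then have "ah * r * d ^ (200000 * t) * (400 * r / d) ^ j =
      ah / 12 * (d / 132) ^ j * (12 * r * d ^ (200000 * t) * (52800 * r / d\<^sup>2) ^ j)" by simp
  also have "\<dots> \<le> ah / 12 * (d / 132) ^ j * 1" using * ah d by (intro mult_left_mono) auto
  finally show ?thesis by simp
qed

text \<open>9 = 6 + 2 + 1: the constant 35 goes into \<open>2 powr (6 * X)\<close>, the factor
  \<open>X\<close> into \<open>2 powr (2 * X)\<close>, and the number of descriptions is the last
  \<open>2 powr X\<close>.\<close>

lemma preprocessing_cost:
  fixes X la Lt N0 Lf q :: real
  assumes X: "1 \<le> X" and Lt: "0 \<le> Lt" "Lt \<le> 2 powr X" and N0: "0 \<le> N0" "N0 \<le> X" and Lf: "0 \<le> Lf" "Lf \<le> X"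
    and q: "0 \<le> q" "q \<le> 2 * la" and la: "1 \<le> la"
  shows "N0 * (5 * q + 6) + Lt * (2 * N0 + 4 * Lf + 10) + 3 \<le> 2 powr (9 * X) * la"
proof -
  have p1: "1 \<le> 2 powr X" using X by (intro ge_one_powr_ge_zero) auto
  have "N0 * (5 * q + 6) \<le> X * (16 * la)" using N0 q la X by (intro mult_mono) auto
  also have "\<dots> \<le> 16 * X * la * 2 powr X" using p1 X la mult_left_mono[of 1 "2 powr X" "16 * X * la"] by simp
  finally have a: "N0 * (5 * q + 6) \<le> 16 * X * la * 2 powr X" .
  have "Lt * (2 * N0 + 4 * Lf + 10) \<le> 2 powr X * (16 * X)" using Lt N0 Lf X by (intro mult_mono) auto
  also have "\<dots> \<le> 16 * X * la * 2 powr X" using la X mult_left_mono[of 1 la "16 * X * 2 powr X"] by (simp add: mult_ac)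
  finally have b: "Lt * (2 * N0 + 4 * Lf + 10) \<le> 16 * X * la * 2 powr X" .
  have "1 * 1 * 1 \<le> X * la * 2 powr X" using X la p1 by (intro mult_mono) auto
  then have "N0 * (5 * q + 6) + Lt * (2 * N0 + 4 * Lf + 10) + 3 \<le> 35 * (X * la * 2 powr X)"
    using a b by simp
  also have "\<dots> \<le> 2 powr (6 * X) * (2 powr (2 * X) * la * 2 powr X)"
  proof (intro mult_mono)
    have "(35::real) \<le> 2 powr 6" by simp
    also have "\<dots> \<le> 2 powr (6 * X)" using X by (intro powr_mono) auto
    finally show "35 \<le> 2 powr (6 * X)" .
    show "X \<le> 2 powr (2 * X)" using X by (intro le_two_powr) simp
  qed (use X la in auto)
  also have "\<dots> = 2 powr (9 * X) * la" by (simp add: powr_add[symmetric])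
  finally show ?thesis .
qed

text \<open>Every cost is charged to \<open>T\<close>, which is at least the size
  \<open>L * (k + 1)\<close> of an output with \<open>L\<close> messages. The factor
  \<open>D \<ge> n / k\<close> pays for reading a fiber of length \<open>n\<close>, with
  \<open>l \<le> L\<close> symbols at each place.\<close>

lemma blockT_bound:
  fixes D :: real
  assumes kn: "0 < k" "k \<le> n" and t: "1 \<le> t" and m: "1 \<le> m" and L: "1 \<le> L" "l \<le> L" "L * (k + 1) \<le> T"
    and D: "1 \<le> D" "n \<le> k * D"
  shows "real (prog.blockT k n l t m L T) \<le> 445 * t * real m ^ t * (T * D)"
proof -
  interpret prog undefined k n l t m L 0 T undefined undefined by unfold_locales (use kn in auto)
  define Z where "Z = T * D"
  have LT: "L \<le> T" "k \<le> T" "L * k \<le> T" "1 \<le> T" "L * (k * 10 + 16) \<le> 16 * T"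
  proof -
    have a: "k \<le> L * k" using L by simp
    have b: "L * k + L \<le> T" using L(3) by (simp add: algebra_simps)
    have c: "L * (k * 10 + 16) = 10 * (L * k) + 16 * L" by (simp add: algebra_simps)
    show "L \<le> T" "k \<le> T" "L * k \<le> T" "1 \<le> T" "L * (k * 10 + 16) \<le> 16 * T"
      unfolding c using a b L(1) by linarith+
  qed
  have TZ: "real T \<le> Z" using D mult_left_mono[of 1 D "real T"] by (simp add: Z_def)
  have nZ: "n \<le> Z"
  proof -
    have "n \<le> k * D" by (rule D)
    also have "\<dots> \<le> T * D" using LT(2) D by (intro mult_right_mono) auto
    finally show ?thesis by (simp add: Z_def)
  qed
  have nlZ: "real n * l \<le> Z"
  proof -
    have "real n * l \<le> (k * D) * L" using D L by (intro mult_mono) auto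
    also have "\<dots> = real (L * k) * D" by simp
    also have "\<dots> \<le> T * D"
    proof (rule mult_right_mono)
      show "real (L * k) \<le> real T" using LT(3) by (simp only: of_nat_le_iff)
    qed (use D in simp)
    finally show ?thesis by (simp add: Z_def)
  qed
  have Z: "0 \<le> Z" "1 \<le> Z" using TZ LT(4) by linarith+
  have mm: "real (L * (k * 10 + 16) + 3 * n + 24) \<le> 43 * Z"
  proof -
    have "real (L * (k * 10 + 16)) \<le> real (16 * T)" using LT(5) by (simp only: of_nat_le_iff)
    then show ?thesis using TZ nZ Z by simp
  qed
  have "real evT = 40 * (real n * l) + 15 * n + 200 * T + m * real (L * (k * 10 + 16) + 3 * n + 24) + 22 * L + 60"
    by (simp add: evT_def algebra_simps)
  also have "\<dots> \<le> 40 * Z + 15 * Z + 200 * Z + m * (43 * Z) + 22 * Z + 60 * Z"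
    using nlZ nZ TZ LT(1) Z mult_left_mono[OF mm, of "real m"] by (intro add_mono) auto
  also have "\<dots> = 337 * Z + 43 * (m * Z)" by simp
  also have "\<dots> \<le> 380 * (m * Z)" using m Z mult_right_mono[of 1 "real m" Z] by simp
  finally have ev: "real evT \<le> 380 * (m * Z)" .
  have mt: "real m ^ (t - 1) * m = real m ^ t" using t by (cases t) auto
  have mt1: "1 \<le> real m ^ t" using m by simp
  have tm: "1 \<le> t * real m ^ t" using mult_mono[of 1 "real t" 1 "real m ^ t"] t mt1 by simp
  have "real blockT = t * (k * 15 + 20) + t * real m ^ (t - 1) * evT + 30" by (simp add: blockT_def)
  also have "\<dots> \<le> t * (35 * Z) + t * real m ^ (t - 1) * (380 * (m * Z)) + 30 * Z"
  proof -
    have "real k * 15 + 20 \<le> 35 * Z" using LT(2) TZ Z by linarith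
    then have "real (t * (k * 15 + 20)) \<le> t * (35 * Z)" unfolding of_nat_mult by (intro mult_left_mono) auto
    moreover have "t * real m ^ (t - 1) * evT \<le> t * real m ^ (t - 1) * (380 * (m * Z))"
      by (rule mult_left_mono[OF ev]) simp
    ultimately show ?thesis using Z by linarith
  qed
  also have "t * real m ^ (t - 1) * (380 * (m * Z)) = 380 * (t * real m ^ t) * Z" by (simp add: mt[symmetric])
  also have "t * (35 * Z) + 380 * (t * real m ^ t) * Z + 30 * Z \<le>
      (35 * (t * real m ^ t) + 380 * (t * real m ^ t) + 30 * (t * real m ^ t)) * Z"
  proof -
    have "t * (35 * Z) \<le> 35 * (t * real m ^ t) * Z"
      using mult_right_mono[OF mult_left_mono[OF mt1, of "35 * real t"] Z(1)] by (simp add: mult_ac)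
    moreover have "30 * Z \<le> 30 * (t * real m ^ t) * Z" using tm Z mult_right_mono[of 1 "t * real m ^ t" Z] by simp
    ultimately show ?thesis by (simp add: algebra_simps)
  qed
  finally show ?thesis by (simp add: Z_def algebra_simps)
qed

section \<open>Code parameters and degenerate cases\<close>

lemma decoder_lister:
  assumes "field F" "finite (carrier F)" "linear_code F k n C" "systematic (carrier F) k n C" "0 < k"
    and P: "list_recovery_alg F k n C \<alpha> l P T"
    and L: "\<And>f. f \<in> list_strings (carrier F) l n \<Longrightarrow> card (close_messages (carrier F) k n C \<alpha> f) \<le> L"
  shows "decoder F k n l L C \<alpha> (\<lambda>f. lister F T P (inp n f))"
proof (intro decoder.intro nat_field.intro decoder_axioms.intro assms)
  fix f assume f: "f \<in> list_strings (carrier F) l n"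
  show "set (lister F T P (inp n f)) = (\<lambda>x. map x [0..<k]) ` close_messages (carrier F) k n C \<alpha> f"
    by (rule lister_set(2)[OF P f])
  have "length (lister F T P (inp n f)) = card ((\<lambda>x. map x [0..<k]) ` close_messages (carrier F) k n C \<alpha> f)"
    using lister_set[OF P f] by (metis distinct_card)
  also have "\<dots> \<le> card (close_messages (carrier F) k n C \<alpha> f)"
    by (rule card_image_le, rule finite_subset[OF _ finite_strings[OF assms(2)]]) (auto simp: close_messages_def)
  finally show "length (lister F T P (inp n f)) \<le> L" using L[OF f] by simp
qed

lemma (in decoder) gen_H:
  fixes lg ah d :: real and t q :: nat
  assumes m: "m = msize lg t ah d" and \<theta>: "\<theta> = 2 * usize lg t ah d"
    and lg: "1 \<le> lg" and L: "L \<le> 2 powr lg" "1 \<le> L" and ah: "0 < ah" "ah \<le> 1" and \<alpha>: "0 < \<alpha>"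
    and t: "1 \<le> t" and q: "n \<le> 2 ^ q" and d: "0 < d" "d \<le> 1"
    and dist: "\<And>x x'. x \<in> strings (carrier F) k \<Longrightarrow> x' \<in> strings (carrier F) k \<Longrightarrow> x \<noteq> x' \<Longrightarrow>
      d * n \<le> card {i. i < n \<and> C x i \<noteq> C x' i}"
    and r: "k / n \<le> 2 * (1 - d)"
    and M: "M \<in> strings (carrier F) (k ^ t)" and zone: "zone (carrier F) l S 0 (n ^ t)"
    and e: "errs S 0 t M \<le> \<alpha> * ah * k ^ t * d ^ (200000 * t)"
  shows "2/3 \<le> measure_pmf.prob (replicate_pmf ((t - 1) * m) (samp q n))
    {rs. card {y. y < k ^ t \<and> bad S t (\<lambda>e. rs ! e) 0 M y} \<le> ah * k ^ t}"
proof -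
  define u where "u = usize lg t ah d"
  \<comment> \<open>Going down a dimension, \<open>\<beta>\<close> loses the factor
    \<open>d / 132\<close>: \<open>33 / d\<close> for \<open>m / u\<close> and 4 for the quarter. An
    average row carries \<open>1 / n\<close> of the errors; the slack \<open>400 / d\<close> in
    \<open>Eb\<close> keeps the probability of an overfull row at \<open>d / 200\<close>, including
    the factor 2 lost in sampling.\<close>
  define \<beta> where "\<beta> s = ah / 3 * (d / 132) ^ (t - s)" for s
  define Eb where "Eb s = \<alpha> * ah * k ^ t * d ^ (200000 * t) * (400 / (n * d)) ^ (t - s)" for s
  note prm = lg ah d t L(1)
  note ub = u_bounds[OF prm, folded u_def] and mb = m_bounds[OF prm, folded u_def m]
  have kn0: "0 < real k" "0 < real n" using k npos by auto
  have Epos: "0 < Eb s" for s using \<alpha> ah d kn0 by (simp add: Eb_def)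
  have bpos: "0 \<le> \<beta> s" for s using ah d by (simp add: \<beta>_def)
  have E: "Eb (Suc s) / (\<alpha> * n) \<le> \<beta> (Suc s) / 4 * k ^ s" if s: "s < t" for s
  proof -
    define j where "j = t - Suc s"
    have tj: "t = j + Suc s" using s by (simp add: j_def)
    have "(k / n) * (400 * (k / n) / d) ^ j = real k ^ Suc j / n * (400 / (n * d)) ^ j"
      by (simp add: power_mult_distrib power_divide)
    moreover have "real k ^ t = real k ^ Suc j * k ^ s" by (simp add: tj power_add)
    ultimately have "Eb (Suc s) / (\<alpha> * n) = ah * (k / n) * d ^ (200000 * t) * (400 * (k / n) / d) ^ j * k ^ s"
      using \<alpha> unfolding Eb_def j_def[symmetric] by (simp add: divide_simps)
    also have "\<dots> \<le> ah / 3 * (d / 132) ^ j / 4 * k ^ s"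
      by (intro mult_right_mono error_param[OF d _ r ah(1)]) (use kn0 s in \<open>auto simp: j_def\<close>)
    finally show ?thesis by (simp add: \<beta>_def j_def)
  qed
  have "(\<Sum>y<k ^ (t - 1). badprob (samp q n) S t 0 M y) \<le> \<beta> t * k ^ (t - 1)"
  proof (rule badprob_main[where t=t and Eb=Eb and \<beta>=\<beta> and \<delta>=d and u=u])
    show "set_pmf (samp q n) \<subseteq> {..<n}" by (rule samp_bounds(1)[OF npos q])
    show "card X / (2 * n) \<le> measure_pmf.prob (samp q n) X" if "X \<subseteq> {..<n}" for X
      using samp_bounds(2)[OF npos q that] by simp
    show "measure_pmf.prob (samp q n) X \<le> 2 * card X / n" if "X \<subseteq> {..<n}" for X
      using samp_bounds(3)[OF npos q that] by simp
    show "0 < \<alpha>" "0 < u" "\<theta> = 2 * u" using \<alpha> ub(3) \<theta> by (auto simp: u_def)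
    have "\<beta> 1 / 4 \<le> 1"
    proof -
      have "ah / 3 * (d / 132) ^ (t - 1) \<le> 1 * 1" using ah d by (intro mult_mono power_le_one) auto
      then show ?thesis by (simp add: \<beta>_def)
    qed
    moreover have "Eb 1 / (\<alpha> * n) \<le> \<beta> 1 / 4 * k ^ 0" unfolding One_nat_def by (rule E) (use t in simp)
    moreover have "\<beta> 1 / 4 * real (k ^ 0) = \<beta> 1 / 4" by simp
    ultimately have "Eb 1 / (\<alpha> * n) \<le> 1" by linarith
    then show "Eb 1 \<le> \<alpha> * n" using \<alpha> kn0 by (simp add: divide_le_eq)
    show "0 \<le> \<beta> 1" by (rule bpos)
    show "0 < Eb s \<and> 0 \<le> \<beta> s" for s using Epos bpos by simp
    show "Eb (Suc s) / (\<alpha> * n) \<le> \<beta> (Suc s) / 4 * k ^ s" if "s < t" for s by (rule E[OF that])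
    show "L * (2 ^ (2 * \<theta>) * (1 - d / 4) ^ m) \<le> \<beta> (Suc s) / 4" for s
      using sep_param[OF prm, of "t - Suc s"] by (simp add: \<beta>_def \<theta> m)
    show "(1 / 4) ^ u * (1 + 3 * (2 * Eb (Suc s) / (n * Eb s))) ^ m \<le> \<beta> (Suc s) / 4" if s: "s < t" for s
    proof -
      have "Eb s = Eb (Suc s) * (400 / (n * d))" using s by (simp add: Eb_def Suc_diff_Suc[symmetric])
      then have e: "2 * Eb (Suc s) / (n * Eb s) = d / 200" using Epos[of "Suc s"] Epos[of s] kn0 d by (simp add: divide_simps mult_ac)
      show ?thesis unfolding e using tail_param[OF prm, of "t - Suc s"] L(2) by (simp add: \<beta>_def u_def m)
    qed
    show "m / u * \<beta> s \<le> \<beta> (Suc s) / 4" if s: "s < t" for s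
    proof -
      have "m / u * \<beta> s \<le> 33 / d * \<beta> s" using mb(2) bpos by (intro mult_right_mono) auto
      also have "\<dots> = 33 / d * (\<beta> (Suc s) * (d / 132))" using s by (simp add: \<beta>_def Suc_diff_Suc[symmetric])
      also have "\<dots> = \<beta> (Suc s) / 4" using d by simp
      finally show ?thesis .
    qed
    show "errs S 0 t M \<le> Eb t" using e by (simp add: Eb_def)
  qed (use dist t M zone in auto)
  then show ?thesis by (rule few_bad[rotated]) (use t ah in \<open>auto simp: \<beta>_def\<close>)
qed

text \<open>The last inequality is the Singleton bound. Systematicity gives a witness at once: the
  codewords of 0 and of a unit vector agree on all but one of the first \<open>k\<close>
  coordinates.\<close>

lemma (in decoder) distance:
  defines "d \<equiv> relative_distance (carrier F) k n C"
  shows "\<And>x x'. x \<in> strings (carrier F) k \<Longrightarrow> x' \<in> strings (carrier F) k \<Longrightarrow> x \<noteq> x' \<Longrightarrow>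
      d * n \<le> card {i. i < n \<and> C x i \<noteq> C x' i}"
    "0 < d" "d \<le> 1" "d * n \<le> real n - k + 1"
proof -
  let ?St = "strings (carrier F) k"
  define D where "D = {hdist n (C x) (C y) |x y. x \<in> ?St \<and> y \<in> ?St \<and> x \<noteq> y}"
  have "D \<subseteq> (\<lambda>(x, y). hdist n (C x) (C y)) ` (?St \<times> ?St)" by (auto simp: D_def)
  then have finD: "finite D" using finite_strings[OF finF] by (meson finite_SigmaI finite_imageI finite_subset)
  define z where "z = (\<lambda>j\<in>{..<k}. \<zero>)"
  define e where "e = (\<lambda>j\<in>{..<k}. if j = 0 then \<one> else \<zero>)"
  have z: "z \<in> ?St" and e: "e \<in> ?St" unfolding z_def e_def by (auto intro!: strings_restrict)
  have ze: "z \<noteq> e" using k by (auto simp: z_def e_def fun_eq_iff)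
  show dist: "d * n \<le> card {i. i < n \<and> C x i \<noteq> C x' i}" if "x \<in> ?St" "x' \<in> ?St" "x \<noteq> x'" for x x'
  proof -
    have "hdist n (C x) (C x') \<in> D" using that by (auto simp: D_def)
    then have "d \<le> hdist n (C x) (C x')" unfolding d_def relative_distance_def D_def[symmetric] using finD by simp
    then show ?thesis using npos by (simp add: hdist_def pos_le_divide_eq)
  qed
  have "D \<noteq> {}" using z e ze by (auto simp: D_def)
  then have "d \<in> D" unfolding d_def relative_distance_def D_def[symmetric] using finD by (rule Min_in[rotated])
  then obtain x y where xy: "d = hdist n (C x) (C y)" "x \<in> ?St" "y \<in> ?St" "x \<noteq> y" by (auto simp: D_def)
  have "\<exists>i<n. C x i \<noteq> C y i"
  proof (rule ccontr)
    assume "\<not> (\<exists>i<n. C x i \<noteq> C y i)"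
    then have "C x = C y" using linmap_strings[OF C_lin] xy by (intro strings_eqI) auto
    then show False using lin xy by (auto simp: linear_code_def is_code_def dest: inj_onD)
  qed
  then have "0 < card {i. i < n \<and> C x i \<noteq> C y i}" by (auto simp: card_gt_0_iff)
  then show "0 < d" using npos by (simp add: xy hdist_def)
  have "card {i. i < n \<and> C x i \<noteq> C y i} \<le> card {..<n}" by (intro card_mono) auto
  then show "d \<le> 1" using npos by (simp add: xy hdist_def)
  have "{i. i < n \<and> C z i \<noteq> C e i} \<subseteq> insert 0 {k..<n}"
  proof
    fix i assume i: "i \<in> {i. i < n \<and> C z i \<noteq> C e i}"
    have "C z i = z i" "C e i = e i" if "i < k" using sys z e that by (auto simp: systematic_def)
    then show "i \<in> insert 0 {k..<n}" using i by (cases "i < k") (auto simp: z_def e_def split: if_splits)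
  qed
  then have "card {i. i < n \<and> C z i \<noteq> C e i} \<le> card (insert 0 {k..<n})" by (intro card_mono) auto
  also have "\<dots> \<le> Suc (n - k)" by (metis card_insert_le_m1 card_atLeastLessThan card_insert_if finite_atLeastLessThan le_SucI order_refl)
  finally have "real (card {i. i < n \<and> C z i \<noteq> C e i}) \<le> real n - k + 1" using kn by simp
  then show "d * n \<le> real n - k + 1" using dist[OF z e ze] by linarith
qed

text \<open>The first bound uses \<open>k - 1 \<ge> k / 2\<close>, the second the largest value
  \<open>(n + 1)\<^sup>2 / 4\<close> of \<open>k * (n - k + 1)\<close>. Both would fail for
  \<open>k = n = 1\<close>.\<close>

lemma rate_distance:
  fixes k n :: nat and d :: real
  assumes k: "2 \<le> k" "k \<le> n" and d: "0 < d" "d * n \<le> real n - k + 1"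
  shows "k / n \<le> 2 * (1 - d)" "k / n * d \<le> 9 / 16"
proof -
  have n: "0 < real n" "2 \<le> real n" using k by auto
  have "2 * (d * n) \<le> 2 * real n - k" using d k by simp
  then have "real k \<le> 2 * (1 - d) * n" by (simp add: algebra_simps)
  then show "k / n \<le> 2 * (1 - d)" using n by (simp add: pos_divide_le_eq)
  have "real k * (d * n) \<le> k * (real n - k + 1)" using d by (intro mult_left_mono) auto
  also have "\<dots> \<le> (real n + 1)\<^sup>2 / 4"
    using zero_le_power2[of "2 * real k - (real n + 1)"] by (simp add: power2_eq_square algebra_simps)
  also have "\<dots> \<le> (3 / 2 * real n)\<^sup>2 / 4" using n by (intro divide_right_mono power_mono) auto
  finally have "real k * d * n \<le> 9 / 16 * real n * n" by (simp add: power2_eq_square mult_ac)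
  then have "real k * d \<le> 9 / 16 * real n" using n by simp
  then show "k / n * d \<le> 9 / 16" using n by (simp add: divide_le_eq)
qed

text \<open>The \<open>l\<close> constant messages with symbols in \<open>Y\<close> all agree with a
  suitable \<open>f\<close>. So the attained list size is at least \<open>l\<close>, and reading
  input lists can be charged to the size of the output.\<close>

lemma (in nat_field) list_size_ge:
  assumes C: "linear_code F k n C" and k: "0 < k" and \<alpha>: "0 \<le> \<alpha>" and fin: "finite (carrier F)" and l: "l \<le> card (carrier F)"
  shows "\<exists>f\<in>list_strings (carrier F) l n. l \<le> card (close_messages (carrier F) k n C \<alpha> f)"
proof -
  obtain Y where Y: "Y \<subseteq> carrier F" "card Y = l" "finite Y" using obtain_subset_with_card_n[OF l] by metis
  define x where "x a = (\<lambda>j\<in>{..<k}. a :: nat)" for a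
  have x: "x a \<in> strings (carrier F) k" if "a \<in> Y" for a
    unfolding x_def using that Y by (intro strings_restrict) auto
  have "\<exists>B. (\<lambda>a. C (x a) i) ` Y \<subseteq> B \<and> B \<subseteq> carrier F \<and> card B = l" if i: "i < n" for i
  proof -
    have "(\<lambda>a. C (x a) i) ` Y \<subseteq> carrier F" using linmap_mem[OF linear_code_linmap[OF C] x i] by auto
    then show ?thesis
      using exists_subset_between[of "(\<lambda>a. C (x a) i) ` Y" l "carrier F"] card_image_le[OF Y(3), of "\<lambda>a. C (x a) i"] Y(2) l fin
      by auto
  qed
  then obtain B where B: "\<And>i. i < n \<Longrightarrow> (\<lambda>a. C (x a) i) ` Y \<subseteq> B i \<and> B i \<subseteq> carrier F \<and> card (B i) = l" by metis
  define f where "f = (\<lambda>i\<in>{..<n}. B i)"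
  have f: "f \<in> list_strings (carrier F) l n" using B by (auto simp: f_def list_strings_def)
  have "x ` Y \<subseteq> close_messages (carrier F) k n C \<alpha> f"
  proof clarify
    fix a assume a: "a \<in> Y"
    have "C (x a) i \<in> B i" if "i < n" for i using B[OF that] a by blast
    then have "{i. i < n \<and> C (x a) i \<notin> f i} = {}" by (auto simp: f_def)
    then have "list_dist n (C (x a)) f = 0" unfolding list_dist_def by (simp only: card.empty)
    then show "x a \<in> close_messages (carrier F) k n C \<alpha> f" using x[OF a] \<alpha> by (simp add: close_messages_def)
  qed
  moreover have "finite (close_messages (carrier F) k n C \<alpha> f)"
    by (rule finite_subset[OF _ finite_strings[OF fin]]) (auto simp: close_messages_def)
  moreover have "inj_on x Y"
  proof (rule inj_onI)
    fix a b assume "x a = x b"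
    then have "x a 0 = x b 0" by simp
    then show "a = b" using k by (simp add: x_def)
  qed
  ultimately have "l \<le> card (close_messages (carrier F) k n C \<alpha> f)" using Y(2) by (metis card_image card_mono)
  then show ?thesis using f by blast
qed

text \<open>At radius 1 a single word is close to every codeword, and two disjoint outputs would
  each have probability \<open>2/3\<close>. The strict bound keeps the new radius below
  \<open>\<rho> ^ t\<close>.\<close>

lemma (in nat_field) decoding_radius:
  assumes khat: "0 < khat" and ld: "local_decoder F khat N Chat Q \<alpha>hat B T"
    and Chat: "\<And>x. x \<in> strings (carrier F) khat \<Longrightarrow> Chat x \<in> strings (carrier F) N"
  shows "\<alpha>hat < 1"
proof (rule ccontr)
  assume "\<not> \<alpha>hat < 1"
  then have a: "1 \<le> \<alpha>hat" by simp
  define x where "x c = (\<lambda>j\<in>{..<khat}. c :: nat)" for c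
  have x: "x \<zero> \<in> strings (carrier F) khat" "x \<one> \<in> strings (carrier F) khat"
    unfolding x_def by (auto intro!: strings_restrict)
  define w where "w = Chat (x \<zero>)"
  define p where "p = run F (string_oracle N w) T B (\<lambda>_ _. 0)"
  have hd: "hdist N w (Chat y) \<le> \<alpha>hat" for y
  proof -
    have "card {i. i < N \<and> w i \<noteq> Chat y i} \<le> card {..<N}" by (intro card_mono) auto
    then have "hdist N w (Chat y) \<le> 1" by (simp add: hdist_def divide_le_eq)
    then show ?thesis using a by simp
  qed
  have inp: "input_mem 0 [] (\<lambda>_ _. 0)" by (simp add: input_mem_def input_array_def)
  have w: "w \<in> strings (carrier F) N" unfolding w_def by (rule Chat[OF x(1)])
  have ge: "2/3 \<le> measure_pmf.prob p {(cs, s). items s = [[y 0]]}" if "y \<in> strings (carrier F) khat" for y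
    using ld w khat inp that hd unfolding local_decoder_def p_def by blast
  have x0: "x c 0 = c" for c using khat by (simp add: x_def)
  have "measure_pmf.prob p {(cs, s). items s = [[\<zero>]]} + measure_pmf.prob p {(cs, s). items s = [[\<one>]]} =
      measure_pmf.prob p ({(cs, s). items s = [[\<zero>]]} \<union> {(cs, s). items s = [[\<one>]]})"
    by (rule measure_pmf.finite_measure_Union[symmetric]) auto
  also have "\<dots> \<le> 1" by (rule measure_pmf.prob_le_1)
  finally show False using ge[OF x(1)] ge[OF x(2)] by (simp add: x0)
qed

lemma no_message_alg:
  assumes "1 \<le> Tpre"
  shows "\<exists>A B. local_list_recovery_alg F 0 N C Q \<alpha> l 1 A B Tpre T"
proof -
  have "run F no_oracle Tpre EndItem m = return_pmf ([], \<lparr>memory = m, queries = 0, current = [], items = [[]]\<rparr>)" for m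
    unfolding run_def using assms by (subst steps_determ_halts) auto
  then have "local_list_recovery_alg F 0 N C Q \<alpha> l 1 EndItem Skip Tpre T"
    by (auto simp: local_list_recovery_alg_def)
  then show ?thesis by blast
qed

lemma no_close_alg:
  assumes "1 \<le> Tpre"
    and "\<And>S x. S \<in> list_strings (carrier F) l N \<Longrightarrow> x \<in> strings (carrier F) khat \<Longrightarrow> \<not> list_dist N (C x) S \<le> \<alpha>"
  shows "\<exists>A B. local_list_recovery_alg F khat N C Q \<alpha> l 0 A B Tpre T"
proof -
  have "run F no_oracle Tpre Skip m = return_pmf ([], \<lparr>memory = m, queries = 0, current = [], items = []\<rparr>)" for m
    unfolding run_def using assms by (subst steps_determ_halts) auto
  then have "local_list_recovery_alg F khat N C Q \<alpha> l 0 Skip Skip Tpre T"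
    using assms(2) by (auto simp: local_list_recovery_alg_def)
  then show ?thesis by blast
qed

lemma (in decoder) k1_H:
  fixes ah :: real
  assumes "M \<in> strings (carrier F) (k ^ Suc 0)" "errs S 0 (Suc 0) M = 0" "0 < \<alpha>" "0 \<le> ah"
  shows "2/3 \<le> measure_pmf.prob p {rs. card {y. y < k ^ Suc 0 \<and> bad S (Suc 0) (\<lambda>e. rs ! e) 0 M y} \<le> ah * k ^ Suc 0}"
proof -
  have "clo S 0 0 M y" for y by (rule clo_base) (use assms in auto)
  then show ?thesis using assms(4) by simp
qed

text \<open>The three parameters are chosen before \<open>P\<close> and \<open>Bhat\<close>; so the
  table program together with any local decoder witnesses the part of the claim that mentions no
  given algorithms.\<close>

lemma conclude:
  fixes X :: real and c :: nat
  assumes code: "is_code (carrier F) khat N Ct" and "real Qt \<le> real Qhat * real n * X" "real Lt \<le> 2 powr (real c * X)"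
    "real Tpre \<le> 2 powr (real c * X) * log 2 (real (max 2 n))" and fin: "finite (carrier F)"
    and ld: "locally_decodable F khat K Chat Qhat \<alpha>hat"
    and alg: "\<And>P T Bhat That. list_recovery_alg F k n C \<alpha> l P T \<Longrightarrow> local_decoder F khat K Chat Qhat \<alpha>hat Bhat That \<Longrightarrow>
      \<exists>A B Tt. real Tt \<le> real That + real c * real Qhat * real T * X \<and>
        local_list_recovery_alg F khat N Ct Qt \<alpha>t l Lt A B Tpre Tt"
  shows "is_code (carrier F) khat N Ct \<and>
    (\<exists>(Qtilde::nat) (Ltilde::nat) (Tpre::nat).
      real Qtilde \<le> real Qhat * real n * X \<and>
      real Ltilde \<le> 2 powr (real c * X) \<and>
      real Tpre \<le> 2 powr (real c * X) * log 2 (real (max 2 n)) \<and>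
      locally_list_recoverable F khat N Ct Qtilde \<alpha>t l Ltilde \<and>
      (\<exists>A B T. local_list_recovery_alg F khat N Ct Qtilde \<alpha>t l Ltilde A B Tpre T) \<and>
      (\<forall>P T Bhat That. list_recovery_alg F k n C \<alpha> l P T \<and> local_decoder F khat K Chat Qhat \<alpha>hat Bhat That \<longrightarrow>
        (\<exists>A B Ttilde. real Ttilde \<le> real That + real c * real Qhat * real T * X \<and>
          local_list_recovery_alg F khat N Ct Qtilde \<alpha>t l Ltilde A B Tpre Ttilde)))"
proof -
  obtain P T where P: "list_recovery_alg F k n C \<alpha> l P T" using list_recovery_alg_exists[OF fin] by blast
  obtain Bhat That where B: "local_decoder F khat K Chat Qhat \<alpha>hat Bhat That" using ld unfolding locally_decodable_def by blast
  have ex: "\<exists>A B T. local_list_recovery_alg F khat N Ct Qt \<alpha>t l Lt A B Tpre T" using alg[OF P B] by blast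
  then have "locally_list_recoverable F khat N Ct Qt \<alpha>t l Lt" unfolding locally_list_recoverable_def by blast
  then show ?thesis
    using assms(1-4) ex alg by (intro conjI exI[of _ Qt] exI[of _ Lt] exI[of _ Tpre] allI impI) blast+
qed

theorem lemma5p4:
  shows "\<exists>c::nat. \<forall>(F::nat ring) (k::nat) (n::nat) (t::nat) C (\<rho>::real) (\<delta>::real) (\<alpha>::real) (l::nat) (L::nat)
      (khat::nat) Chat (Qhat::nat) (\<alpha>hat::real).
    field F \<and> finite (carrier F) \<and> 1 \<le> t \<and> 1 \<le> k \<and>
    linear_code F k n C \<and> systematic (carrier F) k n C \<and>
    \<rho> = real k / real n \<and> \<delta> = relative_distance (carrier F) k n C \<and>
    0 < \<alpha> \<and> \<alpha> \<le> 1 \<and> list_recoverable (carrier F) k n C \<alpha> l L \<and>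
    is_code (carrier F) khat (k ^ t) Chat \<and>
    0 < \<alpha>hat \<and> \<alpha>hat \<le> 1 \<and> locally_decodable F khat (k ^ t) Chat Qhat \<alpha>hat
    \<longrightarrow>
    (let Ctilde = (\<lambda>x. tensor_pow F k n C t (Chat x));
         \<alpha>tilde = \<alpha> * \<alpha>hat * \<rho> ^ t * \<delta> ^ (c * t);
         X = (log 2 (real (max 2 L))) ^ t / ((\<alpha> * \<alpha>hat) ^ (c * t) * (\<rho> * \<delta>) ^ (c * t\<^sup>2))
     in
       is_code (carrier F) khat (n ^ t) Ctilde \<and>
       (\<exists>(Qtilde::nat) (Ltilde::nat) (Tpre::nat).
          real Qtilde \<le> real Qhat * real n * X \<and>
          real Ltilde \<le> 2 powr (real c * X) \<and>
          real Tpre \<le> 2 powr (real c * X) * log 2 (real (max 2 n)) \<and>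
          locally_list_recoverable F khat (n ^ t) Ctilde Qtilde \<alpha>tilde l Ltilde \<and>
          (\<exists>A B T. local_list_recovery_alg F khat (n ^ t) Ctilde Qtilde \<alpha>tilde l Ltilde A B Tpre T) \<and>
          (\<forall>P T Bhat That.
             list_recovery_alg F k n C \<alpha> l P T \<and>
             local_decoder F khat (k ^ t) Chat Qhat \<alpha>hat Bhat That \<longrightarrow>
             (\<exists>A B Ttilde.
                real Ttilde \<le> real That + real c * real Qhat * real T * X \<and>
                local_list_recovery_alg F khat (n ^ t) Ctilde Qtilde \<alpha>tilde l Ltilde A B Tpre Ttilde))))"
proof (intro exI[of _ 200000] allI impI, elim conjE)
  fix F :: "nat ring" and k n t C and \<rho> \<delta> \<alpha> :: real and l L khat Chat Qhat and \<alpha>hat :: real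
  assume fld: "field F" and fin: "finite (carrier F)" and t: "1 \<le> t" and k1: "1 \<le> k"
    and lin: "linear_code F k n C" and sys: "systematic (carrier F) k n C"
    and \<rho>: "\<rho> = real k / real n" and \<delta>: "\<delta> = relative_distance (carrier F) k n C"
    and \<alpha>: "0 < \<alpha>" "\<alpha> \<le> 1" and lr: "list_recoverable (carrier F) k n C \<alpha> l L"
    and Chat: "is_code (carrier F) khat (k ^ t) Chat"
    and ah: "0 < \<alpha>hat" "\<alpha>hat \<le> 1" and ldec: "locally_decodable F khat (k ^ t) Chat Qhat \<alpha>hat"
  define X where "X = (log 2 (real (max 2 L))) ^ t / ((\<alpha> * \<alpha>hat) ^ (200000 * t) * (\<rho> * \<delta>) ^ (200000 * t\<^sup>2))"
  define atl where "atl = \<alpha> * \<alpha>hat * \<rho> ^ t * \<delta> ^ (200000 * t)"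
  define Ct where "Ct = (\<lambda>x. tensor_pow F k n C t (Chat x))"
  define lg where "lg = log 2 (real (max 2 L))"
  define la where "la = log 2 (real (max 2 n))"
  define q where "q = nat \<lceil>la\<rceil>"
  interpret nf: nat_field F by (rule nat_field.intro[OF fld])
  obtain P0 T0 where P0: "list_recovery_alg F k n C \<alpha> l P0 T0" using list_recovery_alg_exists[OF fin] by blast
  have kpos: "0 < k" using k1 by simp
  have cl: "card (close_messages (carrier F) k n C \<alpha> f) \<le> L" if "f \<in> list_strings (carrier F) l n" for f
    using lr that by (simp add: list_recoverable_def)
  \<comment> \<open>Dummy sampling parameters: only facts about the code itself are taken from this
    instance.\<close>
  interpret d0: decoder F k n l 1 0 L C \<alpha> "\<lambda>f. lister F T0 P0 (inp n f)"
    by (rule decoder_lister[OF fld fin lin sys kpos P0 cl])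
  have kn: "k \<le> n" and npos: "0 < n" using d0.kn d0.npos by auto
  have dist: "\<delta> * n \<le> card {i. i < n \<and> C x i \<noteq> C x' i}"
    if "x \<in> strings (carrier F) k" "x' \<in> strings (carrier F) k" "x \<noteq> x'" for x x'
    unfolding \<delta> by (rule d0.distance(1)[OF that])
  have d: "0 < \<delta>" "\<delta> \<le> 1" "\<delta> * n \<le> real n - k + 1" unfolding \<delta> by (rule d0.distance)+
  have r: "0 < \<rho>" "\<rho> \<le> 1" using k1 kn npos by (auto simp: \<rho>)
  have rd: "0 < \<rho> * \<delta>" "\<rho> * \<delta> \<le> 1" using r d by (auto intro: mult_le_one)
  have aa: "0 < \<alpha> * \<alpha>hat" "\<alpha> * \<alpha>hat \<le> 1" using \<alpha> ah by (auto intro: mult_le_one)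
  have lg: "1 \<le> lg" "lg \<le> lg ^ t" "1 \<le> lg ^ t"
  proof -
    have "log 2 2 \<le> lg" unfolding lg_def by (subst log_le_cancel_iff) auto
    then show 1: "1 \<le> lg" by simp
    show "lg \<le> lg ^ t" using 1 t by (intro self_le_power) auto
    show "1 \<le> lg ^ t" using 1 by (rule one_le_power)
  qed
  have Lpow: "L \<le> 2 powr lg" unfolding lg_def by simp
  have la: "1 \<le> la"
  proof -
    have "log 2 2 \<le> la" unfolding la_def by (subst log_le_cancel_iff) auto
    then show ?thesis by simp
  qed
  have q: "n \<le> 2 ^ q" "real q \<le> 2 * la"
  proof -
    have "real n \<le> 2 powr la" unfolding la_def by simp
    also have "\<dots> \<le> 2 powr q" unfolding q_def using la by (intro powr_mono) auto
    also have "\<dots> = real (2 ^ q)" by (simp add: powr_realpow)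
    finally show "n \<le> 2 ^ q" by (simp only: of_nat_le_iff)
    show "real q \<le> 2 * la" unfolding q_def using la by linarith
  qed
  have den: "0 < (\<alpha> * \<alpha>hat) ^ (200000 * t) * (\<rho> * \<delta>) ^ (200000 * t\<^sup>2)"
    "(\<alpha> * \<alpha>hat) ^ (200000 * t) \<le> 1" "(\<rho> * \<delta>) ^ (200000 * t\<^sup>2) \<le> 1" "0 < (\<rho> * \<delta>) ^ (200000 * t\<^sup>2)"
    using aa rd by (auto intro: power_le_one)
  have X_lg: "lg ^ t \<le> X"
  proof -
    have "(\<alpha> * \<alpha>hat) ^ (200000 * t) * (\<rho> * \<delta>) ^ (200000 * t\<^sup>2) \<le> 1" using den by (intro mult_le_one) auto
    then have "lg ^ t / 1 \<le> X" unfolding X_def lg_def[symmetric] using den(1) lg by (intro divide_left_mono) auto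
    then show ?thesis by simp
  qed
  have X1: "1 \<le> X" using X_lg lg by linarith
  have X_D: "1 / (\<rho> * \<delta>) \<le> X"
  proof -
    have "(\<rho> * \<delta>) ^ (200000 * t\<^sup>2) \<le> (\<rho> * \<delta>) ^ 1" using rd t by (intro power_decreasing) auto
    then have "(\<alpha> * \<alpha>hat) ^ (200000 * t) * (\<rho> * \<delta>) ^ (200000 * t\<^sup>2) \<le> 1 * (\<rho> * \<delta>)"
      using den rd by (intro mult_mono) auto
    then show ?thesis unfolding X_def lg_def[symmetric] using den(1) lg rd by (intro frac_le) auto
  qed
  have p1: "1 \<le> 2 powr (real 200000 * X)" using X1 by (intro ge_one_powr_ge_zero) auto
  have p1': "1 \<le> 2 powr (real 200000 * X) * la" using mult_mono[OF p1 la] by simp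
  have pX: "2 powr (b * X) \<le> 2 powr (real 200000 * X)" if "b \<le> 200000" for b
    using that X1 by (intro powr_mono mult_right_mono) auto
  have code: "is_code (carrier F) khat (n ^ t) Ct" unfolding Ct_def by (rule d0.Tp_code[OF _ Chat]) (use t in simp)
  have Chs: "Chat x \<in> strings (carrier F) (k ^ t)" if "x \<in> strings (carrier F) khat" for x
    using Chat that unfolding is_code_def by blast
  note conc = conclude[OF code _ _ _ fin ldec, where n=n and X=X and c=200000 and \<alpha>t=atl and k=k and C=C and \<alpha>=\<alpha> and l=l, folded la_def]
  have "is_code (carrier F) khat (n ^ t) Ct \<and>
    (\<exists>(Qtilde::nat) (Ltilde::nat) (Tpre::nat).
      real Qtilde \<le> real Qhat * real n * X \<and>
      real Ltilde \<le> 2 powr (real 200000 * X) \<and>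
      real Tpre \<le> 2 powr (real 200000 * X) * la \<and>
      locally_list_recoverable F khat (n ^ t) Ct Qtilde atl l Ltilde \<and>
      (\<exists>A B T. local_list_recovery_alg F khat (n ^ t) Ct Qtilde atl l Ltilde A B Tpre T) \<and>
      (\<forall>P T Bhat That. list_recovery_alg F k n C \<alpha> l P T \<and> local_decoder F khat (k ^ t) Chat Qhat \<alpha>hat Bhat That \<longrightarrow>
        (\<exists>A B Ttilde. real Ttilde \<le> real That + real 200000 * real Qhat * real T * X \<and>
          local_list_recovery_alg F khat (n ^ t) Ct Qtilde atl l Ltilde A B Tpre Ttilde)))"
  proof (cases "khat = 0")
    case True
    show ?thesis
    proof (rule conc[of 0 1 1])
      fix P T Bhat That
      have le0: "real (0::nat) \<le> real That + real 200000 * real Qhat * real T * X" using X1 by simp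
      show "\<exists>A B Tt. real Tt \<le> real That + real 200000 * real Qhat * real T * X \<and>
        local_list_recovery_alg F khat (n ^ t) Ct 0 atl l 1 A B 1 Tt"
        using no_message_alg[OF order.refl, of F "n ^ t" Ct 0 atl l 0] le0 unfolding True by blast
    qed (use X1 p1 p1' in auto)
  next
    case False
    then have khat: "0 < khat" by simp
    have ah1: "\<alpha>hat < 1"
    proof -
      obtain B T where "local_decoder F khat (k ^ t) Chat Qhat \<alpha>hat B T" using ldec unfolding locally_decodable_def by blast
      from nf.decoding_radius[OF khat this Chs] show ?thesis .
    qed
    have aa1: "\<alpha> * \<alpha>hat < 1" using mult_left_le_one_le[of \<alpha>hat \<alpha>] \<alpha> ah ah1 by linarith
    have dpow: "\<delta> ^ (200000 * t) \<le> 1" "0 \<le> \<delta> ^ (200000 * t)" using d by (auto intro: power_le_one)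
    have at1: "atl < \<rho> ^ t"
    proof -
      have "atl \<le> \<alpha> * \<alpha>hat * \<rho> ^ t" unfolding atl_def using dpow aa r by (intro mult_left_le) auto
      also have "\<dots> < 1 * \<rho> ^ t" using aa1 r by (intro mult_strict_right_mono) auto
      finally show ?thesis by simp
    qed
    have rt1: "\<rho> ^ t \<le> 1" using r by (intro power_le_one) auto
    show ?thesis
    proof (cases "l = 0 \<or> card (carrier F) < l")
      case True
      \<comment> \<open>Either there is no string of \<open>l\<close>-subsets at all, or every set
        is empty and all distances are 1, beyond the radius. The empty list of algorithms then
        suffices.\<close>
      have noclose: "\<not> list_dist (n ^ t) (Ct x) S \<le> atl" if S: "S \<in> list_strings (carrier F) l (n ^ t)" for S x
      proof -
        have Si: "S i \<subseteq> carrier F \<and> card (S i) = l" if "i < n ^ t" for i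
          using PiE_mem[OF S[unfolded list_strings_def], of i] that by simp
        have "0 < n ^ t" using npos by simp
        then have "l \<le> card (carrier F)" using Si card_mono[OF fin] by metis
        then have l0: "l = 0" using True by simp
        have "S i = {}" if "i < n ^ t" for i using Si[OF that] l0 fin by (metis card_eq_0_iff finite_subset)
        then have "{i. i < n ^ t \<and> Ct x i \<notin> S i} = {..<n ^ t}" by auto
        then have "list_dist (n ^ t) (Ct x) S = 1" using npos by (simp add: list_dist_def)
        then show ?thesis using at1 rt1 by simp
      qed
      show ?thesis
      proof (rule conc[of 0 0 1])
        fix P T Bhat That
        have le0: "real (0::nat) \<le> real That + real 200000 * real Qhat * real T * X" using X1 by simp
        show "\<exists>A B Tt. real Tt \<le> real That + real 200000 * real Qhat * real T * X \<and>
          local_list_recovery_alg F khat (n ^ t) Ct 0 atl l 0 A B 1 Tt"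
          using no_close_alg[of 1 F l "n ^ t" khat Ct atl 0 0, OF order.refl] noclose le0 by blast
      qed (use X1 p1 p1' in auto)
    next
      case False
      then have l: "1 \<le> l" "l \<le> card (carrier F)" by auto
      define cc where "cc f = card (close_messages (carrier F) k n C \<alpha> f)" for f
      \<comment> \<open>The largest list size that occurs. Unlike \<open>L\<close> it is bounded by
        the running time of every list recovery program for \<open>C\<close>, as \<open>LT\<close>
        shows.\<close>
      define L' where "L' = Max (cc ` list_strings (carrier F) l n)"
      have finLS: "finite (list_strings (carrier F) l n)"
        unfolding list_strings_def
        by (rule finite_PiE, simp) (rule finite_subset[OF _ finite_Pow_iff[THEN iffD2, OF fin]], blast)
      obtain f1 where f1: "f1 \<in> list_strings (carrier F) l n" "l \<le> cc f1"
        using nf.list_size_ge[OF lin kpos less_imp_le[OF \<alpha>(1)] fin l(2)] by (auto simp: cc_def)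
      have ccL': "cc f \<le> L'" if "f \<in> list_strings (carrier F) l n" for f
        unfolding L'_def using finLS that by (intro Max_ge) auto
      have "L' \<in> cc ` list_strings (carrier F) l n" unfolding L'_def using finLS f1 by (intro Max_in) auto
      then obtain f2 where f2: "f2 \<in> list_strings (carrier F) l n" "L' = cc f2" by blast
      have L': "l \<le> L'" "1 \<le> L'" "L' \<le> L" "L' \<le> 2 powr lg"
      proof -
        show "l \<le> L'" using f1 ccL' le_trans by blast
        then show "1 \<le> L'" using l by simp
        show "L' \<le> L" using f2 cl by (simp add: cc_def)
        then show "L' \<le> 2 powr lg" using Lpow by linarith
      qed
      have L'1: "L' \<le> 2 powr X" by (rule order_trans[OF L'(4)]) (use lg X_lg in auto)
      have L'X: "L' \<le> 2 powr (real 200000 * X)" by (rule order_trans[OF L'1 pX[of 1, unfolded mult_1]]) simp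
      have dec': "decoder F k n l L' C \<alpha> (\<lambda>f. lister F T P (inp n f))"
        if "list_recovery_alg F k n C \<alpha> l P T" for P T
        by (rule decoder_lister[OF fld fin lin sys kpos that]) (use ccL' in \<open>simp add: cc_def\<close>)
      have LT: "L' * (k + 1) \<le> T" if P: "list_recovery_alg F k n C \<alpha> l P T" for P T
      proof -
        \<comment> \<open>\<open>f2\<close> attains the maximum, so on this input the program must
          write \<open>L'\<close> items of length \<open>k\<close>.\<close>
        have s: "set (lister F T P (inp n f2)) = (\<lambda>x. map x [0..<k]) ` close_messages (carrier F) k n C \<alpha> f2"
          by (rule lister_set(2)[OF P f2(1)])
        have "inj_on (\<lambda>x. map x [0..<k]) (close_messages (carrier F) k n C \<alpha> f2)"
          by (rule inj_onI, rule d0.map_inj[of _ "carrier F"]) (auto simp: close_messages_def)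
        then have "length (lister F T P (inp n f2)) = L'"
          using distinct_card[OF lister_set(1)[OF P f2(1)]] by (simp add: s card_image f2(2) cc_def)
        moreover have "\<forall>x\<in>set (lister F T P (inp n f2)). length x = k" by (auto simp: s)
        ultimately show ?thesis using lister_time by metis
      qed
      have nD: "n \<le> k * (1 / (\<rho> * \<delta>))" "1 \<le> 1 / (\<rho> * \<delta>)"
      proof -
        have "real n = k / \<rho>" using kpos npos by (simp add: \<rho>)
        also have "\<dots> \<le> k / (\<rho> * \<delta>)" using r d rd by (intro divide_left_mono) (auto intro: mult_left_le)
        finally show "n \<le> k * (1 / (\<rho> * \<delta>))" by simp
        show "1 \<le> 1 / (\<rho> * \<delta>)" using rd by simp
      qed
      have cost: "real (That + Qhat * prog.blockT k n l t' m L' T) \<le> real That + real 200000 * real Qhat * real T * X"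
        if P: "list_recovery_alg F k n C \<alpha> l P T" and "1 \<le> t'" "1 \<le> m" "t' * real m ^ t' * (1 / (\<rho> * \<delta>)) \<le> X"
        for P T t' m That
      proof -
        have "real (prog.blockT k n l t' m L' T) \<le> 445 * real t' * real m ^ t' * (T * (1 / (\<rho> * \<delta>)))"
          by (rule blockT_bound[OF kpos kn that(2,3) L'(2,1) LT[OF P] nD(2,1)])
        also have "\<dots> = 445 * T * (t' * real m ^ t' * (1 / (\<rho> * \<delta>)))" by simp
        also have "\<dots> \<le> 445 * T * X" using that(4) by (intro mult_left_mono) auto
        also have "\<dots> \<le> 200000 * T * X" using X1 by (intro mult_right_mono) auto
        finally have "real Qhat * real (prog.blockT k n l t' m L' T) \<le> real Qhat * (200000 * T * X)"
          by (rule mult_left_mono) simp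
        then show ?thesis by simp
      qed
      have lde: "list_dist (n ^ t) (Ct x) S \<le> atl \<Longrightarrow> card {i. i < n ^ t \<and> Ct x i \<notin> S i} \<le> atl * real n ^ t" for x S
        using npos by (simp add: list_dist_def divide_le_eq)
      show ?thesis
      proof (cases "k = 1")
        \<comment> \<open>Here \<open>\<rho> * \<delta>\<close> may be 1 and cannot absorb
          constants. Instead the first \<open>n\<close> symbols are decoded as a codeword of
          \<open>C\<close>, in dimension 1, where no rows are drawn.\<close>
        case True
        show ?thesis
        proof (rule conc[of "Qhat * (1 * 1 ^ (1 - 1) * n)" "L' ^ (1 ^ (1 - 1))" "L' * 14 + 3"])
          show "real (Qhat * (1 * 1 ^ (1 - 1) * n)) \<le> real Qhat * real n * X"
            using mult_left_mono[OF X1, of "real Qhat * real n"] by simp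
          show "real (L' ^ (1 ^ (1 - 1))) \<le> 2 powr (real 200000 * X)" using L'X by simp
          have "0 * (5 * real q + 6) + real L' * (2 * 0 + 4 * 1 + 10) + 3 \<le> 2 powr (9 * X) * la"
            by (rule preprocessing_cost[OF X1 _ L'1 _ _ _ _ _ q(2) la]) (use X1 in auto)
          also have "\<dots> \<le> 2 powr (real 200000 * X) * la" using la by (intro mult_right_mono pX) auto
          finally show "real (L' * 14 + 3) \<le> 2 powr (real 200000 * X) * la" by simp
          fix P T Bhat That
          assume P: "list_recovery_alg F k n C \<alpha> l P T"
            and B: "local_decoder F khat (k ^ t) Chat Qhat \<alpha>hat Bhat That"
          interpret d1: decoder F k n l 1 0 L' C \<alpha> "\<lambda>f. lister F T P (inp n f)" by (rule dec'[OF P])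
          have "\<exists>A B. local_list_recovery_alg F khat (n ^ t) Ct (Qhat * (1 * 1 ^ (1 - 1) * n)) atl l (L' ^ (1 ^ (1 - 1))) A B
              (L' * 14 + 3) (That + Qhat * prog.blockT k n l 1 1 L' T)"
          proof (rule d1.core[where Chat=Chat and \<alpha>hat=\<alpha>hat and Bhat=Bhat and P=P and q=q])
            show "local_decoder F khat (k ^ 1) Chat Qhat \<alpha>hat Bhat That" using B True by simp
            show "Chat x \<in> strings (carrier F) (k ^ 1)" if "x \<in> strings (carrier F) khat" for x
              using Chs[OF that] True by simp
            show "n ^ 1 \<le> n ^ t" using npos t by (simp add: self_le_power)
            show "n \<le> 2 ^ q" by (rule q(1))
            fix S x assume S: "S \<in> list_strings (carrier F) l (n ^ t)" and x: "x \<in> strings (carrier F) khat"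
              and le: "list_dist (n ^ t) (Ct x) S \<le> atl"
            have M: "Chat x \<in> strings (carrier F) (k ^ Suc 0)" "Chat x \<in> strings (carrier F) (k ^ t)"
              using Chs[OF x] True by auto
            \<comment> \<open>As \<open>\<alpha>hat < 1\<close>, the radius is below
              \<open>\<rho> ^ t = 1 / n ^ t\<close>, so a close string has no error at all.\<close>
            have "atl * real n ^ t < \<rho> ^ t * real n ^ t" using at1 npos by (intro mult_strict_right_mono) auto
            also have "\<dots> = 1" using npos True by (simp add: \<rho> flip: power_mult_distrib)
            finally have "card {i. i < n ^ t \<and> Ct x i \<notin> S i} < 1" using lde[OF le] by linarith
            then have "{i. i < n ^ t \<and> Ct x i \<notin> S i} = {}" by simp
            then have all: "Ct x i \<in> S i" if "i < n ^ t" for i using that by blast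
            obtain s where s: "t = Suc s" using t by (cases t) auto
            have "C (Chat x) i \<in> S i" if i: "i < n" for i
            proof -
              have "n \<le> n ^ t" using npos t by (simp add: self_le_power)
              then have "i < n ^ t" using i by linarith
              moreover have "Ct x i = C (Chat x) i"
                unfolding Ct_def s by (rule d1.Tp_k1[OF True _ i]) (use M(2) s in simp)
              ultimately show ?thesis using all[of i] by simp
            qed
            then have "d1.errs S 0 (Suc 0) (Chat x) = 0" by (auto simp: d1.errs_def)
            note k1 = d1.k1_H[OF M(1) this \<alpha>(1) less_imp_le[OF ah(1)], unfolded One_nat_def]
            show "2/3 \<le> measure_pmf.prob (replicate_pmf ((1 - 1) * 1) (samp q n))
              {rs. card {y. y < k ^ 1 \<and> d1.bad S 1 (\<lambda>e. rs ! e) 0 (Chat x) y} \<le> \<alpha>hat * k ^ 1}"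
              unfolding One_nat_def by (rule k1)
          qed (use L'(2) in auto)
          then obtain A B' where AB: "local_list_recovery_alg F khat (n ^ t) Ct (Qhat * (1 * 1 ^ (1 - 1) * n)) atl l
              (L' ^ (1 ^ (1 - 1))) A B' (L' * 14 + 3) (That + Qhat * prog.blockT k n l 1 1 L' T)" by blast
          have "real (That + Qhat * prog.blockT k n l 1 1 L' T) \<le> real That + real 200000 * real Qhat * real T * X"
            by (rule cost[OF P]) (use X_D in auto)
          with AB show "\<exists>A B Tt. real Tt \<le> real That + real 200000 * real Qhat * real T * X \<and>
            local_list_recovery_alg F khat (n ^ t) Ct (Qhat * (1 * 1 ^ (1 - 1) * n)) atl l (L' ^ (1 ^ (1 - 1))) A B (L' * 14 + 3) Tt"
            by blast
        qed
      next
        case False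
        then have k2: "2 \<le> k" using k1 by simp
        define m where "m = msize lg t \<alpha>hat \<delta>"
        define u where "u = usize lg t \<alpha>hat \<delta>"
        note prm = lg(1) ah d(1,2) t L'(4)
        note rdist = rate_distance[OF k2 kn d(1,3), folded \<rho>]
        have mb: "1 \<le> m" "u \<le> m" "lg \<le> u"
          using m_bounds(4,5)[OF prm] u_bounds(4)[OF prm] by (simp_all add: m_def u_def)
        have big: "1000 * real t ^ 2 * real m ^ t * (1 / (\<rho> * \<delta>)) \<le> X"
          using m_power_le[OF prm r rdist(2) \<alpha>] by (simp only: X_def lg_def[symmetric] m_def)
        have tm1: "1 \<le> real t" "1 \<le> real m ^ t" "1 \<le> real m" using t mb by auto
        have big2: "t * real m ^ t * (1 / (\<rho> * \<delta>)) \<le> X"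
        proof -
          have "real t \<le> real t * (1000 * real t)" using mult_left_mono[of 1 "1000 * real t" "real t"] tm1 by simp
          moreover have "0 \<le> real m ^ t * (1 / (\<rho> * \<delta>))" using rd by simp
          ultimately have "real t * (real m ^ t * (1 / (\<rho> * \<delta>))) \<le> real t * (1000 * real t) * (real m ^ t * (1 / (\<rho> * \<delta>)))"
            by (rule mult_right_mono)
          also have "\<dots> = 1000 * real t ^ 2 * real m ^ t * (1 / (\<rho> * \<delta>))" by (simp add: power2_eq_square)
          finally show ?thesis using big by (simp add: mult.assoc)
        qed
        have big3: "t * real m ^ t \<le> X"
        proof -
          have "t * real m ^ t * 1 \<le> t * real m ^ t * (1 / (\<rho> * \<delta>))" using nD(2) by (intro mult_left_mono) auto
          then show ?thesis using big2 by linarith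
        qed
        have mp: "real m ^ (t - 1) \<le> real m ^ t" "real m \<le> real m ^ t" "real m ^ (t - 1) * m = real m ^ t"
        proof -
          show "real m ^ (t - 1) \<le> real m ^ t" using tm1 by (intro power_increasing) auto
          show "real m \<le> real m ^ t" using tm1 t by (intro self_le_power) auto
          show "real m ^ (t - 1) * m = real m ^ t" using t by (cases t) auto
        qed
        have mt3: "real m ^ t \<le> X" using big3 mult_right_mono[OF tm1(1), of "real m ^ t"] tm1 by linarith
        define Tp where "Tp = (t - 1) * m * (5 * q + 6) + L' ^ (m ^ (t - 1)) * (2 * ((t - 1) * m) + 4 * m ^ (t - 1) + 10) + 3"
        have LtX: "real (L' ^ (m ^ (t - 1))) \<le> 2 powr X"
        proof -
          have "real (L' ^ (m ^ (t - 1))) \<le> (2 powr lg) ^ (m ^ (t - 1))" using L'(4) by (simp add: power_mono)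
          also have "\<dots> = 2 powr (lg * real m ^ (t - 1))" by (simp add: powr_realpow[symmetric] powr_powr)
          also have "\<dots> \<le> 2 powr X"
          proof (rule powr_mono)
            \<comment> \<open>Listing the advice raises \<open>L'\<close> to the number
              \<open>m ^ (t - 1)\<close> of leaves. The spare factor \<open>m\<close> in
              \<open>m ^ t\<close> pays for \<open>lg\<close>.\<close>
            have "lg \<le> m" using mb by linarith
            then have "real m ^ (t - 1) * lg \<le> real m ^ (t - 1) * m" by (intro mult_left_mono) auto
            then show "lg * real m ^ (t - 1) \<le> X" using mp(3) mt3 by (simp add: mult.commute)
          qed simp
          finally show ?thesis .
        qed
        show ?thesis
        proof (rule conc[of "Qhat * (t * m ^ (t - 1) * n)" "L' ^ (m ^ (t - 1))" Tp])
          have "t * real m ^ (t - 1) \<le> X" using mult_left_mono[OF mp(1), of "real t"] big3 by linarith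
          then have "real Qhat * real n * (t * real m ^ (t - 1)) \<le> real Qhat * real n * X" by (intro mult_left_mono) auto
          then show "real (Qhat * (t * m ^ (t - 1) * n)) \<le> real Qhat * real n * X" by (simp add: mult_ac)
          show "real (L' ^ (m ^ (t - 1))) \<le> 2 powr (real 200000 * X)" by (rule order_trans[OF LtX pX[of 1, unfolded mult_1]]) simp
          have N0: "real ((t - 1) * m) \<le> X"
          proof -
            have "real ((t - 1) * m) \<le> t * real m" by (simp add: mult_right_mono)
            also have "\<dots> \<le> t * real m ^ t" using mp(2) by (intro mult_left_mono) auto
            finally show ?thesis using big3 by linarith
          qed
          have "real ((t - 1) * m) * (5 * real q + 6) +
              real (L' ^ (m ^ (t - 1))) * (2 * real ((t - 1) * m) + 4 * real (m ^ (t - 1)) + 10) + 3 \<le> 2 powr (9 * X) * la"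
            by (rule preprocessing_cost[OF X1 _ LtX _ N0 _ _ _ q(2) la]) (use mp(1) mt3 in auto)
          also have "\<dots> \<le> 2 powr (real 200000 * X) * la" using la by (intro mult_right_mono pX) auto
          finally show "real Tp \<le> 2 powr (real 200000 * X) * la" by (simp add: Tp_def)
          fix P T Bhat That
          assume P: "list_recovery_alg F k n C \<alpha> l P T"
            and B: "local_decoder F khat (k ^ t) Chat Qhat \<alpha>hat Bhat That"
          interpret d1: decoder F k n l m "2 * u" L' C \<alpha> "\<lambda>f. lister F T P (inp n f)" by (rule dec'[OF P])
          have "\<exists>A B. local_list_recovery_alg F khat (n ^ t) Ct (Qhat * (t * m ^ (t - 1) * n)) atl l (L' ^ (m ^ (t - 1))) A B
              Tp (That + Qhat * prog.blockT k n l t m L' T)"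
          proof (rule d1.core[where Chat=Chat and \<alpha>hat=\<alpha>hat and Bhat=Bhat and P=P and q=q])
            show "local_decoder F khat (k ^ t) Chat Qhat \<alpha>hat Bhat That" by (rule B)
            show "n \<le> 2 ^ q" by (rule q(1))
            fix S x assume S: "S \<in> list_strings (carrier F) l (n ^ t)" and x: "x \<in> strings (carrier F) khat"
              and le: "list_dist (n ^ t) (Ct x) S \<le> atl"
            show "2/3 \<le> measure_pmf.prob (replicate_pmf ((t - 1) * m) (samp q n))
              {rs. card {y. y < k ^ t \<and> d1.bad S t (\<lambda>e. rs ! e) 0 (Chat x) y} \<le> \<alpha>hat * k ^ t}"
            proof (rule d1.gen_H[OF m_def _ lg(1) L'(4,2) ah \<alpha>(1) t q(1) d(1,2) dist _ Chs[OF x]])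
              show "2 * u = 2 * usize lg t \<alpha>hat \<delta>" by (simp add: u_def)
              show "k / n \<le> 2 * (1 - \<delta>)" using rdist(1) by (simp add: \<rho>)
              show "zone (carrier F) l S 0 (n ^ t)"
                unfolding zone_def
              proof (intro allI impI)
                fix i assume "i < n ^ t"
                then show "S (0 + i) \<subseteq> carrier F \<and> card (S (0 + i)) = l"
                  using PiE_mem[OF S[unfolded list_strings_def], of i] by simp
              qed
              have "real (d1.errs S 0 t (Chat x)) \<le> atl * real n ^ t"
                using lde[OF le] by (simp add: d1.errs_def Ct_def)
              also have "\<dots> = \<alpha> * \<alpha>hat * k ^ t * \<delta> ^ (200000 * t)"
                using npos by (simp add: atl_def \<rho> power_divide)
              finally show "real (d1.errs S 0 t (Chat x)) \<le> \<alpha> * \<alpha>hat * k ^ t * \<delta> ^ (200000 * t)" .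
            qed
          qed (use L'(2) mb t Chs in \<open>auto simp: Tp_def\<close>)
          then obtain A B' where AB: "local_list_recovery_alg F khat (n ^ t) Ct (Qhat * (t * m ^ (t - 1) * n)) atl l
              (L' ^ (m ^ (t - 1))) A B' Tp (That + Qhat * prog.blockT k n l t m L' T)" by blast
          have "real (That + Qhat * prog.blockT k n l t m L' T) \<le> real That + real 200000 * real Qhat * real T * X"
            by (rule cost[OF P t mb(1) big2])
          with AB show "\<exists>A B Tt. real Tt \<le> real That + real 200000 * real Qhat * real T * X \<and>
            local_list_recovery_alg F khat (n ^ t) Ct (Qhat * (t * m ^ (t - 1) * n)) atl l (L' ^ (m ^ (t - 1))) A B Tp Tt"
            by blast
        qed
      qed
    qed
  qed
  then show "let Ctilde = (\<lambda>x. tensor_pow F k n C t (Chat x));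
         \<alpha>tilde = \<alpha> * \<alpha>hat * \<rho> ^ t * \<delta> ^ (200000 * t);
         X = (log 2 (real (max 2 L))) ^ t / ((\<alpha> * \<alpha>hat) ^ (200000 * t) * (\<rho> * \<delta>) ^ (200000 * t\<^sup>2))
     in
       is_code (carrier F) khat (n ^ t) Ctilde \<and>
       (\<exists>(Qtilde::nat) (Ltilde::nat) (Tpre::nat).
          real Qtilde \<le> real Qhat * real n * X \<and>
          real Ltilde \<le> 2 powr (real 200000 * X) \<and>
          real Tpre \<le> 2 powr (real 200000 * X) * log 2 (real (max 2 n)) \<and>
          locally_list_recoverable F khat (n ^ t) Ctilde Qtilde \<alpha>tilde l Ltilde \<and>
          (\<exists>A B T. local_list_recovery_alg F khat (n ^ t) Ctilde Qtilde \<alpha>tilde l Ltilde A B Tpre T) \<and>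
          (\<forall>P T Bhat That.
             list_recovery_alg F k n C \<alpha> l P T \<and>
             local_decoder F khat (k ^ t) Chat Qhat \<alpha>hat Bhat That \<longrightarrow>
             (\<exists>A B Ttilde.
                real Ttilde \<le> real That + real 200000 * real Qhat * real T * X \<and>
                local_list_recovery_alg F khat (n ^ t) Ctilde Qtilde \<alpha>tilde l Ltilde A B Tpre Ttilde)))"
    unfolding Let_def X_def Ct_def atl_def la_def .
qed

end
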